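(* Let $v$ be a valuation on $\mathcal{A}_1(\mathbb{R})$ with residue field $\mathbb{R}$, constructed from a finite or infinite sequence $(\omega_i)_{i\ge-1}$ with $v(\omega_i)=\frac{m_{i+1}}{n_{i+1}}$, and let $\beta_i,\alpha_{i,j},h_i$ be the associated data defined in the context. Suppose that (1) for each $i$ such that $n_i$ is even, $\beta_i>0$; and (2) for all $i,j,\ell\ge 0$ with $h_i<h_j\le h_\ell$, $\alpha_{i,j}\alpha_{i,\ell}>0$. Then for each choice of $(\tilde\gamma_i)_{i\ge1}$, $v$ has a unique extension to a valuation $v'$ on $R[y;\delta]$ with residue field $\mathbb{R}$ (satisfying $\overline{x^{m_i/n_i}\omega_{i-1}}=\tilde\gamma_i$ for all $i\ge 1$).
   Context: A valuation on a division ring $D$ is a map $v:D\to\Gamma\cup\{\infty\}$, with $\Gamma$ an additively written totally ordered group and $\infty>\gamma$ for all $\gamma\in\Gamma$, such that $v(a)=\infty\iff a=0$, $v(ab)=v(a)+v(b)$ and $v(a+b)\ge\min\{v(a),v(b)\}$; $\overline{a}$ denotes the residue of an element $a$ with $v(a)\ge 0$. Valuations are trivial on $\mathbb{R}$, and "residue field $\mathbb{R}$" means that the natural map from $\mathbb{R}$ to the residue division ring is an isomorphism. A valuation on an Ore domain extends uniquely to its quotient division ring and is identified with this extension. Uniqueness is up to equivalence of valuations. $\mathcal{A}_1(\mathbb{R})$ is the $\mathbb{R}$-algebra generated by $x,y$ with $yx-xy=1$ and $\mathcal{D}_1(\mathbb{R})$ is its quotient division ring. $R=\{\sum_{k\ge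 m}a_kx^{-k/n}\mid a_k\in\mathbb{R},m\in\mathbb{Z},n\in\mathbb{N}\}$, $\delta(p(x))=p'(x)$, and $R[y;\delta]\supseteq\mathcal{A}_1(\mathbb{R})$ is the skew polynomial ring with $yp=py+\delta(p)$ for $p\in R$. Associated sequence: $v$ is normalized by $v(x)=-1$, and $\mathbb{Q}$ is identified with the rational multiples of $1=-v(x)$ in the divisible hull of the value group. Put $\omega_{-1}=x$, $\omega_0=y$. For $i\ge0$, as long as $v(\omega_i)\in\mathbb{Q}$, write $v(\omega_i)=\frac{m_{i+1}}{n_{i+1}}$ in lowest terms with $n_{i+1}>0$, let $\beta_{i+1}=\overline{x^{m_{i+1}}\omega_i^{n_{i+1}}}\in\mathbb{R}\setminus\{0\}$ and $\omega_{i+1}=x^{m_{i+1}}\omega_i^{n_{i+1}}-\beta_{i+1}$. The sequence is infinite, or it ends with $\omega_N$ if $v(\omega_N)\notin\mathbb{Q}$. Put also $m_0=1$, $n_0=-1$. For indices $i\ne j$, $i,j\ge 0$ (with $v(\omega_{i-1}),v(\omega_{j-1})\in\mathbb{Q}$), set $d_{i,j}=\gcd\{m_jn_i,m_in_j\}$, $K_{i,j}=\frac{m_jn_i}{d_{i,j}}$, $K_{j,i}=\frac{m_in_j}{d_{i,j}}$ and $\alpha_{i,j}=\overline{\omega_{i-1}^{K_{i,j}}\omega_{j-1}^{-K_{j,i}}}\in\mathbb{R}$; also $\alpha_{i,i}=1$. $2^{h_i}$ is the greatest power of two dividing $n_i$. All indices range over those for which these quantities are defined. A choice of $(\tilde\gamma_i)_{i\ge1}$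 means a choice of real numbers $\tilde\gamma_i$ (for all $i\ge1$ with $v(\omega_{i-1})\in\mathbb{Q}$) such that $\tilde\gamma_i^{\,n_i}=\beta_i$ and, with $\tilde\gamma_0=1$, $\alpha_{i,j}=\tilde\gamma_i^{\,K_{i,j}}\tilde\gamma_j^{\,-K_{j,i}}$ for all $i\neq j$. (These are the relations that the residues $\tilde\gamma_i=\overline{x^{m_i/n_i}\omega_{i-1}}$ with respect to any such extension must satisfy.) *)

theory Defs
  imports
    "HOL-Computational_Algebra.Formal_Laurent_Series"
    "HOL-Computational_Algebra.Polynomial"
    "HOL-Computational_Algebra.Factorial_Ring"
    "HOL-Algebra.Group"
begin

text \<open>
  The field of real Puiseux series in \<open>x\<^sup>-\<^sup>1\<close>: \<open>pcoeff f q\<close> is the coefficient of the power of \<open>x\<close> with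
  exponent \<open>- q\<close>, so that supports are bounded below with a common denominator.
\<close>

definition puiseux_support :: "nat \<Rightarrow> int \<Rightarrow> rat set" where
  "puiseux_support n m = {of_int k / of_nat n |k. m \<le> k}"

typedef puiseux = "{f :: rat \<Rightarrow> real. \<exists>n>0. \<exists>m. {q. f q \<noteq> 0} \<subseteq> puiseux_support n m}"
  morphisms pcoeff Abs_puiseux
  by (rule exI[of _ "\<lambda>_. 0"]) (auto intro!: exI[of _ "1::nat"])

setup_lifting type_definition_puiseux

lemma puiseux_eqI: "(\<And>q. pcoeff f q = pcoeff g q) \<Longrightarrow> f = g"
  by (metis pcoeff_inject ext)

text \<open>
  \<open>puiseux_of_fls n F\<close> substitutes the \<open>n\<close>-th root of \<open>1 / x\<close> into the Laurent series \<open>F\<close>. Finitely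
  many Puiseux series always arise from a common \<open>n\<close>, which reduces the field axioms to those
  of Laurent series.
\<close>

lift_definition puiseux_of_fls :: "nat \<Rightarrow> real fls \<Rightarrow> puiseux"
  is "\<lambda>n F q. if n > 0 \<and> q * of_nat n \<in> \<int> then fls_nth F \<lfloor>q * of_nat n\<rfloor> else 0"
proof -
  fix n :: nat and F :: "real fls"
  show "\<exists>n'>0. \<exists>m. {q. (if 0 < n \<and> q * rat_of_nat n \<in> \<int> then fls_nth F \<lfloor>q * rat_of_nat n\<rfloor> else 0) \<noteq> 0}
           \<subseteq> puiseux_support n' m"
  proof (cases "n > 0")
    case True
    show ?thesis
    proof (intro exI[of _ n] conjI exI[of _ "fls_subdegree F"] subsetI, rule True)
      fix q assume "q \<in> {q. (if 0 < n \<and> q * rat_of_nat n \<in> \<int> then fls_nth F \<lfloor>q * rat_of_nat n\<rfloor> else 0) \<noteq> 0}"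
      hence i: "q * rat_of_nat n \<in> \<int>" and nz: "fls_nth F \<lfloor>q * rat_of_nat n\<rfloor> \<noteq> 0"
        by (auto split: if_splits)
      from i obtain k where k: "q * rat_of_nat n = of_int k" by (auto elim: Ints_cases)
      have "fls_subdegree F \<le> k" using nz k by (metis fls_subdegree_leI floor_of_int)
      moreover have "q = of_int k / of_nat n"
        using k True by (simp add: field_simps)
      ultimately show "q \<in> puiseux_support n (fls_subdegree F)"
        by (auto simp: puiseux_support_def)
    qed
  qed (auto intro!: exI[of _ "1::nat"])
qed

lemma puiseux_of_fls_surj:
  obtains n F where "n > 0" "f = puiseux_of_fls n F"
proof -
  from pcoeff[of f] obtain n m where n: "n > 0" and s: "{q. pcoeff f q \<noteq> 0} \<subseteq> puiseux_support n m"
    by auto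
  define F where "F = Abs_fls (\<lambda>k. pcoeff f (of_int k / of_nat n))"
  have nz: "pcoeff f (of_int k / of_nat n) = 0" if "k < m" for k
  proof (rule ccontr)
    assume "pcoeff f (of_int k / of_nat n) \<noteq> 0"
    with s have "of_int k / of_nat n \<in> puiseux_support n m" by blast
    then obtain k' where "m \<le> k'" "rat_of_int k / of_nat n = of_int k' / of_nat n"
      unfolding puiseux_support_def by blast
    hence "k = k'" using n by simp
    with \<open>m \<le> k'\<close> that show False by simp
  qed
  have F: "fls_nth F k = pcoeff f (of_int k / of_nat n)" for k
    unfolding F_def by (rule nth_Abs_fls_lower_bound[of m]) (use nz in auto)
  have "f = puiseux_of_fls n F"
  proof (rule puiseux_eqI)
    fix q
    show "pcoeff f q = pcoeff (puiseux_of_fls n F) q"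
    proof (cases "q * of_nat n \<in> \<int>")
      case True
      then obtain k where k: "q * of_nat n = of_int k" by (auto elim: Ints_cases)
      hence "q = of_int k / of_nat n" using n by (simp add: field_simps)
      thus ?thesis using n by (simp add: puiseux_of_fls.rep_eq F)
    next
      case False
      have "pcoeff f q = 0"
      proof (rule ccontr)
        assume "pcoeff f q \<noteq> 0"
        with s have "q \<in> puiseux_support n m" by blast
        then obtain k' where "q = of_int k' / of_nat n" unfolding puiseux_support_def by blast
        hence "q * of_nat n = of_int k'" using n by simp
        with False show False by simp
      qed
      thus ?thesis using False by (simp add: puiseux_of_fls.rep_eq)
    qed
  qed
  with n that show thesis by blast
qed

lemma puiseux_of_fls_eq:
  assumes "n > 0"
  shows "pcoeff (puiseux_of_fls n F) (of_int k / of_nat n) = fls_nth F k"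
  using assms by (simp add: puiseux_of_fls.rep_eq)

lemma puiseux_of_fls_eq_iff: "n > 0 \<Longrightarrow> puiseux_of_fls n F = puiseux_of_fls n G \<longleftrightarrow> F = G"
  by (metis puiseux_of_fls_eq fls_eqI)

lemma puiseux_of_fls_compose:
  assumes n: "n > 0" and d: "d > 0"
  shows "puiseux_of_fls (n * d) (fls_compose_power F d) = puiseux_of_fls n F"
proof (rule puiseux_eqI)
  fix q
  show "pcoeff (puiseux_of_fls (n * d) (fls_compose_power F d)) q = pcoeff (puiseux_of_fls n F) q"
  proof (cases "q * of_nat n \<in> \<int>")
    case True
    then obtain k where k: "q * of_nat n = of_int k" by (auto elim: Ints_cases)
    hence k2: "q * of_nat (n * d) = of_int (k * int d)" by simp
    have "\<lfloor>q * of_nat (n * d)\<rfloor> = k * int d" unfolding k2 by (rule floor_of_int)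
    moreover have "q * of_nat (n * d) \<in> \<int>" unfolding k2 by (rule Ints_of_int)
    ultimately show ?thesis using k d n by (simp add: puiseux_of_fls.rep_eq fls_nth_compose_power del: of_nat_mult)
  next
    case False
    have "\<not> int d dvd \<lfloor>q * of_nat (n * d)\<rfloor>" if "q * of_nat (n * d) \<in> \<int>"
    proof
      assume "int d dvd \<lfloor>q * of_nat (n * d)\<rfloor>"
      then obtain k where k: "\<lfloor>q * of_nat (n * d)\<rfloor> = int d * k" by auto
      from that obtain l where l: "q * of_nat (n * d) = of_int l" by (auto elim: Ints_cases)
      with k have "q * of_nat (n * d) = of_int (int d * k)" by simp
      hence "q * of_nat n = of_int k" using d by simp
      with False show False by simp
    qed
    thus ?thesis using False d by (simp add: puiseux_of_fls.rep_eq fls_nth_compose_power del: of_nat_mult)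
  qed
qed

lemma puiseux_of_fls_common2:
  obtains n F G where "n > 0" "f = puiseux_of_fls n F" "g = puiseux_of_fls n G"
proof -
  obtain n F where 1: "n > 0" "f = puiseux_of_fls n F" by (rule puiseux_of_fls_surj)
  obtain m G where 2: "m > 0" "g = puiseux_of_fls m G" by (rule puiseux_of_fls_surj)
  show thesis
    by (rule that[of "n * m" "fls_compose_power F m" "fls_compose_power G n"])
       (use 1 2 puiseux_of_fls_compose[of n m F] puiseux_of_fls_compose[of m n G] in \<open>auto simp: mult.commute\<close>)
qed

lemma puiseux_of_fls_common3:
  obtains n F G H where "n > 0" "f = puiseux_of_fls n F" "g = puiseux_of_fls n G" "h = puiseux_of_fls n H"
proof -
  obtain n F G where 1: "n > 0" "f = puiseux_of_fls n F" "g = puiseux_of_fls n G" by (rule puiseux_of_fls_common2)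
  obtain m H where 2: "m > 0" "h = puiseux_of_fls m H" by (rule puiseux_of_fls_surj)
  show thesis
    by (rule that[of "n * m" "fls_compose_power F m" "fls_compose_power G m" "fls_compose_power H n"])
       (use 1 2 puiseux_of_fls_compose[of n m] puiseux_of_fls_compose[of m n H] in \<open>auto simp: mult.commute\<close>)
qed

lemma puiseux_of_fls_conv:
  assumes n: "n > 0"
  shows "(\<Sum>a | pcoeff (puiseux_of_fls n F) a \<noteq> 0 \<and> pcoeff (puiseux_of_fls n G) (q - a) \<noteq> 0.
            pcoeff (puiseux_of_fls n F) a * pcoeff (puiseux_of_fls n G) (q - a)) = pcoeff (puiseux_of_fls n (F * G)) q"
proof (cases "q * of_nat n \<in> \<int>")
  case True
  then obtain k where k: "q * of_nat n = of_int k" by (auto elim: Ints_cases)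
  hence q: "q = of_int k / of_nat n" using n by (simp add: field_simps)
  let ?I = "{fls_subdegree F..k - fls_subdegree G}"
  let ?f = "\<lambda>a. pcoeff (puiseux_of_fls n F) a * pcoeff (puiseux_of_fls n G) (q - a)"
  let ?e = "\<lambda>i::int. of_int i / of_nat n :: rat"
  have d: "q - ?e i = ?e (k - i)" for i unfolding q by (simp add: diff_divide_distrib)
  have inj: "inj_on ?e ?I" using n by (auto simp: inj_on_def)
  have "(\<Sum>a | pcoeff (puiseux_of_fls n F) a \<noteq> 0 \<and> pcoeff (puiseux_of_fls n G) (q - a) \<noteq> 0. ?f a) = sum ?f (?e ` ?I)"
  proof (rule sum.mono_neutral_left)
    show "{a. pcoeff (puiseux_of_fls n F) a \<noteq> 0 \<and> pcoeff (puiseux_of_fls n G) (q - a) \<noteq> 0} \<subseteq> ?e ` ?I"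
    proof
      fix a assume a: "a \<in> {a. pcoeff (puiseux_of_fls n F) a \<noteq> 0 \<and> pcoeff (puiseux_of_fls n G) (q - a) \<noteq> 0}"
      hence "a * of_nat n \<in> \<int>" by (auto simp: puiseux_of_fls.rep_eq split: if_splits)
      then obtain i where "a * of_nat n = of_int i" by (auto elim: Ints_cases)
      hence ai: "a = ?e i" using n by (simp add: field_simps)
      have "fls_nth F i \<noteq> 0" using a ai n puiseux_of_fls_eq[of n F i] by auto
      moreover have "fls_nth G (k - i) \<noteq> 0" using a d n puiseux_of_fls_eq[of n G "k - i"] unfolding ai by auto
      ultimately have "fls_subdegree F \<le> i" "fls_subdegree G \<le> k - i"
        by (auto intro: fls_subdegree_leI)
      thus "a \<in> ?e ` ?I" using ai by auto
    qed
  qed auto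
  also have "\<dots> = (\<Sum>i\<in>?I. fls_nth F i * fls_nth G (k - i))"
    unfolding sum.reindex[OF inj] comp_def d puiseux_of_fls_eq[OF n] by (rule refl)
  also have "\<dots> = pcoeff (puiseux_of_fls n (F * G)) q"
    unfolding q puiseux_of_fls_eq[OF n] by (simp add: fls_times_nth(2))
  finally show ?thesis .
next
  case False
  have "{a. pcoeff (puiseux_of_fls n F) a \<noteq> 0 \<and> pcoeff (puiseux_of_fls n G) (q - a) \<noteq> 0} = {}"
  proof (rule ccontr)
    assume "{a. pcoeff (puiseux_of_fls n F) a \<noteq> 0 \<and> pcoeff (puiseux_of_fls n G) (q - a) \<noteq> 0} \<noteq> {}"
    then obtain a where "a * of_nat n \<in> \<int>" "(q - a) * of_nat n \<in> \<int>"
      by (auto simp: puiseux_of_fls.rep_eq split: if_splits)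
    hence "a * of_nat n + (q - a) * of_nat n \<in> \<int>" by (rule Ints_add)
    with False show False by (simp add: algebra_simps)
  qed
  thus ?thesis using False by (simp only: sum.empty) (simp add: puiseux_of_fls.rep_eq)
qed

instantiation puiseux :: comm_ring_1
begin

lift_definition zero_puiseux :: puiseux is "\<lambda>_. 0" by (auto intro!: exI[of _ "1::nat"])

lift_definition one_puiseux :: puiseux is "\<lambda>q. if q = 0 then 1 else 0"
  by (auto simp: puiseux_support_def intro!: exI[of _ "1::nat"] exI[of _ "0::int"])

lift_definition uminus_puiseux :: "puiseux \<Rightarrow> puiseux" is "\<lambda>f q. - f q" by simp

lift_definition plus_puiseux :: "puiseux \<Rightarrow> puiseux \<Rightarrow> puiseux" is "\<lambda>f g q. f q + g q"
proof -
  fix f g :: "rat \<Rightarrow> real"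
  assume "\<exists>n>0. \<exists>m. {q. f q \<noteq> 0} \<subseteq> puiseux_support n m" "\<exists>n>0. \<exists>m. {q. g q \<noteq> 0} \<subseteq> puiseux_support n m"
  then obtain f' g' where fg: "f = pcoeff f'" "g = pcoeff g'"
    by (metis (mono_tags, lifting) Abs_puiseux_inverse mem_Collect_eq)
  obtain n F G where "n > 0" "f' = puiseux_of_fls n F" "g' = puiseux_of_fls n G" by (rule puiseux_of_fls_common2)
  hence eq: "f q + g q = pcoeff (puiseux_of_fls n (F + G)) q" for q
    unfolding fg by (auto simp: puiseux_of_fls.rep_eq)
  show "\<exists>n>0. \<exists>m. {q. f q + g q \<noteq> 0} \<subseteq> puiseux_support n m"
    unfolding eq using pcoeff[of "puiseux_of_fls n (F + G)"] by simp
qed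

lift_definition minus_puiseux :: "puiseux \<Rightarrow> puiseux \<Rightarrow> puiseux" is "\<lambda>f g q. f q - g q"
proof -
  fix f g :: "rat \<Rightarrow> real"
  assume "\<exists>n>0. \<exists>m. {q. f q \<noteq> 0} \<subseteq> puiseux_support n m" "\<exists>n>0. \<exists>m. {q. g q \<noteq> 0} \<subseteq> puiseux_support n m"
  then obtain f' g' where fg: "f = pcoeff f'" "g = pcoeff g'"
    by (metis (mono_tags, lifting) Abs_puiseux_inverse mem_Collect_eq)
  obtain n F G where "n > 0" "f' = puiseux_of_fls n F" "g' = puiseux_of_fls n G" by (rule puiseux_of_fls_common2)
  hence eq: "f q - g q = pcoeff (puiseux_of_fls n (F - G)) q" for q
    unfolding fg by (auto simp: puiseux_of_fls.rep_eq)
  show "\<exists>n>0. \<exists>m. {q. f q - g q \<noteq> 0} \<subseteq> puiseux_support n m"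
    unfolding eq using pcoeff[of "puiseux_of_fls n (F - G)"] by simp
qed

lift_definition times_puiseux :: "puiseux \<Rightarrow> puiseux \<Rightarrow> puiseux"
  is "\<lambda>f g q. \<Sum>a | f a \<noteq> 0 \<and> g (q - a) \<noteq> 0. f a * g (q - a)"
proof -
  fix f g :: "rat \<Rightarrow> real"
  assume "\<exists>n>0. \<exists>m. {q. f q \<noteq> 0} \<subseteq> puiseux_support n m" "\<exists>n>0. \<exists>m. {q. g q \<noteq> 0} \<subseteq> puiseux_support n m"
  then obtain f' g' where fg: "f = pcoeff f'" "g = pcoeff g'"
    by (metis (mono_tags, lifting) Abs_puiseux_inverse mem_Collect_eq)
  obtain n F G where *: "n > 0" "f' = puiseux_of_fls n F" "g' = puiseux_of_fls n G" by (rule puiseux_of_fls_common2)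
  show "\<exists>n>0. \<exists>m. {q. (\<Sum>a | f a \<noteq> 0 \<and> g (q - a) \<noteq> 0. f a * g (q - a)) \<noteq> 0} \<subseteq> puiseux_support n m"
    unfolding fg *(2,3) puiseux_of_fls_conv[OF *(1)] using pcoeff[of "puiseux_of_fls n (F * G)"] by simp
qed

lemma puiseux_of_fls_add: "n > 0 \<Longrightarrow> puiseux_of_fls n F + puiseux_of_fls n G = puiseux_of_fls n (F + G)"
  by (rule puiseux_eqI) (simp add: plus_puiseux.rep_eq puiseux_of_fls.rep_eq)
lemma puiseux_of_fls_minus: "n > 0 \<Longrightarrow> puiseux_of_fls n F - puiseux_of_fls n G = puiseux_of_fls n (F - G)"
  by (rule puiseux_eqI) (simp add: minus_puiseux.rep_eq puiseux_of_fls.rep_eq)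
lemma puiseux_of_fls_uminus: "n > 0 \<Longrightarrow> - puiseux_of_fls n F = puiseux_of_fls n (- F)"
  by (rule puiseux_eqI) (simp add: uminus_puiseux.rep_eq puiseux_of_fls.rep_eq)
lemma puiseux_of_fls_mult: "n > 0 \<Longrightarrow> puiseux_of_fls n F * puiseux_of_fls n G = puiseux_of_fls n (F * G)"
  by (rule puiseux_eqI) (simp add: times_puiseux.rep_eq puiseux_of_fls_conv)
lemma puiseux_of_fls_0: "puiseux_of_fls n 0 = 0"
  by (rule puiseux_eqI) (simp add: zero_puiseux.rep_eq puiseux_of_fls.rep_eq)
lemma puiseux_of_fls_1: "n > 0 \<Longrightarrow> puiseux_of_fls n 1 = 1"
proof (rule puiseux_eqI)
  fix q assume n: "n > 0"
  have "\<lfloor>q * rat_of_nat n\<rfloor> = 0 \<longleftrightarrow> q = 0" if "q * of_nat n \<in> \<int>"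
    using that n by (auto elim: Ints_cases)
  thus "pcoeff (puiseux_of_fls n 1) q = pcoeff 1 q"
    using n by (simp add: one_puiseux.rep_eq puiseux_of_fls.rep_eq fls_one_nth)
qed

instance
proof
  fix a b c :: puiseux
  obtain n A B C where n: "n > 0" and e: "a = puiseux_of_fls n A" "b = puiseux_of_fls n B" "c = puiseux_of_fls n C"
    by (rule puiseux_of_fls_common3)
  note r = puiseux_of_fls_add[OF n] puiseux_of_fls_minus[OF n] puiseux_of_fls_uminus[OF n] puiseux_of_fls_mult[OF n]
  show "a * b * c = a * (b * c)" "a * b = b * a" "a + b + c = a + (b + c)" "a + b = b + a"
    "(a + b) * c = a * c + b * c" "a - b = a + - b" "- a + a = 0" "0 + a = a" "1 * a = a"
    unfolding e puiseux_of_fls_0[of n, symmetric] puiseux_of_fls_1[OF n, symmetric] r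
    by (simp_all add: algebra_simps)
  show "(0::puiseux) \<noteq> 1"
    unfolding puiseux_of_fls_0[of 1, symmetric] puiseux_of_fls_1[of 1, OF zero_less_one, symmetric] by (simp add: puiseux_of_fls_eq_iff)
qed

end

instantiation puiseux :: field
begin

definition inverse_puiseux_def:
  "inverse (f :: puiseux) = (if f = 0 then 0 else THE g. f * g = 1)"

definition divide_puiseux_def:
  "(f :: puiseux) div g = f * inverse g"

instance
proof
  fix a b :: puiseux
  show "a div b = a * inverse b" by (simp add: divide_puiseux_def)
  show "inverse (0 :: puiseux) = 0" by (simp add: inverse_puiseux_def)
  assume a: "a \<noteq> 0"
  obtain n A where n: "n > 0" "a = puiseux_of_fls n A" by (rule puiseux_of_fls_surj)
  hence "A \<noteq> 0" using a by (auto simp: puiseux_of_fls_0)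
  hence "A * inverse A = 1" by simp
  hence ex: "a * puiseux_of_fls n (inverse A) = 1" using n by (simp add: puiseux_of_fls_mult puiseux_of_fls_1)
  have "a * (THE g. a * g = 1) = 1"
  proof (rule theI, rule ex)
    fix g assume "a * g = 1"
    thus "g = puiseux_of_fls n (inverse A)" using ex by (metis mult.assoc mult.commute mult_1)
  qed
  thus "inverse a * a = 1" using a by (simp add: inverse_puiseux_def mult.commute)
qed

end

text \<open>
  \<open>puiseux_monom c a\<close> is \<open>c\<close> times the power of \<open>x\<close> with exponent \<open>a\<close>.
\<close>

lift_definition puiseux_monom :: "real \<Rightarrow> rat \<Rightarrow> puiseux" is "\<lambda>c a q. if q = - a then c else 0"
proof -
  fix c :: real and a :: rat
  obtain k l where kl: "quotient_of (- a) = (k, l)" by (cases "quotient_of (- a)")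
  hence l: "l > 0" and q: "- a = of_int k / of_int l" using quotient_of_denom_pos
    by (auto simp: dest: quotient_of_div)
  show "\<exists>n>0. \<exists>m. {q. (if q = - a then c else 0) \<noteq> 0} \<subseteq> puiseux_support n m"
    using l q by (auto intro!: exI[of _ "nat l"] exI[of _ k] simp: puiseux_support_def)
qed

class differential_field = field +
  fixes der :: "'a \<Rightarrow> 'a"
  assumes der_add: "der (a + b) = der a + der b"
    and der_mult: "der (a * b) = der a * b + a * der b"

text \<open>
  The derivative with respect to \<open>x\<close>; it maps the power of \<open>x\<close> with exponent \<open>- q\<close> to \<open>- q\<close> times
  the power with exponent \<open>- q - 1\<close>.
\<close>

instantiation puiseux :: differential_field
begin

lift_definition der_puiseux :: "puiseux \<Rightarrow> puiseux" is "\<lambda>f q. - of_rat (q - 1) * f (q - 1)"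
proof -
  fix f :: "rat \<Rightarrow> real"
  assume "\<exists>n>0. \<exists>m. {q. f q \<noteq> 0} \<subseteq> puiseux_support n m"
  then obtain n m where n: "n > 0" and m: "{q. f q \<noteq> 0} \<subseteq> puiseux_support n m" by blast
  have "{q. - of_rat (q - 1) * f (q - 1) \<noteq> 0} \<subseteq> puiseux_support n (m + int n)"
  proof
    fix q assume "q \<in> {q. - of_rat (q - 1) * f (q - 1) \<noteq> 0}"
    hence "q - 1 \<in> puiseux_support n m" using m by auto
    then obtain k where "m \<le> k" "q - 1 = of_int k / of_nat n" by (auto simp: puiseux_support_def)
    hence "m + int n \<le> k + int n" "q = of_int (k + int n) / of_nat n" using n
      by (auto simp: field_simps)
    thus "q \<in> puiseux_support n (m + int n)" unfolding puiseux_support_def by blast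
  qed
  with n show "\<exists>n>0. \<exists>m. {q. - of_rat (q - 1) * f (q - 1) \<noteq> 0} \<subseteq> puiseux_support n m"
    by blast
qed

lemma der_puiseux_of_fls:
  assumes n: "n > 0"
  shows "der (puiseux_of_fls n F) = puiseux_of_fls n (- fls_const (1 / real n) * fls_X_intpow (int n + 1) * fls_deriv F)"
proof (rule puiseux_eqI)
  fix q :: rat
  have i: "(q - 1) * of_nat n \<in> \<int> \<longleftrightarrow> q * of_nat n \<in> \<int>"
  proof -
    have "(q - 1) * of_nat n = q * of_nat n - of_nat n" by (simp add: left_diff_distrib)
    moreover have "q * of_nat n - of_nat n + of_nat n = q * of_nat n" by simp
    ultimately show ?thesis using Ints_diff[of "q * of_nat n" "of_nat n"]
        Ints_add[of "q * of_nat n - of_nat n" "of_nat n"] Ints_of_nat[of n] by metis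
  qed
  show "pcoeff (der (puiseux_of_fls n F)) q =
        pcoeff (puiseux_of_fls n (- fls_const (1 / real n) * fls_X_intpow (int n + 1) * fls_deriv F)) q"
  proof (cases "q * of_nat n \<in> \<int>")
    case True
    then obtain k where k: "q * of_nat n = of_int k" by (auto elim: Ints_cases)
    hence q: "q = of_int k / of_nat n" using n by (simp add: field_simps)
    have q1: "q - 1 = of_int (k - int n) / of_nat n" using n by (simp add: q field_simps)
    have "pcoeff (der (puiseux_of_fls n F)) q = - of_rat (q - 1) * pcoeff (puiseux_of_fls n F) (q - 1)"
      by (simp add: der_puiseux.rep_eq)
    also have "\<dots> = - (of_int (k - int n) / real n) * fls_nth F (k - int n)"
      unfolding q1 puiseux_of_fls_eq[OF n] by (simp add: of_rat_divide of_rat_diff)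
    also have "\<dots> = fls_nth (- fls_const (1 / real n) * fls_X_intpow (int n + 1) * fls_deriv F) k"
    proof -
      have "fls_nth (- fls_const (1 / real n) * fls_X_intpow (int n + 1) * fls_deriv F) k
          = - (1 / real n) * fls_nth (fls_X_intpow (int n + 1) * fls_deriv F) k"
        by (simp only: mult.assoc fls_const_uminus) (simp del: fls_const_uminus)
      also have "fls_nth (fls_X_intpow (int n + 1) * fls_deriv F) k = of_int (k - int n) * fls_nth F (k - int n)"
        unfolding fls_X_intpow_times_conv_shift by simp
      finally show ?thesis by simp
    qed
    finally show ?thesis unfolding q puiseux_of_fls_eq[OF n] .
  next
    case False
    thus ?thesis using i by (simp add: der_puiseux.rep_eq puiseux_of_fls.rep_eq)
  qed
qed

instance
proof
  fix a b :: puiseux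
  obtain n A B where n: "n > 0" and e: "a = puiseux_of_fls n A" "b = puiseux_of_fls n B" by (rule puiseux_of_fls_common2)
  define C where "C = - fls_const (1 / real n) * fls_X_intpow (int n + 1)"
  note r = e puiseux_of_fls_add[OF n] puiseux_of_fls_mult[OF n] der_puiseux_of_fls[OF n] C_def[symmetric]
  show "der (a + b) = der a + der b"
    unfolding r by (simp add: distrib_left)
  show "der (a * b) = der a * b + a * der b"
    unfolding r fls_deriv_mult by (simp only: distrib_left mult_ac add_ac)
qed

end

text \<open>
  The skew polynomial ring over a differential field: \<open>skew P\<close> is the sum of the terms
  \<open>coeff P i\<close> times the \<open>i\<close>-th power of \<open>y\<close>, with coefficients on the left.
\<close>

typedef (overloaded) 'a skew_poly = "UNIV :: 'a :: zero poly set"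
  morphisms poly_of skew
  by auto

setup_lifting type_definition_skew_poly

text \<open>
  Left multiplication by \<open>y\<close>, as forced by \<open>y p = p y + der p\<close>.
\<close>

definition ymult :: "'a::differential_field poly \<Rightarrow> 'a poly" where
  "ymult Q = pCons 0 Q + map_poly der Q"

lemma der_0 [simp]: "der (0 :: 'a::differential_field) = 0"
  using der_add[of 0 "0 :: 'a"] by (metis add_0 add_right_cancel)

lemma der_1 [simp]: "der (1 :: 'a::differential_field) = 0"
  using der_mult[of 1 "1 :: 'a"] by (metis add_0 add_right_cancel mult_1 mult_1_right)

lemma degree_map_der: "degree (map_poly der P) \<le> degree (P :: 'a::differential_field poly)"
  by (rule degree_le) (simp add: coeff_map_poly coeff_eq_0)

definition skew_mult :: "'a::differential_field poly \<Rightarrow> 'a poly \<Rightarrow> 'a poly" where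
  "skew_mult P Q = (\<Sum>i\<le>degree P. smult (coeff P i) ((ymult ^^ i) Q))"

lemma ymult_add: "ymult (P + Q) = ymult P + ymult Q"
  by (rule poly_eqI) (simp add: ymult_def coeff_map_poly der_add coeff_pCons split: nat.split)

lemma ymult_0 [simp]: "ymult 0 = 0"
  by (simp add: ymult_def)

lemma ymult_pow_0 [simp]: "(ymult ^^ i) 0 = 0"
  by (induction i) auto

lemma ymult_pow_add: "(ymult ^^ i) (P + Q) = (ymult ^^ i) P + (ymult ^^ i) Q"
  by (induction i) (auto simp: ymult_add)

lemma ymult_smult: "ymult (smult a Q) = smult a (ymult Q) + smult (der a) Q"
  by (rule poly_eqI)
     (simp add: ymult_def coeff_map_poly der_mult coeff_pCons algebra_simps split: nat.split)

lemma ymult_sum: "ymult (sum f A) = (\<Sum>x\<in>A. ymult (f x))"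
  by (induction A rule: infinite_finite_induct) (auto simp: ymult_add)

lemma skew_mult_bound:
  assumes "degree P \<le> n"
  shows "skew_mult P Q = (\<Sum>i\<le>n. smult (coeff P i) ((ymult ^^ i) Q))"
  unfolding skew_mult_def using assms
  by (intro sum.mono_neutral_left) (auto simp: coeff_eq_0)

lemma skew_mult_add_left: "skew_mult (P + P') Q = skew_mult P Q + skew_mult P' Q"
proof -
  let ?n = "max (degree P) (degree P')"
  show ?thesis
    by (simp add: skew_mult_bound[of _ ?n] degree_add_le smult_add_left sum.distrib)
qed

lemma skew_mult_add_right: "skew_mult P (Q + Q') = skew_mult P Q + skew_mult P Q'"
  by (simp add: skew_mult_def ymult_pow_add smult_add_right sum.distrib)

lemma skew_mult_0_left [simp]: "skew_mult 0 Q = 0"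
  by (simp add: skew_mult_def)

lemma skew_mult_0_right [simp]: "skew_mult P 0 = 0"
  by (simp add: skew_mult_def)

lemma skew_mult_smult: "skew_mult (smult a P) Q = smult a (skew_mult P Q)"
proof -
  have "degree (smult a P) \<le> degree P" by (rule degree_smult_le)
  thus ?thesis
    unfolding skew_mult_def[of P] by (simp add: skew_mult_bound) (rule poly_eqI, simp add: coeff_sum sum_distrib_left mult.assoc)
qed

lemma skew_mult_sum_left: "skew_mult (sum f A) Q = (\<Sum>x\<in>A. skew_mult (f x) Q)"
  by (induction A rule: infinite_finite_induct) (auto simp: skew_mult_add_left)

lemma skew_mult_1_left: "skew_mult 1 Q = Q"
  by (simp add: skew_mult_def)

lemma skew_mult_pCons_0: "skew_mult (pCons 0 P) Q = skew_mult P (ymult Q)"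
proof -
  have "skew_mult (pCons 0 P) Q = (\<Sum>i\<le>Suc (degree P). smult (coeff (pCons 0 P) i) ((ymult ^^ i) Q))"
    by (rule skew_mult_bound) (rule degree_pCons_le)
  also have "\<dots> = (\<Sum>i\<le>degree P. smult (coeff P i) ((ymult ^^ Suc i) Q))"
    using sum.atMost_Suc_shift[of "\<lambda>i. smult (coeff (pCons 0 P) i) ((ymult ^^ i) Q)" "degree P"]
    by (simp only: coeff_pCons_0 coeff_pCons_Suc smult_0_left add_0)
  finally show ?thesis by (simp only: skew_mult_def[of P] funpow_Suc_right o_apply)
qed

lemma skew_mult_ymult: "skew_mult (ymult P) Q = ymult (skew_mult P Q)"
proof -
  have "degree (map_poly der P) \<le> degree P" by (rule degree_map_der)
  hence "skew_mult (map_poly der P) Q = (\<Sum>i\<le>degree P. smult (der (coeff P i)) ((ymult ^^ i) Q))"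
    by (simp add: skew_mult_bound coeff_map_poly)
  moreover have "skew_mult (pCons 0 P) Q = (\<Sum>i\<le>degree P. smult (coeff P i) (ymult ((ymult ^^ i) Q)))"
    by (simp add: skew_mult_pCons_0[of P] skew_mult_def[of P] funpow_swap1)
  ultimately have "skew_mult (ymult P) Q =
      (\<Sum>i\<le>degree P. smult (coeff P i) (ymult ((ymult ^^ i) Q)) + smult (der (coeff P i)) ((ymult ^^ i) Q))"
    by (simp add: ymult_def[of P] skew_mult_add_left sum.distrib)
  thus ?thesis by (simp add: skew_mult_def ymult_sum ymult_smult)
qed

lemma skew_mult_ymult_pow: "skew_mult ((ymult ^^ i) P) Q = (ymult ^^ i) (skew_mult P Q)"
  by (induction i) (auto simp: skew_mult_ymult)

lemma skew_mult_assoc: "skew_mult (skew_mult P Q) S = skew_mult P (skew_mult Q S)"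
  by (simp add: skew_mult_def[of P] skew_mult_sum_left skew_mult_smult skew_mult_ymult_pow)

lemma ymult_pow_1: "(ymult ^^ i) 1 = monom 1 i"
proof (induction i)
  case (Suc i)
  have "map_poly der (monom 1 i :: 'a poly) = 0"
    by (rule poly_eqI) (simp add: coeff_map_poly)
  thus ?case using Suc by (simp add: ymult_def monom_Suc)
qed simp

lemma skew_mult_1_right: "skew_mult P 1 = P"
  using poly_as_sum_of_monoms[of P] by (simp add: skew_mult_def ymult_pow_1 smult_monom)

lemma degree_ymult: "Q \<noteq> 0 \<Longrightarrow> degree (ymult Q) = Suc (degree Q) \<and> lead_coeff (ymult Q) = lead_coeff Q"
proof -
  assume Q: "Q \<noteq> 0"
  have "degree (map_poly der Q) < degree (pCons 0 Q)"
    using degree_map_der[of Q] Q by simp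
  thus ?thesis using Q
    by (simp add: ymult_def degree_add_eq_left coeff_add coeff_eq_0)
qed

lemma ymult_nz: "Q \<noteq> 0 \<Longrightarrow> ymult Q \<noteq> 0"
  using degree_ymult[of Q] by auto

lemma degree_ymult_pow:
  "Q \<noteq> 0 \<Longrightarrow> (ymult ^^ i) Q \<noteq> 0 \<and> degree ((ymult ^^ i) Q) = degree Q + i \<and> lead_coeff ((ymult ^^ i) Q) = lead_coeff Q"
proof (induction i)
  case (Suc i)
  thus ?case using degree_ymult[of "(ymult ^^ i) Q"] ymult_nz[of "(ymult ^^ i) Q"] by auto
qed simp

lemma degree_skew_mult:
  assumes "P \<noteq> 0" "Q \<noteq> 0"
  shows "degree (skew_mult P Q) = degree P + degree Q"
    and "lead_coeff (skew_mult P Q) = lead_coeff P * lead_coeff Q"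
proof -
  let ?n = "degree P + degree Q"
  have le: "degree (skew_mult P Q) \<le> ?n"
    unfolding skew_mult_def
    by (intro degree_sum_le order.trans[OF degree_smult_le]) (auto simp: degree_ymult_pow assms)
  have "coeff (skew_mult P Q) ?n = (\<Sum>i\<le>degree P. coeff P i * coeff ((ymult ^^ i) Q) ?n)"
    by (simp add: skew_mult_def coeff_sum)
  also have "\<dots> = (\<Sum>i\<in>{degree P}. coeff P i * coeff ((ymult ^^ i) Q) ?n)"
    by (intro sum.mono_neutral_right) (auto intro!: coeff_eq_0 simp: degree_ymult_pow assms)
  also have "\<dots> = lead_coeff P * lead_coeff Q"
    using degree_ymult_pow[of Q "degree P"] assms by (auto simp: add.commute)
  finally have *: "coeff (skew_mult P Q) ?n = lead_coeff P * lead_coeff Q" .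
  hence "coeff (skew_mult P Q) ?n \<noteq> 0" using assms by simp
  with le show "degree (skew_mult P Q) = ?n" by (meson le_antisym le_degree)
  with * show "lead_coeff (skew_mult P Q) = lead_coeff P * lead_coeff Q" by simp
qed

lemma skew_mult_nz: "P \<noteq> 0 \<Longrightarrow> Q \<noteq> 0 \<Longrightarrow> skew_mult P Q \<noteq> 0"
  using degree_skew_mult(2)[of P Q] by auto

class right_ore_domain = ring_1_no_zero_divisors +
  assumes right_ore: "b \<noteq> 0 \<Longrightarrow> \<exists>c d. c \<noteq> 0 \<and> a * c = b * d"

instantiation skew_poly :: (differential_field) right_ore_domain
begin

lift_definition zero_skew_poly :: "'a skew_poly" is 0 .
lift_definition one_skew_poly :: "'a skew_poly" is 1 .
lift_definition plus_skew_poly :: "'a skew_poly \<Rightarrow> 'a skew_poly \<Rightarrow> 'a skew_poly" is "(+)" .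
lift_definition minus_skew_poly :: "'a skew_poly \<Rightarrow> 'a skew_poly \<Rightarrow> 'a skew_poly" is "(-)" .
lift_definition uminus_skew_poly :: "'a skew_poly \<Rightarrow> 'a skew_poly" is uminus .
lift_definition times_skew_poly :: "'a skew_poly \<Rightarrow> 'a skew_poly \<Rightarrow> 'a skew_poly" is skew_mult .

lemma skew_ore:
  fixes P Q :: "'a poly"
  assumes "Q \<noteq> 0"
  shows "\<exists>C D. C \<noteq> 0 \<and> skew_mult P C = skew_mult Q D"
  using assms
proof (induction "degree Q" arbitrary: P Q rule: less_induct)
  case less
  note outer = this
  have div: "\<exists>D R. P = skew_mult Q D + R \<and> (R = 0 \<or> degree R < degree Q)" for P
  proof (induction "degree P" arbitrary: P rule: less_induct)
    case less
    show ?case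
    proof (cases "P = 0 \<or> degree P < degree Q")
      case True
      thus ?thesis by (intro exI[of _ 0] exI[of _ P]) auto
    next
      case False
      define c where "c = lead_coeff P / lead_coeff Q"
      define M where "M = monom c (degree P - degree Q)"
      have "c \<noteq> 0" using False outer(2) by (simp add: c_def)
      hence M: "M \<noteq> 0" "degree M = degree P - degree Q" "lead_coeff M = c"
        by (auto simp: M_def degree_monom_eq)
      define P' where "P' = P - skew_mult Q M"
      have d: "degree (skew_mult Q M) = degree P" "lead_coeff (skew_mult Q M) = lead_coeff P"
        using degree_skew_mult[OF outer(2) M(1)] M False outer(2) by (auto simp: c_def)
      show ?thesis
      proof (cases "P' = 0")
        case True
        thus ?thesis by (intro exI[of _ M] exI[of _ 0]) (auto simp: P'_def)
      next
        case nz: False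
        have "degree P' \<le> degree P" using d by (auto simp: P'_def intro: degree_diff_le)
        moreover have "coeff P' (degree P) = 0" using d by (simp add: P'_def)
        ultimately have "degree P' < degree P" using nz
          by (metis le_neq_implies_less leading_coeff_0_iff)
        from less[OF this] obtain D R where
          "P' = skew_mult Q D + R" "R = 0 \<or> degree R < degree Q" by blast
        thus ?thesis
          by (intro exI[of _ "M + D"] exI[of _ R]) (auto simp: P'_def skew_mult_add_right algebra_simps)
      qed
    qed
  qed
  from div[of P] obtain D R where DR: "P = skew_mult Q D + R" "R = 0 \<or> degree R < degree Q" by blast
  show ?case
  proof (cases "R = 0")
    case True
    thus ?thesis using DR by (intro exI[of _ 1] exI[of _ D]) (simp add: skew_mult_1_right)
  next
    case False
    with DR outer(1)[of R Q] obtain C' D' where CD: "C' \<noteq> 0" "skew_mult Q C' = skew_mult R D'" by blast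
    hence "D' \<noteq> 0" using skew_mult_nz[OF outer(2) CD(1)] by auto
    moreover have "skew_mult P D' = skew_mult Q (skew_mult D D' + C')"
      using DR CD by (simp add: skew_mult_add_left skew_mult_add_right skew_mult_assoc)
    ultimately show ?thesis by blast
  qed
qed

instance
proof
  fix a b c :: "'a skew_poly"
  show "a * b * c = a * (b * c)" by transfer (rule skew_mult_assoc)
  show "a + b + c = a + (b + c)" by transfer (rule add.assoc)
  show "a + b = b + a" by transfer (rule add.commute)
  show "0 + a = a" by transfer simp
  show "- a + a = 0" by transfer simp
  show "a - b = a + - b" by transfer simp
  show "(a + b) * c = a * c + b * c" by transfer (rule skew_mult_add_left)
  show "a * (b + c) = a * b + a * c" by transfer (rule skew_mult_add_right)
  show "0 * a = 0" "a * 0 = 0" by (transfer, simp)+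
  show "1 * a = a" by transfer (rule skew_mult_1_left)
  show "a * 1 = a" by transfer (rule skew_mult_1_right)
  show "(0::'a skew_poly) \<noteq> 1" by transfer simp
  show "a \<noteq> 0 \<Longrightarrow> b \<noteq> 0 \<Longrightarrow> a * b \<noteq> 0" by transfer (rule skew_mult_nz)
  show "b \<noteq> 0 \<Longrightarrow> \<exists>c d. c \<noteq> 0 \<and> a * c = b * d"
    by transfer (rule skew_ore)
qed

end

definition sconst :: "'a::differential_field \<Rightarrow> 'a skew_poly" where
  "sconst a = skew [:a:]"

definition svar :: "'a::differential_field skew_poly" where
  "svar = skew [:0, 1:]"

lemma svar_comm: "svar * sconst a = sconst a * svar + sconst (der a)"
  unfolding svar_def sconst_def
  by (simp add: times_skew_poly.abs_eq plus_skew_poly.abs_eq skew_mult_def ymult_def map_poly_pCons)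

lemma right_oreE:
  fixes a b :: "'a::right_ore_domain"
  assumes "b \<noteq> 0"
  obtains c d where "c \<noteq> 0" "a * c = b * d"
  using right_ore[OF assms] by blast

text \<open>
  The quotient division ring of a right Ore domain: classes of right fractions \<open>ore_frac a b\<close>,
  standing for \<open>a\<close> times the inverse of \<open>b\<close>.
\<close>

definition ore_rel :: "'a::right_ore_domain \<times> 'a \<Rightarrow> 'a \<times> 'a \<Rightarrow> bool" where
  "ore_rel = (\<lambda>(a, b) (c, d). b \<noteq> 0 \<and> d \<noteq> 0 \<and>
     (\<exists>s t. s \<noteq> 0 \<and> t \<noteq> 0 \<and> b * s = d * t \<and> a * s = c * t))"

lemma ore_relD:
  assumes "ore_rel (a, b) (c, d)" "b * s = d * t"
  shows "a * s = c * t"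
proof -
  from assms(1) obtain s0 t0 where nz: "b \<noteq> 0" "d \<noteq> 0" "s0 \<noteq> 0" "t0 \<noteq> 0"
    and eq: "b * s0 = d * t0" "a * s0 = c * t0" by (auto simp: ore_rel_def)
  obtain u w where u: "u \<noteq> 0" "s * u = s0 * w" using nz(3) by (rule right_oreE)
  have "d * (t * u) = d * (t0 * w)"
    by (metis assms(2) eq(1) mult.assoc u(2))
  hence "t * u = t0 * w" using nz by simp
  hence "a * s * u = c * t * u" by (metis eq(2) mult.assoc u(2))
  thus ?thesis using u by simp
qed

lemma ore_relI:
  assumes "b \<noteq> 0" "d \<noteq> 0" "\<And>s t. b * s = d * t \<Longrightarrow> a * s = c * t"
  shows "ore_rel (a, b) (c, d)"
proof -
  obtain s t where s: "s \<noteq> 0" "b * s = d * t" using assms(2) by (rule right_oreE)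
  hence "t \<noteq> 0" using assms by auto
  with s assms show ?thesis by (auto simp: ore_rel_def)
qed

lemma part_equivp_ore: "part_equivp (ore_rel :: 'a::right_ore_domain \<times> 'a \<Rightarrow> _)"
proof (rule part_equivpI)
  show "\<exists>x. ore_rel x x"
    by (rule exI[of _ "(0, 1)"]) (auto simp: ore_rel_def intro!: exI[of _ 1])
  show "symp ore_rel"
    by (rule sympI) (auto simp: ore_rel_def, metis)
  have "ore_rel x z" if "ore_rel x y" "ore_rel y z" for x y z :: "'a \<times> 'a"
  proof -
    note that
    moreover obtain a b c d e f where xyz: "x = (a, b)" "y = (c, d)" "z = (e, f)"
      by (cases x; cases y; cases z)
    ultimately have r: "ore_rel (a, b) (c, d)" "ore_rel (c, d) (e, f)" by auto
    hence nz: "b \<noteq> 0" "d \<noteq> 0" "f \<noteq> 0" by (auto simp: ore_rel_def)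
    have "ore_rel (a, b) (e, f)"
    proof (rule ore_relI)
      fix s t assume st: "b * s = f * t"
      obtain u w where u: "u \<noteq> 0" "b * s * u = d * w" using nz(2) by (rule right_oreE)
      have "a * (s * u) = c * w" using ore_relD[OF r(1)] u by (simp add: mult.assoc)
      moreover have "c * w = e * (t * u)" using ore_relD[OF r(2)] u st by (simp add: mult.assoc)
      ultimately have "a * s * u = e * t * u" by (simp add: mult.assoc)
      thus "a * s = e * t" using u by simp
    qed (use nz in auto)
    thus "ore_rel x z" by (simp add: xyz)
  qed
  thus "transp (ore_rel :: 'a \<times> 'a \<Rightarrow> _)" by (auto simp: transp_def)
qed

quotient_type (overloaded) 'a ore_quot = "'a::right_ore_domain \<times> 'a" / partial: ore_rel
  by (rule part_equivp_ore)

definition ore_frac :: "'a::right_ore_domain \<Rightarrow> 'a \<Rightarrow> 'a ore_quot" where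
  "ore_frac a b = abs_ore_quot (a, b)"

lemma ore_rel_refl: "ore_rel (a, b) (a, b) \<longleftrightarrow> b \<noteq> 0"
  by (auto simp: ore_rel_def intro!: exI[of _ 1])

lemma ore_frac_eq_iff:
  assumes "b \<noteq> 0" "d \<noteq> 0"
  shows "ore_frac a b = ore_frac c d \<longleftrightarrow> ore_rel (a, b) (c, d)"
  unfolding ore_frac_def
  using Quotient3_rel[OF Quotient3_ore_quot, of "(a, b)" "(c, d)"] assms by (simp add: ore_rel_refl)

lemma ore_frac_cases:
  obtains a b where "b \<noteq> 0" "q = ore_frac a b"
proof -
  obtain x where "ore_rel x x" "q = abs_ore_quot x"
    by (metis Quotient3_ore_quot Quotient3_abs_rep Quotient3_rep_reflp)
  thus thesis using that by (cases x) (auto simp: ore_rel_refl ore_frac_def)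
qed

lemma ore_frac_expand:
  assumes "b \<noteq> 0" "s \<noteq> 0"
  shows "ore_frac (a * s) (b * s) = ore_frac a b"
proof -
  have "ore_rel (a * s, b * s) (a, b)"
    unfolding ore_rel_def prod.case using assms by (intro conjI exI[of _ 1] exI[of _ s]) auto
  thus ?thesis using assms by (simp add: ore_frac_eq_iff)
qed

text \<open>
  \<open>acts q s t\<close> expresses \<open>q s = t\<close> in the quotient division ring; it is only used for the proofs.
\<close>

definition acts :: "'a::right_ore_domain ore_quot \<Rightarrow> 'a \<Rightarrow> 'a \<Rightarrow> bool" where
  "acts q s t \<longleftrightarrow> (\<exists>a b c d. b \<noteq> 0 \<and> d \<noteq> 0 \<and> q = ore_frac a b \<and> s * d = b * c \<and> t * d = a * c)"

lemma acts_frac: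
  assumes "b \<noteq> 0" "s * d = b * c" "d \<noteq> 0"
  shows "acts (ore_frac a b) s t \<longleftrightarrow> t * d = a * c"
proof
  assume "t * d = a * c"
  thus "acts (ore_frac a b) s t" using assms unfolding acts_def by blast
next
  assume "acts (ore_frac a b) s t"
  then obtain a' b' c' d' where *: "b' \<noteq> 0" "d' \<noteq> 0" "ore_frac a b = ore_frac a' b'"
    "s * d' = b' * c'" "t * d' = a' * c'" unfolding acts_def by blast
  hence r: "ore_rel (a, b) (a', b')" using assms by (simp add: ore_frac_eq_iff)
  obtain u w where u: "u \<noteq> 0" "d * u = d' * w" using *(2) by (rule right_oreE)
  have "b * (c * u) = b' * (c' * w)" using *(4) assms(2) u by (metis mult.assoc)
  hence "a * (c * u) = a' * (c' * w)" by (rule ore_relD[OF r])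
  hence "t * d * u = a * c * u" using *(5) u by (metis mult.assoc)
  thus "t * d = a * c" using u by simp
qed

lemma acts_unique: "acts q s t \<Longrightarrow> acts q s t' \<Longrightarrow> t = t'"
proof -
  assume a: "acts q s t" "acts q s t'"
  obtain a b where q: "b \<noteq> 0" "q = ore_frac a b" by (rule ore_frac_cases)
  obtain d c where "d \<noteq> 0" "s * d = b * c" using q(1) by (rule right_oreE)
  with a q show ?thesis by (metis acts_frac mult_right_cancel)
qed

lemma acts_iff: "s \<noteq> 0 \<Longrightarrow> acts q s t \<longleftrightarrow> q = ore_frac t s"
proof -
  assume s: "s \<noteq> 0"
  obtain a b where q: "b \<noteq> 0" "q = ore_frac a b" by (rule ore_frac_cases)
  obtain d c where dc: "d \<noteq> 0" "s * d = b * c" using q(1) by (rule right_oreE)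
  hence "c \<noteq> 0" using s by auto
  show ?thesis
  proof
    assume "acts q s t"
    hence "t * d = a * c" using acts_frac[OF q(1) dc(2,1)] q by simp
    thus "q = ore_frac t s" using ore_frac_expand[OF s dc(1), of t] ore_frac_expand[OF q(1) \<open>c \<noteq> 0\<close>, of a]
      dc q by simp
  next
    assume "q = ore_frac t s"
    thus "acts q s t" using acts_frac[OF s, of s 1 1 t t] by simp
  qed
qed

lemma acts_ex: "\<exists>c t. c \<noteq> 0 \<and> acts q (s * c) t"
proof -
  obtain a b where q: "b \<noteq> 0" "q = ore_frac a b" by (rule ore_frac_cases)
  obtain d c where dc: "d \<noteq> 0" "s * d = b * c" using q(1) by (rule right_oreE)
  have "acts q (s * d) (a * c)" using acts_frac[OF q(1), of "s * d" 1 c a "a * c"] q dc by simp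
  with dc show ?thesis by blast
qed

lemma acts_mult: "acts q s t \<Longrightarrow> acts q (s * c) (t * c)"
proof -
  assume a: "acts q s t"
  obtain a b where q: "b \<noteq> 0" "q = ore_frac a b" by (rule ore_frac_cases)
  obtain d e where de: "d \<noteq> 0" "s * d = b * e" using q(1) by (rule right_oreE)
  have td: "t * d = a * e" using a q de acts_frac by blast
  obtain f g where fg: "f \<noteq> 0" "c * f = d * g" using de(1) by (rule right_oreE)
  have "(s * c) * f = b * (e * g)" by (metis de(2) fg(2) mult.assoc)
  moreover have "(t * c) * f = a * (e * g)" by (metis td fg(2) mult.assoc)
  ultimately show ?thesis using acts_frac[OF q(1)] fg(1) q(2) by blast
qed

lemma acts_0: "acts q 0 t \<longleftrightarrow> t = 0"
proof -
  obtain a b where q: "b \<noteq> 0" "q = ore_frac a b" by (rule ore_frac_cases)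
  show ?thesis using acts_frac[OF q(1), of 0 1 0 a t] q by simp
qed

lemma acts_add: "acts q s t \<Longrightarrow> acts q s' t' \<Longrightarrow> acts q (s + s') (t + t')"
proof -
  assume a: "acts q s t" "acts q s' t'"
  obtain a b where q: "b \<noteq> 0" "q = ore_frac a b" by (rule ore_frac_cases)
  obtain d e where de: "d \<noteq> 0" "s * d = b * e" using q(1) by (rule right_oreE)
  obtain d' e' where de': "d' \<noteq> 0" "s' * d' = b * e'" using q(1) by (rule right_oreE)
  have t: "t * d = a * e" "t' * d' = a * e'" using a q de de' acts_frac by blast+
  obtain u w where u: "u \<noteq> 0" "d * u = d' * w" using de'(1) by (rule right_oreE)
  have "(s + s') * (d * u) = b * (e * u + e' * w)"
    unfolding distrib_right distrib_left by (metis de(2) de'(2) u(2) mult.assoc)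
  moreover have "(t + t') * (d * u) = a * (e * u + e' * w)"
    unfolding distrib_right distrib_left by (metis t u(2) mult.assoc)
  moreover have "d * u \<noteq> 0" using de u no_zero_divisors by blast
  ultimately show ?thesis using acts_frac[OF q(1)] q(2) by blast
qed

lemma acts_eqI: "s \<noteq> 0 \<Longrightarrow> acts p s t \<Longrightarrow> acts q s t \<Longrightarrow> p = q"
  by (simp add: acts_iff)

lemma acts_common:
  assumes "s \<noteq> 0"
  shows "\<exists>c t t'. c \<noteq> 0 \<and> s * c \<noteq> 0 \<and> acts p (s * c) t \<and> acts q (s * c) t'"
proof -
  obtain c t where c: "c \<noteq> 0" "acts p (s * c) t" using acts_ex by blast
  obtain c' t' where c': "c' \<noteq> 0" "acts q (s * c * c') t'" using acts_ex by blast
  thus ?thesis using assms c acts_mult[OF c(2), of c']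
    by (intro exI[of _ "c * c'"] exI[of _ "t * c'"] exI[of _ t']) (auto simp: mult.assoc)
qed

instantiation ore_quot :: (right_ore_domain) division_ring
begin

definition zero_ore_quot_def: "(0 :: 'a ore_quot) = ore_frac 0 1"
definition one_ore_quot_def: "(1 :: 'a ore_quot) = ore_frac 1 1"
definition uminus_ore_quot_def:
  "- (p :: 'a ore_quot) = (THE r. \<exists>a b. b \<noteq> 0 \<and> p = ore_frac a b \<and> r = ore_frac (- a) b)"
definition plus_ore_quot_def:
  "(p :: 'a ore_quot) + q =
     (THE r. \<exists>a b c. c \<noteq> 0 \<and> p = ore_frac a c \<and> q = ore_frac b c \<and> r = ore_frac (a + b) c)"
definition minus_ore_quot_def: "(p :: 'a ore_quot) - q = p + - q"
definition times_ore_quot_def: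
  "(p :: 'a ore_quot) * q =
     (THE r. \<exists>a b c d e f. b \<noteq> 0 \<and> d \<noteq> 0 \<and> f \<noteq> 0 \<and> p = ore_frac a b \<and> q = ore_frac c d \<and>
        c * f = b * e \<and> r = ore_frac (a * e) (d * f))"
definition inverse_ore_quot_def:
  "inverse (p :: 'a ore_quot) =
     (if p = 0 then 0 else THE r. \<exists>a b. a \<noteq> 0 \<and> b \<noteq> 0 \<and> p = ore_frac a b \<and> r = ore_frac b a)"
definition divide_ore_quot_def: "(p :: 'a ore_quot) div q = p * inverse q"

lemma ore_plus:
  fixes p q :: "'a ore_quot"
  assumes "acts p s t" "acts q s t'" "s \<noteq> 0"
  shows "acts (p + q) s (t + t')"
proof -
  have "p + q = ore_frac (t + t') s" unfolding plus_ore_quot_def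
  proof (rule the_equality)
    show "\<exists>a b c. c \<noteq> 0 \<and> p = ore_frac a c \<and> q = ore_frac b c \<and> ore_frac (t + t') s = ore_frac (a + b) c"
      using assms by (auto simp: acts_iff)
  next
    fix r assume "\<exists>a b c. c \<noteq> 0 \<and> p = ore_frac a c \<and> q = ore_frac b c \<and> r = ore_frac (a + b) c"
    then obtain a b c where c: "c \<noteq> 0" "p = ore_frac a c" "q = ore_frac b c" "r = ore_frac (a + b) c" by blast
    obtain u w where u: "u \<noteq> 0" "c * u = s * w" using assms(3) by (rule right_oreE)
    have "acts p (c * u) (a * u)" "acts p (c * u) (t * w)" "acts q (c * u) (b * u)" "acts q (c * u) (t' * w)"
      using acts_mult[of p c a u] acts_mult[of q c b u] acts_mult[OF assms(1), of w]
        acts_mult[OF assms(2), of w] c u by (auto simp: acts_iff)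
    hence e: "a * u = t * w" "b * u = t' * w" by (auto dest: acts_unique)
    have "acts r (c * u) ((a + b) * u)" using c by (intro acts_mult) (auto simp: acts_iff)
    moreover have "(a + b) * u = (t + t') * w" using e by (simp add: distrib_right)
    moreover have "acts (ore_frac (t + t') s) (c * u) ((t + t') * w)"
      unfolding u using assms by (intro acts_mult) (auto simp: acts_iff)
    moreover have "c * u \<noteq> 0" using c u no_zero_divisors by blast
    ultimately show "r = ore_frac (t + t') s" using acts_eqI[of "c * u"] by metis
  qed
  thus ?thesis using assms by (simp add: acts_iff)
qed

lemma ore_times:
  fixes p q :: "'a ore_quot"
  assumes "acts q s t" "acts p t u" "s \<noteq> 0"
  shows "acts (p * q) s u"
proof -
  have key: "acts (ore_frac (a * e) (d * f)) s u" if "b \<noteq> 0" "d \<noteq> 0" "f \<noteq> 0" "p = ore_frac a b"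
    "q = ore_frac c d" "c * f = b * e" for a b c d e f
  proof -
    have "d * f \<noteq> 0" using that no_zero_divisors by blast
    then obtain g h where gh: "g \<noteq> 0" "s * g = (d * f) * h" by (rule right_oreE)
    have "acts q (d * (f * h)) (c * (f * h))" using that by (intro acts_mult) (auto simp: acts_iff)
    moreover have "acts q (s * g) (t * g)" using assms by (intro acts_mult)
    ultimately have tg: "t * g = c * f * h" using gh by (metis acts_unique mult.assoc)
    hence "acts p (t * g) (a * (e * h))" using that acts_mult[of p b a "e * h"] by (auto simp: acts_iff mult.assoc)
    moreover have "acts p (t * g) (u * g)" using assms by (intro acts_mult)
    ultimately have "u * g = a * e * h" by (metis acts_unique mult.assoc)
    thus ?thesis using that acts_frac[OF _ gh(2,1)] by simp
  qed
  have "p * q = ore_frac u s" unfolding times_ore_quot_def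
  proof (rule the_equality)
    obtain a b where p: "b \<noteq> 0" "p = ore_frac a b" by (rule ore_frac_cases)
    obtain c d where q: "d \<noteq> 0" "q = ore_frac c d" by (rule ore_frac_cases)
    obtain f e where fe: "f \<noteq> 0" "c * f = b * e" using p(1) by (rule right_oreE)
    have "ore_frac u s = ore_frac (a * e) (d * f)" using key p q fe assms(3) acts_iff by metis
    thus "\<exists>a b c d e f. b \<noteq> 0 \<and> d \<noteq> 0 \<and> f \<noteq> 0 \<and> p = ore_frac a b \<and> q = ore_frac c d \<and>
        c * f = b * e \<and> ore_frac u s = ore_frac (a * e) (d * f)" using p q fe by blast
  next
    fix r assume "\<exists>a b c d e f. b \<noteq> 0 \<and> d \<noteq> 0 \<and> f \<noteq> 0 \<and> p = ore_frac a b \<and> q = ore_frac c d \<and>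
        c * f = b * e \<and> r = ore_frac (a * e) (d * f)"
    thus "r = ore_frac u s" using key assms(3) acts_iff by metis
  qed
  thus ?thesis using assms by (simp add: acts_iff)
qed

lemma acts_zero: "acts (0 :: 'a ore_quot) s 0"
  unfolding zero_ore_quot_def using acts_frac[of 1 s 1 s 0 0] by simp

lemma acts_one: "acts (1 :: 'a ore_quot) s s"
  unfolding one_ore_quot_def using acts_frac[of 1 s 1 s 1 s] by simp

lemma ore_uminus:
  fixes p :: "'a ore_quot"
  assumes "acts p s t" "s \<noteq> 0"
  shows "acts (- p) s (- t)"
proof -
  have "- p = ore_frac (- t) s" unfolding uminus_ore_quot_def
  proof (rule the_equality)
    show "\<exists>a b. b \<noteq> 0 \<and> p = ore_frac a b \<and> ore_frac (- t) s = ore_frac (- a) b"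
      using assms by (auto simp: acts_iff)
  next
    fix r assume "\<exists>a b. b \<noteq> 0 \<and> p = ore_frac a b \<and> r = ore_frac (- a) b"
    then obtain a b where b: "b \<noteq> 0" "p = ore_frac a b" "r = ore_frac (- a) b" by blast
    obtain d c where dc: "d \<noteq> 0" "s * d = b * c" using b(1) by (rule right_oreE)
    have "t * d = a * c" using assms b dc acts_frac by blast
    hence "(- t) * d = (- a) * c" by simp
    hence "acts r s (- t)" using b dc acts_frac by blast
    thus "r = ore_frac (- t) s" using assms by (simp add: acts_iff)
  qed
  thus ?thesis using assms by (simp add: acts_iff)
qed

lemma ore_frac_0: "b \<noteq> 0 \<Longrightarrow> ore_frac 0 b = (0 :: 'a ore_quot)"
  using acts_zero[of b] by (simp add: acts_iff)

lemma ore_frac_eq_0: "b \<noteq> 0 \<Longrightarrow> ore_frac a b = (0 :: 'a ore_quot) \<longleftrightarrow> a = 0"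
  using acts_zero[of b] acts_unique[of 0 b a 0] by (auto simp: acts_iff ore_frac_0)

lemma inverse_ore_frac:
  assumes "a \<noteq> 0" "b \<noteq> 0"
  shows "inverse (ore_frac a b :: 'a ore_quot) = ore_frac b a"
proof -
  have "(THE r. \<exists>a' b'. a' \<noteq> 0 \<and> b' \<noteq> 0 \<and> ore_frac a b = ore_frac a' b' \<and> r = ore_frac b' a') = ore_frac b a"
  proof (rule the_equality)
    fix r assume "\<exists>a' b'. a' \<noteq> 0 \<and> b' \<noteq> 0 \<and> ore_frac a b = ore_frac a' b' \<and> r = ore_frac b' a'"
    then obtain a' b' where *: "a' \<noteq> 0" "b' \<noteq> 0" "ore_frac a b = ore_frac a' b'" "r = ore_frac b' a'"
      by blast
    hence "ore_rel (a, b) (a', b')" using assms by (simp add: ore_frac_eq_iff)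
    hence "ore_rel (b, a) (b', a')" using * assms by (auto simp: ore_rel_def)
    thus "r = ore_frac b a" using * assms ore_frac_eq_iff[of a a' b b'] by simp
  qed (use assms in blast)
  thus ?thesis using assms by (simp add: inverse_ore_quot_def ore_frac_eq_0)
qed

instance
proof
  fix p q r :: "'a ore_quot"
  have one: "(1 :: 'a) \<noteq> 0" by simp
  show "p * q * r = p * (q * r)"
  proof -
    obtain c t where 1: "c \<noteq> 0" "acts r c t" using acts_ex[of r 1] by auto
    obtain d u where 2: "d \<noteq> 0" "acts q (t * d) u" using acts_ex[of q t] by auto
    obtain e w where 3: "e \<noteq> 0" "acts p (u * e) w" using acts_ex[of p u] by auto
    let ?s = "c * d * e"
    have s: "?s \<noteq> 0" using 1 2 3 by simp
    have r: "acts r ?s (t * d * e)" using 1 by (intro acts_mult)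
    have q: "acts q (t * d * e) (u * e)" using 2 by (intro acts_mult)
    have "acts (p * (q * r)) ?s w" using ore_times[OF ore_times[OF r q s] 3(2) s] .
    moreover have "acts (p * q * r) ?s w"
    proof (cases "t = 0")
      case True
      hence "u = 0" "w = 0" using 2 3 by (auto simp: acts_0)
      thus ?thesis using ore_times[OF r _ s, of "p * q" 0] True by (simp add: acts_0)
    next
      case False
      hence "t * d * e \<noteq> 0" using 2 3 by simp
      thus ?thesis using ore_times[OF r ore_times[OF q 3(2)] s] by simp
    qed
    ultimately show ?thesis using acts_eqI[OF s] by simp
  qed
  obtain s t t' where s: "s \<noteq> 0" and p: "acts p s t" and q: "acts q s t'"
    using acts_common[OF one, of p q] by auto
  show "p + q = q + p"
    using ore_plus[OF p q s] ore_plus[OF q p s] acts_eqI[OF s] by (simp add: add.commute)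
  show "p + q + r = p + (q + r)"
  proof -
    obtain c u where c: "c \<noteq> 0" "acts r (s * c) u" using acts_ex by blast
    have sc: "s * c \<noteq> 0" using s c by simp
    have p': "acts p (s * c) (t * c)" and q': "acts q (s * c) (t' * c)" using p q by (auto intro: acts_mult)
    show ?thesis
      using ore_plus[OF ore_plus[OF p' q' sc] c(2) sc] ore_plus[OF p' ore_plus[OF q' c(2) sc] sc]
        acts_eqI[OF sc] by (simp add: add.assoc)
  qed
  show "0 + p = p"
    using ore_plus[OF acts_zero p s] p acts_eqI[OF s] by simp
  show "- p + p = 0"
    using ore_plus[OF ore_uminus[OF p s] p s] acts_zero[of s] acts_eqI[OF s] by simp
  show "p - q = p + - q" by (simp add: minus_ore_quot_def)
  show "1 * p = p"
    using ore_times[OF p acts_one s] p acts_eqI[OF s] by simp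
  show "p * 1 = p"
    using ore_times[OF acts_one p s] p acts_eqI[OF s] by simp
  show "(p + q) * r = p * r + q * r"
  proof -
    obtain c u where c: "c \<noteq> 0" "acts r c u" using acts_ex[of r 1] by auto
    show ?thesis
    proof (cases "u = 0")
      case True
      have "acts (p * r) c 0" "acts (q * r) c 0" "acts ((p + q) * r) c 0"
        using ore_times[OF c(2) _ c(1)] True by (auto simp: acts_0)
      thus ?thesis using ore_plus[of "p * r" c 0 "q * r" 0] c(1) acts_eqI[OF c(1)] by simp
    next
      case False
      obtain d w w' where d: "d \<noteq> 0" "u * d \<noteq> 0" "acts p (u * d) w" "acts q (u * d) w'"
        using acts_common[OF False] by blast
      have cd: "c * d \<noteq> 0" using c d by simp
      have r: "acts r (c * d) (u * d)" using c by (intro acts_mult)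
      show ?thesis
        using ore_times[OF r ore_plus[OF d(3,4,2)] cd]
          ore_plus[OF ore_times[OF r d(3) cd] ore_times[OF r d(4) cd] cd] acts_eqI[OF cd] by simp
    qed
  qed
  show "p * (q + r) = p * q + p * r"
  proof -
    obtain c u u' where c: "c \<noteq> 0" "acts q c u" "acts r c u'"
      using acts_common[OF one, of q r] by auto
    obtain d w where d: "d \<noteq> 0" "acts p (u * d) w" using acts_ex by blast
    obtain e w' where e: "e \<noteq> 0" "acts p (u' * d * e) w'" using acts_ex by blast
    let ?s = "c * d * e"
    have s: "?s \<noteq> 0" using c d e by simp
    have q: "acts q ?s (u * d * e)" and r: "acts r ?s (u' * d * e)" using c by (auto intro!: acts_mult)
    have pq: "acts p (u * d * e) (w * e)" using d by (intro acts_mult)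
    show ?thesis
      using ore_times[OF ore_plus[OF q r s] acts_add[OF pq e(2)] s]
        ore_plus[OF ore_times[OF q pq s] ore_times[OF r e(2) s] s] acts_eqI[OF s] by simp
  qed
  show "(0 :: 'a ore_quot) \<noteq> 1"
    using acts_unique[of 0 1 0 1] acts_zero[of 1] acts_one[of 1] by auto
  show "inverse (0 :: 'a ore_quot) = 0" by (simp add: inverse_ore_quot_def)
  show "p div q = p * inverse q" by (simp add: divide_ore_quot_def)
  assume nz: "p \<noteq> 0"
  obtain a b where ab: "b \<noteq> 0" "p = ore_frac a b" by (rule ore_frac_cases)
  hence a: "a \<noteq> 0" using nz by (auto simp: ore_frac_0)
  have 1: "acts p b a" and 2: "acts (inverse p) a b"
    using ab a by (auto simp: acts_iff inverse_ore_frac)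
  show "inverse p * p = 1"
    using ore_times[OF 1 2 ab(1)] acts_one[of b] acts_eqI[OF ab(1)] by simp
  show "p * inverse p = 1"
    using ore_times[OF 2 1 a] acts_one[of a] acts_eqI[OF a] by simp
qed

end

definition to_quot :: "'a::right_ore_domain \<Rightarrow> 'a ore_quot" where
  "to_quot a = ore_frac a 1"

lemma acts_to_quot: "acts (to_quot a) s (a * s)"
  unfolding to_quot_def using acts_frac[of 1 s 1 s a "a * s"] by simp

lemma to_quot_add: "to_quot (a + b) = to_quot a + to_quot b"
  using ore_plus[OF acts_to_quot[of a 1] acts_to_quot[of b 1]] acts_to_quot[of "a + b" 1]
  by (intro acts_eqI[of 1]) auto

lemma to_quot_mult: "to_quot (a * b) = to_quot a * to_quot b"
  using ore_times[OF acts_to_quot[of b 1] acts_to_quot[of a "b * 1"]] acts_to_quot[of "a * b" 1]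
  by (intro acts_eqI[of 1]) auto

lemma to_quot_0 [simp]: "to_quot 0 = 0" by (simp add: to_quot_def zero_ore_quot_def)
lemma to_quot_1 [simp]: "to_quot 1 = 1" by (simp add: to_quot_def one_ore_quot_def)

lemma to_quot_inj: "to_quot a = to_quot b \<longleftrightarrow> a = b"
  using acts_to_quot[of a 1] acts_to_quot[of b 1] acts_unique[of "to_quot a" 1 a b] by auto

lemma ore_frac_conv: "b \<noteq> 0 \<Longrightarrow> ore_frac a b = to_quot a / to_quot b"
proof -
  assume b: "b \<noteq> 0"
  have "inverse (to_quot b) = ore_frac 1 b"
    unfolding to_quot_def using b by (simp add: inverse_ore_frac)
  moreover have "acts (ore_frac 1 b) b 1" using b by (simp add: acts_iff)
  ultimately have "acts (to_quot a / to_quot b) b a"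
    unfolding divide_inverse using ore_times[of "ore_frac 1 b" b 1 "to_quot a" a] acts_to_quot[of a 1] b by simp
  thus ?thesis using b by (simp add: acts_iff)
qed

lemma ore_quot_eq_quotient: "\<exists>a b. b \<noteq> 0 \<and> (q :: 'a::right_ore_domain ore_quot) = to_quot a / to_quot b"
  by (metis ore_frac_cases ore_frac_conv)

text \<open>
  The quotient division ring of the skew polynomial ring over the Puiseux series. The skew
  polynomial ring is the range of \<open>to_quot\<close>. The Weyl algebra and its quotient
  division ring are subsets, and a valuation on any of these domains is identified with its unique
  extension to the quotient division ring.
\<close>

type_synonym weyl_ext = "puiseux skew_poly ore_quot"

definition puiseux_emb :: "puiseux \<Rightarrow> weyl_ext" where
  "puiseux_emb p = to_quot (sconst p)"

definition real_const :: "real \<Rightarrow> weyl_ext" where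
  "real_const r = puiseux_emb (puiseux_monom r 0)"

definition x_pow :: "rat \<Rightarrow> weyl_ext" where
  "x_pow a = puiseux_emb (puiseux_monom 1 a)"

definition weyl_x :: weyl_ext where
  "weyl_x = x_pow 1"

definition weyl_y :: weyl_ext where
  "weyl_y = to_quot svar"

inductive_set weyl_algebra :: "weyl_ext set" where
  real: "real_const r \<in> weyl_algebra"
| x: "weyl_x \<in> weyl_algebra"
| y: "weyl_y \<in> weyl_algebra"
| add: "a \<in> weyl_algebra \<Longrightarrow> b \<in> weyl_algebra \<Longrightarrow> a + b \<in> weyl_algebra"
| mult: "a \<in> weyl_algebra \<Longrightarrow> b \<in> weyl_algebra \<Longrightarrow> a * b \<in> weyl_algebra"

definition weyl_quot :: "weyl_ext set" where
  "weyl_quot = {a / b |a b. a \<in> weyl_algebra \<and> b \<in> weyl_algebra \<and> b \<noteq> 0}"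

text \<open>
  The generators satisfy the defining relation of the Weyl algebra (\<open>weyl_relation\<close>), and
  \<open>weyl_monomials_independent\<close> shows that no further relations hold in \<open>weyl_algebra\<close>.
\<close>

lemma puiseux_monom_add: "puiseux_monom c a + puiseux_monom d a = puiseux_monom (c + d) a"
  by (rule puiseux_eqI) (simp add: plus_puiseux.rep_eq puiseux_monom.rep_eq)

lemma puiseux_monom_mult: "puiseux_monom c a * puiseux_monom d b = puiseux_monom (c * d) (a + b)"
proof (rule puiseux_eqI)
  fix q
  let ?f = "pcoeff (puiseux_monom c a)" and ?g = "pcoeff (puiseux_monom d b)"
  have "(\<Sum>r | ?f r \<noteq> 0 \<and> ?g (q - r) \<noteq> 0. ?f r * ?g (q - r)) = (\<Sum>r\<in>{- a}. ?f r * ?g (q - r))"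
    by (rule sum.mono_neutral_left) (auto simp: puiseux_monom.rep_eq split: if_splits)
  also have "\<dots> = pcoeff (puiseux_monom (c * d) (a + b)) q"
    by (auto simp: puiseux_monom.rep_eq)
  finally show "pcoeff (puiseux_monom c a * puiseux_monom d b) q = pcoeff (puiseux_monom (c * d) (a + b)) q"
    by (simp add: times_puiseux.rep_eq)
qed

lemma puiseux_monom_0 [simp]: "puiseux_monom 0 a = 0"
  by (rule puiseux_eqI) (simp add: puiseux_monom.rep_eq zero_puiseux.rep_eq)

lemma puiseux_monom_1: "puiseux_monom 1 0 = 1"
  by (rule puiseux_eqI) (simp add: puiseux_monom.rep_eq one_puiseux.rep_eq)

lemma der_puiseux_monom: "der (puiseux_monom c a) = puiseux_monom (of_rat a * c) (a - 1)"
  by (rule puiseux_eqI) (auto simp: puiseux_monom.rep_eq der_puiseux.rep_eq of_rat_minus)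

lemma sconst_add: "sconst (a + b) = sconst a + sconst b"
  by (simp add: sconst_def plus_skew_poly.abs_eq)

lemma sconst_mult: "sconst (a * b) = sconst a * sconst b"
  by (simp add: sconst_def times_skew_poly.abs_eq skew_mult_def)

lemma sconst_0 [simp]: "sconst 0 = 0"
  by (simp add: sconst_def zero_skew_poly_def)

lemma sconst_1 [simp]: "sconst 1 = 1"
  by (simp add: sconst_def one_skew_poly_def one_pCons)

lemma sconst_inj: "sconst a = sconst b \<longleftrightarrow> a = b"
  by (simp add: sconst_def skew_inject)

lemma puiseux_emb_add: "puiseux_emb (p + q) = puiseux_emb p + puiseux_emb q"
  and puiseux_emb_mult: "puiseux_emb (p * q) = puiseux_emb p * puiseux_emb q"
  and puiseux_emb_0 [simp]: "puiseux_emb 0 = 0"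
  and puiseux_emb_1 [simp]: "puiseux_emb 1 = 1"
  and puiseux_emb_inj: "puiseux_emb p = puiseux_emb q \<longleftrightarrow> p = q"
  by (simp_all add: puiseux_emb_def sconst_add sconst_mult sconst_inj to_quot_add to_quot_mult to_quot_inj)

lemma weyl_y_comm: "weyl_y * puiseux_emb p = puiseux_emb p * weyl_y + puiseux_emb (der p)"
  by (simp add: weyl_y_def puiseux_emb_def svar_comm to_quot_add[symmetric] to_quot_mult[symmetric])

lemma weyl_relation: "weyl_y * weyl_x - weyl_x * weyl_y = 1"
  by (simp add: weyl_x_def x_pow_def weyl_y_comm der_puiseux_monom puiseux_monom_1)

lemma real_const_central: "real_const r * a = a * real_const r" if "a \<in> weyl_algebra"
  using that
proof induction
  case y
  have "der (puiseux_monom r 0) = 0" by (simp add: der_puiseux_monom)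
  thus ?case by (simp add: real_const_def weyl_y_comm)
next
  case (add a b)
  thus ?case by (simp add: distrib_left distrib_right)
next
  case (mult a b)
  thus ?case by (metis mult.assoc)
qed (simp_all add: real_const_def weyl_x_def x_pow_def puiseux_emb_mult[symmetric] mult.commute)

lemma svar_pow: "(svar :: 'a::differential_field skew_poly) ^ j = skew (monom 1 j)"
proof (induction j)
  case (Suc j)
  have "skew_mult [:0, 1:] (monom 1 j :: 'a poly) = ymult (monom 1 j)"
    using skew_mult_pCons_0[of "1 :: 'a poly" "monom 1 j"]
    unfolding skew_mult_1_left by (simp add: one_pCons)
  also have "\<dots> = monom 1 (Suc j)"
    using ymult_pow_1[of j, where 'a = 'a] ymult_pow_1[of "Suc j", where 'a = 'a] by simp
  finally show ?case using Suc by (simp add: svar_def times_skew_poly.abs_eq)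
qed (simp add: one_skew_poly_def)

lemma sconst_svar_pow: "sconst p * svar ^ j = skew (monom p j)"
  by (simp add: svar_pow sconst_def times_skew_poly.abs_eq skew_mult_def smult_monom)

lemma weyl_x_pow: "weyl_x ^ i = x_pow (of_nat i)"
  by (induction i) (simp_all add: weyl_x_def x_pow_def puiseux_monom_1 puiseux_emb_mult[symmetric]
      puiseux_monom_mult)

lemma weyl_monomials_independent:
  assumes "finite S" "(\<Sum>(i, j)\<in>S. real_const (c i j) * weyl_x ^ i * weyl_y ^ j) = 0" "(i, j) \<in> S"
  shows "c i j = 0"
proof -
  have pow: "to_quot (a ^ k) = to_quot a ^ k" for a :: "puiseux skew_poly" and k
    by (induction k) (simp_all add: to_quot_mult)
  have rx: "real_const (c i j) * weyl_x ^ i = puiseux_emb (puiseux_monom (c i j) (of_nat i))" for i j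
    by (simp add: weyl_x_pow real_const_def x_pow_def puiseux_emb_mult[symmetric] puiseux_monom_mult)
  have trm: "real_const (c i j) * weyl_x ^ i * weyl_y ^ j
      = to_quot (skew (monom (puiseux_monom (c i j) (of_nat i)) j))" for i j
    unfolding rx by (simp add: weyl_y_def pow[symmetric] puiseux_emb_def to_quot_mult[symmetric] sconst_svar_pow)
  have sum: "(\<Sum>x\<in>A. to_quot (skew (f x))) = to_quot (skew (\<Sum>x\<in>A. f x))" if "finite A"
    for A :: "'b set" and f :: "'b \<Rightarrow> puiseux poly"
    using that by (induction A)
      (simp_all add: to_quot_add[symmetric] plus_skew_poly.abs_eq zero_skew_poly_def[symmetric])
  let ?P = "\<Sum>(i, j)\<in>S. monom (puiseux_monom (c i j) (of_nat i)) j"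
  have "to_quot (skew ?P) = (\<Sum>(i, j)\<in>S. real_const (c i j) * weyl_x ^ i * weyl_y ^ j)"
    unfolding trm case_prod_beta by (rule sum[OF assms(1), symmetric])
  hence "to_quot (skew ?P) = to_quot 0" using assms(2) by simp
  hence P: "?P = 0" by (simp add: to_quot_inj zero_skew_poly_def skew_inject)
  have pc: "pcoeff (sum f A) q = (\<Sum>x\<in>A. pcoeff (f x) q)" if "finite A"
    for A :: "'b set" and f :: "'b \<Rightarrow> puiseux" and q
    using that by (induction A) (simp_all add: plus_puiseux.rep_eq zero_puiseux.rep_eq)
  have "0 = pcoeff (coeff ?P j) (- of_nat i)" by (simp add: P zero_puiseux.rep_eq)
  also have "\<dots> = (\<Sum>x\<in>S. if x = (i, j) then c i j else 0)"
    unfolding coeff_sum pc[OF assms(1)]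
    by (rule sum.cong) (auto simp: puiseux_monom.rep_eq zero_puiseux.rep_eq split: if_splits)
  also have "\<dots> = c i j" using assms(1,3) by simp
  finally show ?thesis by simp
qed

text \<open>
  Value groups are arbitrary totally ordered groups, not assumed to be commutative. They are
  handled as objects with an explicit carrier because the value group of an extension has to be
  quantified existentially; up to isomorphism it consists of the cosets of the group of units of the
  valuation ring, so groups of sets of elements of the division ring suffice for this. The additive notation of the literature appears multiplicatively here,
  as \<open>monoid\<close> prescribes.
\<close>

record 'g ordered_group = "'g monoid" +
  le :: "('g \<times> 'g) set"

locale totally_ordered_group = group G for G :: "'g ordered_group" (structure) +
  assumes linear_order: "linear_order_on (carrier G) (le G)"
    and le_translate: "\<lbrakk>(a, b) \<in> le G; c \<in> carrier G\<rbrakk> \<Longrightarrow>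
      (c \<otimes> a, c \<otimes> b) \<in> le G \<and> (a \<otimes> c, b \<otimes> c) \<in> le G"

datatype 'g with_infty = Fin 'g | Infty

fun infty_le :: "'g ordered_group \<Rightarrow> 'g with_infty \<Rightarrow> 'g with_infty \<Rightarrow> bool" where
  "infty_le G _ Infty \<longleftrightarrow> True"
| "infty_le G Infty (Fin b) \<longleftrightarrow> False"
| "infty_le G (Fin a) (Fin b) \<longleftrightarrow> (a, b) \<in> le G"

definition infty_less :: "'g ordered_group \<Rightarrow> 'g with_infty \<Rightarrow> 'g with_infty \<Rightarrow> bool" where
  "infty_less G s t \<longleftrightarrow> infty_le G s t \<and> s \<noteq> t"

definition infty_min :: "'g ordered_group \<Rightarrow> 'g with_infty \<Rightarrow> 'g with_infty \<Rightarrow> 'g with_infty" where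
  "infty_min G s t = (if infty_le G s t then s else t)"

fun infty_add :: "'g ordered_group \<Rightarrow> 'g with_infty \<Rightarrow> 'g with_infty \<Rightarrow> 'g with_infty" where
  "infty_add G (Fin a) (Fin b) = Fin (a \<otimes>\<^bsub>G\<^esub> b)"
| "infty_add G _ _ = Infty"

abbreviation infty_zero :: "'g ordered_group \<Rightarrow> 'g with_infty" where
  "infty_zero G \<equiv> Fin \<one>\<^bsub>G\<^esub>"

text \<open>
  \<open>K\<close> is meant to be a division subring; values outside of \<open>K\<close> are irrelevant.
\<close>

definition valuation ::
  "'a::division_ring set \<Rightarrow> 'g ordered_group \<Rightarrow> ('a \<Rightarrow> 'g with_infty) \<Rightarrow> bool" where
  "valuation K G v \<longleftrightarrow>
     totally_ordered_group G \<and>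
     (\<forall>a\<in>K. v a \<in> insert Infty (Fin ` carrier G)) \<and>
     (\<forall>a\<in>K. v a = Infty \<longleftrightarrow> a = 0) \<and>
     (\<forall>a\<in>K. \<forall>b\<in>K. v (a * b) = infty_add G (v a) (v b)) \<and>
     (\<forall>a\<in>K. \<forall>b\<in>K. infty_le G (infty_min G (v a) (v b)) (v (a + b)))"

definition valuation_ring where
  "valuation_ring K G v = {a \<in> K. infty_le G (infty_zero G) (v a)}"

definition residue_class ::
  "'a::division_ring set \<Rightarrow> 'g ordered_group \<Rightarrow> ('a \<Rightarrow> 'g with_infty) \<Rightarrow> 'a \<Rightarrow> 'a set" where
  "residue_class K G v a = {b \<in> valuation_ring K G v. infty_less G (infty_zero G) (v (b - a))}"

text \<open>
  The valuation is trivial on the reals, and the natural map from the reals to the residue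
  division ring is a bijection.
\<close>

definition residue_field_real ::
  "weyl_ext set \<Rightarrow> 'g ordered_group \<Rightarrow> (weyl_ext \<Rightarrow> 'g with_infty) \<Rightarrow> bool" where
  "residue_field_real K G v \<longleftrightarrow>
     (\<forall>r. r \<noteq> 0 \<longrightarrow> v (real_const r) = infty_zero G) \<and>
     bij_betw (\<lambda>r. residue_class K G v (real_const r)) UNIV
       (residue_class K G v ` valuation_ring K G v)"

definition residue ::
  "weyl_ext set \<Rightarrow> 'g ordered_group \<Rightarrow> (weyl_ext \<Rightarrow> 'g with_infty) \<Rightarrow> weyl_ext \<Rightarrow> real" where
  "residue K G v a = (THE r. residue_class K G v (real_const r) = residue_class K G v a)"

definition value_group :: "'a set \<Rightarrow> ('a \<Rightarrow> 'g with_infty) \<Rightarrow> 'g set" where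
  "value_group K v = {g. Fin g \<in> v ` K}"

text \<open>
  There is an isomorphism of the ordered value groups carrying \<open>v\<close> to \<open>w\<close> on \<open>K\<close>. If \<open>w\<close> is defined on
  a larger division ring, this says that \<open>w\<close> extends \<open>v\<close>.
\<close>

definition equivalent_valuations ::
  "'a set \<Rightarrow> 'g ordered_group \<Rightarrow> ('a \<Rightarrow> 'g with_infty) \<Rightarrow>
     'h ordered_group \<Rightarrow> ('a \<Rightarrow> 'h with_infty) \<Rightarrow> bool" where
  "equivalent_valuations K G v H w \<longleftrightarrow>
     (\<exists>\<phi>\<in>iso (G\<lparr>carrier := value_group K v\<rparr>) (H\<lparr>carrier := value_group K w\<rparr>).
        (\<forall>g\<in>value_group K v. \<forall>h\<in>value_group K v. (g, h) \<in> le G \<longleftrightarrow> (\<phi> g, \<phi> h) \<in> le H) \<and>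
        (\<forall>a\<in>K. w a = map_with_infty \<phi> (v a)))"

text \<open>
  The data associated with a valuation \<open>v\<close> on \<open>weyl_quot\<close>. In the index \<open>i\<close>, \<open>omega i\<close> is the element
  usually written with index \<open>i - 1\<close>: thus \<open>omega 0\<close> is \<open>x\<close>, \<open>omega 1\<close> is \<open>y\<close>, and the value of \<open>omega i\<close>
  is \<open>seq_m i / seq_n i\<close>. The quantities \<open>seq_m i\<close>, \<open>seq_n i\<close>, \<open>seq_beta i\<close> and those derived from them
  are meaningful only if \<open>admissible i\<close> holds, that is, if the sequence reaches \<open>omega i\<close> and the
  value of \<open>omega i\<close> is rational; otherwise they are junk.
\<close>

context
  fixes G :: "'g ordered_group" and v :: "weyl_ext \<Rightarrow> 'g with_infty"
begin

text \<open>
  \<open>value_is_frac a m n\<close>: the value of \<open>a\<close> is \<open>m / n\<close> in lowest terms, where \<open>1\<close> is the negative of the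
  value of \<open>x\<close>; additively, \<open>n v(a) = m (- v(x))\<close>.
\<close>

definition value_is_frac :: "weyl_ext \<Rightarrow> int \<Rightarrow> int \<Rightarrow> bool" where
  "value_is_frac a m n \<longleftrightarrow> n > 0 \<and> coprime m n \<and>
     (\<exists>g e. v a = Fin g \<and> v weyl_x = Fin e \<and> g [^]\<^bsub>G\<^esub> n = (inv\<^bsub>G\<^esub> e) [^]\<^bsub>G\<^esub> m)"

definition rational_value :: "weyl_ext \<Rightarrow> bool" where
  "rational_value a \<longleftrightarrow> (\<exists>m n. value_is_frac a m n)"

definition value_num :: "weyl_ext \<Rightarrow> int" where
  "value_num a = (THE m. \<exists>n. value_is_frac a m n)"

definition value_den :: "weyl_ext \<Rightarrow> int" where
  "value_den a = (THE n. \<exists>m. value_is_frac a m n)"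

fun omega :: "nat \<Rightarrow> weyl_ext" where
  "omega 0 = weyl_x"
| "omega (Suc 0) = weyl_y"
| "omega (Suc (Suc i)) =
     (let w = omega (Suc i); z = weyl_x powi value_num w * w powi value_den w
      in z - real_const (residue weyl_quot G v z))"

definition admissible :: "nat \<Rightarrow> bool" where
  "admissible i \<longleftrightarrow> (\<forall>j\<in>{1..i}. rational_value (omega j))"

definition seq_m :: "nat \<Rightarrow> int" where
  "seq_m i = (if i = 0 then 1 else value_num (omega i))"

definition seq_n :: "nat \<Rightarrow> int" where
  "seq_n i = (if i = 0 then - 1 else value_den (omega i))"

definition seq_beta :: "nat \<Rightarrow> real" where
  "seq_beta i = residue weyl_quot G v (weyl_x powi seq_m i * omega i powi seq_n i)"

definition seq_K :: "nat \<Rightarrow> nat \<Rightarrow> int" where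
  "seq_K i j = seq_m j * seq_n i div gcd (seq_m j * seq_n i) (seq_m i * seq_n j)"

definition seq_alpha :: "nat \<Rightarrow> nat \<Rightarrow> real" where
  "seq_alpha i j = (if i = j then 1
     else residue weyl_quot G v (omega i powi seq_K i j * omega j powi (- seq_K j i)))"

definition seq_h :: "nat \<Rightarrow> nat" where
  "seq_h i = multiplicity 2 (seq_n i)"

definition gamma_choice :: "(nat \<Rightarrow> real) \<Rightarrow> bool" where
  "gamma_choice \<gamma> \<longleftrightarrow> \<gamma> 0 = 1 \<and>
     (\<forall>i\<ge>1. admissible i \<longrightarrow> \<gamma> i powi seq_n i = seq_beta i) \<and>
     (\<forall>i j. admissible i \<and> admissible j \<and> i \<noteq> j \<longrightarrow>
        seq_alpha i j = \<gamma> i powi seq_K i j * \<gamma> j powi (- seq_K j i))"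

text \<open>
  The extensions of \<open>v\<close> with residue field the reals and with prescribed residues \<open>\<gamma>\<close>.
\<close>

definition gamma_extension ::
  "(nat \<Rightarrow> real) \<Rightarrow> 'h ordered_group \<Rightarrow> (weyl_ext \<Rightarrow> 'h with_infty) \<Rightarrow> bool" where
  "gamma_extension \<gamma> H w \<longleftrightarrow>
     valuation UNIV H w \<and> residue_field_real UNIV H w \<and>
     equivalent_valuations weyl_quot G v H w \<and>
     (\<forall>i\<ge>1. admissible i \<longrightarrow>
        residue UNIV H w (x_pow (of_int (seq_m i) / of_int (seq_n i)) * omega i) = \<gamma> i)"

end

end

theory Submission
  imports Defs
begin

text \<open>
  A valuation \<open>w\<close> extending \<open>v\<close> is positive on power series without constant term, because
  \<open>1 + t\<close> and \<open>1 - t\<close> are squares for such \<open>t\<close> and \<open>- 1\<close> is not a square in the residue field. Hence the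
  value and the residue of an element with a dominating term are known, and the prescribed
  residues determine, term by term, a Puiseux series \<open>p\<close> that approximates \<open>y\<close>: the element
  \<open>omega k\<close> of the sequence is linear in \<open>y - p\<close> up to smaller terms, and its residue gives the next term
  of \<open>p\<close>. Either the process stops with an irrational value of \<open>y - p\<close>, and \<open>w\<close> is a Gauss valuation in
  \<open>y - p\<close>, or every element eventually has a dominating constant term; in both cases \<open>w\<close> is
  determined. Conversely, this defines a valuation with the required residues. It extends \<open>v\<close>
  because elements of the Weyl algebra expand in the elements of the sequence, with
  pairwise different leading terms, so that \<open>v\<close> dominates the Gauss valuations of all approximations.
  The relations between the residues make the choices consistent with \<open>v\<close> since some earlier
  \<open>omega i\<close> has a value with odd numerator over the common denominator, and odd roots are unique.
\<close>

section \<open>Coefficients of skew polynomials over the Puiseux series\<close>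

text \<open>The obstacle is that v is known only on the Weyl algebra, which has no roots of x, and
  that v is not known to come from a Gauss valuation. What is proved instead is an inequality,
  \<open>below\<close>, which is raised stage by stage. Let u, the current element of the sequence,
  have value q, let n be the current ramification and L the order of q modulo multiples of 1/n. Then
  z = u^L - c^L x^(-L q), with an element of the algebra standing in for the root of x, has degree L
  in y - p for the old Gauss valuation but degree 1 for the new one. Products of roots of x, powers
  u^i with i < L and powers of z have pairwise different leading positions for the new valuation. So
  a sum of them has the least Gauss value of its terms, and v bounds each term by multiplicativity.
  This is the mechanism of MacLane's key polynomials. The bound 1 for the value of y - p comes from
  y x - x y = 1: it makes Gauss valuations multiplicative, and together with the bounded
  ramification of a single element it forces a leading constant for each element in an infinite
  process.\<close>

type_synonym spoly = "puiseux skew_poly"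

definition scoeff :: "spoly \<Rightarrow> nat \<Rightarrow> puiseux" where
  "scoeff f i = coeff (poly_of f) i"

lemma scoeff_add [simp]: "scoeff (f + g) i = scoeff f i + scoeff g i"
  and scoeff_diff [simp]: "scoeff (f - g) i = scoeff f i - scoeff g i"
  and scoeff_uminus [simp]: "scoeff (- f) i = - scoeff f i"
  and scoeff_0 [simp]: "scoeff 0 i = 0"
  and scoeff_1: "scoeff 1 i = (if i = 0 then 1 else 0)"
  by (simp_all add: scoeff_def plus_skew_poly.rep_eq minus_skew_poly.rep_eq uminus_skew_poly.rep_eq
      zero_skew_poly.rep_eq one_skew_poly.rep_eq)

lemma scoeff_eqI: "(\<And>i. scoeff f i = scoeff g i) \<Longrightarrow> f = g"
  by (metis scoeff_def poly_eqI poly_of_inject)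

lemma scoeff_sum: "scoeff (sum F A) i = (\<Sum>x\<in>A. scoeff (F x) i)"
  by (induction A rule: infinite_finite_induct) auto

lemma scoeff_sconst_mult [simp]: "scoeff (sconst c * f) i = c * scoeff f i"
proof -
  have "poly_of (sconst c * f) = smult c (poly_of f)"
    by (simp add: times_skew_poly.rep_eq sconst_def skew_inverse skew_mult_def)
  thus ?thesis by (simp add: scoeff_def)
qed

lemma scoeff_sconst: "scoeff (sconst c) i = (if i = 0 then c else 0)"
  using scoeff_sconst_mult[of c 1 i] by (simp add: scoeff_1)

lemma scoeff_svar_mult:
  "scoeff (svar * f) k = (if k = 0 then 0 else scoeff f (k - 1)) + der (scoeff f k)"
proof -
  have "poly_of (svar * f) = ymult (poly_of f)"
    using skew_mult_pCons_0[of 1 "poly_of f"]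
    by (simp add: times_skew_poly.rep_eq svar_def skew_inverse one_pCons[symmetric] skew_mult_1_left)
  thus ?thesis by (auto simp: scoeff_def ymult_def coeff_map_poly coeff_pCons split: nat.split)
qed

lemma scoeff_svar_pow: "scoeff (svar ^ j) i = (if i = j then 1 else 0)"
  by (simp add: svar_pow scoeff_def skew_inverse)

lemma spoly_sum: "f = (\<Sum>i\<le>degree (poly_of f). sconst (scoeff f i) * svar ^ i)"
proof (rule scoeff_eqI)
  fix k
  show "scoeff f k = scoeff (\<Sum>i\<le>degree (poly_of f). sconst (scoeff f i) * svar ^ i) k"
  proof (cases "k \<le> degree (poly_of f)")
    case True
    thus ?thesis by (simp add: scoeff_sum scoeff_svar_pow if_distrib cong: if_cong)
  next
    case False
    hence "scoeff f k = 0" by (simp add: scoeff_def coeff_eq_0)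
    moreover have "(\<Sum>i\<le>degree (poly_of f). scoeff f i * (if k = i then 1 else 0)) = 0"
      using False by (intro sum.neutral) auto
    ultimately show ?thesis by (simp add: scoeff_sum scoeff_svar_pow)
  qed
qed

text \<open>The argument q is the value of x^(-q), not an exponent of x; the term meant is x^(-q)
  y^i.\<close>

definition cf :: "spoly \<Rightarrow> nat \<Rightarrow> rat \<Rightarrow> real" where
  "cf f i q = pcoeff (scoeff f i) q"

lemma pcoeff_sum: "pcoeff (sum F A) q = (\<Sum>x\<in>A. pcoeff (F x) q)"
  by (induction A rule: infinite_finite_induct) (auto simp: plus_puiseux.rep_eq zero_puiseux.rep_eq)

lemma cf_add [simp]: "cf (f + g) i q = cf f i q + cf g i q"
  and cf_diff [simp]: "cf (f - g) i q = cf f i q - cf g i q"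
  and cf_uminus [simp]: "cf (- f) i q = - cf f i q"
  and cf_0 [simp]: "cf 0 i q = 0"
  by (simp_all add: cf_def plus_puiseux.rep_eq minus_puiseux.rep_eq uminus_puiseux.rep_eq zero_puiseux.rep_eq)

lemma cf_sum: "cf (sum F A) i q = (\<Sum>x\<in>A. cf (F x) i q)"
  by (simp add: cf_def scoeff_sum pcoeff_sum)

lemma pcoeff_mult_ne:
  "pcoeff (c * d) s \<noteq> 0 \<Longrightarrow> \<exists>a b. pcoeff c a \<noteq> 0 \<and> pcoeff d b \<noteq> 0 \<and> s = a + b"
proof -
  assume "pcoeff (c * d) s \<noteq> 0"
  hence "{a. pcoeff c a \<noteq> 0 \<and> pcoeff d (s - a) \<noteq> 0} \<noteq> {}"
    unfolding times_puiseux.rep_eq by (metis (no_types, lifting) sum.empty)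
  then obtain a where "pcoeff c a \<noteq> 0" "pcoeff d (s - a) \<noteq> 0" by blast
  thus ?thesis by (intro exI[of _ a] exI[of _ "s - a"]) auto
qed

lemma pcoeff_monom_mult: "pcoeff (puiseux_monom r a * c) q = r * pcoeff c (q + a)"
proof -
  have "pcoeff (puiseux_monom r a * c) q =
      (\<Sum>t | pcoeff (puiseux_monom r a) t \<noteq> 0 \<and> pcoeff c (q - t) \<noteq> 0. pcoeff (puiseux_monom r a) t * pcoeff c (q - t))"
    by (simp add: times_puiseux.rep_eq)
  also have "\<dots> = (\<Sum>t\<in>{- a}. pcoeff (puiseux_monom r a) t * pcoeff c (q - t))"
    by (rule sum.mono_neutral_left) (auto simp: puiseux_monom.rep_eq split: if_splits)
  finally show ?thesis by (simp add: puiseux_monom.rep_eq)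
qed

lemma puiseux_lead:
  assumes "c \<noteq> 0"
  obtains q where "pcoeff c q \<noteq> 0" "\<forall>s<q. pcoeff c s = 0"
proof -
  obtain n F where nF: "n > 0" "c = puiseux_of_fls n F" by (rule puiseux_of_fls_surj)
  hence F: "F \<noteq> 0" using assms by (auto simp: puiseux_of_fls_0)
  let ?q = "of_int (fls_subdegree F) / of_nat n :: rat"
  have "pcoeff c ?q \<noteq> 0" unfolding nF(2) puiseux_of_fls_eq[OF nF(1)] using F by simp
  moreover have "pcoeff c s = 0" if "s < ?q" for s
  proof (rule ccontr)
    assume a: "pcoeff c s \<noteq> 0"
    hence "s * of_nat n \<in> \<int>" using nF by (auto simp: puiseux_of_fls.rep_eq split: if_splits)
    then obtain k where k: "s * of_nat n = of_int k" by (auto elim: Ints_cases)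
    hence s: "s = of_int k / of_nat n" using nF by (simp add: field_simps)
    have "fls_nth F k \<noteq> 0" using a unfolding nF(2) s puiseux_of_fls_eq[OF nF(1)] .
    hence "fls_subdegree F \<le> k" by (rule fls_subdegree_leI)
    hence "?q \<le> s" unfolding s using nF by (simp add: divide_right_mono)
    thus False using that by simp
  qed
  ultimately show thesis using that by blast
qed

lemma cf_sconst_mult_ne:
  "cf (sconst c * f) k s \<noteq> 0 \<Longrightarrow> \<exists>a b. pcoeff c a \<noteq> 0 \<and> cf f k b \<noteq> 0 \<and> s = a + b"
  unfolding cf_def scoeff_sconst_mult by (drule pcoeff_mult_ne) blast

lemma cf_sconst: "cf (sconst c) i q = (if i = 0 then pcoeff c q else 0)"
  by (simp add: cf_def scoeff_sconst zero_puiseux.rep_eq)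

lemma cf_svar_mult:
  "cf (svar * f) k s = (if k = 0 then 0 else cf f (k - 1) s) - of_rat (s - 1) * cf f k (s - 1)"
  by (simp add: cf_def scoeff_svar_mult plus_puiseux.rep_eq der_puiseux.rep_eq zero_puiseux.rep_eq)

lemma cf_svar_pow_mult_ne:
  "cf (svar ^ n * f) k s \<noteq> 0 \<Longrightarrow> \<exists>j b d. cf f j b \<noteq> 0 \<and> k + d = n + j \<and> s = b + of_nat d"
proof (induction n arbitrary: k s)
  case 0
  thus ?case by (intro exI[of _ k] exI[of _ s] exI[of _ 0]) auto
next
  case (Suc n)
  from Suc.prems have "cf (svar * (svar ^ n * f)) k s \<noteq> 0" by (simp add: mult.assoc)
  then consider "k \<noteq> 0" "cf (svar ^ n * f) (k - 1) s \<noteq> 0" | "cf (svar ^ n * f) k (s - 1) \<noteq> 0"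
    by (cases "cf (svar ^ n * f) k (s - 1) = 0") (auto simp: cf_svar_mult split: if_splits)
  thus ?case
  proof cases
    case 1
    with Suc.IH obtain j b d where "cf f j b \<noteq> 0" "k - 1 + d = n + j" "s = b + of_nat d" by blast
    thus ?thesis using 1 by (intro exI[of _ j] exI[of _ b] exI[of _ d]) auto
  next
    case 2
    with Suc.IH obtain j b d where "cf f j b \<noteq> 0" "k + d = n + j" "s - 1 = b + of_nat d" by blast
    thus ?thesis by (intro exI[of _ j] exI[of _ b] exI[of _ "Suc d"]) (auto simp: algebra_simps)
  qed
qed

text \<open>Every exchange of \<open>y\<close> with a coefficient loses one power of \<open>y\<close> and one power of \<open>x\<close>.\<close>

lemma cf_mult_ne:
  assumes "cf (f * g) k s \<noteq> 0"
  obtains i a j b d where "cf f i a \<noteq> 0" "cf g j b \<noteq> 0" "k + d = i + j" "s = a + b + of_nat d"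
proof -
  have "f * g = (\<Sum>i\<le>degree (poly_of f). sconst (scoeff f i) * (svar ^ i * g))"
    by (subst spoly_sum[of f]) (simp add: sum_distrib_right mult.assoc)
  hence "\<exists>i\<in>{..degree (poly_of f)}. cf (sconst (scoeff f i) * (svar ^ i * g)) k s \<noteq> 0"
    using assms by (metis (no_types, lifting) cf_sum sum.neutral)
  then obtain i where "cf (sconst (scoeff f i) * (svar ^ i * g)) k s \<noteq> 0" by blast
  from cf_sconst_mult_ne[OF this] obtain a t where 1: "cf f i a \<noteq> 0" "cf (svar ^ i * g) k t \<noteq> 0" "s = a + t"
    by (auto simp: cf_def)
  from cf_svar_pow_mult_ne[OF 1(2)] obtain j b d where "cf g j b \<noteq> 0" "k + d = i + j" "t = b + of_nat d"
    by blast
  with 1 show thesis by (intro that[of i a j b d]) auto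
qed

text \<open>The number d counts the derivatives that a term has absorbed. In a commutator at least
  one is taken, so each term gains at least 1 - g when y has value g < 1: the reason why leading
  terms multiply as in a commutative ring.\<close>

lemma cf_svar_pow_comm_ne:
  "cf (svar ^ n * sconst c - sconst c * svar ^ n) k s \<noteq> 0 \<Longrightarrow>
     \<exists>b d. pcoeff c b \<noteq> 0 \<and> d \<ge> 1 \<and> k + d = n \<and> s = b + of_nat d"
proof (induction n arbitrary: k s)
  case (Suc n)
  let ?e = "svar ^ n * sconst c - sconst c * svar ^ n"
  have "svar ^ Suc n * sconst c - sconst c * svar ^ Suc n = svar * ?e + sconst (der c) * svar ^ n"
  proof -
    have "svar * (sconst c * svar ^ n) = sconst c * svar ^ Suc n + sconst (der c) * svar ^ n"
      by (simp add: mult.assoc[symmetric] svar_comm distrib_right)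
    thus ?thesis by (simp add: right_diff_distrib mult.assoc)
  qed
  with Suc.prems consider "cf (svar * ?e) k s \<noteq> 0" | "cf (sconst (der c) * svar ^ n) k s \<noteq> 0"
    by (cases "cf (svar * ?e) k s = 0") (auto simp del: power_Suc cf_diff)
  thus ?case
  proof cases
    case 1
    then consider "k \<noteq> 0" "cf ?e (k - 1) s \<noteq> 0" | "cf ?e k (s - 1) \<noteq> 0"
      by (cases "cf ?e k (s - 1) = 0") (auto simp: cf_svar_mult simp del: cf_diff split: if_splits)
    thus ?thesis
    proof cases
      case 1
      then obtain b d where "pcoeff c b \<noteq> 0 \<and> d \<ge> 1 \<and> k - 1 + d = n \<and> s = b + of_nat d" using Suc.IH by blast
      thus ?thesis using 1(1) by (intro exI[of _ b] exI[of _ d]) auto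
    next
      case 2
      then obtain b d where "pcoeff c b \<noteq> 0 \<and> d \<ge> 1 \<and> k + d = n \<and> s - 1 = b + of_nat d" using Suc.IH by blast
      thus ?thesis by (intro exI[of _ b] exI[of _ "Suc d"]) (auto simp: algebra_simps)
    qed
  next
    case 2
    hence "pcoeff (der c * (if k = n then 1 else 0)) s \<noteq> 0" by (simp add: cf_def scoeff_svar_pow)
    hence "k = n" "pcoeff (der c) s \<noteq> 0" by (auto simp: zero_puiseux.rep_eq split: if_splits)
    thus ?thesis by (intro exI[of _ "s - 1"] exI[of _ 1]) (auto simp: der_puiseux.rep_eq)
  qed
qed simp

section \<open>Skew polynomials with coefficients in a differential subring\<close>

text \<open>Closure under \<open>der\<close> is what multiplication by y requires, so the skew
  polynomials with coefficients in X form a ring. It is used for bounded ramification, for Laurent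
  polynomials and for polynomials in x.\<close>

definition dsubring :: "puiseux set \<Rightarrow> bool" where
  "dsubring X \<longleftrightarrow> 1 \<in> X \<and> (\<forall>a\<in>X. \<forall>b\<in>X. a - b \<in> X \<and> a * b \<in> X) \<and> (\<forall>a\<in>X. der a \<in> X)"

lemma dsubringD:
  assumes "dsubring X"
  shows "1 \<in> X" "a \<in> X \<Longrightarrow> b \<in> X \<Longrightarrow> a - b \<in> X" "a \<in> X \<Longrightarrow> b \<in> X \<Longrightarrow> a * b \<in> X"
    "a \<in> X \<Longrightarrow> der a \<in> X" "0 \<in> X" "a \<in> X \<Longrightarrow> b \<in> X \<Longrightarrow> a + b \<in> X"
proof -
  show 0: "1 \<in> X" "\<And>a b. a \<in> X \<Longrightarrow> b \<in> X \<Longrightarrow> a - b \<in> X" "a \<in> X \<Longrightarrow> b \<in> X \<Longrightarrow> a * b \<in> X"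
    "a \<in> X \<Longrightarrow> der a \<in> X" using assms by (auto simp: dsubring_def)
  have "1 - 1 \<in> X" using 0 by blast
  thus z: "0 \<in> X" by simp
  assume "a \<in> X" "b \<in> X"
  hence "a - (0 - b) \<in> X" using 0 z by blast
  thus "a + b \<in> X" by simp
qed

definition skew_over :: "puiseux set \<Rightarrow> spoly set" where
  "skew_over X = {f. \<forall>i. scoeff f i \<in> X}"

lemma skew_overD: "f \<in> skew_over X \<Longrightarrow> scoeff f i \<in> X"
  by (simp add: skew_over_def)

lemma skew_over_closed:
  assumes X: "dsubring X"
  shows "sconst c \<in> skew_over X \<longleftrightarrow> c \<in> X"
    and "svar \<in> skew_over X" and "1 \<in> skew_over X" and "0 \<in> skew_over X"
    and "f \<in> skew_over X \<Longrightarrow> g \<in> skew_over X \<Longrightarrow> f + g \<in> skew_over X"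
    and "f \<in> skew_over X \<Longrightarrow> g \<in> skew_over X \<Longrightarrow> f - g \<in> skew_over X"
    and "f \<in> skew_over X \<Longrightarrow> g \<in> skew_over X \<Longrightarrow> f * g \<in> skew_over X"
    and "f \<in> skew_over X \<Longrightarrow> f ^ n \<in> skew_over X"
    and "(\<And>x. x \<in> A \<Longrightarrow> F x \<in> skew_over X) \<Longrightarrow> sum F A \<in> skew_over X"
proof -
  note D = dsubringD[OF X]
  show "sconst c \<in> skew_over X \<longleftrightarrow> c \<in> X" using D by (auto simp: skew_over_def scoeff_sconst)
  show one: "1 \<in> skew_over X" and z: "0 \<in> skew_over X" and "svar \<in> skew_over X"
    using D scoeff_svar_pow[of 1] by (auto simp: skew_over_def scoeff_1)
  show add: "f + g \<in> skew_over X" if "f \<in> skew_over X" "g \<in> skew_over X" for f g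
    using D that by (auto simp: skew_over_def)
  show "f \<in> skew_over X \<Longrightarrow> g \<in> skew_over X \<Longrightarrow> f - g \<in> skew_over X"
    using D by (auto simp: skew_over_def)
  show sum: "(\<And>x. x \<in> A \<Longrightarrow> F x \<in> skew_over X) \<Longrightarrow> sum F A \<in> skew_over X" for F :: "'a \<Rightarrow> _" and A
    using add z by (induction A rule: infinite_finite_induct) auto
  have pw: "svar ^ n * g \<in> skew_over X" if "g \<in> skew_over X" for n g
  proof (induction n)
    case (Suc n)
    hence "scoeff (svar * (svar ^ n * g)) k \<in> X" for k
      unfolding scoeff_svar_mult using D by (auto simp: skew_over_def)
    thus ?case by (auto simp: skew_over_def mult.assoc)
  qed (use that in simp)
  show mult: "f * g \<in> skew_over X" if "f \<in> skew_over X" "g \<in> skew_over X" for f g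
  proof -
    have "f * g = (\<Sum>i\<le>degree (poly_of f). sconst (scoeff f i) * (svar ^ i * g))"
      by (subst spoly_sum[of f]) (simp add: sum_distrib_right mult.assoc)
    moreover have "sconst (scoeff f i) * (svar ^ i * g) \<in> skew_over X" for i
      using pw[OF that(2), of i] D skew_overD[OF that(1), of i] by (auto simp: skew_over_def)
    moreover have "\<And>F A. (\<And>x::nat. x \<in> A \<Longrightarrow> F x \<in> skew_over X) \<Longrightarrow> sum F A \<in> skew_over X"
    proof -
      fix F :: "nat \<Rightarrow> spoly" and A assume "\<And>x. x \<in> A \<Longrightarrow> F x \<in> skew_over X"
      thus "sum F A \<in> skew_over X"
        using add z by (induction A rule: infinite_finite_induct) auto
    qed
    ultimately show ?thesis by simp
  qed
  show "f \<in> skew_over X \<Longrightarrow> f ^ n \<in> skew_over X"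
    using one mult by (induction n) auto
qed

text \<open>For n > 0 this is the field of Laurent series in the n-th root of 1/x.\<close>

definition ramified :: "nat \<Rightarrow> puiseux set" where
  "ramified n = {c. \<forall>q. pcoeff c q \<noteq> 0 \<longrightarrow> q * of_nat n \<in> \<int>}"

lemma dsubring_ramified: "dsubring (ramified n)"
  unfolding dsubring_def
proof (intro conjI ballI)
  show "1 \<in> ramified n" by (auto simp: ramified_def one_puiseux.rep_eq)
  fix a assume a: "a \<in> ramified n"
  show "der a \<in> ramified n" unfolding ramified_def
  proof (intro CollectI allI impI)
    fix q assume "pcoeff (der a) q \<noteq> 0"
    hence "(q - 1) * of_nat n \<in> \<int>" using a by (auto simp: ramified_def der_puiseux.rep_eq)
    hence "(q - 1) * of_nat n + of_nat n \<in> \<int>" by (intro Ints_add) auto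
    thus "q * of_nat n \<in> \<int>" by (simp add: algebra_simps)
  qed
  fix b assume b: "b \<in> ramified n"
  show "a - b \<in> ramified n" unfolding ramified_def
  proof (intro CollectI allI impI)
    fix q assume "pcoeff (a - b) q \<noteq> 0"
    hence "pcoeff a q \<noteq> 0 \<or> pcoeff b q \<noteq> 0" by (auto simp: minus_puiseux.rep_eq)
    thus "q * of_nat n \<in> \<int>" using a b by (auto simp: ramified_def)
  qed
  show "a * b \<in> ramified n" unfolding ramified_def
  proof (intro CollectI allI impI)
    fix q assume "pcoeff (a * b) q \<noteq> 0"
    from pcoeff_mult_ne[OF this] obtain s t where "pcoeff a s \<noteq> 0" "pcoeff b t \<noteq> 0" "q = s + t" by blast
    hence "s * of_nat n + t * of_nat n \<in> \<int>" using a b by (intro Ints_add) (auto simp: ramified_def)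
    thus "q * of_nat n \<in> \<int>" using \<open>q = s + t\<close> by (simp add: algebra_simps)
  qed
qed

lemma ramified_mono: "n dvd m \<Longrightarrow> ramified n \<subseteq> ramified m"
proof (rule subsetI, unfold ramified_def, intro CollectI allI impI)
  fix c q assume "n dvd m" and c: "c \<in> {c. \<forall>q. pcoeff c q \<noteq> 0 \<longrightarrow> q * rat_of_nat n \<in> \<int>}" "pcoeff c q \<noteq> 0"
  then obtain k where "m = n * k" by auto
  moreover have "q * of_nat n \<in> \<int>" using c by blast
  hence "q * of_nat n * of_nat k \<in> \<int>" by (rule Ints_mult) auto
  ultimately show "q * of_nat m \<in> \<int>" by (simp add: mult.assoc)
qed

lemma puiseux_ramified: obtains n where "n > 0" "c \<in> ramified n"
proof -
  obtain n F where "n > 0" "c = puiseux_of_fls n F" by (rule puiseux_of_fls_surj)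
  thus thesis by (intro that[of n]) (auto simp: ramified_def puiseux_of_fls.rep_eq split: if_splits)
qed

lemma spoly_ramified: obtains n where "n > 0" "f \<in> skew_over (ramified n)"
proof -
  have "\<exists>n>0. \<forall>i\<le>d. scoeff f i \<in> ramified n" for d
  proof (induction d)
    case 0
    obtain n where "n > 0" "scoeff f 0 \<in> ramified n" by (rule puiseux_ramified)
    thus ?case by auto
  next
    case (Suc d)
    then obtain n where n: "n > 0" "\<forall>i\<le>d. scoeff f i \<in> ramified n" by blast
    obtain m where m: "m > 0" "scoeff f (Suc d) \<in> ramified m" by (rule puiseux_ramified)
    show ?case using n m ramified_mono[of n "n * m"] ramified_mono[of m "n * m"]
      by (intro exI[of _ "n * m"]) (auto simp: le_Suc_eq)
  qed
  then obtain n where n: "n > 0" "\<forall>i\<le>degree (poly_of f). scoeff f i \<in> ramified n" by blast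
  have "scoeff f i \<in> ramified n" for i
    using n dsubringD(5)[OF dsubring_ramified] by (cases "i \<le> degree (poly_of f)") (auto simp: scoeff_def coeff_eq_0)
  thus thesis using n that by (auto simp: skew_over_def)
qed

section \<open>Shifts of the variable\<close>

text \<open>The ring homomorphism over the Puiseux series that maps y to y + p. The coefficients of
  \<open>shift p f\<close> are thus those of f expanded in powers of y - p, with coefficients on the
  left.\<close>

definition shift :: "puiseux \<Rightarrow> spoly \<Rightarrow> spoly" where
  "shift p f = (\<Sum>i\<le>degree (poly_of f). sconst (scoeff f i) * (svar + sconst p) ^ i)"

lemma shift_bound:
  assumes "degree (poly_of f) \<le> n"
  shows "shift p f = (\<Sum>i\<le>n. sconst (scoeff f i) * (svar + sconst p) ^ i)"
  unfolding shift_def using assms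
  by (intro sum.mono_neutral_left) (auto simp: scoeff_def coeff_eq_0)

lemma shift_add: "shift p (f + g) = shift p f + shift p g"
proof -
  let ?n = "max (degree (poly_of f)) (degree (poly_of g))"
  have "degree (poly_of (f + g)) \<le> ?n" by (simp add: plus_skew_poly.rep_eq degree_add_le)
  thus ?thesis
    by (simp add: shift_bound[of _ ?n] sconst_add distrib_right sum.distrib)
qed

lemma shift_0 [simp]: "shift p 0 = 0"
  using shift_add[of p 0 0] by simp

lemma shift_uminus: "shift p (- f) = - shift p f"
  using shift_add[of p f "- f"] by (simp add: eq_neg_iff_add_eq_0 add.commute)

lemma shift_diff: "shift p (f - g) = shift p f - shift p g"
  using shift_add[of p f "- g"] by (simp add: shift_uminus)

lemma shift_sum: "shift p (sum F A) = (\<Sum>x\<in>A. shift p (F x))"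
  by (induction A rule: infinite_finite_induct) (auto simp: shift_add)

lemma shift_sconst_mult: "shift p (sconst c * f) = sconst c * shift p f"
proof -
  have "poly_of (sconst c * f) = smult c (poly_of f)"
    by (rule poly_eqI) (use scoeff_sconst_mult[of c f] in \<open>simp add: scoeff_def\<close>)
  hence "degree (poly_of (sconst c * f)) \<le> degree (poly_of f)" by simp
  thus ?thesis
    by (simp add: shift_bound[of _ "degree (poly_of f)"] sconst_mult sum_distrib_left mult.assoc)
qed

lemma shift_svar_pow: "shift p (svar ^ n) = (svar + sconst p) ^ n"
proof -
  have "shift p (svar ^ n) = (\<Sum>i\<le>n. sconst (scoeff (svar ^ n) i) * (svar + sconst p) ^ i)"
    by (rule shift_bound) (simp add: svar_pow skew_inverse degree_monom_le)
  also have "\<dots> = (\<Sum>i\<le>n. if i = n then (svar + sconst p) ^ i else 0)"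
    by (rule sum.cong) (auto simp: scoeff_svar_pow)
  finally show ?thesis by simp
qed

lemma shift_svar [simp]: "shift p svar = svar + sconst p"
  using shift_svar_pow[of p 1] by simp

lemma shift_1 [simp]: "shift p 1 = 1"
  using shift_svar_pow[of p 0] by simp

lemma shift_sconst [simp]: "shift p (sconst c) = sconst c"
  using shift_sconst_mult[of p c 1] by simp

text \<open>Puiseux series commute with each other, so y + p obeys the same rule as y for moving
  past a coefficient; multiplicativity of \<open>shift\<close> follows from this case.\<close>

lemma shift_svar_mult: "shift p (svar * f) = (svar + sconst p) * shift p f"
proof -
  have "shift p (svar * (sconst a * svar ^ i)) = (svar + sconst p) * shift p (sconst a * svar ^ i)" for a i
  proof -
    have "svar * (sconst a * svar ^ i) = sconst a * svar ^ Suc i + sconst (der a) * svar ^ i"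
      by (simp add: mult.assoc[symmetric] svar_comm distrib_right)
    hence "shift p (svar * (sconst a * svar ^ i)) =
        sconst a * (svar + sconst p) ^ Suc i + sconst (der a) * (svar + sconst p) ^ i"
      by (simp only: shift_add shift_sconst_mult shift_svar_pow)
    also have "\<dots> = (svar + sconst p) * sconst a * (svar + sconst p) ^ i"
      by (simp add: distrib_right distrib_left mult.assoc svar_comm[of a, unfolded mult.assoc])
         (simp add: mult.assoc[symmetric] svar_comm distrib_right sconst_mult[symmetric] mult.commute[of p] distrib_left)
    finally show ?thesis by (simp add: shift_sconst_mult shift_svar_pow mult.assoc)
  qed
  thus ?thesis
    by (subst (1 2) spoly_sum[of f]) (simp add: sum_distrib_left shift_sum)
qed

lemma shift_mult: "shift p (f * g) = shift p f * shift p g"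
proof -
  have pw: "shift p (svar ^ n * g) = (svar + sconst p) ^ n * shift p g" for n
    by (induction n) (auto simp: mult.assoc shift_svar_mult)
  have "f * g = (\<Sum>i\<le>degree (poly_of f). sconst (scoeff f i) * (svar ^ i * g))"
    by (subst spoly_sum[of f]) (simp add: sum_distrib_right mult.assoc)
  thus ?thesis
    by (simp add: shift_sum shift_sconst_mult pw shift_def[of p f] sum_distrib_right mult.assoc)
qed

lemma shift_power: "shift p (f ^ n) = shift p f ^ n"
  by (induction n) (auto simp: shift_mult)

lemma shift_shift: "shift p (shift q f) = shift (p + q) f"
proof -
  have "shift p ((svar + sconst q) ^ i) = (svar + sconst (p + q)) ^ i" for i
    by (simp add: shift_power shift_add sconst_add add.assoc)
  thus ?thesis
    unfolding shift_def[of q f] shift_sum shift_sconst_mult by (simp add: shift_def)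
qed

lemma shift_id [simp]: "shift 0 f = f"
  by (simp add: shift_def spoly_sum[symmetric])

lemma shift_eq_0_iff [simp]: "shift p f = 0 \<longleftrightarrow> f = 0"
  using shift_shift[of "- p" p f] by (auto simp: )

lemma shift_skew_over:
  assumes "dsubring X" "p \<in> X" "f \<in> skew_over X"
  shows "shift p f \<in> skew_over X"
  unfolding shift_def using assms by (intro skew_over_closed(7-9) skew_over_closed(5))
    (auto simp: skew_over_closed skew_overD)

section \<open>Gauss valuations on the skew polynomial ring\<close>

text \<open>
  Values are taken in the ordered group of real polynomials: a rational number \<open>q\<close> is
  represented by \<open>q X\<close>, so that constants are infinitesimal and \<open>X\<^sup>2\<close> is infinitely large. Every cut
  of the rational numbers is realised by an element of this group.
\<close>

definition rv :: "rat \<Rightarrow> real poly" where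
  "rv q = [:0, of_rat q:]"

lemma rv_0 [simp]: "rv 0 = 0"
  and rv_add: "rv (a + b) = rv a + rv b"
  and rv_minus: "rv (- a) = - rv a"
  and rv_diff: "rv (a - b) = rv a - rv b"
  and rv_eq_iff [simp]: "rv a = rv b \<longleftrightarrow> a = b"
  and rv_less_iff [simp]: "rv a < rv b \<longleftrightarrow> a < b"
  by (simp_all add: rv_def of_rat_add of_rat_minus of_rat_diff less_poly_def of_rat_less pos_poly_pCons)

lemma rv_le_iff [simp]: "rv a \<le> rv b \<longleftrightarrow> a \<le> b"
  by (auto simp: order_le_less)

lemma rv_of_nat_mult: "rv (of_nat n * a) = of_nat n * rv a"
  by (simp add: rv_def of_rat_mult of_nat_poly)

definition wt :: "real poly \<Rightarrow> rat \<Rightarrow> nat \<Rightarrow> real poly" where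
  "wt g q i = rv q + of_nat i * g"

lemma wt_0 [simp]: "wt g q 0 = rv q"
  by (simp add: wt_def)

lemma wt_add: "wt g (q + q') (i + i') = wt g q i + wt g q' i'"
  by (simp add: wt_def rv_add distrib_right)

text \<open>The variable \<open>y - p\<close> is given the value \<open>g\<close>.\<close>

definition gauss_ge :: "puiseux \<Rightarrow> real poly \<Rightarrow> real poly \<Rightarrow> spoly \<Rightarrow> bool" where
  "gauss_ge p g s f \<longleftrightarrow> (\<forall>i q. cf (shift p f) i q \<noteq> 0 \<longrightarrow> s \<le> wt g q i)"

definition gauss_gt :: "puiseux \<Rightarrow> real poly \<Rightarrow> real poly \<Rightarrow> spoly \<Rightarrow> bool" where
  "gauss_gt p g s f \<longleftrightarrow> (\<forall>i q. cf (shift p f) i q \<noteq> 0 \<longrightarrow> s < wt g q i)"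

lemma gauss_geD: "gauss_ge p g s f \<Longrightarrow> cf (shift p f) i q \<noteq> 0 \<Longrightarrow> s \<le> wt g q i"
  and gauss_gtD: "gauss_gt p g s f \<Longrightarrow> cf (shift p f) i q \<noteq> 0 \<Longrightarrow> s < wt g q i"
  by (auto simp: gauss_ge_def gauss_gt_def)

lemma gauss_gt_imp_ge: "gauss_gt p g s f \<Longrightarrow> gauss_ge p g s f"
  by (force simp: gauss_ge_def gauss_gt_def)

lemma gauss_ge_mono: "gauss_ge p g s f \<Longrightarrow> t \<le> s \<Longrightarrow> gauss_ge p g t f"
  and gauss_ge_imp_gt: "gauss_ge p g s f \<Longrightarrow> t < s \<Longrightarrow> gauss_gt p g t f"
  by (force simp: gauss_ge_def gauss_gt_def)+

lemma gauss_ge_0 [simp]: "gauss_ge p g s 0"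
  and gauss_gt_0 [simp]: "gauss_gt p g s 0"
  by (simp_all add: gauss_ge_def gauss_gt_def)

lemma gauss_ge_add: "gauss_ge p g s f \<Longrightarrow> gauss_ge p g s h \<Longrightarrow> gauss_ge p g s (f + h)"
  and gauss_gt_add: "gauss_gt p g s f \<Longrightarrow> gauss_gt p g s h \<Longrightarrow> gauss_gt p g s (f + h)"
  unfolding gauss_ge_def gauss_gt_def shift_add cf_add by (metis add_0)+

lemma gauss_ge_uminus [simp]: "gauss_ge p g s (- f) \<longleftrightarrow> gauss_ge p g s f"
  and gauss_gt_uminus [simp]: "gauss_gt p g s (- f) \<longleftrightarrow> gauss_gt p g s f"
  by (simp_all add: gauss_ge_def gauss_gt_def shift_uminus)

lemma gauss_ge_diff: "gauss_ge p g s f \<Longrightarrow> gauss_ge p g s h \<Longrightarrow> gauss_ge p g s (f - h)"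
  and gauss_gt_diff: "gauss_gt p g s f \<Longrightarrow> gauss_gt p g s h \<Longrightarrow> gauss_gt p g s (f - h)"
  using gauss_ge_add[of p g s f "- h"] gauss_gt_add[of p g s f "- h"] by simp_all

lemma gauss_gt_sum: "(\<And>x. x \<in> A \<Longrightarrow> gauss_gt p g s (F x)) \<Longrightarrow> gauss_gt p g s (sum F A)"
  by (induction A rule: infinite_finite_induct) (auto intro: gauss_gt_add)

lemma gauss_gt_shift: "gauss_gt 0 g s (shift p f) \<longleftrightarrow> gauss_gt p g s f"
  by (simp add: gauss_gt_def)

text \<open>Each of the d derivatives removes a factor y - p, of value g, and creates a factor 1/x,
  of value 1. The gain d (1 - g) is the reason for the bound g \<le> 1 on Gauss valuations.\<close>

lemma wt_mult:
  assumes "k + d = i + j"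
  shows "wt g (a + b + of_nat d) k = wt g a i + wt g b j + of_nat d * (rv 1 - g)"
proof -
  have "(of_nat k + of_nat d :: real poly) = of_nat i + of_nat j"
    using assms by (metis of_nat_add)
  hence k: "(of_nat k :: real poly) = of_nat i + of_nat j - of_nat d" by (simp add: algebra_simps)
  show ?thesis unfolding wt_def k rv_add using rv_of_nat_mult[of d 1] by (simp add: algebra_simps)
qed

lemma gauss_mult:
  assumes g: "g \<le> rv 1"
  shows gauss_ge_mult: "gauss_ge p g s f \<Longrightarrow> gauss_ge p g t h \<Longrightarrow> gauss_ge p g (s + t) (f * h)"
    and gauss_gt_mult1: "gauss_gt p g s f \<Longrightarrow> gauss_ge p g t h \<Longrightarrow> gauss_gt p g (s + t) (f * h)"
    and gauss_gt_mult2: "gauss_ge p g s f \<Longrightarrow> gauss_gt p g t h \<Longrightarrow> gauss_gt p g (s + t) (f * h)"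
proof -
  have key: "\<exists>i a j b. cf (shift p f) i a \<noteq> 0 \<and> cf (shift p h) j b \<noteq> 0 \<and> wt g a i + wt g b j \<le> wt g q k"
    if "cf (shift p (f * h)) k q \<noteq> 0" for k q
  proof -
    from that have "cf (shift p f * shift p h) k q \<noteq> 0" by (simp add: shift_mult)
    then obtain i a j b d where 1: "cf (shift p f) i a \<noteq> 0" "cf (shift p h) j b \<noteq> 0"
      and d: "k + d = i + j" "q = a + b + of_nat d" by (rule cf_mult_ne)
    have "0 \<le> of_nat d * (rv 1 - g)" using g by (intro mult_nonneg_nonneg) auto
    hence "wt g a i + wt g b j \<le> wt g q k" unfolding d(2) wt_mult[OF d(1)] by simp
    with 1 show ?thesis by blast
  qed
  show "gauss_ge p g s f \<Longrightarrow> gauss_ge p g t h \<Longrightarrow> gauss_ge p g (s + t) (f * h)"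
    unfolding gauss_ge_def by (meson key add_mono order_trans)
  show "gauss_gt p g s f \<Longrightarrow> gauss_ge p g t h \<Longrightarrow> gauss_gt p g (s + t) (f * h)"
    unfolding gauss_ge_def gauss_gt_def by (meson key add_less_le_mono order_less_le_trans)
  show "gauss_ge p g s f \<Longrightarrow> gauss_gt p g t h \<Longrightarrow> gauss_gt p g (s + t) (f * h)"
    unfolding gauss_ge_def gauss_gt_def by (meson key add_le_less_mono order_less_le_trans)
qed

lemma gauss_ge_power:
  assumes "g \<le> rv 1" "gauss_ge p g s f"
  shows "gauss_ge p g (of_nat n * s) (f ^ n)"
proof (induction n)
  case 0
  show ?case by (auto simp: gauss_ge_def cf_def scoeff_1 one_puiseux.rep_eq zero_puiseux.rep_eq split: if_splits)
next
  case (Suc n)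
  thus ?case using gauss_ge_mult[OF assms Suc] by (simp add: algebra_simps)
qed

lemma gauss_ge_sconst: "(\<And>q. pcoeff c q \<noteq> 0 \<Longrightarrow> s \<le> rv q) \<Longrightarrow> gauss_ge p g s (sconst c)"
  and gauss_gt_sconst: "(\<And>q. pcoeff c q \<noteq> 0 \<Longrightarrow> s < rv q) \<Longrightarrow> gauss_gt p g s (sconst c)"
  by (auto simp: gauss_ge_def gauss_gt_def cf_sconst split: if_splits)

section \<open>Monomials in y - p and leading terms\<close>

definition mon :: "puiseux \<Rightarrow> real \<Rightarrow> rat \<Rightarrow> nat \<Rightarrow> spoly" where
  "mon p r q i = sconst (puiseux_monom r (- q)) * (svar - sconst p) ^ i"

lemma sconst_uminus: "sconst (- c) = - sconst (c :: puiseux)"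
  by (rule scoeff_eqI) (simp add: scoeff_sconst)

lemma sconst_diff: "sconst (a - b) = sconst a - sconst (b :: puiseux)"
  by (rule scoeff_eqI) (simp add: scoeff_sconst)

lemma shift_mon: "shift p (mon p r q i) = sconst (puiseux_monom r (- q)) * svar ^ i"
  by (simp add: mon_def shift_sconst_mult shift_power shift_diff)

lemma cf_shift_mon: "cf (shift p (mon p r q i)) j s = (if j = i \<and> s = q then r else 0)"
  by (simp add: shift_mon cf_def scoeff_svar_pow puiseux_monom.rep_eq zero_puiseux.rep_eq)

lemma gauss_ge_mon: "s \<le> wt g q i \<Longrightarrow> gauss_ge p g s (mon p r q i)"
  and gauss_gt_mon: "s < wt g q i \<Longrightarrow> gauss_gt p g s (mon p r q i)"
  by (auto simp: gauss_ge_def gauss_gt_def cf_shift_mon split: if_splits)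

lemma mon_const: "mon p r q 0 = sconst (puiseux_monom r (- q))"
  by (simp add: mon_def)

lemma puiseux_monom_diff: "puiseux_monom c a - puiseux_monom d a = puiseux_monom (c - d) a"
  by (rule puiseux_eqI) (simp add: minus_puiseux.rep_eq puiseux_monom.rep_eq)

lemma mon_add: "mon p r q i + mon p s q i = mon p (r + s) q i"
  and mon_diff: "mon p r q i - mon p s q i = mon p (r - s) q i"
  and mon_0 [simp]: "mon p 0 q i = 0"
  by (simp_all add: mon_def distrib_right[symmetric] left_diff_distrib[symmetric] sconst_add[symmetric]
      sconst_diff[symmetric] puiseux_monom_add puiseux_monom_diff)

text \<open>After the shift the difference is a commutator of y^i with a coefficient, between two
  further factors; with g < 1 its terms gain a positive amount.\<close>

lemma gauss_gt_mon_mult: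
  assumes g: "g < rv 1"
  shows "gauss_gt p g (wt g q i + wt g q' i') (mon p r q i * mon p r' q' i' - mon p (r * r') (q + q') (i + i'))"
proof -
  define c c' where "c = puiseux_monom r (- q)" and "c' = puiseux_monom r' (- q')"
  define e where "e = svar ^ i * sconst c' - sconst c' * svar ^ i"
  have cc: "puiseux_monom (r * r') (- (q + q')) = c * c'"
    by (simp add: c_def c'_def puiseux_monom_mult)
  have eq: "shift p (mon p r q i * mon p r' q' i' - mon p (r * r') (q + q') (i + i')) = sconst c * e * svar ^ i'"
    unfolding shift_diff shift_mult shift_mon cc
    by (simp add: e_def c_def c'_def algebra_simps power_add sconst_mult)
  have "gauss_gt 0 g (rv q' + of_nat i * g) e"
    unfolding gauss_gt_def
  proof (intro allI impI)
    fix k s assume "cf (shift 0 e) k s \<noteq> 0"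
    hence "cf (svar ^ i * sconst c' - sconst c' * svar ^ i) k s \<noteq> 0" unfolding e_def by (simp del: cf_diff)
    from cf_svar_pow_comm_ne[OF this] obtain b d where b: "pcoeff c' b \<noteq> 0" "d \<ge> 1" "k + d = i" "s = b + of_nat d"
      by blast
    hence "b = q'" by (auto simp: c'_def puiseux_monom.rep_eq split: if_splits)
    moreover have "of_nat d * (rv 1 - g) > 0" using g b by (intro mult_pos_pos) auto
    ultimately show "rv q' + of_nat i * g < wt g s k"
      using wt_mult[of k d i 0 g 0 b] b by (simp add: wt_def)
  qed
  moreover have "gauss_ge 0 g (rv q) (sconst c)"
    by (rule gauss_ge_sconst) (auto simp: c_def puiseux_monom.rep_eq split: if_splits)
  moreover have "gauss_ge 0 g (rv 0 + of_nat i' * g) (svar ^ i')"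
    by (auto simp: gauss_ge_def cf_def scoeff_svar_pow wt_def one_puiseux.rep_eq zero_puiseux.rep_eq split: if_splits)
  ultimately have "gauss_gt 0 g (rv q + (rv q' + of_nat i * g) + (rv 0 + of_nat i' * g)) (sconst c * e * svar ^ i')"
    using g by (intro gauss_gt_mult1 gauss_gt_mult2) auto
  hence "gauss_gt 0 g (wt g q i + wt g q' i') (sconst c * e * svar ^ i')"
    by (simp add: wt_def algebra_simps)
  thus ?thesis unfolding eq[symmetric] gauss_gt_shift .
qed

text \<open>The coefficient r may be 0, and then the statement only bounds f from below
  (\<open>lead_0_iff\<close>). So sums in which leading terms cancel need no case
  distinction.\<close>

definition lead :: "puiseux \<Rightarrow> real poly \<Rightarrow> spoly \<Rightarrow> real \<Rightarrow> rat \<Rightarrow> nat \<Rightarrow> bool" where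
  "lead p g f r q i \<longleftrightarrow> gauss_gt p g (wt g q i) (f - mon p r q i)"

lemma lead_mon [simp]: "lead p g (mon p r q i) r q i"
  by (simp add: lead_def)

lemma lead_coeff_eq: "lead p g f r q i \<Longrightarrow> cf (shift p f) i q = r"
  unfolding lead_def using gauss_gtD[of p g "wt g q i" "f - mon p r q i" i q]
  by (auto simp: shift_diff cf_shift_mon)

lemma lead_imp_ge: "lead p g f r q i \<Longrightarrow> gauss_ge p g (wt g q i) f"
  unfolding lead_def
  using gauss_ge_add[OF gauss_gt_imp_ge gauss_ge_mon, of p g "wt g q i" "f - mon p r q i" q i r] by simp

lemma lead_cong: "lead p g f r q i \<Longrightarrow> gauss_gt p g (wt g q i) (h - f) \<Longrightarrow> lead p g h r q i"
  unfolding lead_def using gauss_gt_add[of p g "wt g q i" "f - mon p r q i" "h - f"] by simp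

lemma lead_add: "lead p g f r q i \<Longrightarrow> lead p g h s q i \<Longrightarrow> lead p g (f + h) (r + s) q i"
  and lead_diff: "lead p g f r q i \<Longrightarrow> lead p g h s q i \<Longrightarrow> lead p g (f - h) (r - s) q i"
  unfolding lead_def
  using gauss_gt_add[of p g "wt g q i" "f - mon p r q i" "h - mon p s q i"]
    gauss_gt_diff[of p g "wt g q i" "f - mon p r q i" "h - mon p s q i"]
  by (simp_all add: mon_add[symmetric] mon_diff[symmetric] algebra_simps)

lemma lead_0_iff: "lead p g f 0 q i \<longleftrightarrow> gauss_gt p g (wt g q i) f"
  by (simp add: lead_def)

lemma lead_mult:
  assumes g: "g < rv 1" and f: "lead p g f r q i" and h: "lead p g h s q' j"
  shows "lead p g (f * h) (r * s) (q + q') (i + j)"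
proof -
  let ?m = "mon p r q i" and ?n = "mon p s q' j"
  have "gauss_gt p g (wt g q i + wt g q' j) ((f - ?m) * h)"
    using f g lead_imp_ge[OF h] by (intro gauss_gt_mult1) (auto simp: lead_def)
  moreover have "gauss_gt p g (wt g q i + wt g q' j) (?m * (h - ?n))"
    using h g by (intro gauss_gt_mult2 gauss_ge_mon) (auto simp: lead_def)
  ultimately have "gauss_gt p g (wt g q i + wt g q' j)
      ((f - ?m) * h + ?m * (h - ?n) + (?m * ?n - mon p (r * s) (q + q') (i + j)))"
    using gauss_gt_mon_mult[OF g] by (intro gauss_gt_add) auto
  thus ?thesis by (simp add: lead_def wt_add algebra_simps)
qed

lemma lead_1: "lead p g 1 1 0 0"
  using lead_mon[of p g 1 0 0] by (simp add: mon_def puiseux_monom_1)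

lemma lead_power:
  assumes g: "g < rv 1" and f: "lead p g f r q i"
  shows "lead p g (f ^ n) (r ^ n) (of_nat n * q) (n * i)"
proof (induction n)
  case 0
  thus ?case by (simp add: lead_1)
next
  case (Suc n)
  show ?case using lead_mult[OF g f Suc] by (simp add: algebra_simps)
qed

lemma lead_sconst_mult:
  assumes g: "g < rv 1" and f: "lead p g f r q i"
  shows "lead p g (sconst (puiseux_monom a (- s)) * f) (a * r) (s + q) i"
  using lead_mult[OF g lead_mon[of p g a s 0] f] by (simp add: mon_const)

text \<open>The element y - p is (y - p') + (p' - p), and both summands have value at least g for
  the new Gauss valuation; powers keep that bound because g \<le> 1. Moving the centre by terms of
  value at least g and raising the value of the variable therefore never lowers a Gauss
  value.\<close>

lemma gauss_change:
  assumes d: "\<And>q. pcoeff (p' - p) q \<noteq> 0 \<Longrightarrow> g \<le> rv q" and g: "g \<le> rv 1" and gg: "g \<le> g'"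
  shows gauss_ge_change: "gauss_ge p g s f \<Longrightarrow> gauss_ge p' g' s f"
    and gauss_gt_change: "gauss_gt p g s f \<Longrightarrow> gauss_gt p' g' s f"
proof -
  let ?F = "shift p f" and ?d = "p' - p"
  have key: "\<exists>i a. cf ?F i a \<noteq> 0 \<and> wt g a i \<le> wt g' q k" if "cf (shift p' f) k q \<noteq> 0" for k q
  proof -
    have "shift p' f = shift ?d ?F" by (simp add: shift_shift)
    hence "cf (\<Sum>i\<le>degree (poly_of ?F). sconst (scoeff ?F i) * (svar + sconst ?d) ^ i) k q \<noteq> 0"
      using that by (simp add: shift_def[of ?d ?F])
    hence "\<exists>i\<in>{..degree (poly_of ?F)}. cf (sconst (scoeff ?F i) * (svar + sconst ?d) ^ i) k q \<noteq> 0"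
      unfolding cf_sum by (metis (no_types, lifting) sum.neutral)
    then obtain i where "cf (sconst (scoeff ?F i) * (svar + sconst ?d) ^ i) k q \<noteq> 0" by blast
    from cf_sconst_mult_ne[OF this] obtain a b where
      ab: "cf ?F i a \<noteq> 0" "cf ((svar + sconst ?d) ^ i) k b \<noteq> 0" "q = a + b"
      by (auto simp: cf_def)
    have "gauss_ge 0 g g (svar + sconst ?d)"
    proof (intro gauss_ge_add gauss_ge_sconst d)
      show "gauss_ge 0 g g svar" using gauss_ge_mon[of g g 0 1 0 1] by (simp add: mon_def puiseux_monom_1 wt_def)
    qed
    hence "gauss_ge 0 g (of_nat i * g) ((svar + sconst ?d) ^ i)" using g by (intro gauss_ge_power)
    hence "of_nat i * g \<le> wt g b k" using ab(2) by (auto dest: gauss_geD)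
    moreover have "of_nat k * g \<le> of_nat k * g'" using gg by (intro mult_left_mono) auto
    ultimately have "wt g a i \<le> wt g' q k"
      unfolding ab(3) wt_def rv_add by (simp add: add.assoc)
    with ab show ?thesis by blast
  qed
  show "gauss_ge p g s f \<Longrightarrow> gauss_ge p' g' s f"
    unfolding gauss_ge_def by (meson key order_trans)
  show "gauss_gt p g s f \<Longrightarrow> gauss_gt p' g' s f"
    unfolding gauss_gt_def by (meson key order_less_le_trans)
qed

lemma lead_change:
  assumes "\<And>q. pcoeff (p' - p) q \<noteq> 0 \<Longrightarrow> g \<le> rv q" "g \<le> rv 1" "g \<le> g'" "lead p g f r q 0"
  shows "lead p' g' f r q 0"
  using gauss_gt_change[OF assms(1-3), where s = "rv q" and f = "f - mon p r q 0"] assms(4)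
  by (simp add: lead_def mon_const)

text \<open>The derivative with respect to \<open>y\<close> is the commutator with \<open>x\<close>.\<close>

definition dy :: "spoly \<Rightarrow> spoly" where
  "dy f = f * sconst (puiseux_monom 1 1) - sconst (puiseux_monom 1 1) * f"

lemma dy_add: "dy (f + g) = dy f + dy g"
  and dy_diff: "dy (f - g) = dy f - dy g"
  and dy_mult: "dy (f * g) = dy f * g + f * dy g"
  and dy_0 [simp]: "dy 0 = 0"
  by (simp_all add: dy_def algebra_simps)

lemma dy_sconst [simp]: "dy (sconst c) = 0"
  by (simp add: dy_def sconst_mult[symmetric] mult.commute)

lemma dy_svar [simp]: "dy svar = 1"
  by (simp add: dy_def svar_comm der_puiseux_monom puiseux_monom_1)

lemma dy_sum: "dy (sum F A) = (\<Sum>x\<in>A. dy (F x))"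
  by (induction A rule: infinite_finite_induct) (auto simp: dy_add)

lemma shift_dy: "shift p (dy f) = dy (shift p f)"
  by (simp add: dy_def shift_diff shift_mult)

lemma dy_svar_pow: "dy (svar ^ Suc n) = sconst (of_nat (Suc n)) * svar ^ n"
proof (induction n)
  case (Suc n)
  have c: "svar * sconst (of_nat k) = sconst (of_nat k) * (svar :: spoly)" for k
  proof -
    have "der (of_nat k :: puiseux) = 0" by (induction k) (auto simp: der_add)
    thus ?thesis by (simp add: svar_comm)
  qed
  have "dy (svar ^ Suc (Suc n)) = svar ^ Suc n + svar * (sconst (of_nat (Suc n)) * svar ^ n)"
    by (subst power_Suc, subst dy_mult, subst Suc) simp
  also have "\<dots> = sconst 1 * svar ^ Suc n + sconst (of_nat (Suc n)) * svar ^ Suc n"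
    by (simp add: mult.assoc[symmetric] c del: of_nat_Suc)
  also have "\<dots> = sconst (of_nat (Suc (Suc n))) * svar ^ Suc n"
    unfolding distrib_right[symmetric] sconst_add[symmetric] by (simp add: add.commute)
  finally show ?case .
qed simp

lemma scoeff_dy: "scoeff (dy f) i = of_nat (Suc i) * scoeff f (Suc i)"
proof -
  have t: "scoeff (dy (sconst c * svar ^ j)) i = of_nat (Suc i) * scoeff (sconst c * svar ^ j) (Suc i)" for c j
    by (cases j) (simp_all add: dy_mult dy_svar_pow scoeff_svar_pow del: power_Suc of_nat_Suc, simp_all add: scoeff_1 scoeff_sconst)
  show ?thesis
    by (subst (1 2) spoly_sum[of f]) (simp only: dy_sum scoeff_sum t sum_distrib_left)
qed

lemma cf_dy: "cf (dy f) i q = of_nat (Suc i) * cf f (Suc i) q"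
proof -
  have "pcoeff (of_nat k * c) q = of_nat k * pcoeff c q" for k c
    by (induction k) (auto simp: plus_puiseux.rep_eq zero_puiseux.rep_eq distrib_right)
  thus ?thesis by (simp only: cf_def scoeff_dy)
qed

lemma gauss_ge_dy: "gauss_ge p g s f \<Longrightarrow> gauss_ge p g (s - g) (dy f)"
proof -
  have e: "wt g q (Suc i) - g = wt g q i" for q i by (simp add: wt_def algebra_simps)
  have c: "cf (shift p f) (Suc i) q \<noteq> 0" if "cf (shift p (dy f)) i q \<noteq> 0" for i q
    using that by (auto simp: shift_dy cf_dy)
  show "gauss_ge p g s f \<Longrightarrow> gauss_ge p g (s - g) (dy f)"
    unfolding gauss_ge_def using c e by (metis diff_right_mono)
qed

lemma dy_skew_over: "dsubring X \<Longrightarrow> f \<in> skew_over X \<Longrightarrow> dy f \<in> skew_over X"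
proof -
  assume X: "dsubring X" and f: "f \<in> skew_over X"
  have "of_nat n * c \<in> X" if "c \<in> X" for n c
    using dsubringD[OF X] that by (induction n) (auto simp: distrib_right)
  thus ?thesis using f by (auto simp: skew_over_def scoeff_dy simp del: of_nat_Suc)
qed

section \<open>Valuations as dominance relations\<close>

lemma x_pow_mult: "x_pow a * x_pow b = x_pow (a + b)"
  by (simp add: x_pow_def puiseux_emb_mult[symmetric] puiseux_monom_mult)

lemma x_pow_0 [simp]: "x_pow 0 = 1"
  by (simp add: x_pow_def puiseux_monom_1)

lemma x_pow_nz [simp]: "x_pow a \<noteq> 0"
  using x_pow_mult[of a "- a"] by auto

lemma x_pow_inverse: "inverse (x_pow a) = x_pow (- a)"
  using x_pow_mult[of a "- a"] by (simp add: inverse_unique)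

lemma x_pow_power: "x_pow a ^ n = x_pow (of_nat n * a)"
  by (induction n) (simp_all add: x_pow_mult algebra_simps)

lemma x_pow_powi: "x_pow a powi k = x_pow (of_int k * a)"
  by (simp add: power_int_def x_pow_power x_pow_inverse)

lemma weyl_x_powi: "weyl_x powi k = x_pow (of_int k)"
  by (simp add: weyl_x_def x_pow_powi)

lemma weyl_x_nz [simp]: "weyl_x \<noteq> 0"
  by (simp add: weyl_x_def)

lemma real_const_mult: "real_const (r * s) = real_const r * real_const s"
  and real_const_add: "real_const (r + s) = real_const r + real_const s"
  and real_const_1 [simp]: "real_const 1 = 1"
  and real_const_0 [simp]: "real_const 0 = 0"
  by (simp_all add: real_const_def puiseux_emb_mult[symmetric] puiseux_emb_add[symmetric]
      puiseux_monom_mult puiseux_monom_add puiseux_monom_1)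

lemma real_const_uminus: "real_const (- r) = - real_const r"
  using real_const_add[of r "- r"] by (simp add: eq_neg_iff_add_eq_0 add.commute)

lemma real_const_diff: "real_const (r - s) = real_const r - real_const s"
  using real_const_add[of r "- s"] by (simp add: real_const_uminus)

lemma real_const_eq_0 [simp]: "real_const r = 0 \<longleftrightarrow> r = 0"
proof -
  have "real_const r * real_const (1 / r) = 1" if "r \<noteq> 0"
    using real_const_mult[of r "1 / r"] that by simp
  thus ?thesis by (metis mult_zero_left real_const_0 zero_neq_one)
qed

lemma real_const_inverse: "inverse (real_const r) = real_const (1 / r)"
proof (cases "r = 0")
  case False
  hence "real_const r * real_const (1 / r) = 1" using real_const_mult[of r "1 / r"] by simp
  thus ?thesis by (rule inverse_unique)
qed simp

lemma commute_mult:
  fixes a b c :: "'a :: semigroup_mult"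
  assumes "c * a = a * c" "c * b = b * c"
  shows "c * (a * b) = (a * b) * c"
proof -
  have "c * (a * b) = a * (c * b)" unfolding mult.assoc[symmetric] assms(1) ..
  thus ?thesis unfolding assms(2) mult.assoc .
qed

lemma sconst_real_comm: "sconst (puiseux_monom r 0) * f = f * sconst (puiseux_monom r 0)" for f :: spoly
proof -
  let ?r = "sconst (puiseux_monom r 0)"
  have "svar ^ n * ?r = ?r * svar ^ n" for n
    by (rule power_commuting_commutes) (simp add: svar_comm der_puiseux_monom)
  hence "?r * (sconst c * svar ^ n) = (sconst c * svar ^ n) * ?r" for c n
    by (intro commute_mult) (simp_all add: sconst_mult[symmetric] mult.commute)
  thus ?thesis
    by (subst (1 2) spoly_sum[of f]) (simp add: sum_distrib_left sum_distrib_right)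
qed

lemma commute_inverse:
  fixes a b :: "'a :: division_ring"
  assumes "a * b = b * a" "b \<noteq> 0"
  shows "a * inverse b = inverse b * a"
proof -
  have "b * (a * inverse b) = b * (inverse b * a)"
    using assms by (simp add: mult.assoc[symmetric]) (simp add: assms(1)[symmetric] mult.assoc)
  thus ?thesis using assms by simp
qed

lemma real_const_comm: "real_const r * a = a * real_const r"
proof -
  obtain f h where h: "h \<noteq> 0" and a: "a = to_quot f / to_quot h"
    using ore_quot_eq_quotient by blast
  have c: "real_const r * to_quot g = to_quot g * real_const r" for g
    using sconst_real_comm[of r g] by (simp add: real_const_def puiseux_emb_def to_quot_mult[symmetric])
  have "to_quot h \<noteq> 0" using h to_quot_inj[of h 0] by simp
  hence "real_const r * inverse (to_quot h) = inverse (to_quot h) * real_const r"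
    using c[of h] by (intro commute_inverse)
  thus ?thesis unfolding a divide_inverse by (rule commute_mult[OF c])
qed

lemma power_real_const_mult: "(real_const r * a) powi j = real_const (r powi j) * a powi j"
proof -
  have pw: "(real_const r * a) ^ n = real_const (r ^ n) * a ^ n" for r a n
  proof (induction n)
    case (Suc n)
    have "(real_const r * a) ^ Suc n = real_const r * (a * real_const (r ^ n)) * a ^ n"
      by (simp add: Suc mult.assoc)
    also have "\<dots> = real_const r * (real_const (r ^ n) * a) * a ^ n" by (simp only: real_const_comm)
    finally show ?case by (simp add: real_const_mult mult.assoc)
  qed simp
  have "inverse (real_const r * a) = real_const (inverse r) * inverse a"
  proof (cases "r = 0 \<or> a = 0")
    case False
    thus ?thesis by (simp add: nonzero_inverse_mult_distrib real_const_inverse real_const_comm divide_inverse)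
  qed auto
  thus ?thesis using pw by (simp add: power_int_def power_inverse)
qed

lemma to_quot_diff: "to_quot (a - b) = to_quot a - to_quot b"
  using to_quot_add[of "a - b" b] by (simp add: algebra_simps)

lemma to_quot_dy: "to_quot (dy f) = to_quot f * weyl_x - weyl_x * to_quot f"
  by (simp add: dy_def weyl_x_def x_pow_def puiseux_emb_def to_quot_diff to_quot_mult)

lemma to_quot_eq_0 [simp]: "to_quot f = 0 \<longleftrightarrow> f = 0"
  using to_quot_inj[of f 0] by simp

lemma common_denominator:
  fixes q s :: rat
  obtains n :: nat and k l where "n > 0" "q = of_int k / of_nat n" "s = of_int l / of_nat n"
proof -
  obtain a b where 1: "quotient_of q = (a, b)" by (cases "quotient_of q")
  obtain c d where 2: "quotient_of s = (c, d)" by (cases "quotient_of s")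
  have b: "b > 0" "d > 0" using 1 2 quotient_of_denom_pos by auto
  have q: "q = of_int a / of_int b" "s = of_int c / of_int d" using 1 2 quotient_of_div by auto
  have n: "(of_nat (nat (b * d)) :: rat) = of_int b * of_int d"
    using b by (metis of_int_mult of_int_of_nat_eq int_nat_eq order_less_imp_le mult_pos_pos)
  show thesis
    by (rule that[of "nat (b * d)" "a * d" "c * b"]) (use b q n in \<open>auto simp: field_simps\<close>)
qed

text \<open>
  \<open>vle a b\<close> says that the value of \<open>a\<close> is at most that of \<open>b\<close>. Working with this relation instead of
  the value group makes the possible lack of commutativity of the group harmless.
\<close>

locale dominance =
  fixes K :: "weyl_ext set" and vle :: "weyl_ext \<Rightarrow> weyl_ext \<Rightarrow> bool"
  assumes K_diff: "a \<in> K \<Longrightarrow> b \<in> K \<Longrightarrow> a - b \<in> K"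
    and K_mult: "a \<in> K \<Longrightarrow> b \<in> K \<Longrightarrow> a * b \<in> K"
    and K_inverse: "a \<in> K \<Longrightarrow> inverse a \<in> K"
    and K_real: "real_const r \<in> K"
    and K_x: "weyl_x \<in> K"
    and vle_trans: "a \<in> K \<Longrightarrow> b \<in> K \<Longrightarrow> c \<in> K \<Longrightarrow> vle a b \<Longrightarrow> vle b c \<Longrightarrow> vle a c"
    and vle_total: "a \<in> K \<Longrightarrow> b \<in> K \<Longrightarrow> vle a b \<or> vle b a"
    and vle_0: "a \<in> K \<Longrightarrow> vle a 0"
    and vle_0D: "a \<in> K \<Longrightarrow> vle 0 a \<Longrightarrow> a = 0"
    and vle_mult_left: "a \<in> K \<Longrightarrow> b \<in> K \<Longrightarrow> c \<in> K \<Longrightarrow> vle a b \<Longrightarrow> vle (c * a) (c * b)"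
    and vle_mult_right: "a \<in> K \<Longrightarrow> b \<in> K \<Longrightarrow> c \<in> K \<Longrightarrow> vle a b \<Longrightarrow> vle (a * c) (b * c)"
    and vle_add: "a \<in> K \<Longrightarrow> b \<in> K \<Longrightarrow> c \<in> K \<Longrightarrow> vle c a \<Longrightarrow> vle c b \<Longrightarrow> vle c (a + b)"
    and vle_real: "r \<noteq> 0 \<Longrightarrow> vle 1 (real_const r)"
    and vle_residue: "a \<in> K \<Longrightarrow> vle 1 a \<Longrightarrow> \<exists>r. \<not> vle (a - real_const r) 1"
    and vle_x: "\<not> vle 1 weyl_x"
begin

lemma K_0 [simp]: "0 \<in> K" and K_1 [simp]: "1 \<in> K"
  using K_real[of 0] K_real[of 1] by auto

lemma K_uminus: "a \<in> K \<Longrightarrow> - a \<in> K"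
  using K_diff[of 0 a] by simp

lemma K_add: "a \<in> K \<Longrightarrow> b \<in> K \<Longrightarrow> a + b \<in> K"
  using K_diff[of a "- b"] K_uminus[of b] by simp

lemma K_power: "a \<in> K \<Longrightarrow> a ^ n \<in> K"
  by (induction n) (auto intro: K_mult)

lemma K_powi: "a \<in> K \<Longrightarrow> a powi k \<in> K"
  by (auto simp: power_int_def intro: K_power K_inverse)

lemma K_x_pow: "x_pow (of_int k) \<in> K"
  using K_powi[OF K_x, of k] by (simp add: weyl_x_powi)

lemmas K_intros = K_diff K_mult K_inverse K_real K_x K_uminus K_add K_power K_powi K_x_pow

abbreviation vlt where "vlt a b \<equiv> \<not> vle b a"
abbreviation veqv where "veqv a b \<equiv> vle a b \<and> vle b a"

lemma vle_refl: "a \<in> K \<Longrightarrow> vle a a"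
  using vle_total by blast

lemma vlt_imp_vle: "a \<in> K \<Longrightarrow> b \<in> K \<Longrightarrow> vlt a b \<Longrightarrow> vle a b"
  using vle_total by blast

lemma vle_mult: "a \<in> K \<Longrightarrow> b \<in> K \<Longrightarrow> c \<in> K \<Longrightarrow> d \<in> K \<Longrightarrow> vle a b \<Longrightarrow> vle c d \<Longrightarrow> vle (a * c) (b * d)"
  by (rule vle_trans[OF _ _ _ vle_mult_right vle_mult_left]) (auto intro: K_intros)

lemma vle_cancel_left: "a \<in> K \<Longrightarrow> b \<in> K \<Longrightarrow> c \<in> K \<Longrightarrow> c \<noteq> 0 \<Longrightarrow> vle (c * a) (c * b) \<longleftrightarrow> vle a b"
  using vle_mult_left[of "c * a" "c * b" "inverse c"] vle_mult_left[of a b c]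
  by (auto simp: mult.assoc[symmetric] K_mult K_inverse)

lemma vle_cancel_right: "a \<in> K \<Longrightarrow> b \<in> K \<Longrightarrow> c \<in> K \<Longrightarrow> c \<noteq> 0 \<Longrightarrow> vle (a * c) (b * c) \<longleftrightarrow> vle a b"
  using vle_mult_right[of "a * c" "b * c" "inverse c"] vle_mult_right[of a b c]
  by (auto simp: mult.assoc K_mult K_inverse)

lemma vlt_nz: "a \<in> K \<Longrightarrow> b \<in> K \<Longrightarrow> vlt a b \<Longrightarrow> a \<noteq> 0"
  using vle_0 by auto

lemma vlt_vle_trans: "a \<in> K \<Longrightarrow> b \<in> K \<Longrightarrow> c \<in> K \<Longrightarrow> vlt a b \<Longrightarrow> vle b c \<Longrightarrow> vlt a c"
  and vle_vlt_trans: "a \<in> K \<Longrightarrow> b \<in> K \<Longrightarrow> c \<in> K \<Longrightarrow> vle a b \<Longrightarrow> vlt b c \<Longrightarrow> vlt a c"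
  using vle_trans[of b c a] vle_trans[of c a b] by blast+

lemma vlt_mult_le: "a \<in> K \<Longrightarrow> b \<in> K \<Longrightarrow> c \<in> K \<Longrightarrow> d \<in> K \<Longrightarrow> vlt a b \<Longrightarrow> vle c d \<Longrightarrow> c \<noteq> 0 \<Longrightarrow> vlt (a * c) (b * d)"
  using vlt_vle_trans[of "a * c" "b * c" "b * d"] vle_cancel_right[of b a c] vle_mult_left[of c d b] K_mult
  by blast

lemma vle_mult_lt: "a \<in> K \<Longrightarrow> b \<in> K \<Longrightarrow> c \<in> K \<Longrightarrow> d \<in> K \<Longrightarrow> vle a b \<Longrightarrow> vlt c d \<Longrightarrow> a \<noteq> 0 \<Longrightarrow> vlt (a * c) (b * d)"
  using vlt_vle_trans[of "a * c" "a * d" "b * d"] vle_cancel_left[of d c a] vle_mult_right[of a b d] K_mult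
  by blast

lemma vle_power: "a \<in> K \<Longrightarrow> b \<in> K \<Longrightarrow> vle a b \<Longrightarrow> vle (a ^ n) (b ^ n)"
  by (induction n) (auto intro!: vle_mult K_power vle_refl)

lemma vlt_power: "a \<in> K \<Longrightarrow> b \<in> K \<Longrightarrow> vlt a b \<Longrightarrow> n > 0 \<Longrightarrow> vlt (a ^ n) (b ^ n)"
proof (induction n)
  case 0
  thus ?case by blast
next
  case (Suc n)
  hence 1: "vle (a ^ n) (b ^ n)" by (intro vle_power vlt_imp_vle)
  have 2: "a ^ n \<noteq> 0" using Suc vlt_nz by simp
  have "vlt (a * a ^ n) (b * b ^ n)"
    by (rule vlt_mult_le[OF Suc.prems(1,2) _ _ Suc.prems(3) 1 2]) (use Suc.prems K_power in blast)+
  thus ?case by (simp only: power_Suc simp_thms)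
qed

lemma vle_power_iff: "a \<in> K \<Longrightarrow> b \<in> K \<Longrightarrow> n > 0 \<Longrightarrow> vle (a ^ n) (b ^ n) \<longleftrightarrow> vle a b"
  using vle_power[of a b n] vlt_power[of b a n] by blast

lemma vle_m1: "vle 1 (- 1)"
  using vle_real[of "- 1"] by (simp add: real_const_uminus)

lemma vle_uminus: "a \<in> K \<Longrightarrow> b \<in> K \<Longrightarrow> vle a (- b) \<longleftrightarrow> vle a b"
proof -
  have *: "vle a (- b)" if "a \<in> K" "b \<in> K" "vle a b" for b
    using vle_mult[of 1 "- 1" a b] vle_m1 that K_uminus[of 1] by simp
  assume "a \<in> K" "b \<in> K"
  thus ?thesis using *[of b] *[of "- b"] by (auto intro: K_intros)
qed

lemma vle_uminus_left: "a \<in> K \<Longrightarrow> b \<in> K \<Longrightarrow> vle (- a) b \<longleftrightarrow> vle a b"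
proof -
  have *: "veqv a (- a)" if "a \<in> K" for a
    using vle_uminus[of a a] vle_uminus[of "- a" a] vle_refl[of a] vle_refl[of "- a"] that K_uminus by auto
  assume "a \<in> K" "b \<in> K"
  thus ?thesis using *[of a] vle_trans[of "- a" a b] vle_trans[of a "- a" b] K_uminus[of a] by blast
qed

lemma vle_diff: "a \<in> K \<Longrightarrow> b \<in> K \<Longrightarrow> c \<in> K \<Longrightarrow> vle c a \<Longrightarrow> vle c b \<Longrightarrow> vle c (a - b)"
  using vle_add[of a "- b" c] vle_uminus[of c b] by (auto intro: K_intros)

lemma vlt_add: "a \<in> K \<Longrightarrow> b \<in> K \<Longrightarrow> c \<in> K \<Longrightarrow> vlt c a \<Longrightarrow> vlt c b \<Longrightarrow> vlt c (a + b)"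
proof -
  assume K: "a \<in> K" "b \<in> K" "c \<in> K" and c: "vlt c a" "vlt c b"
  have "vle a (a + b) \<or> vle b (a + b)"
    using K vle_total[of a b] vle_add[of a b a] vle_add[of a b b] vle_refl by blast
  thus ?thesis using c K vlt_vle_trans[of c a "a + b"] vlt_vle_trans[of c b "a + b"] K_add by blast
qed

lemma vlt_diff: "a \<in> K \<Longrightarrow> b \<in> K \<Longrightarrow> c \<in> K \<Longrightarrow> vlt c a \<Longrightarrow> vlt c b \<Longrightarrow> vlt c (a - b)"
  using vlt_add[of a "- b" c] vle_uminus_left[of b c] K_uminus[of b] by simp

lemma veqv_real: "r \<noteq> 0 \<Longrightarrow> veqv 1 (real_const r)"
proof -
  assume r: "r \<noteq> 0"
  have "vle (1 * real_const r) (real_const (1 / r) * real_const r)"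
    using r vle_real[of "1 / r"] by (intro vle_mult_right) (auto intro: K_intros)
  thus ?thesis using r vle_real by (simp add: real_const_mult[symmetric])
qed

lemma veqv_real_mult: "a \<in> K \<Longrightarrow> r \<noteq> 0 \<Longrightarrow> veqv (real_const r * a) a"
  using veqv_real[of r] vle_mult_right[of 1 "real_const r" a] vle_mult_right[of "real_const r" 1 a]
  by (auto simp: K_real)

lemma vle_real_mult: "a \<in> K \<Longrightarrow> b \<in> K \<Longrightarrow> vle a b \<Longrightarrow> vle a (real_const r * b)"
  using veqv_real_mult[of b r] vle_trans[of a b "real_const r * b"] vle_0
  by (cases "r = 0") (auto intro: K_intros)

lemma vlt_real_mult: "a \<in> K \<Longrightarrow> b \<in> K \<Longrightarrow> vlt a b \<Longrightarrow> vlt a (real_const r * b)"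
  using veqv_real_mult[of b r] vlt_vle_trans[of a b "real_const r * b"] vlt_nz[of a b] vle_0D[of a]
    K_mult[OF K_real, of b r]
  by (cases "r = 0") auto

lemma vlt_imp_veqv_diff: "a \<in> K \<Longrightarrow> b \<in> K \<Longrightarrow> vlt a b \<Longrightarrow> veqv a (a - b)"
proof -
  assume a: "a \<in> K" "b \<in> K" "vlt a b"
  have "vle a (a - b)" using a by (intro vle_diff vle_refl vlt_imp_vle)
  moreover have "vle (a - b) a"
  proof (rule ccontr)
    assume "vlt a (a - b)"
    hence "vlt a (a - b + b)" using a by (intro vlt_add) (auto intro: K_intros)
    thus False using a vle_refl by simp
  qed
  ultimately show ?thesis by simp
qed

text \<open>Equality of leading terms: the quotient has residue 1. Zero is similar to nothing.
  Unlike residues, this compares elements of any value.\<close>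

definition sim :: "weyl_ext \<Rightarrow> weyl_ext \<Rightarrow> bool" where
  "sim a b \<longleftrightarrow> a \<in> K \<and> b \<in> K \<and> vlt b (a - b)"

lemma sim_K: "sim a b \<Longrightarrow> a \<in> K" "sim a b \<Longrightarrow> b \<in> K"
  by (auto simp: sim_def)

lemma sim_veqv: "sim a b \<Longrightarrow> veqv a b"
proof -
  assume s: "sim a b"
  hence "veqv b (b - (b - a))" unfolding sim_def
    using vle_uminus_left[of "b - a" b] by (intro vlt_imp_veqv_diff) (auto intro: K_intros)
  thus ?thesis by simp
qed

lemma sim_nz: "sim a b \<Longrightarrow> a \<noteq> 0" "sim a b \<Longrightarrow> b \<noteq> 0"
proof -
  assume s: "sim a b"
  thus b: "b \<noteq> 0" using vlt_nz K_diff unfolding sim_def by blast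
  thus "a \<noteq> 0" using sim_veqv[OF s] vle_0D sim_K[OF s] by blast
qed

lemma sim_refl: "a \<in> K \<Longrightarrow> a \<noteq> 0 \<Longrightarrow> sim a a"
  using vle_0D by (auto simp: sim_def)

lemma sim_sym: "sim a b \<Longrightarrow> sim b a"
proof -
  assume s: "sim a b"
  note K = sim_K[OF s]
  have "vlt a (a - b)" using s sim_veqv[OF s] K K_diff vle_vlt_trans[of a b "a - b"] unfolding sim_def by blast
  hence "vlt a (- (a - b))" using vle_uminus_left[of "a - b" a] K K_diff by simp
  thus ?thesis using K by (simp add: sim_def)
qed

lemma sim_trans: "sim a b \<Longrightarrow> sim b c \<Longrightarrow> sim a c"
proof -
  assume ab: "sim a b" and bc: "sim b c"
  note K = sim_K[OF ab] sim_K[OF bc]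
  have "vlt c (a - b)" using ab K sim_veqv[OF bc] K_diff[of a b] vle_vlt_trans[of c b "a - b"]
    unfolding sim_def by blast
  hence "vlt c ((a - b) + (b - c))" using bc K K_diff unfolding sim_def by (intro vlt_add) auto
  thus ?thesis using ab bc by (simp add: sim_def)
qed

lemma sim_mult: "sim a b \<Longrightarrow> sim c d \<Longrightarrow> sim (a * c) (b * d)"
proof -
  assume ab: "sim a b" and cd: "sim c d"
  note K = sim_K[OF ab] sim_K[OF cd]
  have "vlt (b * d) ((a - b) * c)"
    using ab sim_veqv[OF cd] sim_nz[OF cd] K unfolding sim_def by (intro vlt_mult_le) (auto intro: K_intros)
  moreover have "vlt (b * d) (b * (c - d))"
    using cd sim_nz[OF ab] K vle_refl unfolding sim_def by (intro vle_mult_lt) (auto intro: K_intros)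
  ultimately have "vlt (b * d) ((a - b) * c + b * (c - d))"
    using K by (intro vlt_add) (auto intro: K_intros)
  moreover have "(a - b) * c + b * (c - d) = a * c - b * d" by (simp add: algebra_simps)
  ultimately have "vlt (b * d) (a * c - b * d)" by metis
  thus ?thesis using K K_mult by (simp add: sim_def)
qed

lemma sim_inverse: "sim a b \<Longrightarrow> sim (inverse a) (inverse b)"
proof -
  assume ab: "sim a b"
  note K = sim_K[OF ab] and nz = sim_nz[OF ab]
  have "sim (inverse b * (b * inverse a)) (inverse b * (a * inverse a))"
    using K nz K_inverse by (intro sim_mult[OF sim_refl sim_mult[OF sim_sym[OF ab] sim_refl]]) auto
  moreover have "inverse b * (b * inverse a) = inverse a" using nz by (simp add: mult.assoc[symmetric])
  ultimately show ?thesis using nz by simp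
qed

lemma sim_power: "sim a b \<Longrightarrow> sim (a ^ n) (b ^ n)"
  by (induction n) (auto intro: sim_mult sim_refl)

lemma sim_powi: "sim a b \<Longrightarrow> sim (a powi k) (b powi k)"
  by (auto simp: power_int_def intro: sim_power sim_inverse)

lemma sim_real_iff: "sim (real_const r) (real_const s) \<longleftrightarrow> r = s \<and> s \<noteq> 0"
proof
  assume s: "sim (real_const r) (real_const s)"
  hence "s \<noteq> 0" using sim_nz by fastforce
  moreover have "r = s"
  proof (rule ccontr)
    assume "r \<noteq> s"
    hence "veqv 1 (real_const (r - s))" by (intro veqv_real) simp
    moreover have "vlt (real_const s) (real_const (r - s))"
      using s by (simp add: sim_def real_const_diff)
    ultimately show False
      using veqv_real[OF \<open>s \<noteq> 0\<close>] vle_trans[of "real_const (r - s)" 1 "real_const s"] K_real K_1 by blast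
  qed
  ultimately show "r = s \<and> s \<noteq> 0" by simp
qed (auto intro: sim_refl K_real)

text \<open>The factor is the residue of a b^(-1): this is how the real residue field is
  used.\<close>

lemma sim_real_ex:
  assumes "a \<in> K" "b \<in> K" "veqv a b" "b \<noteq> 0"
  obtains r where "r \<noteq> 0" "sim a (real_const r * b)"
proof -
  let ?c = "a * inverse b"
  have c: "vle 1 ?c" "vle ?c 1"
    using vle_mult_right[of b a "inverse b"] vle_mult_right[of a b "inverse b"] assms K_inverse by simp_all
  have cK: "?c \<in> K" by (intro K_mult K_inverse assms)
  then obtain r where r: "vlt 1 (?c - real_const r)" using c vle_residue by blast
  have r0: "r \<noteq> 0"
    using r c by (cases "r = 0") simp_all
  have "vlt (real_const r) (?c - real_const r)"
    using r veqv_real[OF r0] vle_vlt_trans[of "real_const r" 1 "?c - real_const r"]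
      K_diff[OF cK K_real] by (simp add: K_real)
  hence "sim ?c (real_const r)" using cK by (simp add: sim_def K_real)
  hence "sim (?c * b) (real_const r * b)" using assms by (intro sim_mult sim_refl)
  thus thesis using that r0 assms by (simp add: mult.assoc)
qed

section \<open>Comparison with rational values\<close>

text \<open>
  The value of \<open>f\<close> is at least \<open>q\<close>, where \<open>- 1\<close> is the value of \<open>x\<close>. Taking powers avoids the divisible
  hull of the value group.
\<close>

definition vge :: "weyl_ext \<Rightarrow> rat \<Rightarrow> bool" where
  "vge f q \<longleftrightarrow> f \<in> K \<and> (\<exists>m n. n > 0 \<and> q = of_int m / of_nat n \<and> vle (x_pow (- of_int m)) (f ^ n))"

lemma vge_K: "vge f q \<Longrightarrow> f \<in> K"
  by (simp add: vge_def)

lemma K_x_pow_minus: "x_pow (- of_int k) \<in> K"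
  using K_x_pow[of "- k"] by simp

text \<open>Two fractions for q are compared after raising to the product of the denominators. Only
  powers of f and powers of x occur, each family commuting with itself, and roots can be extracted
  from an inequality by totality (\<open>vle_power_iff\<close>).\<close>

lemma vge_iff:
  assumes "n > 0" "f \<in> K" "q = of_int m / of_nat n"
  shows "vge f q \<longleftrightarrow> vle (x_pow (- of_int m)) (f ^ n)"
proof
  assume "vge f q"
  then obtain m' n' where n': "n' > 0" "q = of_int m' / of_nat n'" "vle (x_pow (- of_int m')) (f ^ n')"
    unfolding vge_def by blast
  have "(of_int (m * int n') :: rat) = of_int (m' * int n)" using assms n' by (simp add: field_simps)
  hence eq: "m * int n' = m' * int n" by (simp only: of_int_eq_iff)
  have "vle (x_pow (- of_int m') ^ n) ((f ^ n') ^ n)"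
    using n' assms by (intro vle_power K_x_pow_minus K_power)
  moreover have "x_pow (- of_int m') ^ n = x_pow (- of_int m) ^ n'"
  proof -
    have "of_nat n * (- of_int m') = - (of_int (m' * int n) :: rat)" by simp
    also have "\<dots> = of_nat n' * (- of_int m)" unfolding eq[symmetric] by simp
    finally show ?thesis by (simp add: x_pow_power)
  qed
  moreover have "(f ^ n') ^ n = (f ^ n) ^ n'" by (simp add: power_mult[symmetric] mult.commute)
  ultimately show "vle (x_pow (- of_int m)) (f ^ n)"
    using n' assms vle_power_iff by (auto intro: K_x_pow_minus K_power)
qed (use assms in \<open>auto simp: vge_def\<close>)

lemma vle_x_pow_iff: "vle (x_pow (- of_int k)) (x_pow (- of_int l)) \<longleftrightarrow> k \<le> l"
proof -
  have x: "vlt weyl_x 1" using vle_x .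
  have lt: "vlt (x_pow (- of_int k)) (x_pow (- of_int l))" if "k < l" for k l
  proof -
    have "vlt (weyl_x ^ nat (l - k)) (1 ^ nat (l - k))"
      using x that by (intro vlt_power) (auto intro: K_intros)
    hence "vlt (x_pow (of_int (l - k))) 1" using that by (simp add: weyl_x_def x_pow_power)
    hence "vlt (x_pow (of_int (l - k)) * x_pow (- of_int l)) (1 * x_pow (- of_int l))"
      by (subst vle_cancel_right) (auto intro: K_intros K_x_pow_minus K_x_pow simp del: of_int_diff)
    thus ?thesis by (simp add: x_pow_mult)
  qed
  show ?thesis
  proof (cases k l rule: linorder_cases)
    case less
    thus ?thesis using lt[of k l] vle_total[of "x_pow (- of_int k)" "x_pow (- of_int l)"] K_x_pow_minus by auto
  next
    case equal
    thus ?thesis using vle_refl K_x_pow_minus by simp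
  next
    case greater
    thus ?thesis using lt[of l k] by simp
  qed
qed

lemma vge_vle: "vge f q \<Longrightarrow> h \<in> K \<Longrightarrow> vle f h \<Longrightarrow> vge h q"
proof -
  assume f: "vge f q" and h: "h \<in> K" "vle f h"
  then obtain m n where n: "n > 0" "q = of_int m / of_nat n" "vle (x_pow (- of_int m)) (f ^ n)"
    unfolding vge_def by blast
  have "vle (x_pow (- of_int m)) (h ^ n)"
    by (rule vle_trans[OF K_x_pow_minus _ _ n(3)]) (use vge_K[OF f] h in \<open>auto intro: K_power vle_power\<close>)
  thus ?thesis using h(1) n unfolding vge_def by blast
qed

lemma vge_add: "vge f q \<Longrightarrow> vge h q \<Longrightarrow> vge (f + h) q"
proof -
  assume f: "vge f q" and h: "vge h q"
  note K = vge_K[OF f] vge_K[OF h]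
  show ?thesis
  proof (cases "vle f h")
    case True
    hence "vle f (f + h)" using K by (intro vle_add vle_refl)
    thus ?thesis using f K by (intro vge_vle[OF f]) (auto intro: K_add)
  next
    case False
    hence "vle h (f + h)" using K by (intro vle_add vle_refl) (auto intro: vlt_imp_vle)
    thus ?thesis using h K by (intro vge_vle[OF h]) (auto intro: K_add)
  qed
qed

lemma vge_0 [simp]: "vge 0 q"
proof -
  obtain n k l where "n > 0" "q = of_int k / of_nat n" "q = of_int l / of_nat n" by (rule common_denominator)
  thus ?thesis using vge_iff[of n 0 q k] vle_0 K_x_pow_minus by (simp add: zero_power)
qed

lemma vge_sum: "(\<And>x. x \<in> A \<Longrightarrow> vge (F x) q) \<Longrightarrow> vge (sum F A) q"
  by (induction A rule: infinite_finite_induct) (auto intro: vge_add)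

lemma vge_mono: "vge f q \<Longrightarrow> s \<le> q \<Longrightarrow> vge f s"
proof -
  assume f: "vge f q" "s \<le> q"
  obtain n k l where n: "n > 0" "q = of_int k / of_nat n" "s = of_int l / of_nat n" by (rule common_denominator)
  have "l \<le> k" using f n by (simp add: divide_le_cancel)
  hence "vle (x_pow (- of_int l)) (x_pow (- of_int k))" by (simp add: vle_x_pow_iff)
  moreover have "vle (x_pow (- of_int k)) (f ^ n)" using f(1) vge_iff[OF n(1) vge_K[OF f(1)] n(2)] by blast
  ultimately have "vle (x_pow (- of_int l)) (f ^ n)"
    by (rule vle_trans[rotated 3]) (auto intro: K_x_pow_minus K_power vge_K[OF f(1)])
  thus ?thesis using vge_iff[OF n(1) vge_K[OF f(1)] n(3)] by blast
qed

text \<open>In a totally ordered group this replaces the power law of commutative groups.\<close>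

lemma power_mult_le:
  assumes K: "a \<in> K" "b \<in> K" and ab: "vle (a * b) (b * a)"
  shows "vle (a ^ n * b ^ n) ((a * b) ^ n)" "vle (a ^ n * b ^ n) ((b * a) ^ n)"
proof -
  have 1: "vle (a * b ^ n) (b ^ n * a)" for n
  proof (induction n)
    case (Suc n)
    have "vle (a * b * b ^ n) (b * a * b ^ n)" "vle (b * (a * b ^ n)) (b * (b ^ n * a))"
      using K ab Suc by (auto intro!: vle_mult_left vle_mult_right K_intros)
    thus ?case using vle_trans[of "a * b * b ^ n" "b * a * b ^ n" "b * (b ^ n * a)"] K
      by (simp add: mult.assoc K_intros)
  qed (use K vle_refl in simp)
  show 2: "vle (a ^ n * b ^ n) ((a * b) ^ n)"
  proof (induction n)
    case (Suc n)
    have "vle (a ^ n * (a * b ^ n) * b) (a ^ n * (b ^ n * a) * b)" "vle (a ^ n * b ^ n * (a * b)) ((a * b) ^ n * (a * b))"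
      using K 1 Suc by (auto intro!: vle_mult_left vle_mult_right K_intros)
    hence "vle (a ^ n * (a * b ^ n) * b) ((a * b) ^ n * (a * b))"
      using vle_trans[of "a ^ n * (a * b ^ n) * b" "a ^ n * b ^ n * (a * b)" "(a * b) ^ n * (a * b)"] K
      by (simp add: mult.assoc K_intros)
    thus ?case by (simp add: power_Suc2 mult.assoc del: power_Suc)
  qed (simp add: vle_refl)
  have "vle ((a * b) ^ n) ((b * a) ^ n)" using K ab by (intro vle_power) (auto intro: K_intros)
  thus "vle (a ^ n * b ^ n) ((b * a) ^ n)"
    using 2 vle_trans[of "a ^ n * b ^ n" "(a * b) ^ n" "(b * a) ^ n"] K by (auto intro: K_intros)
qed

text \<open>The n-th power of f h need not have the value of f^n h^n. By totality one of f h and h f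
  is the smaller, and \<open>power_mult_le\<close> then bounds (f h)^n below by f^n h^n or by h^n
  f^n; both dominate the same power of x.\<close>

lemma vge_mult: "vge f q \<Longrightarrow> vge h s \<Longrightarrow> vge (f * h) (q + s)"
proof -
  assume f: "vge f q" and h: "vge h s"
  note K = vge_K[OF f] vge_K[OF h]
  obtain n k l where n: "n > 0" "q = of_int k / of_nat n" "s = of_int l / of_nat n" by (rule common_denominator)
  have 1: "vle (x_pow (- of_int k)) (f ^ n)" "vle (x_pow (- of_int l)) (h ^ n)"
    using f h n vge_iff K by blast+
  have "vle (x_pow (- of_int k) * x_pow (- of_int l)) (f ^ n * h ^ n)"
    "vle (x_pow (- of_int l) * x_pow (- of_int k)) (h ^ n * f ^ n)"
    using 1 K by (auto intro!: vle_mult K_x_pow_minus K_power)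
  hence 2: "vle (x_pow (- of_int (k + l))) (f ^ n * h ^ n)" "vle (x_pow (- of_int (k + l))) (h ^ n * f ^ n)"
    by (simp_all add: x_pow_mult add.commute)
  have "vle (x_pow (- of_int (k + l))) ((f * h) ^ n)"
  proof (cases "vle (f * h) (h * f)")
    case True
    from vle_trans[OF K_x_pow_minus _ _ 2(1) power_mult_le(1)[OF K True]] K show ?thesis by (auto intro: K_intros)
  next
    case False
    hence "vle (h * f) (f * h)" using K by (auto intro: vlt_imp_vle K_intros)
    from vle_trans[OF K_x_pow_minus _ _ 2(2) power_mult_le(2)[OF K(2,1) this]] K show ?thesis by (auto intro: K_intros)
  qed
  moreover have "q + s = of_int (k + l) / of_nat n" using n by (simp add: add_divide_distrib)
  ultimately show ?thesis using vge_iff[of n "f * h" "q + s" "k + l"] n K by (simp add: K_intros)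
qed

lemma vge_1: "vge 1 0"
  using vge_iff[of 1 1 0 0] vle_refl[of 1] by simp

lemma vge_power: "vge f q \<Longrightarrow> vge (f ^ n) (of_nat n * q)"
proof (induction n)
  case (Suc n)
  show ?case using vge_mult[OF Suc.prems Suc.IH[OF Suc.prems]] by (simp add: algebra_simps)
qed (simp add: vge_1)

lemma vge_0_iff: "f \<in> K \<Longrightarrow> vge f 0 \<longleftrightarrow> vle 1 f"
  using vge_iff[of 1 f 0 0] by simp

lemma vge_real: "vge (real_const r) 0"
  using vge_0_iff[OF K_real, of r] vle_real[of r] by (cases "r = 0") auto

lemma vge_real_mult: "vge f q \<Longrightarrow> vge (real_const r * f) q"
  using vge_mult[OF vge_real, of f q r] by simp

lemma vge_uminus: "vge f q \<Longrightarrow> vge (- f) q"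
  using vge_real_mult[of f q "- 1"] by (simp add: real_const_uminus)

lemma vge_diff: "vge f q \<Longrightarrow> vge h q \<Longrightarrow> vge (f - h) q"
  using vge_add[of f q "- h"] vge_uminus by simp

lemma vge_x_pow: "vge (x_pow (of_int k)) (- of_int k)"
  using vge_iff[of 1 "x_pow (of_int k)" "- of_int k" "- k"] vle_refl[OF K_x_pow] by (simp add: K_x_pow)

lemma vge_pos: "vge f q \<Longrightarrow> q > 0 \<Longrightarrow> vlt 1 f"
proof -
  assume f: "vge f q" "q > 0"
  obtain n k where n: "n > 0" "q = of_int k / of_nat n" by (rule common_denominator[of q q])
  have k: "vle (x_pow (- of_int k)) (f ^ n)" "k > 0"
    using f vge_iff[OF n(1) vge_K[OF f(1)] n(2)] n by (auto simp: zero_less_divide_iff)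
  hence "vlt 1 (x_pow (- of_int k))" using vle_x_pow_iff[of k 0] by simp
  hence "vlt (1 ^ n) (f ^ n)"
    using k vge_K[OF f(1)] vlt_vle_trans[of 1 "x_pow (- of_int k)" "f ^ n"] K_x_pow_minus K_power by simp
  thus ?thesis using n vle_power[of f 1 n] vge_K[OF f(1)] by auto
qed

definition veq :: "weyl_ext \<Rightarrow> rat \<Rightarrow> bool" where
  "veq f q \<longleftrightarrow> f \<noteq> 0 \<and> vge f q \<and> vge (inverse f) (- q)"

lemma veq_K: "veq f q \<Longrightarrow> f \<in> K"
  by (auto simp: veq_def dest: vge_K)

lemma veq_imp_vge: "veq f q \<Longrightarrow> vge f q"
  by (simp add: veq_def)

lemma veq_inverse: "veq f q \<Longrightarrow> veq (inverse f) (- q)"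
  by (simp add: veq_def)

lemma veq_mult:
  assumes "veq f q" "veq h s"
  shows "veq (f * h) (q + s)"
proof -
  have nz: "f \<noteq> 0" "h \<noteq> 0" and i: "vge (inverse f) (- q)" "vge (inverse h) (- s)"
    and d: "vge f q" "vge h s" using assms by (simp_all add: veq_def)
  have "vge (inverse h * inverse f) (- s + - q)" using i by (intro vge_mult)
  hence "vge (inverse (f * h)) (- (q + s))"
    unfolding nonzero_inverse_mult_distrib[OF nz] by (simp add: add.commute)
  thus ?thesis using nz vge_mult[OF d] by (simp add: veq_def)
qed

lemma veq_1: "veq 1 0"
  by (simp add: veq_def vge_1)

lemma veq_power: "veq f q \<Longrightarrow> veq (f ^ n) (of_nat n * q)"
proof (induction n)
  case (Suc n)
  show ?case using veq_mult[OF Suc.prems Suc.IH[OF Suc.prems]] by (simp add: algebra_simps)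
qed (simp add: veq_1)

lemma veq_powi: "veq f q \<Longrightarrow> veq (f powi k) (of_int k * q)"
proof -
  assume f: "veq f q"
  show ?thesis
  proof (cases "k \<ge> 0")
    case True
    thus ?thesis using veq_power[OF f, of "nat k"] by (simp add: power_int_def)
  next
    case False
    thus ?thesis using veq_power[OF veq_inverse[OF f], of "nat (- k)"] by (simp add: power_int_def)
  qed
qed

lemma veq_real: "r \<noteq> 0 \<Longrightarrow> veq (real_const r) 0"
  using vge_real[of r] vge_real[of "1 / r"] by (simp add: veq_def real_const_inverse)

lemma veq_real_mult: "veq f q \<Longrightarrow> r \<noteq> 0 \<Longrightarrow> veq (real_const r * f) q"
  using veq_mult[OF veq_real, of r f q] by simp

lemma veq_x_pow: "veq (x_pow (of_int k)) (- of_int k)"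
  using vge_x_pow[of k] vge_x_pow[of "- k"] by (simp add: veq_def x_pow_inverse)

lemma veq_vge_vlt: "veq f q \<Longrightarrow> vge h s \<Longrightarrow> q < s \<Longrightarrow> vlt f h"
proof -
  assume f: "veq f q" and h: "vge h s" and "q < s"
  hence "vlt 1 (h * inverse f)"
    using vge_pos[OF vge_mult[of h s "inverse f" "- q"]] by (simp add: veq_def)
  moreover have "f \<noteq> 0" using f by (simp add: veq_def)
  ultimately have "vlt (1 * f) (h * inverse f * f)"
    using veq_K[OF f] vge_K[OF h] by (subst vle_cancel_right) (auto intro: K_intros)
  thus ?thesis using \<open>f \<noteq> 0\<close> by (simp add: mult.assoc)
qed

lemma veq_vge_vle: "veq f q \<Longrightarrow> vge h q \<Longrightarrow> vle f h"
proof -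
  assume f: "veq f q" and h: "vge h q"
  have f0: "f \<noteq> 0" and K: "f \<in> K" "h \<in> K" using f h veq_K vge_K by (auto simp: veq_def)
  have "vge (h * inverse f) 0" using vge_mult[OF h, of "inverse f" "- q"] f by (simp add: veq_def)
  hence "vle 1 (h * inverse f)" using vge_0_iff[of "h * inverse f"] K K_mult K_inverse by blast
  hence "vle (1 * f) (h * inverse f * f)" using K by (intro vle_mult_right K_mult K_inverse K_1)
  thus ?thesis using f0 by (simp add: mult.assoc)
qed

lemma veq_veqv: "veq f q \<Longrightarrow> h \<in> K \<Longrightarrow> veqv f h \<Longrightarrow> veq h q"
proof -
  assume f: "veq f q" and h: "h \<in> K" "veqv f h"
  have f0: "f \<noteq> 0" using f by (simp add: veq_def)
  hence h0: "h \<noteq> 0" using h vle_0D veq_K[OF f] by blast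
  note K = veq_K[OF f] h(1)
  have "vle (inverse h * (h * inverse f)) (inverse h * (f * inverse f))" using K h
    by (intro vle_mult_left vle_mult_right) (auto intro: K_intros)
  hence "vle (inverse f) (inverse h)" using h0 f0 by (simp add: mult.assoc[symmetric])
  thus ?thesis using f h h0 K vge_vle[of f q h] vge_vle[of "inverse f" "- q" "inverse h"] K_inverse
    unfolding veq_def by blast
qed

lemma veq_sim: "sim h f \<Longrightarrow> veq f q \<Longrightarrow> veq h q"
  using veq_veqv[of f q h] sim_veqv[of h f] sim_K[of h f] by blast

lemma veq_unique: "veq f q \<Longrightarrow> veq f s \<Longrightarrow> q = s"
  using veq_vge_vlt[of f q f s] veq_vge_vlt[of f s f q] vle_refl[OF veq_K, of f q]
  by (cases q s rule: linorder_cases) (auto simp: veq_def)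

lemma veq_vge_iff: "veq f q \<Longrightarrow> vge f s \<longleftrightarrow> s \<le> q"
  using veq_vge_vlt[of f q f s] vge_mono[OF veq_imp_vge, of f q s] vle_refl[OF veq_K, of f q] by force

lemma veq_imp_veqv: "veq f q \<Longrightarrow> veq h q \<Longrightarrow> veqv f h"
  by (simp add: veq_vge_vle veq_imp_vge)

lemma veq_iff_power:
  assumes f: "f \<in> K" and n: "n > 0" and q: "q = of_int m / of_nat n"
  shows "veq f q \<longleftrightarrow> veqv (f ^ n) (x_pow (- of_int m))"
proof
  have nq: "of_nat n * q = of_int m" using n q by simp
  have x: "veq (x_pow (- of_int m)) (of_int m)" using veq_x_pow[of "- m"] by simp
  show "veqv (f ^ n) (x_pow (- of_int m))" if "veq f q"
    using veq_power[OF that, of n] x unfolding nq by (rule veq_imp_veqv)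
  assume e: "veqv (f ^ n) (x_pow (- of_int m))"
  have fn: "veq (f ^ n) (of_int m)"
    by (rule veq_veqv[OF x]) (use e f K_power in auto)
  hence f0: "f \<noteq> 0" using n by (auto simp: veq_def zero_power)
  have "vge f q" using vge_iff[OF n f q] e by blast
  moreover have "vge (inverse f) (- q)"
  proof -
    have 1: "vge (inverse f ^ n) (of_int (- m))" using fn by (simp add: veq_def power_inverse)
    have "vle (x_pow (- of_int (- m))) ((inverse f ^ n) ^ 1)"
      by (rule vge_iff[THEN iffD1, OF _ _ _ 1]) (use f K_power K_inverse in auto)
    hence "vle (x_pow (- of_int (- m))) (inverse f ^ n)" by (simp only: power_one_right)
    moreover have "- q = of_int (- m) / of_nat n" using q by simp
    ultimately show ?thesis using vge_iff[OF n K_inverse[OF f]] by blast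
  qed
  ultimately show "veq f q" using f0 by (simp add: veq_def)
qed

lemma sim_vgeI: "veq b q \<Longrightarrow> vge (a - b) s \<Longrightarrow> q < s \<Longrightarrow> sim a b"
  unfolding sim_def using veq_vge_vlt[of b q "a - b" s] veq_K[of b q] vge_K[of "a - b" s]
    K_add[of "a - b" b] by simp

section \<open>Commutation with \<open>x\<close>\<close>

text \<open>
  A commutator with \<open>x\<close> has a larger value than the product. Since \<open>dy\<close> lowers the degree in \<open>y\<close>, this
  follows by induction, although the value group need not be commutative.
\<close>

lemma vlt_dy:
  assumes A: "\<And>f. f \<in> A \<Longrightarrow> dy f \<in> A" "\<And>f. f \<in> A \<Longrightarrow> to_quot f \<in> K"
    and f: "f \<in> A" "f \<noteq> 0"
  shows "vlt (to_quot f * weyl_x) (to_quot (dy f))" "veqv (to_quot f * weyl_x) (weyl_x * to_quot f)"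
proof -
  let ?x = weyl_x
  have main: "veqv (to_quot f * ?x) (?x * to_quot f) \<and> (f \<noteq> 0 \<longrightarrow> vlt (to_quot f * ?x) (to_quot (dy f)))"
    if "f \<in> A" "\<forall>i\<ge>n. scoeff f i = 0" for n f
    using that
  proof (induction n arbitrary: f)
    case 0
    hence "f = 0" by (intro scoeff_eqI) simp
    thus ?case by (simp add: vle_refl)
  next
    case (Suc n)
    define F H where "F = to_quot f" and "H = to_quot (dy f)"
    have FK: "F \<in> K" "H \<in> K" using A Suc.prems(1) by (simp_all add: F_def H_def)
    have K [simp]: "F \<in> K" "H \<in> K" "?x \<in> K" "F * ?x \<in> K" "?x * F \<in> K" "H * ?x \<in> K" "?x * H \<in> K"
        "F * ?x * ?x \<in> K" "?x * F * ?x \<in> K" "?x * (?x * F) \<in> K"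
      by (intro FK K_mult K_x)+
    have H: "H = F * ?x - ?x * F" by (simp add: F_def H_def to_quot_dy)
    have IH: "veqv (H * ?x) (?x * H)" "dy f \<noteq> 0 \<Longrightarrow> vlt (H * ?x) (to_quot (dy (dy f)))"
      using Suc.IH[of "dy f"] Suc.prems A(1) by (simp_all add: H_def scoeff_dy del: of_nat_Suc)
    show ?case
    proof (cases "dy f = 0")
      case True
      hence "F * ?x = ?x * F" using H by (simp add: H_def)
      moreover have "vlt (F * ?x) 0" if "f \<noteq> 0"
        using vle_0D[OF K(4)] that by (auto simp: F_def)
      ultimately show ?thesis using True vle_refl[OF K(5)] by (simp add: F_def)
    next
      case False
      have eq: "veqv (F * ?x) (?x * F)"
      proof (rule ccontr)
        assume "\<not> veqv (F * ?x) (?x * F)"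
        then consider "vlt (F * ?x) (?x * F)" | "vlt (?x * F) (F * ?x)" by blast
        thus False
        proof cases
          case 1
          \<comment> \<open>The smaller of the two products has the value of H, and H x and x H have
            the same value by induction. Multiplying by x on both sides transfers this to F, against
            the assumption.\<close>
          hence h: "veqv (F * ?x) H" unfolding H by (intro vlt_imp_veqv_diff) auto
          hence "veqv (F * ?x * ?x) (H * ?x)" "veqv (?x * (F * ?x)) (?x * H)"
            by (auto intro!: vle_mult_right vle_mult_left)
          hence "veqv (F * ?x * ?x) (?x * F * ?x)"
            using IH(1) vle_trans[of "F * ?x * ?x" "H * ?x" "?x * H"] vle_trans[of "F * ?x * ?x" "?x * H" "?x * F * ?x"]
              vle_trans[of "?x * F * ?x" "?x * H" "H * ?x"] vle_trans[of "?x * F * ?x" "H * ?x" "F * ?x * ?x"]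
            by (simp add: mult.assoc[symmetric])
          thus False using 1 vle_cancel_right[of "?x * F" "F * ?x" ?x] by simp
        next
          case 2
          hence "veqv (?x * F) (?x * F - F * ?x)" by (intro vlt_imp_veqv_diff) auto
          moreover have "?x * F - F * ?x = - H" by (simp add: H)
          ultimately have h: "veqv (?x * F) H" using vle_uminus[of "?x * F" H] vle_uminus_left[of H "?x * F"]
            by simp
          hence "veqv (?x * F * ?x) (H * ?x)" "veqv (?x * (?x * F)) (?x * H)"
            by (auto intro!: vle_mult_right vle_mult_left)
          hence "veqv (?x * F * ?x) (?x * (?x * F))"
            using IH(1) vle_trans[of "?x * F * ?x" "H * ?x" "?x * H"] vle_trans[of "?x * F * ?x" "?x * H" "?x * (?x * F)"]
              vle_trans[of "?x * (?x * F)" "?x * H" "H * ?x"] vle_trans[of "?x * (?x * F)" "H * ?x" "?x * F * ?x"]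
            by simp
          hence "veqv (?x * (F * ?x)) (?x * (?x * F))" by (simp add: mult.assoc)
          thus False using 2 vle_cancel_left[of "F * ?x" "?x * F" ?x] by simp
        qed
      qed
      moreover have "vlt (F * ?x) H"
      proof (rule ccontr)
        assume "\<not> vlt (F * ?x) H"
        moreover have "vle (F * ?x) H" unfolding H using eq by (intro vle_diff vle_refl) auto
        ultimately have e: "veqv (F * ?x) H" by simp
        have H0: "H \<noteq> 0" using False by (simp add: H_def)
        \<comment> \<open>Suppose that F x has the value of H. Write F x = s H + d with d of larger
          value; the commutator of this with x is H x = s (H x - x H) + (d x - x d), where every
          summand on the right has a larger value than H x.\<close>
        from sim_real_ex[OF _ _ e H0] obtain s where s: "sim (F * ?x) (real_const s * H)" by auto
        define d where "d = F * ?x - real_const s * H"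
        have sH: "real_const s * H \<in> K" by (intro K_mult K_real K)
        hence d: "d \<in> K" unfolding d_def by (intro K_diff K)
        have "vlt (F * ?x) d"
          using s sim_veqv[OF s] d vle_vlt_trans[of "F * ?x" "real_const s * H" d] sH
          by (simp add: sim_def d_def[symmetric])
        hence "vlt H d" using e d vle_trans[of d H "F * ?x"] by auto
        hence "vlt (H * ?x) (d * ?x)" "vlt (?x * H) (?x * d)"
          using d by (auto simp: vle_cancel_left vle_cancel_right)
        hence 1: "vlt (H * ?x) (d * ?x)" "vlt (H * ?x) (?x * d)"
          using IH(1) d vle_vlt_trans[of "H * ?x" "?x * H" "?x * d"] by (simp_all add: K_mult)
        have ddK: "to_quot (dy (dy f)) \<in> K" using A Suc.prems by blast
        have "vlt (H * ?x) (real_const s * to_quot (dy (dy f)))"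
          using IH(2)[OF False] ddK by (intro vlt_real_mult) auto
        hence "vlt (H * ?x) (real_const s * to_quot (dy (dy f)) + (d * ?x - ?x * d))"
          using d 1 ddK by (intro vlt_add vlt_diff) (simp_all add: K_mult K_diff K_real)
        moreover have "real_const s * to_quot (dy (dy f)) + (d * ?x - ?x * d) = H * ?x"
        proof -
          have dd: "to_quot (dy (dy f)) = H * ?x - ?x * H" unfolding H_def by (rule to_quot_dy)
          have xs: "?x * (real_const s * H) = real_const s * (?x * H)"
            by (simp only: mult.assoc[symmetric] real_const_comm[of s ?x])
          have 1: "d * ?x = F * ?x * ?x - real_const s * (H * ?x)"
            by (simp add: d_def left_diff_distrib mult.assoc)
          have 2: "?x * d = ?x * F * ?x - real_const s * (?x * H)"
            unfolding d_def right_diff_distrib xs by (simp add: mult.assoc)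
          have "H * ?x = F * ?x * ?x - ?x * F * ?x" unfolding H left_diff_distrib ..
          thus ?thesis unfolding 1 2 dd right_diff_distrib by (simp add: algebra_simps)
        qed
        ultimately show False using vle_refl by simp
      qed
      ultimately show ?thesis unfolding F_def H_def by blast
    qed
  qed
  have "\<forall>i\<ge>Suc (degree (poly_of f)). scoeff f i = 0" by (simp add: scoeff_def coeff_eq_0)
  from main[OF f(1) this] f(2) show "vlt (to_quot f * weyl_x) (to_quot (dy f))"
    "veqv (to_quot f * weyl_x) (weyl_x * to_quot f)" by auto
qed

end

section \<open>Gauss valuations below a given valuation\<close>

text \<open>Laurent polynomials in x rather than series: supports are finite and integral.\<close>

definition laurent :: "puiseux set" where
  "laurent = {c. finite {q. pcoeff c q \<noteq> 0} \<and> {q. pcoeff c q \<noteq> 0} \<subseteq> \<int>}"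

lemma dsubring_laurent: "dsubring laurent"
  unfolding dsubring_def
proof (intro conjI ballI)
  have "{q. pcoeff 1 q \<noteq> 0} = {0}" by (auto simp: one_puiseux.rep_eq)
  thus "1 \<in> laurent" by (simp add: laurent_def)
  fix a assume a: "a \<in> laurent"
  have "{q. pcoeff (der a) q \<noteq> 0} \<subseteq> (\<lambda>q. q + 1) ` {q. pcoeff a q \<noteq> 0}"
  proof
    fix q assume "q \<in> {q. pcoeff (der a) q \<noteq> 0}"
    hence "pcoeff a (q - 1) \<noteq> 0" by (simp add: der_puiseux.rep_eq)
    thus "q \<in> (\<lambda>q. q + 1) ` {q. pcoeff a q \<noteq> 0}" by (intro image_eqI[of _ _ "q - 1"]) auto
  qed
  hence "finite {q. pcoeff (der a) q \<noteq> 0}" by (rule finite_subset) (use a in \<open>simp add: laurent_def\<close>)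
  moreover have "q \<in> \<int>" if "pcoeff (der a) q \<noteq> 0" for q
  proof -
    have "q - 1 \<in> \<int>" using that a by (auto simp: laurent_def der_puiseux.rep_eq)
    hence "q - 1 + 1 \<in> \<int>" by (rule Ints_add) simp
    thus ?thesis by simp
  qed
  ultimately show "der a \<in> laurent" by (auto simp: laurent_def)
  fix b assume b: "b \<in> laurent"
  have "{q. pcoeff (a - b) q \<noteq> 0} \<subseteq> {q. pcoeff a q \<noteq> 0} \<union> {q. pcoeff b q \<noteq> 0}"
    by (auto simp: minus_puiseux.rep_eq)
  hence "finite {q. pcoeff (a - b) q \<noteq> 0}" by (rule finite_subset) (use a b in \<open>simp add: laurent_def\<close>)
  moreover have "q \<in> \<int>" if "pcoeff (a - b) q \<noteq> 0" for q
    using that a b by (cases "pcoeff a q = 0") (auto simp: laurent_def minus_puiseux.rep_eq)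
  ultimately show "a - b \<in> laurent" by (auto simp: laurent_def)
  have "{q. pcoeff (a * b) q \<noteq> 0} \<subseteq> (\<lambda>(s, t). s + t) ` ({q. pcoeff a q \<noteq> 0} \<times> {q. pcoeff b q \<noteq> 0})"
  proof
    fix q assume "q \<in> {q. pcoeff (a * b) q \<noteq> 0}"
    then obtain s t where "pcoeff a s \<noteq> 0" "pcoeff b t \<noteq> 0" "q = s + t" using pcoeff_mult_ne[of a b q] by auto
    thus "q \<in> (\<lambda>(s, t). s + t) ` ({q. pcoeff a q \<noteq> 0} \<times> {q. pcoeff b q \<noteq> 0})"
      by (intro image_eqI[of _ _ "(s, t)"]) auto
  qed
  hence "finite {q. pcoeff (a * b) q \<noteq> 0}" by (rule finite_subset) (use a b in \<open>simp add: laurent_def\<close>)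
  moreover have "q \<in> \<int>" if "pcoeff (a * b) q \<noteq> 0" for q
    using pcoeff_mult_ne[OF that] a b by (auto simp: laurent_def intro!: Ints_add)
  ultimately show "a * b \<in> laurent" by (auto simp: laurent_def)
qed

lemma laurent_monom: "puiseux_monom r (of_int k) \<in> laurent"
proof -
  have "{q. pcoeff (puiseux_monom r (of_int k)) q \<noteq> 0} \<subseteq> {of_int (- k)}"
    by (auto simp: puiseux_monom.rep_eq split: if_splits)
  moreover from this have "finite {q. pcoeff (puiseux_monom r (of_int k)) q \<noteq> 0}" by (rule finite_subset) simp
  moreover have "rat_of_int (- k) \<in> \<int>" by (rule Ints_of_int)
  ultimately show ?thesis unfolding laurent_def by blast
qed

lemma laurent_sum:
  assumes "c \<in> laurent"
  shows "c = (\<Sum>q | pcoeff c q \<noteq> 0. puiseux_monom (pcoeff c q) (- q))"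
  using assms
  by (intro puiseux_eqI)
     (auto simp: laurent_def pcoeff_sum puiseux_monom.rep_eq sum.delta' eq_commute[of _ "_ :: rat"] cong: if_cong)

lemma laurent_ramified: "laurent \<subseteq> ramified n"
  by (auto simp: laurent_def ramified_def intro!: Ints_mult)

text \<open>The Weyl algebra with x inverted. It has the same quotient division ring, and it
  contains the integral powers of x with which values are compared.\<close>

definition wl :: "spoly set" where
  "wl = skew_over laurent"

lemmas wl_closed = skew_over_closed[OF dsubring_laurent, folded wl_def]

lemma wl_mon: "mon p r (of_int k) 0 \<in> wl"
  using wl_closed(1) laurent_monom[of r "- k"] by (simp add: mon_const)

lemma wl_monom: "sconst (puiseux_monom r (of_int k)) \<in> wl"
  using wl_closed(1) laurent_monom by simp

lemma wl_real: "sconst (puiseux_monom r 0) \<in> wl"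
  using wl_monom[of r 0] by simp

lemma wl_dy: "f \<in> wl \<Longrightarrow> dy f \<in> wl"
  using dy_skew_over[OF dsubring_laurent] by (simp add: wl_def)

lemma wl_ramified: "f \<in> wl \<Longrightarrow> p \<in> ramified n \<Longrightarrow> shift p f \<in> skew_over (ramified n)"
  using laurent_ramified[of n] by (intro shift_skew_over[OF dsubring_ramified]) (auto simp: wl_def skew_over_def)

lemma to_quot_sum: "to_quot (sum F A) = (\<Sum>x\<in>A. to_quot (F x))"
  by (induction A rule: infinite_finite_induct) (auto simp: to_quot_add)

lemma to_quot_power: "to_quot (f ^ n) = to_quot f ^ n"
  by (induction n) (auto simp: to_quot_mult)

lemma to_quot_monom: "to_quot (sconst (puiseux_monom r a)) = real_const r * x_pow a"
  by (simp add: real_const_def x_pow_def puiseux_emb_def to_quot_mult[symmetric] sconst_mult[symmetric] puiseux_monom_mult)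

lemma to_quot_mon_const: "to_quot (mon p r q 0) = real_const r * x_pow (- q)"
  by (simp add: mon_const to_quot_monom)

lemma to_quot_real: "to_quot (sconst (puiseux_monom r 0)) = real_const r"
  by (simp add: to_quot_monom)

lemma sconst_laurent:
  assumes "c \<in> laurent"
  shows "sconst c = (\<Sum>q | pcoeff c q \<noteq> 0. sconst (puiseux_monom (pcoeff c q) (- q)))"
proof -
  have "sconst (\<Sum>s\<in>A. F s) = (\<Sum>s\<in>A. sconst (F s))" for F :: "rat \<Rightarrow> puiseux" and A
    by (induction A rule: infinite_finite_induct) (auto simp: sconst_add)
  thus ?thesis using laurent_sum[OF assms] by metis
qed

lemma to_quot_laurent:
  "c \<in> laurent \<Longrightarrow> to_quot (sconst c) = (\<Sum>q | pcoeff c q \<noteq> 0. real_const (pcoeff c q) * x_pow (- q))"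
  by (subst sconst_laurent) (simp_all add: to_quot_sum to_quot_monom)

section \<open>Discreteness of Gauss values and homogeneous parts\<close>

lemma gauss_ge_ex:
  obtains q where "gauss_ge p (rv g) (rv q) f"
proof -
  define F where "F = shift p f"
  have "\<exists>q. \<forall>i\<le>d. \<forall>s. cf F i s \<noteq> 0 \<longrightarrow> rv q \<le> wt (rv g) s i" for d
  proof (induction d)
    case 0
    show ?case
    proof (cases "scoeff F 0 = 0")
      case False
      then obtain q where "pcoeff (scoeff F 0) q \<noteq> 0" "\<forall>s<q. pcoeff (scoeff F 0) s = 0" by (rule puiseux_lead)
      thus ?thesis by (intro exI[of _ q]) (auto simp: cf_def not_less[symmetric])
    qed (auto simp: cf_def zero_puiseux.rep_eq)
  next
    case (Suc d)
    then obtain q where q: "\<forall>i\<le>d. \<forall>s. cf F i s \<noteq> 0 \<longrightarrow> rv q \<le> wt (rv g) s i" by blast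
    show ?case
    proof (cases "scoeff F (Suc d) = 0")
      case True
      thus ?thesis using q by (intro exI[of _ q]) (auto simp: cf_def zero_puiseux.rep_eq le_Suc_eq)
    next
      case False
      then obtain t where "pcoeff (scoeff F (Suc d)) t \<noteq> 0" and t: "\<forall>s<t. pcoeff (scoeff F (Suc d)) s = 0"
        by (rule puiseux_lead)
      define q' where "q' = min q (t + of_nat (Suc d) * g)"
      have "rv q' \<le> wt (rv g) s i" if "i \<le> Suc d" "cf F i s \<noteq> 0" for i s
      proof (cases "i = Suc d")
        case True
        hence "t \<le> s" using t that by (auto simp: cf_def not_less[symmetric])
        hence "q' \<le> s + of_nat (Suc d) * g" by (auto simp: q'_def)
        hence "rv q' \<le> rv (s + of_nat (Suc d) * g)" by simp
        thus ?thesis unfolding wt_def True rv_of_nat_mult[symmetric] rv_add[symmetric] .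
      next
        case False
        hence "rv q \<le> wt (rv g) s i" using that q by auto
        moreover have "rv q' \<le> rv q" by (simp add: q'_def)
        ultimately show ?thesis by (rule order_trans[rotated])
      qed
      thus ?thesis by blast
    qed
  qed
  then obtain q where q: "\<forall>i\<le>degree (poly_of F). \<forall>s. cf F i s \<noteq> 0 \<longrightarrow> rv q \<le> wt (rv g) s i" by blast
  have "gauss_ge p (rv g) (rv q) f" unfolding gauss_ge_def F_def[symmetric]
  proof (intro allI impI)
    fix i s assume a: "cf F i s \<noteq> 0"
    hence "i \<le> degree (poly_of F)" by (auto simp: cf_def scoeff_def zero_puiseux.rep_eq intro!: le_degree)
    thus "rv q \<le> wt (rv g) s i" using a q by blast
  qed
  thus thesis using that by blast
qed

lemma wt_rv: "wt (rv g) s i = rv (s + of_nat i * g)"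
  by (simp add: wt_def rv_add rv_of_nat_mult)

lemma Ints_less_imp: "a \<in> \<int> \<Longrightarrow> b < a \<Longrightarrow> of_int (\<lfloor>b\<rfloor> + 1) \<le> (a :: rat)"
proof -
  assume "a \<in> \<int>" "b < a"
  then obtain z where z: "a = of_int z" "b < of_int z" by (auto elim: Ints_cases)
  hence "\<lfloor>b\<rfloor> < z" by (simp only: floor_less_iff)
  hence "\<lfloor>b\<rfloor> + 1 \<le> z" by simp
  thus ?thesis unfolding z(1) by (simp only: of_int_le_iff)
qed

text \<open>All weights of terms are multiples of 1/n, so a strict inequality moves up to the next
  multiple of 1/n, whose numerator is the floor of q n plus 1.\<close>

lemma gauss_gt_discrete:
  assumes f: "shift p f \<in> skew_over (ramified n)" and n: "n > 0" "g * of_nat n \<in> \<int>"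
    and gt: "gauss_gt p (rv g) (rv q) f"
  shows "gauss_ge p (rv g) (rv (of_int (\<lfloor>q * of_nat n\<rfloor> + 1) / of_nat n)) f"
  unfolding gauss_ge_def
proof (intro allI impI)
  fix i s assume c: "cf (shift p f) i s \<noteq> 0"
  hence "s * of_nat n \<in> \<int>" using f by (auto simp: skew_over_def cf_def ramified_def)
  moreover have "of_nat i * (g * of_nat n) \<in> \<int>" by (rule Ints_mult[OF Ints_of_nat n(2)])
  ultimately have i: "(s + of_nat i * g) * of_nat n \<in> \<int>" by (simp add: distrib_right mult.assoc)
  have "q < s + of_nat i * g" using gauss_gtD[OF gt c] by (simp add: wt_rv)
  hence "q * of_nat n < (s + of_nat i * g) * of_nat n" using n by simp
  hence "of_int (\<lfloor>q * of_nat n\<rfloor> + 1) \<le> (s + of_nat i * g) * of_nat n" by (rule Ints_less_imp[OF i])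
  thus "rv (of_int (\<lfloor>q * of_nat n\<rfloor> + 1) / of_nat n) \<le> wt (rv g) s i"
    using n by (simp add: wt_rv pos_divide_le_eq)
qed

lemma rat_denominator: obtains n :: nat where "n > 0" "(q :: rat) * of_nat n \<in> \<int>"
proof -
  obtain a b where 1: "quotient_of q = (a, b)" by (cases "quotient_of q")
  hence b: "b > 0" "q = of_int a / of_int b" using quotient_of_denom_pos quotient_of_div by auto
  hence "q * of_nat (nat b) = of_int a" by simp
  thus thesis using b by (intro that[of "nat b"]) auto
qed

lemma gauss_gt_gap:
  assumes "gauss_gt p (rv g) (rv q) f"
  obtains s where "q < s" "gauss_ge p (rv g) (rv s) f"
proof -
  obtain n where n: "n > 0" "shift p f \<in> skew_over (ramified n)" by (rule spoly_ramified)
  obtain m where m: "m > 0" "g * of_nat m \<in> \<int>" by (rule rat_denominator)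
  have r: "shift p f \<in> skew_over (ramified (n * m))"
    using n ramified_mono[of n "n * m"] by (auto simp: skew_over_def)
  have "g * of_nat m * of_nat n \<in> \<int>" by (rule Ints_mult[OF m(2) Ints_of_nat])
  hence g: "g * of_nat (n * m) \<in> \<int>" by (simp add: mult_ac)
  have pos: "0 < n * m" using n m by simp
  have "q * of_nat (n * m) < of_int (\<lfloor>q * of_nat (n * m)\<rfloor> + 1)" by linarith
  hence "q < of_int (\<lfloor>q * of_nat (n * m)\<rfloor> + 1) / of_nat (n * m)"
    using pos by (subst pos_less_divide_eq) (auto simp del: of_nat_mult)
  thus thesis using that gauss_gt_discrete[OF r pos g assms] by blast
qed

text \<open>In degree i a term of weight exactly q must have the exponent q - i g; these terms form
  the homogeneous part that is removed.\<close>

lemma gauss_gt_peel: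
  assumes "gauss_ge p (rv g) (rv q) f"
  shows "gauss_gt p (rv g) (rv q)
    (f - (\<Sum>i\<le>degree (poly_of (shift p f)). mon p (cf (shift p f) i (q - of_nat i * g)) (q - of_nat i * g) i))"
  (is "gauss_gt _ _ _ (f - ?h)")
  unfolding gauss_gt_def
proof (intro allI impI)
  fix k s assume a: "cf (shift p (f - ?h)) k s \<noteq> 0"
  let ?F = "shift p f"
  have "cf (shift p ?h) k s = (\<Sum>i\<le>degree (poly_of ?F). if k = i \<and> s = q - of_nat i * g then cf ?F k s else 0)"
    unfolding shift_sum cf_sum cf_shift_mon by (intro sum.cong) auto
  also have "\<dots> = (\<Sum>i\<le>degree (poly_of ?F). if i = k then (if s = q - of_nat k * g then cf ?F k s else 0) else 0)"
    by (intro sum.cong) auto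
  also have "\<dots> = (if s = q - of_nat k * g then cf ?F k s else 0)"
  proof (cases "k \<le> degree (poly_of ?F)")
    case False
    hence "cf ?F k s = 0" by (simp add: cf_def scoeff_def coeff_eq_0 zero_puiseux.rep_eq)
    thus ?thesis using False by auto
  qed auto
  finally have h: "cf (shift p ?h) k s = (if s = q - of_nat k * g then cf ?F k s else 0)" .
  with a have "cf ?F k s \<noteq> 0" "s \<noteq> q - of_nat k * g" by (auto simp: shift_diff split: if_splits)
  thus "rv q < wt (rv g) s k" using gauss_geD[OF assms] by (force simp: wt_rv)
qed

text \<open>Among the terms with R x \<noteq> 0 take one of least weight. At its position no other
  leading term occurs, by injectivity, and all non-leading terms weigh more, so its coefficient
  survives in the sum.\<close>

lemma gauss_no_cancel:
  assumes I: "finite I" and M: "\<And>x. x \<in> I \<Longrightarrow> lead p g (M x) (\<rho> x) (s x) (l x) \<and> \<rho> x \<noteq> 0"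
    and inj: "inj_on (\<lambda>x. (s x, l x)) I"
  shows "gauss_ge p g \<sigma> (\<Sum>x\<in>I. sconst (puiseux_monom (R x) 0) * M x) \<Longrightarrow> x \<in> I \<Longrightarrow> R x \<noteq> 0 \<Longrightarrow> \<sigma> \<le> wt g (s x) (l x)"
    and "gauss_gt p g \<sigma> (\<Sum>x\<in>I. sconst (puiseux_monom (R x) 0) * M x) \<Longrightarrow> x \<in> I \<Longrightarrow> R x \<noteq> 0 \<Longrightarrow> \<sigma> < wt g (s x) (l x)"
proof -
  let ?h = "\<Sum>x\<in>I. sconst (puiseux_monom (R x) 0) * M x"
  define J where "J = {x \<in> I. R x \<noteq> 0}"
  have key: "\<exists>y. cf (shift p ?h) (l y) (s y) \<noteq> 0 \<and> wt g (s y) (l y) \<le> wt g (s x) (l x)" if "x \<in> I" "R x \<noteq> 0" for x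
  proof -
    have J: "finite J" "J \<noteq> {}" using I that by (auto simp: J_def)
    obtain y where y: "y \<in> J" "\<And>z. z \<in> J \<Longrightarrow> wt g (s y) (l y) \<le> wt g (s z) (l z)"
      using ex_min_if_finite[of "(\<lambda>x. wt g (s x) (l x)) ` J"] J by (auto simp: not_less)
    have c: "cf (shift p (sconst (puiseux_monom (R z) 0) * M z)) (l y) (s y) = (if z = y then R y * \<rho> y else 0)"
      if z: "z \<in> I" for z
    proof -
      have cz: "cf (shift p (sconst (puiseux_monom (R z) 0) * M z)) (l y) (s y) = R z * cf (shift p (M z)) (l y) (s y)"
        by (simp add: shift_sconst_mult cf_def pcoeff_monom_mult)
      show ?thesis
      proof (cases "z = y")
        case True
        thus ?thesis using cz lead_coeff_eq M z by force
      next
        case False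
        show ?thesis
        proof (cases "R z = 0")
          case nz: False
          hence "wt g (s y) (l y) \<le> wt g (s z) (l z)" using y z by (simp add: J_def)
          moreover have "gauss_gt p g (wt g (s z) (l z)) (M z - mon p (\<rho> z) (s z) (l z))"
            using M z by (simp add: lead_def)
          ultimately have "cf (shift p (M z - mon p (\<rho> z) (s z) (l z))) (l y) (s y) = 0"
            using gauss_gtD by (metis not_less)
          moreover have "(s z, l z) \<noteq> (s y, l y)" using inj False z y unfolding J_def inj_on_def by blast
          ultimately show ?thesis using cz False by (auto simp: shift_diff cf_shift_mon split: if_splits)
        qed (use cz False in simp)
      qed
    qed
    have "cf (shift p ?h) (l y) (s y) = (\<Sum>z\<in>I. if z = y then R y * \<rho> y else 0)"
      unfolding shift_sum cf_sum using c by (intro sum.cong) auto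
    also have "\<dots> = R y * \<rho> y" using I y by (simp add: J_def)
    also have "\<dots> \<noteq> 0" using y M by (auto simp: J_def)
    finally show ?thesis using y(2)[of x] that by (auto simp: J_def)
  qed
  show "gauss_ge p g \<sigma> ?h \<Longrightarrow> x \<in> I \<Longrightarrow> R x \<noteq> 0 \<Longrightarrow> \<sigma> \<le> wt g (s x) (l x)"
    using key[of x] gauss_geD by (meson order_trans)
  show "gauss_gt p g \<sigma> ?h \<Longrightarrow> x \<in> I \<Longrightarrow> R x \<noteq> 0 \<Longrightarrow> \<sigma> < wt g (s x) (l x)"
    using key[of x] gauss_gtD by (meson order_less_le_trans)
qed

text \<open>
  Stand-ins in \<open>wl\<close> for the powers of \<open>x\<close> with exponent \<open>- e / n\<close>; the leading term of \<open>a\<close> is meant to be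
  the one with exponent \<open>- 1 / n\<close>.
\<close>

definition stand_in :: "nat \<Rightarrow> spoly \<Rightarrow> int \<Rightarrow> spoly" where
  "stand_in n a e = sconst (puiseux_monom 1 (- of_int (e div int n))) * a ^ nat (e mod int n)"

lemma stand_in_wl: "a \<in> wl \<Longrightarrow> stand_in n a e \<in> wl"
  unfolding stand_in_def using wl_monom[of 1 "- (e div int n)"] by (intro wl_closed) auto

lemma lead_stand_in:
  assumes "n > 0" "g < rv 1" "lead p g a 1 (1 / of_nat n) 0"
  shows "lead p g (stand_in n a e) 1 (of_int e / of_nat n) 0"
proof -
  have "lead p g (a ^ nat (e mod int n)) 1 (of_nat (nat (e mod int n)) / of_nat n) 0"
    using lead_power[OF assms(2,3), of "nat (e mod int n)"] by simp
  hence "lead p g (stand_in n a e) (1 * 1) (of_int (e div int n) + of_nat (nat (e mod int n)) / of_nat n) 0"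
    unfolding stand_in_def using assms(2) by (intro lead_sconst_mult)
  moreover have "of_int (e div int n) + of_nat (nat (e mod int n)) / of_nat n = (of_int e / of_nat n :: rat)"
  proof -
    have "(of_nat (nat (e mod int n)) :: rat) = of_int (e mod int n)" using assms(1) by simp
    moreover have "(of_int e :: rat) = of_int (e div int n) * of_nat n + of_int (e mod int n)"
      by (metis div_mult_mod_eq of_int_add of_int_mult of_int_of_nat_eq)
    ultimately show ?thesis using assms(1) by (simp add: add_divide_distrib)
  qed
  ultimately show ?thesis by simp
qed

text \<open>The index j is written in base L. With u of degree 1 and z of degree L in y - p the
  product has degree j, so each degree is reached by one j; for the next Gauss valuation u counts as
  a constant and z as linear.\<close>

definition exp_term :: "nat \<Rightarrow> spoly \<Rightarrow> nat \<Rightarrow> spoly \<Rightarrow> spoly \<Rightarrow> int \<times> nat \<Rightarrow> spoly" where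
  "exp_term n a L u z = (\<lambda>(e, j). stand_in n a e * u ^ (j mod L) * z ^ (j div L))"

lemma exp_term_wl: "a \<in> wl \<Longrightarrow> u \<in> wl \<Longrightarrow> z \<in> wl \<Longrightarrow> exp_term n a L u z x \<in> wl"
  unfolding exp_term_def by (cases x) (auto intro!: wl_closed stand_in_wl)

lemma lead_exp_term:
  assumes n: "n > 0" and g: "g < rv 1" and a: "lead p g a 1 (1 / of_nat n) 0"
    and u: "L > 1 \<Longrightarrow> lead p g u r q i" and z: "lead p g z t q' k" and L: "L > 0"
  shows "lead p g (exp_term n a L u z (e, j)) (r ^ (j mod L) * t ^ (j div L))
    (of_int e / of_nat n + of_nat (j mod L) * q + of_nat (j div L) * q') (j mod L * i + j div L * k)"
proof -
  have "lead p g (u ^ (j mod L)) (r ^ (j mod L)) (of_nat (j mod L) * q) (j mod L * i)"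
  proof (cases "L > 1")
    case True
    thus ?thesis using u g by (intro lead_power)
  next
    case False
    hence "L = 1" using L by simp
    thus ?thesis by (simp add: lead_1)
  qed
  from lead_mult[OF g lead_mult[OF g lead_stand_in[OF n g a, of e] this] lead_power[OF g z, of "j div L"]]
  show ?thesis by (simp add: exp_term_def)
qed

definition real_span :: "('b \<Rightarrow> spoly) \<Rightarrow> spoly set" where
  "real_span M = {h. \<exists>I R. finite I \<and> h = (\<Sum>x\<in>I. sconst (puiseux_monom (R x) 0) * M x)}"

lemma real_span_add:
  assumes "f \<in> real_span M" "h \<in> real_span M"
  shows "f + h \<in> real_span M"
proof -
  obtain I R where 1: "finite I" "f = (\<Sum>x\<in>I. sconst (puiseux_monom (R x) 0) * M x)"
    using assms(1) by (auto simp: real_span_def)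
  obtain J S where 2: "finite J" "h = (\<Sum>x\<in>J. sconst (puiseux_monom (S x) 0) * M x)"
    using assms(2) by (auto simp: real_span_def)
  define T where "T x = (if x \<in> I then R x else 0) + (if x \<in> J then S x else 0)" for x
  have "f = (\<Sum>x\<in>I \<union> J. sconst (puiseux_monom (if x \<in> I then R x else 0) 0) * M x)"
    unfolding 1(2) using 1(1) 2(1) by (intro sum.mono_neutral_cong_left) auto
  moreover have "h = (\<Sum>x\<in>I \<union> J. sconst (puiseux_monom (if x \<in> J then S x else 0) 0) * M x)"
    unfolding 2(2) using 1(1) 2(1) by (intro sum.mono_neutral_cong_left) auto
  ultimately have "f + h = (\<Sum>x\<in>I \<union> J. sconst (puiseux_monom (T x) 0) * M x)"
    by (simp only: T_def puiseux_monom_add[symmetric] sconst_add distrib_right sum.distrib)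
  thus ?thesis unfolding real_span_def using 1(1) 2(1) by (intro CollectI exI[of _ "I \<union> J"] exI[of _ T]) simp
qed

lemma real_span_0: "0 \<in> real_span M"
  unfolding real_span_def by (intro CollectI exI[of _ "{}"]) simp

lemma real_span_base: "sconst (puiseux_monom r 0) * M x \<in> real_span M"
  unfolding real_span_def by (intro CollectI exI[of _ "{x}"] exI[of _ "\<lambda>_. r"]) simp

lemma real_span_sum: "(\<And>x. x \<in> A \<Longrightarrow> F x \<in> real_span M) \<Longrightarrow> sum F A \<in> real_span M"
  by (induction A rule: infinite_finite_induct) (auto intro: real_span_add real_span_0)

lemma real_span_wl: "h \<in> real_span M \<Longrightarrow> (\<And>x. M x \<in> wl) \<Longrightarrow> h \<in> wl"
  unfolding real_span_def using wl_real by (auto intro!: wl_closed(7,9))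

text \<open>
  The terms exhaust the leading forms with respect to the Gauss valuation, whose values on \<open>wl\<close> are
  discrete; hence each element is approximated by finite sums of terms.
\<close>

lemma expansion:
  assumes n: "n > 0" and g: "g < 1" and a: "lead p (rv g) a 1 (1 / of_nat n) 0" "a \<in> wl"
    and u: "L > 1 \<Longrightarrow> lead p (rv g) u r q 1 \<and> r \<noteq> 0 \<and> q * of_nat n \<in> \<int>" "u \<in> wl"
    and z: "lead p (rv g) z t q' L" "z \<in> wl" "t \<noteq> 0" "q' * of_nat n \<in> \<int>" and L: "L > 0"
    and p: "p \<in> ramified n" and f: "f \<in> wl"
  shows "\<exists>h\<in>real_span (exp_term n a L u z). gauss_ge p (rv g) (rv (of_nat k)) (f - h)"
proof -
  let ?S = "real_span (exp_term n a L u z)"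
  have g': "rv g < rv 1" using g by simp
  have wl: "h \<in> wl" if "h \<in> ?S" for h
    using real_span_wl[OF that exp_term_wl] a u z by blast
  have step: "\<exists>h\<in>?S. gauss_gt p (rv g) (rv s) (f - h)"
    if f: "f \<in> wl" and ge: "gauss_ge p (rv g) (rv s) f" for f s
  proof -
    define c where "c i = cf (shift p f) i (s - of_nat i * g)" for i
    have "\<exists>h\<in>?S. gauss_gt p (rv g) (rv s) (mon p (c i) (s - of_nat i * g) i - h)" for i
    proof (cases "c i = 0")
      case True
      thus ?thesis using real_span_0 by (intro bexI[of _ 0]) auto
    next
      case False
      define \<rho> where "\<rho> = r ^ (i mod L) * t ^ (i div L)"
      have "\<rho> \<noteq> 0"
      proof (cases "L > 1")
        case False
        hence "L = 1" using L by simp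
        thus ?thesis using z by (simp add: \<rho>_def)
      qed (use u z in \<open>auto simp: \<rho>_def\<close>)
      \<comment> \<open>The exponent left to the root of x after u and z have contributed theirs to
        s - i g. It is a multiple of 1/n because all the other exponents are.\<close>
      define w where "w = s - of_nat i * g - of_nat (i mod L) * q - of_nat (i div L) * q'"
      have "(s - of_nat i * g) * of_nat n \<in> \<int>"
        using wl_ramified[OF f p] False by (auto simp: skew_over_def ramified_def c_def cf_def)
      moreover have "of_nat (i mod L) * (q * of_nat n) \<in> \<int>"
      proof (cases "L > 1")
        case False
        hence "L = 1" using L by simp
        thus ?thesis by simp
      qed (use u in \<open>auto intro!: Ints_mult\<close>)
      moreover have "of_nat (i div L) * (q' * of_nat n) \<in> \<int>" using z by (auto intro!: Ints_mult)
      ultimately have "(s - of_nat i * g) * of_nat n - of_nat (i mod L) * (q * of_nat n) - of_nat (i div L) * (q' * of_nat n) \<in> \<int>"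
        by (intro Ints_diff)
      hence "w * of_nat n \<in> \<int>" by (simp add: w_def left_diff_distrib mult.assoc)
      then obtain e where "w * of_nat n = of_int e" by (auto elim: Ints_cases)
      hence e: "of_int e / of_nat n = w" using n by (simp add: field_simps)
      have "lead p (rv g) (exp_term n a L u z (e, i)) \<rho>
          (w + of_nat (i mod L) * q + of_nat (i div L) * q') (i mod L * 1 + i div L * L)"
        unfolding \<rho>_def e[symmetric] using u z L by (intro lead_exp_term n g' a) auto
      hence "lead p (rv g) (exp_term n a L u z (e, i)) \<rho> (s - of_nat i * g) i"
        by (simp add: w_def algebra_simps)
      hence "lead p (rv g) (sconst (puiseux_monom (c i / \<rho>) (- 0)) * exp_term n a L u z (e, i)) (c i / \<rho> * \<rho>) (0 + (s - of_nat i * g)) i"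
        by (rule lead_sconst_mult[OF g'])
      hence gt: "gauss_gt p (rv g) (rv s) (sconst (puiseux_monom (c i / \<rho>) 0) * exp_term n a L u z (e, i) - mon p (c i) (s - of_nat i * g) i)"
        using \<open>\<rho> \<noteq> 0\<close> by (simp add: lead_def wt_rv)
      have "gauss_gt p (rv g) (rv s) (mon p (c i) (s - of_nat i * g) i - sconst (puiseux_monom (c i / \<rho>) 0) * exp_term n a L u z (e, i))"
        using gauss_gt_diff[OF gauss_gt_0 gt] by simp
      thus ?thesis using real_span_base[of "c i / \<rho>" "exp_term n a L u z" "(e, i)"] by blast
    qed
    hence "\<forall>i. \<exists>h. h \<in> ?S \<and> gauss_gt p (rv g) (rv s) (mon p (c i) (s - of_nat i * g) i - h)" by blast
    from choice[OF this] obtain H where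
      H: "\<forall>i. H i \<in> ?S \<and> gauss_gt p (rv g) (rv s) (mon p (c i) (s - of_nat i * g) i - H i)" by blast
    let ?D = "{..degree (poly_of (shift p f))}"
    have "gauss_gt p (rv g) (rv s) ((f - (\<Sum>i\<in>?D. mon p (c i) (s - of_nat i * g) i)) + (\<Sum>i\<in>?D. mon p (c i) (s - of_nat i * g) i - H i))"
      by (rule gauss_gt_add[OF gauss_gt_peel[OF ge, folded c_def] gauss_gt_sum]) (use H in blast)
    hence "gauss_gt p (rv g) (rv s) (f - (\<Sum>i\<in>?D. H i))" by (simp add: sum_subtractf)
    moreover have "(\<Sum>i\<in>?D. H i) \<in> ?S" by (rule real_span_sum) (use H in blast)
    ultimately show ?thesis by blast
  qed
  obtain m where m: "m > 0" "g * of_nat m \<in> \<int>" by (rule rat_denominator)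
  \<comment> \<open>A common denominator for g and for the exponents of elements of
    \<open>wl\<close> expanded at p. Each correction raises the bound for the error by 1/d.\<close>
  define d where "d = n * m"
  have d: "d > 0" using n m by (simp add: d_def)
  have "g * of_nat m * of_nat n \<in> \<int>" by (rule Ints_mult[OF m(2) Ints_of_nat])
  hence gd: "g * of_nat d \<in> \<int>" by (simp add: mult_ac d_def)
  obtain q0 where q0: "gauss_ge p (rv g) (rv q0) f" by (rule gauss_ge_ex)
  define k0 where "k0 = \<lfloor>q0 * of_nat d\<rfloor>"
  have main: "\<exists>h\<in>?S. gauss_ge p (rv g) (rv (of_int (k0 + int j) / of_nat d)) (f - h)" for j
  proof (induction j)
    case 0
    have "of_int k0 \<le> q0 * of_nat d" unfolding k0_def by simp
    hence "of_int k0 / of_nat d \<le> q0" using d by (simp add: pos_divide_le_eq)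
    thus ?case using gauss_ge_mono[OF q0] real_span_0 by (intro bexI[of _ 0]) auto
  next
    case (Suc j)
    then obtain h where h: "h \<in> ?S" "gauss_ge p (rv g) (rv (of_int (k0 + int j) / of_nat d)) (f - h)" by blast
    have "f - h \<in> wl" using f wl[OF h(1)] by (intro wl_closed)
    from step[OF this h(2)] obtain h' where h': "h' \<in> ?S"
      "gauss_gt p (rv g) (rv (of_int (k0 + int j) / of_nat d)) (f - h - h')" by blast
    have "f - h - h' \<in> wl" using f wl h h' by (intro wl_closed) auto
    hence "shift p (f - h - h') \<in> skew_over (ramified n)" using p by (rule wl_ramified)
    hence "shift p (f - h - h') \<in> skew_over (ramified d)"
      using ramified_mono[of n d] by (auto simp: skew_over_def d_def)
    note gauss_gt_discrete[OF this d gd h'(2)]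
    moreover have "of_int (k0 + int j) / of_nat d * of_nat d = (of_int (k0 + int j) :: rat)" using d by simp
    moreover have "\<lfloor>rat_of_int (k0 + int j)\<rfloor> + 1 = k0 + int (Suc j)" unfolding floor_of_int by simp
    moreover have "f - h - h' = f - (h + h')" by (simp add: diff_diff_eq)
    ultimately have "gauss_ge p (rv g) (rv (of_int (k0 + int (Suc j)) / of_nat d)) (f - (h + h'))"
      by (simp only:)
    thus ?case using real_span_add[OF h(1) h'(1)] by blast
  qed
  have "int k * int d \<le> k0 + int (nat (int k * int d - k0))" by linarith
  then obtain j where "int k * int d \<le> k0 + int j" by blast
  hence "(of_int (int k * int d) :: rat) \<le> of_int (k0 + int j)" by (simp only: of_int_le_iff)
  hence "of_nat k \<le> of_int (k0 + int j) / (of_nat d :: rat)" using d by (simp add: pos_le_divide_eq)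
  hence "rv (of_nat k) \<le> rv (of_int (k0 + int j) / of_nat d)" by (simp only: rv_le_iff)
  thus ?thesis using main[of j] gauss_ge_mono by blast
qed

text \<open>For l \<noteq> l' the equation could be solved for G, which would be the rational number
  (s - s') / (l' - l).\<close>

lemma irrational_wt_eq:
  assumes "\<And>t. rv t \<noteq> G" "wt G s l = wt G s' l'"
  shows "s = s' \<and> l = l'"
proof -
  have main: "\<not> l < l'" if "wt G s l = wt G s' l'" for s l s' l'
  proof
    assume "l < l'"
    then obtain d where d: "d > 0" "l' = l + d" using less_imp_add_positive by blast
    have "rv s = rv s' + of_nat d * G" using that unfolding wt_def d(2) by (simp add: algebra_simps)
    hence "rv (s - s') = of_nat d * G" by (simp add: rv_diff)
    moreover have "rv (s - s') = of_nat d * rv ((s - s') / of_nat d)"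
      using d by (simp add: rv_of_nat_mult[symmetric])
    ultimately have "of_nat d * rv ((s - s') / of_nat d) = of_nat d * G" by simp
    hence "rv ((s - s') / of_nat d) = G" using d(1) by simp
    thus False using assms(1) by blast
  qed
  have "l = l'" using main[OF assms(2)] main[OF assms(2)[symmetric]] by simp
  thus ?thesis using assms(2) by (simp add: wt_def)
qed

lemma wt_bound:
  assumes "G < rv 1"
  obtains k :: nat where "wt G s l < rv (of_nat k)"
proof -
  obtain k :: nat where k: "s + of_nat l < of_nat k" using reals_Archimedean2 by blast
  have "of_nat l * G \<le> of_nat l * rv 1" using assms by (intro mult_left_mono) auto
  hence "wt G s l \<le> rv (s + of_nat l)" unfolding wt_def rv_add using rv_of_nat_mult[of l 1] by simp
  also have "\<dots> < rv (of_nat k)" using k by simp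
  finally show thesis using that by blast
qed

section \<open>Lower bounds for a valuation by Gauss valuations\<close>

locale weyl_dominance = dominance +
  assumes wl_K: "f \<in> wl \<Longrightarrow> to_quot f \<in> K"
begin

text \<open>For rational g the Gauss values are rational, so comparing rational bounds suffices and
  no embedding of the value group into the real polynomials is needed.\<close>

definition below :: "puiseux \<Rightarrow> rat \<Rightarrow> bool" where
  "below p g \<longleftrightarrow> (\<forall>f\<in>wl. \<forall>q. gauss_ge p (rv g) (rv q) f \<longrightarrow> vge (to_quot f) q)"

lemma belowD: "below p g \<Longrightarrow> f \<in> wl \<Longrightarrow> gauss_ge p (rv g) (rv q) f \<Longrightarrow> vge (to_quot f) q"
  by (simp add: below_def)

lemma weyl_y_K: "weyl_y \<in> K"
  using wl_K[OF wl_closed(2)] by (simp add: weyl_y_def)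

text \<open>Each monomial x^(-s) y^i with integral s is bounded by multiplicativity, and a sum is at
  least as large as its least term.\<close>

lemma below_initial:
  assumes y: "vge weyl_y g"
  shows "below 0 g"
  unfolding below_def
proof (intro ballI allI impI)
  fix f q assume f: "f \<in> wl" and ge: "gauss_ge 0 (rv g) (rv q) f"
  have "vge (to_quot (sconst (scoeff f i) * svar ^ i)) q" for i
  proof -
    let ?S = "{s. pcoeff (scoeff f i) s \<noteq> 0}"
    have c: "scoeff f i \<in> laurent" using f by (auto simp: wl_def skew_over_def)
    have eq: "to_quot (sconst (scoeff f i) * svar ^ i) =
        (\<Sum>s\<in>?S. real_const (pcoeff (scoeff f i) s) * x_pow (- s) * weyl_y ^ i)"
      by (simp add: to_quot_mult to_quot_laurent[OF c] sum_distrib_right to_quot_power weyl_y_def)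
    have "vge (real_const (pcoeff (scoeff f i) s) * x_pow (- s) * weyl_y ^ i) q" if s: "s \<in> ?S" for s
    proof -
      obtain k where k: "s = of_int k" using c s by (auto simp: laurent_def elim: Ints_cases)
      have "vge (x_pow (- s)) s" using vge_x_pow[of "- k"] k by simp
      hence "vge (real_const (pcoeff (scoeff f i) s) * x_pow (- s) * weyl_y ^ i) (s + of_nat i * g)"
        by (intro vge_mult[OF vge_real_mult vge_power[OF y]])
      moreover have "q \<le> s + of_nat i * g"
        using gauss_geD[OF ge, of i s] s by (simp add: wt_rv cf_def)
      ultimately show ?thesis by (rule vge_mono)
    qed
    thus ?thesis unfolding eq by (rule vge_sum)
  qed
  hence "vge (\<Sum>i\<le>degree (poly_of f). to_quot (sconst (scoeff f i) * svar ^ i)) q"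
    by (intro vge_sum)
  thus "vge (to_quot f) q" by (subst spoly_sum) (simp add: to_quot_sum)
qed

lemma below_mono: "below p g \<Longrightarrow> h \<le> g \<Longrightarrow> h \<le> 1 \<Longrightarrow> below p h"
  unfolding below_def using gauss_ge_change[of p p "rv h" "rv g"] by (auto simp: zero_puiseux.rep_eq)

lemma below_shift:
  assumes "below p g" "\<And>q. pcoeff (p' - p) q \<noteq> 0 \<Longrightarrow> g \<le> q" "g \<le> 1"
  shows "below p' g"
proof -
  have "g \<le> q" if "pcoeff (p - p') q \<noteq> 0" for q
    using that assms(2)[of q] by (auto simp: minus_puiseux.rep_eq)
  thus ?thesis using assms unfolding below_def
    using gauss_ge_change[of p p' "rv g" "rv g"] by auto
qed

lemma below_vge_gt:
  assumes "below p g" "f \<in> wl" "gauss_gt p (rv g) (rv q) f"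
  obtains s where "q < s" "vge (to_quot f) s"
  using assms gauss_gt_gap[OF assms(3)] belowD by metis

text \<open>The power x^(-q) may lie outside the Weyl algebra. Raising to the denominator n of q
  makes the leading term an element of \<open>wl\<close>, and the rest has a strictly larger value
  by \<open>below\<close>.\<close>

lemma below_veq:
  assumes b: "below p g" "g < 1" and f: "f \<in> wl" "lead p (rv g) f r q 0" "r \<noteq> 0"
  shows "veq (to_quot f) q"
proof -
  obtain n where n: "n > 0" "q * of_nat n \<in> \<int>" by (rule rat_denominator)
  then obtain m where m: "q * of_nat n = of_int m" by (auto elim: Ints_cases)
  hence q: "q = of_int m / of_nat n" using n by (simp add: field_simps)
  let ?m = "mon p (r ^ n) (of_int m) 0"
  have "lead p (rv g) (f ^ n) (r ^ n) (of_int m) 0"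
    using lead_power[OF _ f(2), of n] b m by (simp add: mult.commute)
  hence gt: "gauss_gt p (rv g) (rv (of_int m)) (f ^ n - ?m)" by (simp add: lead_def)
  have wl: "f ^ n - ?m \<in> wl" using f wl_mon by (intro wl_closed)
  from below_vge_gt[OF b(1) wl gt] obtain s where s: "of_int m < s" "vge (to_quot (f ^ n - ?m)) s" .
  have mm: "veq (to_quot ?m) (of_int m)"
    using veq_real_mult[OF veq_x_pow[of "- m"], of "r ^ n"] f(3) by (simp add: to_quot_mon_const)
  have "sim (to_quot f ^ n) (to_quot ?m)"
    using sim_vgeI[OF mm _ s(1)] s(2) by (simp add: to_quot_diff to_quot_power)
  hence "veq (to_quot f ^ n) (of_int m)" using mm by (rule veq_sim)
  moreover have "veq (x_pow (- of_int m)) (of_int m)" using veq_x_pow[of "- m"] by simp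
  ultimately have "veqv (to_quot f ^ n) (x_pow (- of_int m))" by (rule veq_imp_veqv)
  thus ?thesis using veq_iff_power[OF wl_K[OF f(1)] n(1) q] by blast
qed

lemma below_sim:
  assumes b: "below p g" "g < 1" and f: "f \<in> wl" "lead p (rv g) f r q 0"
    and h: "h \<in> wl" "lead p (rv g) h s q 0" "s \<noteq> 0" and r: "r \<noteq> 0"
  shows "sim (to_quot f) (real_const (r / s) * to_quot h)"
proof -
  let ?c = "sconst (puiseux_monom (r / s) 0)"
  have "lead p (rv g) (?c * h) r q 0"
    using lead_sconst_mult[OF _ h(2), of "r / s" 0] b h by simp
  hence "gauss_gt p (rv g) (rv q) (f - ?c * h)" using lead_diff[OF f(2)] lead_0_iff[of p "rv g" _ q 0] by fastforce
  moreover have "f - ?c * h \<in> wl" using f h wl_real by (intro wl_closed)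
  ultimately obtain t where "q < t" "vge (to_quot (f - ?c * h)) t" using below_vge_gt[OF b(1)] by blast
  moreover have "veq (real_const (r / s) * to_quot h) q"
    using below_veq[OF b h] r h by (intro veq_real_mult) auto
  ultimately show ?thesis
    using sim_vgeI[of "real_const (r / s) * to_quot h" q "to_quot f" t]
    by (simp add: to_quot_diff to_quot_mult to_quot_real)
qed

text \<open>No positive i < L makes i q a multiple of 1/n, so the exponent modulo 1/n determines j
  mod L once the degree j div L is known.\<close>

lemma exp_term_inj:
  fixes q c :: rat
  assumes n: "n > 0" and indep: "\<And>i. i < L \<Longrightarrow> of_nat i * q * of_nat n \<in> \<int> \<Longrightarrow> i = 0" and L: "L > 0"
  shows "inj_on (\<lambda>x. (of_int (fst x) / of_nat n + of_nat (snd x mod L) * q + of_nat (snd x div L) * c, snd x div L)) I"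
proof (rule inj_onI)
  fix x y :: "int \<times> nat"
  obtain e j e' j' where xy: "x = (e, j)" "y = (e', j')" by (cases x; cases y)
  assume "(of_int (fst x) / of_nat n + of_nat (snd x mod L) * q + of_nat (snd x div L) * c, snd x div L)
    = (of_int (fst y) / of_nat n + of_nat (snd y mod L) * q + of_nat (snd y div L) * c, snd y div L)"
  hence d: "j div L = j' div L" and
    s: "of_int e / of_nat n + of_nat (j mod L) * q = of_int e' / of_nat n + of_nat (j' mod L) * q"
    by (auto simp: xy)
  have main: "k = l" if "of_int e / of_nat n + of_nat k * q = of_int e' / of_nat n + of_nat l * q"
    "k \<le> l" "l < L" for k l :: nat and e e' :: int
  proof -
    have "of_nat (l - k) * q = of_nat l * q - of_nat k * q" using that(2) by (simp add: of_nat_diff left_diff_distrib)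
    also have "\<dots> = of_int e / of_nat n - of_int e' / of_nat n" using that(1) by linarith
    finally have "of_nat (l - k) * q = of_int e / of_nat n - of_int e' / of_nat n" .
    hence "of_nat (l - k) * q * of_nat n = of_int (e - e')" using n by (simp add: field_simps)
    hence "of_nat (l - k) * q * of_nat n \<in> \<int>" by (metis Ints_of_int)
    hence "l - k = 0" by (rule indep[rotated]) (use that in linarith)
    thus ?thesis using that by linarith
  qed
  have "j mod L = j' mod L"
    using main[OF s] main[OF s[symmetric]] L by (cases "j mod L \<le> j' mod L") auto
  hence "j = j'" "of_int e / rat_of_nat n = of_int e' / of_nat n" using d s by (metis div_mult_mod_eq, simp)
  thus "x = y" using n by (simp add: xy)
qed

text \<open>Expand f in the terms adapted to the old Gauss valuation. For the new one their leading
  positions differ, so a lower bound s for f holds for each term separately, and the bounds assumed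
  for u and z carry it over to the valuation of each term. The remainder of the expansion is
  controlled by the old bound.\<close>

lemma below_raise:
  assumes b: "below p g" and n: "n > 0" and g: "g < 1" and a: "lead p (rv g) a 1 (1 / of_nat n) 0" "a \<in> wl"
    and u: "L > 1 \<Longrightarrow> lead p (rv g) u r q 1 \<and> r \<noteq> 0 \<and> q * of_nat n \<in> \<int>" "u \<in> wl"
    and z: "lead p (rv g) z t q' L" "z \<in> wl" "t \<noteq> 0" "q' * of_nat n \<in> \<int>" and L: "L > 0"
    and p: "p \<in> ramified n"
    and p': "\<And>q. pcoeff (p' - p) q \<noteq> 0 \<Longrightarrow> g \<le> q" and g': "g \<le> g'" "g' < 1"
    and u': "L > 1 \<Longrightarrow> lead p' (rv g') u r' qu 0 \<and> r' \<noteq> 0 \<and> vge (to_quot u) qu"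
    and z': "lead p' (rv g') z t' c 1" "t' \<noteq> 0" "vge (to_quot z) (c + g')"
    and indep: "\<And>i. i < L \<Longrightarrow> of_nat i * qu * of_nat n \<in> \<int> \<Longrightarrow> i = 0"
  shows "below p' g'"
  unfolding below_def
proof (intro ballI allI impI)
  fix f s assume f: "f \<in> wl" and ge: "gauss_ge p' (rv g') (rv s) f"
  let ?M = "exp_term n a L u z"
  obtain k :: nat where k: "s \<le> of_nat k" using real_arch_simple by blast
  from expansion[OF n g a u z L p f, of k] obtain h where h: "h \<in> real_span ?M"
    "gauss_ge p (rv g) (rv (of_nat k)) (f - h)" by blast
  have wlh: "f - h \<in> wl" using f real_span_wl[OF h(1) exp_term_wl] a u z by (intro wl_closed) auto
  have rest: "vge (to_quot (f - h)) s" using vge_mono[OF belowD[OF b wlh h(2)] k] .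
  have "gauss_ge p' (rv g') (rv (of_nat k)) (f - h)"
    by (rule gauss_ge_change[OF _ _ _ h(2)]) (use p' g g' in auto)
  hence "gauss_ge p' (rv g') (rv s) (f - h)" by (rule gauss_ge_mono) (use k in simp)
  hence hs: "gauss_ge p' (rv g') (rv s) h" using gauss_ge_diff[OF ge] by fastforce
  obtain I R where I: "finite I" and hI: "h = (\<Sum>x\<in>I. sconst (puiseux_monom (R x) 0) * ?M x)"
    using h(1) by (auto simp: real_span_def)
  have a': "lead p' (rv g') a 1 (1 / of_nat n) 0"
    by (rule lead_change[OF _ _ _ a(1)]) (use p' g g' in auto)
  define \<rho> S where "\<rho> x = r' ^ (snd x mod L) * t' ^ (snd x div L)"
    and "S x = of_int (fst x) / of_nat n + of_nat (snd x mod L) * qu + of_nat (snd x div L) * c" for x :: "int \<times> nat"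
  have lead: "lead p' (rv g') (?M x) (\<rho> x) (S x) (snd x div L) \<and> \<rho> x \<noteq> 0" for x
  proof -
    have "lead p' (rv g') (?M (fst x, snd x)) (\<rho> x) (S x) (snd x mod L * 0 + snd x div L * 1)"
      unfolding \<rho>_def S_def using u' z' L g' by (intro lead_exp_term[OF n _ a']) auto
    moreover have "\<rho> x \<noteq> 0"
    proof (cases "L > 1")
      case False
      hence "L = 1" using L by simp
      thus ?thesis using z' by (simp add: \<rho>_def)
    qed (use u' z' in \<open>auto simp: \<rho>_def\<close>)
    ultimately show ?thesis by simp
  qed
  have inj: "inj_on (\<lambda>x. (S x, snd x div L)) I"
    unfolding S_def using exp_term_inj[OF n indep L] by blast
  have "vge (to_quot (?M x)) s" if x: "x \<in> I" "R x \<noteq> 0" for x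
  proof -
    have "rv s \<le> wt (rv g') (S x) (snd x div L)"
      by (rule gauss_no_cancel(1)[where M = ?M and \<rho> = \<rho> and s = S and l = "\<lambda>x. snd x div L" and R = R,
          OF I lead inj hs[unfolded hI] x])
    hence s: "s \<le> S x + of_nat (snd x div L) * g'" by (simp add: wt_rv)
    have "vge (to_quot (stand_in n a (fst x))) (of_int (fst x) / of_nat n)"
      by (rule belowD[OF b]) (use a n g stand_in_wl lead_imp_ge[OF lead_stand_in] in force)+
    moreover have "vge (to_quot u ^ (snd x mod L)) (of_nat (snd x mod L) * qu)"
    proof (cases "L > 1")
      case False
      hence "L = 1" using L by simp
      thus ?thesis by (simp add: vge_1)
    qed (use u' in \<open>auto intro: vge_power\<close>)
    moreover have "vge (to_quot z ^ (snd x div L)) (of_nat (snd x div L) * (c + g'))"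
      using z' by (intro vge_power)
    ultimately have "vge (to_quot (stand_in n a (fst x)) * to_quot u ^ (snd x mod L) * to_quot z ^ (snd x div L))
        (of_int (fst x) / of_nat n + of_nat (snd x mod L) * qu + of_nat (snd x div L) * (c + g'))"
      by (intro vge_mult)
    moreover have "to_quot (?M x) = to_quot (stand_in n a (fst x)) * to_quot u ^ (snd x mod L) * to_quot z ^ (snd x div L)"
      by (cases x) (simp add: exp_term_def to_quot_mult to_quot_power)
    ultimately show ?thesis using s vge_mono by (simp add: S_def algebra_simps)
  qed
  hence "vge (\<Sum>x\<in>I. real_const (R x) * to_quot (?M x)) s"
    by (intro vge_sum) (metis mult_zero_left real_const_0 vge_0 vge_real_mult)
  hence "vge (to_quot h) s" by (simp add: hI to_quot_sum to_quot_mult to_quot_real)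
  from vge_add[OF this rest] show "vge (to_quot f) s" by (simp add: to_quot_diff)
qed

section \<open>Irrational values\<close>

text \<open>The clause on \<open>veq\<close> does not follow from the one on \<open>vge\<close>: G
  may exceed a rational t by an infinitesimal, and then the lower bounds alone do not distinguish z
  from an element of value t.\<close>

definition cut :: "weyl_ext \<Rightarrow> real poly \<Rightarrow> bool" where
  "cut z G \<longleftrightarrow> z \<in> K \<and> z \<noteq> 0 \<and> (\<forall>t. (vge z t \<longleftrightarrow> rv t < G) \<and> \<not> veq z t \<and> rv t \<noteq> G)"

lemma cut_vlt_power:
  assumes z: "cut z G" and C: "veq C (of_nat d * t)" and d: "d > 0"
  shows "rv t < G \<Longrightarrow> vlt C (z ^ d)" and "G < rv t \<Longrightarrow> vlt (z ^ d) C"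
proof -
  obtain n where n: "n > 0" "t * of_nat n \<in> \<int>" by (rule rat_denominator)
  then obtain m where m: "t * of_nat n = of_int m" by (auto elim: Ints_cases)
  hence t: "t = of_int m / of_nat n" using n by (simp add: field_simps)
  have K: "z \<in> K" "C \<in> K" "x_pow (- of_int m) \<in> K" "z ^ n \<in> K"
    using z veq_K[OF C] K_x_pow_minus K_power by (auto simp: cut_def)
  have "veq (C ^ n) (of_nat n * (of_nat d * t))" by (rule veq_power[OF C])
  moreover have nd: "of_nat n * (of_nat d * t) = of_nat d * of_int m"
    by (simp add: m[symmetric] mult_ac)
  have "veq (x_pow (- of_int m) ^ d) (of_nat n * (of_nat d * t))"
    unfolding nd using veq_power[OF veq_x_pow[of "- m"], of d] by simp
  ultimately have e: "veqv (C ^ n) (x_pow (- of_int m) ^ d)" by (rule veq_imp_veqv)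
  have zz: "(z ^ d) ^ n = (z ^ n) ^ d" by (simp add: power_mult[symmetric] mult.commute)
  have KK: "C ^ n \<in> K" "x_pow (- of_int m) ^ d \<in> K" "(z ^ n) ^ d \<in> K" "z ^ d \<in> K" using K K_power by auto
  {
    assume "rv t < G"
    hence "vge z t" "\<not> veq z t" using z by (auto simp: cut_def)
    hence "vlt (x_pow (- of_int m)) (z ^ n)"
      using vge_iff[OF n(1) K(1) t] veq_iff_power[OF K(1) n(1) t] by blast
    hence "vlt (x_pow (- of_int m) ^ d) ((z ^ n) ^ d)" using K d by (intro vlt_power)
    hence "vlt (C ^ n) ((z ^ d) ^ n)" unfolding zz using e KK vle_vlt_trans by blast
    thus "vlt C (z ^ d)" using vle_power[OF KK(4) K(2)] by blast
  }
  assume "G < rv t"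
  hence "\<not> vge z t" using z by (auto simp: cut_def)
  hence "vlt (z ^ n) (x_pow (- of_int m))" using vge_iff[OF n(1) K(1) t] by blast
  hence "vlt ((z ^ n) ^ d) (x_pow (- of_int m) ^ d)" using K d by (intro vlt_power)
  hence "vlt ((z ^ d) ^ n) (C ^ n)" unfolding zz using e KK vlt_vle_trans by blast
  thus "vlt (z ^ d) C" using vle_power[OF K(2) KK(4)] by blast
qed

lemma cut_mult_less:
  assumes "d > 0" "of_nat d * G < rv (of_nat d * t)"
  shows "G < rv t"
  using assms mult_left_mono[of "rv t" G "of_nat d"] by (force simp: rv_of_nat_mult not_less[symmetric])

lemma cut_mult_greater:
  assumes "d > 0" "rv (of_nat d * t) < of_nat d * G"
  shows "rv t < G"
  using assms mult_left_mono[of G "rv t" "of_nat d"] by (force simp: rv_of_nat_mult not_less[symmetric])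

text \<open>The comparison reduces to one of z^d with a quotient of B and B', whose value is
  rational. Quotients are formed on the left and powers of z cancelled on the right, since z need
  not commute with B.\<close>

lemma cut_less:
  assumes z: "cut z G" and B: "veq B s" and B': "veq B' s'"
    and less: "rv s + of_nat l * G < rv s' + of_nat l' * G"
  shows "vlt (B * z ^ l) (B' * z ^ l')"
proof -
  have nz: "B \<noteq> 0" "B' \<noteq> 0" "z \<noteq> 0" and K: "B \<in> K" "B' \<in> K" "z \<in> K"
    using z veq_K[OF B] veq_K[OF B'] B B' by (auto simp: cut_def veq_def)
  consider "l = l'" | "l < l'" | "l' < l" by linarith
  thus ?thesis
  proof cases
    case 1
    hence "s < s'" using less by simp
    hence "vlt B B'" using veq_vge_vlt[OF B veq_imp_vge[OF B']] by blast
    thus ?thesis using 1 K nz vle_cancel_right[of B' B "z ^ l"] K_power by simp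
  next
    case 2
    define d where "d = l' - l"
    have d: "d > 0" "l' = d + l" using 2 by (auto simp: d_def)
    define t where "t = (s - s') / of_nat d"
    have t: "of_nat d * t = s - s'" using d by (simp add: t_def)
    have "rv (s - s') < of_nat d * G" using less unfolding d(2) rv_diff by (simp add: algebra_simps)
    hence "rv t < G" using cut_mult_greater[OF d(1)] t by metis
    have C: "veq (inverse B' * B) (of_nat d * t)"
      using veq_mult[OF veq_inverse[OF B'] B] by (simp add: t)
    have "vlt (inverse B' * B) (z ^ d)" by (rule cut_vlt_power(1)[OF z C d(1) \<open>rv t < G\<close>])
    hence "vlt (B' * (inverse B' * B)) (B' * z ^ d)"
      using K nz by (subst vle_cancel_left) (auto intro!: K_mult K_inverse K_power)
    hence "vlt B (B' * z ^ d)" using nz by (simp add: mult.assoc[symmetric])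
    hence "vlt (B * z ^ l) (B' * z ^ d * z ^ l)"
      using K nz by (subst vle_cancel_right) (auto intro!: K_mult K_power)
    thus ?thesis by (simp add: d(2) power_add mult.assoc)
  next
    case 3
    define d where "d = l - l'"
    have d: "d > 0" "l = d + l'" using 3 by (auto simp: d_def)
    define t where "t = (s' - s) / of_nat d"
    have t: "of_nat d * t = s' - s" using d by (simp add: t_def)
    have "of_nat d * G < rv (s' - s)" using less unfolding d(2) rv_diff by (simp add: algebra_simps)
    hence "G < rv t" using cut_mult_less[OF d(1)] t by metis
    have C: "veq (inverse B * B') (of_nat d * t)"
      using veq_mult[OF veq_inverse[OF B] B'] by (simp add: t)
    have "vlt (z ^ d) (inverse B * B')" by (rule cut_vlt_power(2)[OF z C d(1) \<open>G < rv t\<close>])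
    hence "vlt (B * z ^ d) (B * (inverse B * B'))"
      using K nz by (subst vle_cancel_left) (auto intro!: K_mult K_inverse K_power)
    hence "vlt (B * z ^ d) B'" using nz by (simp add: mult.assoc[symmetric])
    hence "vlt (B * z ^ d * z ^ l') (B' * z ^ l')"
      using K nz by (subst vle_cancel_right) (auto intro!: K_mult K_power)
    thus ?thesis by (simp add: d(2) power_add mult.assoc)
  qed
qed

lemma cut_less_vge:
  assumes z: "cut z G" and B: "veq B s" and less: "rv s + of_nat l * G < rv (of_nat k)" and h: "vge h (of_nat k)"
  shows "vlt (B * z ^ l) h"
proof -
  have x: "veq (x_pow (- of_nat k)) (of_nat k)" using veq_x_pow[of "- int k"] by simp
  have "vlt (B * z ^ l) (x_pow (- of_nat k) * z ^ 0)" using less by (intro cut_less[OF z B x]) simp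
  hence "vlt (B * z ^ l) (x_pow (- of_nat k))" by simp
  moreover have "vle (x_pow (- of_nat k)) h" by (rule veq_vge_vle[OF x h])
  moreover have "B * z ^ l \<in> K" "x_pow (- of_nat k) \<in> K" "h \<in> K"
    using veq_K[OF B] veq_K[OF x] vge_K[OF h] z by (auto simp: cut_def intro!: K_mult K_power)
  ultimately show ?thesis using vlt_vle_trans by blast
qed

lemma vlt_sum:
  assumes "c \<in> K" "c \<noteq> 0" "\<And>x. x \<in> A \<Longrightarrow> F x \<in> K \<and> vlt c (F x)"
  shows "sum F A \<in> K \<and> vlt c (sum F A)"
  using assms(3)
proof (induction A rule: infinite_finite_induct)
  case (insert x A)
  hence "F x \<in> K \<and> vlt c (F x)" "sum F A \<in> K \<and> vlt c (sum F A)" by blast+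
  thus ?case using insert assms(1) vlt_add K_add by simp
qed (use assms vle_0D in auto)

text \<open>Expand h and f up to a bound k beyond the leading weight of h. Since G is irrational,
  that weight belongs to a single term of the expansion of h; all its other terms and all terms of f
  weigh more, and by \<open>cut_less\<close> the valuation orders terms as their weights do. So h
  has the value of that one term and f a larger one.\<close>

lemma irrational_vlt:
  assumes n: "n > 0" and a: "lead p G a 1 (1 / of_nat n) 0" "a \<in> wl" "\<And>e. veq (to_quot (stand_in n a e)) (of_int e / of_nat n)"
    and u: "L > 1 \<Longrightarrow> lead p G u r qu 0 \<and> r \<noteq> 0 \<and> veq (to_quot u) qu" "u \<in> wl"
    and z: "lead p G z t c 1" "t \<noteq> 0" "z \<in> wl" "cut (to_quot z) (G + rv c)"
    and L: "L > 0" and indep: "\<And>i. i < L \<Longrightarrow> of_nat i * qu * of_nat n \<in> \<int> \<Longrightarrow> i = 0"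
    and G: "G < rv 1" "\<And>t. rv t \<noteq> G"
    and expand: "\<And>f k. f \<in> wl \<Longrightarrow> \<exists>h\<in>real_span (exp_term n a L u z).
      gauss_ge p G (rv (of_nat k)) (f - h) \<and> vge (to_quot (f - h)) (of_nat k)"
    and h: "h \<in> wl" "lead p G h r0 s l" "r0 \<noteq> 0" and f: "f \<in> wl" "gauss_gt p G (wt G s l) f"
  shows "vlt (to_quot h) (to_quot f)"
proof -
  let ?M = "exp_term n a L u z"
  define \<rho> S where "\<rho> x = r ^ (snd x mod L) * t ^ (snd x div L)"
    and "S x = of_int (fst x) / of_nat n + of_nat (snd x mod L) * qu + of_nat (snd x div L) * c" for x :: "int \<times> nat"
  let ?l = "\<lambda>x :: int \<times> nat. snd x div L"
  have lead: "lead p G (?M x) (\<rho> x) (S x) (?l x) \<and> \<rho> x \<noteq> 0" for x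
  proof -
    have "lead p G (?M (fst x, snd x)) (\<rho> x) (S x) (snd x mod L * 0 + snd x div L * 1)"
      unfolding \<rho>_def S_def using u z L G by (intro lead_exp_term[OF n _ a(1)]) auto
    moreover have "\<rho> x \<noteq> 0"
    proof (cases "L > 1")
      case False
      hence "L = 1" using L by simp
      thus ?thesis using z by (simp add: \<rho>_def)
    qed (use u z in \<open>auto simp: \<rho>_def\<close>)
    ultimately show ?thesis by simp
  qed
  have inj: "inj_on (\<lambda>x. (S x, ?l x)) I" for I
    unfolding S_def using exp_term_inj[OF n indep L] by blast
  define B where "B x = to_quot (stand_in n a (fst x)) * to_quot u ^ (snd x mod L)" for x
  have MB: "to_quot (?M x) = B x * to_quot z ^ ?l x" for x
    by (cases x) (simp add: exp_term_def to_quot_mult to_quot_power B_def)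
  have B: "veq (B x) (of_int (fst x) / of_nat n + of_nat (snd x mod L) * qu)" for x
  proof -
    have "veq (to_quot u ^ (snd x mod L)) (of_nat (snd x mod L) * qu)"
    proof (cases "L > 1")
      case False
      hence "L = 1" using L by simp
      thus ?thesis by (simp add: veq_1)
    qed (use u in \<open>auto intro: veq_power\<close>)
    thus ?thesis unfolding B_def by (intro veq_mult a)
  qed
  have wtB: "wt G (S x) (?l x) = rv (of_int (fst x) / of_nat n + of_nat (snd x mod L) * qu) + of_nat (?l x) * (G + rv c)" for x
    unfolding wt_def S_def rv_add rv_of_nat_mult by (simp add: distrib_left)
  have MK: "to_quot (?M x) \<in> K" for x using wl_K exp_term_wl a u z by blast
  have Mnz: "to_quot (?M x) \<noteq> 0" for x
    using B[of x] z unfolding MB by (auto simp: veq_def cut_def)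
  have less: "vlt (to_quot (?M x)) (to_quot (?M y))" if "wt G (S x) (?l x) < wt G (S y) (?l y)" for x y
    unfolding MB using that unfolding wtB by (intro cut_less[OF z(4) B B])
  obtain k where k: "wt G s l < rv (of_nat k)" by (rule wt_bound[OF G(1)])
  obtain H where H: "H \<in> real_span ?M" "gauss_ge p G (rv (of_nat k)) (h - H)" "vge (to_quot (h - H)) (of_nat k)"
    using expand[OF h(1)] by blast
  obtain F where F: "F \<in> real_span ?M" "gauss_ge p G (rv (of_nat k)) (f - F)" "vge (to_quot (f - F)) (of_nat k)"
    using expand[OF f(1)] by blast
  obtain I R where I: "finite I" and HI: "H = (\<Sum>x\<in>I. sconst (puiseux_monom (R x) 0) * ?M x)"
    using H(1) by (auto simp: real_span_def)
  obtain J Q where J: "finite J" and FJ: "F = (\<Sum>x\<in>J. sconst (puiseux_monom (Q x) 0) * ?M x)"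
    using F(1) by (auto simp: real_span_def)
  have "gauss_gt p G (wt G s l) (h - H)" using gauss_ge_imp_gt[OF H(2) k] .
  hence leadH: "lead p G H r0 s l" using lead_cong[OF h(2), of H] gauss_gt_uminus[of p G _ "h - H"] by simp
  have "gauss_gt p G (wt G s l) F"
    using gauss_gt_diff[OF f(2) gauss_ge_imp_gt[OF F(2) k]] by simp
  hence Fx: "wt G s l < wt G (S x) (?l x)" if "x \<in> J" "Q x \<noteq> 0" for x
    by (intro gauss_no_cancel(2)[where M = ?M and \<rho> = \<rho> and s = S and l = ?l and R = Q,
        OF J lead inj _ that]) (simp add: FJ)
  have Hx: "wt G s l \<le> wt G (S x) (?l x)" if "x \<in> I" "R x \<noteq> 0" for x
    by (rule gauss_no_cancel(1)[where M = ?M and \<rho> = \<rho> and s = S and l = ?l and R = R,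
        OF I lead inj lead_imp_ge[OF leadH, unfolded HI] that])
  have "cf (shift p H) l s \<noteq> 0" using lead_coeff_eq[OF leadH] h(3) by simp
  hence "(\<Sum>x\<in>I. cf (shift p (sconst (puiseux_monom (R x) 0) * ?M x)) l s) \<noteq> 0"
    by (simp add: HI shift_sum cf_sum)
  then obtain x0 where x0: "x0 \<in> I" "cf (shift p (sconst (puiseux_monom (R x0) 0) * ?M x0)) l s \<noteq> 0"
    by (meson sum.neutral)
  hence R0: "R x0 \<noteq> 0" and c0: "cf (shift p (?M x0)) l s \<noteq> 0"
    by (auto simp: shift_sconst_mult cf_def pcoeff_monom_mult)
  have "cf (shift p (?M x0 - mon p (\<rho> x0) (S x0) (?l x0))) l s = 0"
    using gauss_gtD[of p G "wt G (S x0) (?l x0)" "?M x0 - mon p (\<rho> x0) (S x0) (?l x0)" l s]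
      lead[of x0] Hx[OF x0(1) R0] unfolding lead_def by force
  hence e0: "s = S x0 \<and> l = ?l x0" using c0 by (auto simp: shift_diff cf_shift_mon split: if_splits)
  let ?m = "to_quot (?M x0)"
  have rest: "vlt ?m g" if "vge g (of_nat k)" for g
  proof -
    have "rv (of_int (fst x0) / of_nat n + of_nat (snd x0 mod L) * qu) + of_nat (?l x0) * (G + rv c) < rv (of_nat k)"
      using k e0 wtB[of x0] by simp
    thus ?thesis unfolding MB by (rule cut_less_vge[OF z(4) B _ that])
  qed
  have Fsum: "to_quot F = (\<Sum>x\<in>J. real_const (Q x) * to_quot (?M x))"
    by (simp add: FJ to_quot_sum to_quot_mult to_quot_real)
  have "to_quot F \<in> K \<and> vlt ?m (to_quot F)" unfolding Fsum
  proof (rule vlt_sum[OF MK Mnz])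
    fix x assume x: "x \<in> J"
    have "vlt ?m (real_const (Q x) * to_quot (?M x))"
    proof (cases "Q x = 0")
      case True
      thus ?thesis using vle_0D[OF MK[of x0]] Mnz[of x0] by auto
    next
      case False
      hence "vlt ?m (to_quot (?M x))" using Fx[OF x False] e0 less by simp
      thus ?thesis by (rule vlt_real_mult[OF MK MK])
    qed
    thus "real_const (Q x) * to_quot (?M x) \<in> K \<and> vlt ?m (real_const (Q x) * to_quot (?M x))"
      using K_mult[OF K_real MK] by blast
  qed
  hence "vlt ?m (to_quot F + to_quot (f - F))"
    using rest[OF F(3)] vge_K[OF F(3)] MK by (intro vlt_add) auto
  hence f1: "vlt ?m (to_quot f)" by (simp add: to_quot_diff)
  have Hsum: "to_quot H = real_const (R x0) * ?m + (\<Sum>x\<in>I - {x0}. real_const (R x) * to_quot (?M x))"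
    unfolding HI to_quot_sum to_quot_mult to_quot_real by (rule sum.remove[OF I x0(1)])
  have "(\<Sum>x\<in>I - {x0}. real_const (R x) * to_quot (?M x)) \<in> K \<and> vlt ?m (\<Sum>x\<in>I - {x0}. real_const (R x) * to_quot (?M x))"
    (is "?T \<in> K \<and> _")
  proof (rule vlt_sum[OF MK Mnz])
    fix x assume x: "x \<in> I - {x0}"
    have "vlt ?m (real_const (R x) * to_quot (?M x))"
    proof (cases "R x = 0")
      case True
      thus ?thesis using vle_0D[OF MK[of x0]] Mnz[of x0] by auto
    next
      case False
      have "wt G s l \<noteq> wt G (S x) (?l x)"
      proof
        assume "wt G s l = wt G (S x) (?l x)"
        hence "s = S x \<and> l = ?l x" by (rule irrational_wt_eq[OF G(2)])
        thus False using inj[of I] e0 x x0(1) unfolding inj_on_def by auto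
      qed
      hence "wt G s l < wt G (S x) (?l x)" using Hx[of x] False x by simp
      hence "vlt ?m (to_quot (?M x))" using e0 less[of x0 x] by simp
      thus ?thesis by (rule vlt_real_mult[OF MK MK])
    qed
    thus "real_const (R x) * to_quot (?M x) \<in> K \<and> vlt ?m (real_const (R x) * to_quot (?M x))"
      using K_mult[OF K_real MK] by blast
  qed
  hence T: "?T + to_quot (h - H) \<in> K" "vlt ?m (?T + to_quot (h - H))"
    using K_add[OF _ vge_K[OF H(3)], of ?T] vlt_add[OF _ vge_K[OF H(3)] MK _ rest[OF H(3)], of ?T] by blast+
  have m: "real_const (R x0) * ?m \<in> K" "veqv (real_const (R x0) * ?m) ?m"
    using K_mult[OF K_real MK] veqv_real_mult[OF MK R0] by auto
  have "vlt (real_const (R x0) * ?m) (- (?T + to_quot (h - H)))"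
    using vle_vlt_trans[OF m(1) MK T(1)] m(2) T vle_uminus_left[OF T(1) m(1)] by blast
  hence "veqv (real_const (R x0) * ?m) (real_const (R x0) * ?m - - (?T + to_quot (h - H)))"
    using m T K_uminus by (intro vlt_imp_veqv_diff)
  moreover have "real_const (R x0) * ?m - - (?T + to_quot (h - H)) = to_quot h"
    by (simp add: to_quot_diff Hsum)
  ultimately have "vle (to_quot h) (real_const (R x0) * ?m)" by simp
  hence "vle (to_quot h) ?m" using m vle_trans[OF wl_K[OF h(1)] m(1) MK] by blast
  thus ?thesis using f1 vle_vlt_trans[OF wl_K[OF h(1)] MK wl_K[OF f(1)]] by blast
qed

end

section \<open>Elements that are linear in \<open>y - p\<close> up to smaller terms\<close>

text \<open>Stated for values g' strictly between g and 1, because at g itself further terms of the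
  same weight are allowed. The number h measures the constant term of f at p: f looks like r x^(-k)
  (y - p) as long as y - p has a value below h.\<close>

definition lin :: "puiseux \<Rightarrow> rat \<Rightarrow> spoly \<Rightarrow> real \<Rightarrow> rat \<Rightarrow> rat \<Rightarrow> bool" where
  "lin p g f r k h \<longleftrightarrow> (\<forall>g'. rv g < g' \<longrightarrow> g' < rv 1 \<longrightarrow> lead p g' (dy f) r k 0) \<and>
     (\<forall>q. cf (shift p f) 0 q \<noteq> 0 \<longrightarrow> k + h \<le> q)"

text \<open>Up to positive integer factors, \<open>dy f\<close> has the coefficients of f of
  positive degree. A leading constant of \<open>dy f\<close> is thus a leading linear term of f once
  the constant term of f is large enough.\<close>

lemma lead_of_dy:
  assumes d: "lead p g (dy f) r k 0" and c: "\<And>q. cf (shift p f) 0 q \<noteq> 0 \<Longrightarrow> rv k + g < rv q"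
  shows "lead p g f r k 1"
  unfolding lead_def gauss_gt_def
proof (intro allI impI)
  fix i s assume a: "cf (shift p (f - mon p r k 1)) i s \<noteq> 0"
  show "wt g k 1 < wt g s i"
  proof (cases i)
    case 0
    hence "cf (shift p f) 0 s \<noteq> 0" using a by (simp add: shift_diff cf_shift_mon)
    thus ?thesis using c 0 by (simp add: wt_def)
  next
    case (Suc j)
    hence "cf (shift p (dy f - mon p r k 0)) j s \<noteq> 0"
      using a by (auto simp: shift_diff cf_shift_mon shift_dy cf_dy split: if_splits simp del: of_nat_Suc)
    hence "wt g k 0 < wt g s j" using d gauss_gtD unfolding lead_def by blast
    thus ?thesis using Suc by (simp add: wt_def algebra_simps)
  qed
qed

lemma lin_lead: "lin p g f r k h \<Longrightarrow> rv g < g' \<Longrightarrow> g' < rv 1 \<Longrightarrow> g' < rv h \<Longrightarrow> lead p g' f r k 1"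
  by (rule lead_of_dy) (auto simp: lin_def rv_add intro: less_le_trans dest!: rv_le_iff[THEN iffD2])

lemma lin_of_lead:
  assumes "lead p (rv g) (dy f) r k 0" "g < 1" "\<And>q. cf (shift p f) 0 q \<noteq> 0 \<Longrightarrow> k + h \<le> q"
  shows "lin p g f r k h"
  unfolding lin_def using assms lead_change[OF _ _ _ assms(1), of p]
  by (auto simp: zero_puiseux.rep_eq)

lemma pcoeff_ge_change:
  fixes q g :: rat
  shows "pcoeff (p'' - p) q \<noteq> 0 \<Longrightarrow> (\<And>q. pcoeff (p' - p) q \<noteq> 0 \<Longrightarrow> g < q) \<Longrightarrow>
    (\<And>q. pcoeff (p'' - p') q \<noteq> 0 \<Longrightarrow> g < q) \<Longrightarrow> g < q"
  by (cases "pcoeff (p' - p) q = 0") (auto simp: minus_puiseux.rep_eq)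

text \<open>
  Newton's method; only finitely many steps are needed because approximation up to a term of
  relative value \<open>1\<close> suffices.
\<close>

lemma newton:
  assumes f: "f \<in> wl" and p: "p \<in> ramified n" and n: "n > 0" and g: "g < 1"
    and d: "lead p (rv g) (dy f) r k 0" "r \<noteq> 0"
    and c: "\<And>q. cf (shift p f) 0 q \<noteq> 0 \<Longrightarrow> k + g < q"
  obtains p' where "p' \<in> ramified n" "\<And>q. pcoeff (p' - p) q \<noteq> 0 \<Longrightarrow> g < q"
    "\<And>q. cf (shift p' f) 0 q \<noteq> 0 \<Longrightarrow> k + 1 \<le> q"
proof -
  \<comment> \<open>The numerator of the first multiple of 1/n beyond k + g. Each step of the
    iteration raises the bound for the constant term by 1/n.\<close>
  define k0 where "k0 = \<lfloor>(k + g) * of_nat n\<rfloor> + 1"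
  have kn: "k * of_nat n \<in> \<int>"
    using wl_ramified[OF wl_dy[OF f] p] lead_coeff_eq[OF d(1)] d(2)
    by (auto simp: skew_over_def ramified_def cf_def)
  have int: "q * of_nat n \<in> \<int>" if "cf (shift p' f) i q \<noteq> 0" "p' \<in> ramified n" for p' i q
    using wl_ramified[OF f that(2)] that(1) by (auto simp: skew_over_def ramified_def cf_def)
  have main: "\<exists>p'\<in>ramified n. (\<forall>q. pcoeff (p' - p) q \<noteq> 0 \<longrightarrow> g < q) \<and>
      (\<forall>q. cf (shift p' f) 0 q \<noteq> 0 \<longrightarrow> min (of_int (k0 + int j)) ((k + 1) * of_nat n) \<le> q * of_nat n)" for j
  proof (induction j)
    case 0
    have "min (of_int (k0 + int 0)) ((k + 1) * of_nat n) \<le> q * of_nat n" if "cf (shift p f) 0 q \<noteq> 0" for q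
    proof -
      have "(k + g) * of_nat n < q * of_nat n" using c[OF that] n by simp
      from Ints_less_imp[OF int[OF that p] this] show ?thesis by (intro min.coboundedI1) (simp add: k0_def)
    qed
    thus ?case using p by (intro bexI[of _ p]) (auto simp: zero_puiseux.rep_eq)
  next
    case (Suc j)
    then obtain p' where p': "p' \<in> ramified n" "\<And>q. pcoeff (p' - p) q \<noteq> 0 \<Longrightarrow> g < q"
      "\<And>q. cf (shift p' f) 0 q \<noteq> 0 \<Longrightarrow> min (of_int (k0 + int j)) ((k + 1) * of_nat n) \<le> q * of_nat n" by blast
    show ?case
    proof (cases "of_int (k0 + int j) \<ge> (k + 1) * of_nat n")
      case True
      thus ?thesis using p' by (intro bexI[of _ p']) auto
    next
      case False
      define s where "s = of_int (k0 + int j) / (of_nat n :: rat)"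
      define h where "h = s - k"
      have sn: "s * of_nat n = of_int (k0 + int j)" using n by (simp add: s_def)
      have "s < k + 1" using False n by (simp add: s_def pos_divide_less_eq)
      hence h1: "h < 1" by (simp add: h_def)
      have "(k + g) * of_nat n < of_int k0" unfolding k0_def by linarith
      also have "\<dots> \<le> of_int (k0 + int j)" by simp
      finally have "k + g < s" using n by (simp add: s_def pos_less_divide_eq)
      hence gh: "g < h" by (simp add: h_def)
      have cs: "s \<le> q" if "cf (shift p' f) 0 q \<noteq> 0" for q
      proof -
        have "of_int (k0 + int j) \<le> q * of_nat n" using p'(3)[OF that] False by linarith
        thus ?thesis using n by (simp add: s_def pos_divide_le_eq)
      qed
      \<comment> \<open>The constant term c0 x^(-s) is absorbed into r x^(-k) (y - p') by moving the
        zero: p' loses c0/r times x^(-(s - k)).\<close>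
      define c0 where "c0 = cf (shift p' f) 0 s"
      define p'' where "p'' = p' - puiseux_monom (c0 / r) (- h)"
      have eq: "mon p' c0 s 0 + mon p' r k 1 = mon p'' r k 1"
      proof -
        have "mon p'' r k 1 = mon p' r k 1 + sconst (puiseux_monom r (- k)) * sconst (puiseux_monom (c0 / r) (- h))"
          by (simp add: mon_def p''_def sconst_diff algebra_simps)
        thus ?thesis using d(2) by (simp add: sconst_mult[symmetric] puiseux_monom_mult mon_const h_def add.commute)
      qed
      have "lead p' (rv h) (dy f) r k 0"
        by (rule lead_change[OF _ _ _ d(1)]) (use p' g gh in \<open>auto intro: less_imp_le\<close>)
      moreover have "dy (f - mon p' c0 s 0) = dy f" by (simp add: dy_diff mon_const)
      moreover have "rv k + rv h < rv q" if "cf (shift p' (f - mon p' c0 s 0)) 0 q \<noteq> 0" for q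
      proof -
        have "q \<noteq> s" using that by (auto simp: shift_diff cf_shift_mon c0_def)
        moreover have "s \<le> q" using that cs by (auto simp: shift_diff cf_shift_mon split: if_splits)
        ultimately show ?thesis by (simp add: rv_add[symmetric] h_def)
      qed
      ultimately have "lead p' (rv h) (f - mon p' c0 s 0) r k 1" by (intro lead_of_dy) auto
      hence "gauss_gt p' (rv h) (wt (rv h) k 1) (f - (mon p' c0 s 0 + mon p' r k 1))"
        by (simp add: lead_def diff_diff_eq)
      hence "gauss_gt p' (rv h) (wt (rv h) k 1) (f - mon p'' r k 1)" unfolding eq .
      hence gt: "gauss_gt p'' (rv h) (rv s) (f - mon p'' r k 1)"
        by (intro gauss_gt_change[of p'' p' "rv h"])
          (use h1 in \<open>auto simp: p''_def minus_puiseux.rep_eq uminus_puiseux.rep_eq puiseux_monom.rep_eq wt_rv h_def split: if_splits\<close>)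
      have r'': "p'' \<in> ramified n"
      proof -
        have "h * of_nat n = of_int (k0 + int j) - k * of_nat n" by (simp add: h_def left_diff_distrib sn)
        hence "h * of_nat n \<in> \<int>" using kn by (metis Ints_diff Ints_of_int)
        hence "puiseux_monom (c0 / r) (- h) \<in> ramified n"
          by (auto simp: ramified_def puiseux_monom.rep_eq)
        thus ?thesis unfolding p''_def by (intro dsubringD(2)[OF dsubring_ramified] p')
      qed
      have "min (of_int (k0 + int (Suc j))) ((k + 1) * of_nat n) \<le> q * of_nat n" if q: "cf (shift p'' f) 0 q \<noteq> 0" for q
      proof -
        have "cf (shift p'' (f - mon p'' r k 1)) 0 q \<noteq> 0" using q by (simp add: shift_diff cf_shift_mon)
        hence "s < q" using gauss_gtD[OF gt] by fastforce
        hence "of_int (k0 + int j) < q * of_nat n" using n sn by (metis mult_strict_right_mono of_nat_0_less_iff)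
        from Ints_less_imp[OF int[OF q r''] this] show ?thesis by (simp add: add.assoc)
      qed
      moreover have "g < q" if "pcoeff (p'' - p) q \<noteq> 0" for q
        using that by (rule pcoeff_ge_change[OF _ p'(2)])
          (use gh in \<open>auto simp: p''_def minus_puiseux.rep_eq uminus_puiseux.rep_eq puiseux_monom.rep_eq split: if_splits\<close>)
      ultimately show ?thesis using r'' by blast
    qed
  qed
  obtain j :: nat where "(k + 1) * of_nat n - of_int k0 \<le> of_nat j" using real_arch_simple by blast
  hence j: "(k + 1) * of_nat n \<le> of_int (k0 + int j)" by simp
  obtain p' where p': "p' \<in> ramified n" "\<And>q. pcoeff (p' - p) q \<noteq> 0 \<Longrightarrow> g < q"
    "\<And>q. cf (shift p' f) 0 q \<noteq> 0 \<Longrightarrow> min (of_int (k0 + int j)) ((k + 1) * of_nat n) \<le> q * of_nat n"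
    using main[of j] by blast
  have "k + 1 \<le> q" if "cf (shift p' f) 0 q \<noteq> 0" for q
  proof -
    have "(k + 1) * of_nat n \<le> q * of_nat n" using p'(3)[OF that] j by linarith
    thus ?thesis using n by simp
  qed
  thus thesis using that p' by blast
qed

text \<open>The Leibniz rule; u and \<open>dy u\<close> need not commute, but their leading terms
  do.\<close>

lemma lead_dy_power:
  assumes g: "g < rv 1" and u: "lead p g u c q 0" and d: "lead p g (dy u) r k 0"
  shows "lead p g (dy (u ^ Suc N)) (of_nat (Suc N) * c ^ N * r) (of_nat N * q + k) 0"
proof (induction N)
  case 0
  thus ?case using d by simp
next
  case (Suc N)
  have "dy (u ^ Suc (Suc N)) = dy u * u ^ Suc N + u * dy (u ^ Suc N)" by (simp only: power_Suc dy_mult)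
  moreover have "lead p g (dy u * u ^ Suc N) (r * c ^ Suc N) (of_nat (Suc N) * q + k) 0"
    using lead_mult[OF g d lead_power[OF g u, of "Suc N"]] by (simp only: mult_0_right add_0_right add.commute)
  moreover have "lead p g (u * dy (u ^ Suc N)) (of_nat (Suc N) * c ^ Suc N * r) (of_nat (Suc N) * q + k) 0"
    using lead_mult[OF g u Suc] by (simp add: algebra_simps)
  ultimately have "lead p g (dy (u ^ Suc (Suc N))) (r * c ^ Suc N + of_nat (Suc N) * c ^ Suc N * r) (of_nat (Suc N) * q + k) 0"
    by (simp only: lead_add)
  moreover have "r * c ^ Suc N + of_nat (Suc N) * c ^ Suc N * r = of_nat (Suc (Suc N)) * c ^ Suc N * r"
    by (simp add: algebra_simps)
  ultimately show ?case by simp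
qed

text \<open>
  The leading constants of the two summands cancel, but the first one still dominates the derivative.
\<close>

lemma lin_power_diff:
  assumes G: "G < 1" and u: "\<And>g. rv G < g \<Longrightarrow> g < rv 1 \<Longrightarrow> lead p g u c q 0"
    and d: "\<And>g. rv G < g \<Longrightarrow> g < rv 1 \<Longrightarrow> lead p g (dy u) r k 0" and N: "N > 0"
    and h: "\<And>g. rv G < g \<Longrightarrow> g < rv 1 \<Longrightarrow> lead p g h (c ^ N) (of_nat N * q - m) 0"
    and dh: "\<And>g. rv G < g \<Longrightarrow> g < rv 1 \<Longrightarrow> gauss_gt p g (rv (of_nat (N - 1) * q + k - m)) (dy h)"
    and G_eq: "k + G = q"
  obtains H where "G < H"
    "lin p G (sconst (puiseux_monom 1 m) * u ^ N - h) (of_nat N * c ^ (N - 1) * r) (of_nat (N - 1) * q + k - m) H"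
proof -
  let ?F = "sconst (puiseux_monom 1 m) * u ^ N - h" and ?k = "of_nat (N - 1) * q + k - m"
  obtain N' where N': "N = Suc N'" using N by (cases N) auto
  have dF: "lead p g (dy ?F) (of_nat N * c ^ (N - 1) * r) ?k 0" if g: "rv G < g" "g < rv 1" for g
  proof -
    have "lead p g (sconst (puiseux_monom 1 (- (- m))) * dy (u ^ N)) (1 * (of_nat N * c ^ (N - 1) * r))
        (- m + (of_nat (N - 1) * q + k)) 0"
      using lead_sconst_mult[OF g(2) lead_dy_power[OF g(2) u[OF g] d[OF g], of N'], of 1 "- m"] by (simp only: N' diff_Suc_1)
    hence "lead p g (dy (sconst (puiseux_monom 1 m) * u ^ N)) (of_nat N * c ^ (N - 1) * r) ?k 0"
      by (simp add: dy_mult add.commute)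
    moreover have "gauss_gt p g (wt g ?k 0) (dy ?F - dy (sconst (puiseux_monom 1 m) * u ^ N))"
      using dh[OF g] by (simp add: dy_diff)
    ultimately show ?thesis by (rule lead_cong)
  qed
  \<comment> \<open>The common value of the two constants that cancel. It equals
    \<open>?k + G\<close>, so what remains of the constant term lies beyond \<open>?k + G\<close>,
    which makes room for some H > G.\<close>
  define s where "s = of_nat N * q - m"
  have s: "?k + G = s" by (simp add: s_def N' G_eq[symmetric] algebra_simps)
  have gt: "s < t" if "cf (shift p ?F) 0 t \<noteq> 0" for t
  proof -
    obtain g where g: "G < g" "g < 1" using dense[OF G] by blast
    have g': "rv G < rv g" "rv g < rv 1" using g by auto
    have "lead p (rv g) (sconst (puiseux_monom 1 (- (- m))) * u ^ N) (1 * c ^ N) (- m + of_nat N * q) 0"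
      using lead_power[OF g'(2) u[OF g'], of N] by (intro lead_sconst_mult[OF g'(2)]) simp
    hence "lead p (rv g) (sconst (puiseux_monom 1 m) * u ^ N) (c ^ N) (of_nat N * q - m) 0" by simp
    hence "lead p (rv g) ?F 0 (of_nat N * q - m) 0" using lead_diff[OF _ h[OF g']] by fastforce
    hence "gauss_gt p (rv g) (rv s) ?F" by (simp add: lead_0_iff s_def)
    thus ?thesis using gauss_gtD[of p "rv g" "rv s" ?F 0 t] that by simp
  qed
  show thesis
  proof (cases "scoeff (shift p ?F) 0 = 0")
    case True
    \<comment> \<open>Any H > G serves when there is no constant term.\<close>
    hence "lin p G ?F (of_nat N * c ^ (N - 1) * r) ?k (G + 1)"
      using dF by (simp add: lin_def cf_def zero_puiseux.rep_eq)
    thus thesis using that[of "G + 1"] by simp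
  next
    case False
    then obtain t where t: "pcoeff (scoeff (shift p ?F) 0) t \<noteq> 0" "\<forall>q<t. pcoeff (scoeff (shift p ?F) 0) q = 0"
      by (rule puiseux_lead)
    have "s < t" using gt t(1) by (simp add: cf_def)
    moreover have "lin p G ?F (of_nat N * c ^ (N - 1) * r) ?k (t - ?k)"
      using dF t(2) by (auto simp: lin_def cf_def not_less[symmetric])
    ultimately show thesis using that[of "t - ?k"] s by simp
  qed
qed

section \<open>Cuts of the rational numbers\<close>

lemma rv_less_pCons: "rv t < [:e, s:] \<longleftrightarrow> of_rat t < s \<or> of_rat t = s \<and> 0 < e"
  by (auto simp: rv_def less_poly_def pos_poly_pCons)

text \<open>If C holds somewhere but not everywhere, its supremum s gives the polynomial s X. For
  rational s an added constant 1 or - 1, which is infinitesimal, decides on which side s lies; the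
  two extreme cases use X^2 and - X^2.\<close>

lemma rational_cut_ex:
  assumes C: "\<And>t t'. t \<le> t' \<Longrightarrow> C t' \<Longrightarrow> C t"
  shows "\<exists>G. \<forall>t. (C t \<longleftrightarrow> rv t < G) \<and> rv t \<noteq> G"
proof -
  consider "\<forall>t. \<not> C t" | "\<forall>t. C t" | a b where "C a" "\<not> C b" by blast
  thus ?thesis
  proof cases
    case 1
    thus ?thesis by (intro exI[of _ "[:0, 0, - 1:]"]) (simp add: rv_def less_poly_def pos_poly_pCons)
  next
    case 2
    thus ?thesis by (intro exI[of _ "[:0, 0, 1:]"]) (simp add: rv_def less_poly_def pos_poly_pCons)
  next
    case 3
    define s :: real where "s = Sup (of_rat ` {t. C t})"
    have bdd: "of_rat t \<le> (of_rat b :: real)" if "C t" for t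
      using C[of b t] that 3 by (simp add: of_rat_less_eq) (meson linear)
    have up: "of_rat t \<le> s" if "C t" for t
      unfolding s_def using that bdd by (intro cSup_upper bdd_aboveI[of _ "of_rat b"]) auto
    have low: "C t" if "of_rat t < s" for t
    proof -
      have "\<exists>y\<in>of_rat ` {t. C t}. of_rat t < (y :: real)"
        using that 3 unfolding s_def by (subst (asm) less_cSup_iff) (use bdd in \<open>auto intro!: bdd_aboveI[of _ "of_rat b"]\<close>)
      then obtain t' where "C t'" "t < t'" by (auto simp: of_rat_less)
      thus ?thesis using C[of t t'] by simp
    qed
    show ?thesis
    proof (cases "\<exists>t. of_rat t = s")
      case False
      have "rv t \<noteq> [:0, s:]" for t using False by (simp add: rv_def)
      moreover have "C t \<longleftrightarrow> rv t < [:0, s:]" for t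
        using low[of t] up[of t] False by (auto simp: rv_less_pCons order_le_less)
      ultimately show ?thesis by blast
    next
      case True
      then obtain t0 where t0: "of_rat t0 = s" by blast
      define e :: real where "e = (if C t0 then 1 else - 1)"
      have "rv t \<noteq> [:e, s:]" for t by (simp add: rv_def e_def)
      moreover have "C t \<longleftrightarrow> rv t < [:e, s:]" for t
      proof (cases "t = t0")
        case True
        thus ?thesis using t0 by (auto simp: rv_less_pCons e_def)
      next
        case False
        hence "of_rat t \<noteq> s" using t0 by auto
        thus ?thesis using low[of t] up[of t] by (auto simp: rv_less_pCons)
      qed
      ultimately show ?thesis by blast
    qed
  qed
qed

text \<open>The order L of q in the rationals modulo multiples of 1/n is the ramification caused by
  adjoining the power of x with exponent q.\<close>

lemma least_multiple:
  fixes q :: rat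
  assumes n: "n > 0"
  obtains L :: nat and e where "L > 0" "of_nat L * q * of_nat n = of_int e"
    "\<And>i. i < L \<Longrightarrow> of_nat i * q * of_nat n \<in> \<int> \<Longrightarrow> i = 0"
proof -
  let ?P = "\<lambda>L::nat. L > 0 \<and> of_nat L * q * of_nat n \<in> \<int>"
  obtain m where m: "m > 0" "q * of_nat m \<in> \<int>" by (rule rat_denominator)
  have "q * of_nat m * of_nat n \<in> \<int>" by (rule Ints_mult[OF m(2) Ints_of_nat])
  hence "?P m" using m(1) by (simp add: mult_ac)
  hence L: "?P (LEAST L. ?P L)" by (rule LeastI)
  then obtain e where "of_nat (LEAST L. ?P L) * q * of_nat n = of_int e" by (auto elim: Ints_cases)
  moreover have "i = 0" if "i < (LEAST L. ?P L)" "of_nat i * q * of_nat n \<in> \<int>" for i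
    using not_less_Least[OF that(1)] that(2) by auto
  ultimately show thesis using that L by blast
qed

section \<open>The inductive step\<close>

text \<open>Minimality of L makes j = n L q prime to L, so Bezout's identity produces the exponent 1
  / (n L) from 1 / n and q: a power of the old root times a power of u serves as the new root. If L
  is even, then j is odd, which keeps an odd numerator available.\<close>

lemma bezout_stand_in:
  fixes q :: rat
  assumes n: "n > 0" and L: "L > 0" and q: "of_nat L * q * of_nat n \<in> \<int>"
    and indep: "\<And>i. i < L \<Longrightarrow> of_nat i * q * of_nat n \<in> \<int> \<Longrightarrow> i = 0"
  obtains s :: int and t :: nat where "of_int s / of_nat n + of_nat t * q = 1 / of_nat (n * L)"
    "even L \<Longrightarrow> \<exists>j. odd j \<and> of_nat (n * L) * q = of_int j"
proof -
  obtain j where j: "of_nat L * q * of_nat n = of_int j" using q by (auto elim: Ints_cases)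
  define d where "d = gcd j (int L)"
  have d: "d > 0" "d dvd j" "d dvd int L" using L by (auto simp: d_def)
  have "d = 1"
  proof (rule ccontr)
    assume "d \<noteq> 1"
    obtain j' where j': "j = d * j'" using d by auto
    obtain L' where L': "int L = d * L'" using d by auto
    have "0 < L'" using L' L d by (metis of_nat_0_less_iff zero_less_mult_pos)
    have "nat L' < L" using L' d \<open>d \<noteq> 1\<close> \<open>0 < L'\<close> by (simp add: nat_less_iff)
    moreover have "of_int d * (of_nat (nat L') * q * of_nat n) = of_int d * (of_int j' :: rat)"
    proof -
      have "of_int d * (of_nat (nat L') * q * of_nat n) = of_int (d * L') * q * (of_nat n :: rat)"
        using \<open>0 < L'\<close> by simp
      also have "of_int (d * L') = (of_nat L :: rat)" unfolding L'[symmetric] by simp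
      finally show ?thesis using j j' by simp
    qed
    hence "of_nat (nat L') * q * of_nat n = of_int j'" using d by simp
    hence "of_nat (nat L') * q * of_nat n \<in> \<int>" by simp
    ultimately have "nat L' = 0" by (intro indep)
    thus False using \<open>0 < L'\<close> by simp
  qed
  then obtain u v where uv: "u * j + v * int L = 1" using bezout_int[of j "int L"] by (auto simp: d_def)
  \<comment> \<open>The power of u must be natural, so the Bezout coefficient is reduced modulo L
    and the correction goes into s, which may be negative.\<close>
  define t where "t = nat (u mod int L)"
  define s where "s = v + j * (u div int L)"
  have t: "int t = u mod int L" using L by (simp add: t_def)
  have "s * int L + int t * j = v * int L + j * (u div int L * int L + u mod int L)"
    unfolding s_def t distrib_left distrib_right by (simp add: mult_ac del: mult_div_mod_eq div_mult_mod_eq)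
  also have "u div int L * int L + u mod int L = u" by simp
  also have "v * int L + j * u = 1" using uv by (simp add: mult.commute)
  finally have "(of_int (s * int L + int t * j) :: rat) = 1" by simp
  hence "of_int s * of_nat L + of_nat t * (of_nat L * q * of_nat n) = 1" unfolding j by simp
  hence "(of_int s / of_nat n + of_nat t * q) * of_nat (n * L) = 1"
    using n unfolding distrib_right by (simp add: mult_ac)
  hence "of_int s / of_nat n + of_nat t * q = 1 / of_nat (n * L)" using n L by (simp add: eq_divide_eq)
  moreover have "\<exists>j. odd j \<and> of_nat (n * L) * q = of_int j" if "even L"
  proof (intro exI[of _ j] conjI)
    show "odd j"
    proof
      assume "even j"
      hence "2 dvd d" using that by (simp add: d_def)
      thus False using \<open>d = 1\<close> by simp
    qed
    show "of_nat (n * L) * q = of_int j" using j by (simp add: mult_ac)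
  qed
  ultimately show thesis using that by blast
qed

context weyl_dominance
begin

lemma vge_weyl_x: "vge weyl_x (- 1)"
  using vge_x_pow[of 1] by (simp add: weyl_x_def)

text \<open>With that bound u x would have value at least k, the value of \<open>dy u\<close>,
  whereas \<open>vlt_dy\<close> makes it smaller. This is the source of the bound 1 for the value of
  y - p.\<close>

lemma dy_value_bound:
  assumes u: "u \<in> wl" and d: "veq (to_quot (dy u)) k"
  shows "\<not> vge (to_quot u) (k + 1)"
proof
  assume "vge (to_quot u) (k + 1)"
  from vge_mult[OF this vge_weyl_x] have "vge (to_quot u * weyl_x) k" by simp
  with d have "vle (to_quot (dy u)) (to_quot u * weyl_x)" by (rule veq_vge_vle)
  moreover have "u \<noteq> 0" using d by (auto simp: veq_def)
  ultimately show False using vlt_dy(1)[of wl u] wl_dy wl_K u by blast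
qed

text \<open>
  \<open>y\<close> has been approximated by \<open>p\<close>: the valuation dominates the Gauss valuation at \<open>p\<close> with value \<open>g\<close>
  for \<open>y - p\<close>, and \<open>u\<close>, the current element of the sequence, is \<open>r (y - p)\<close> times \<open>x\<close> to the power
  \<open>- k\<close> up to terms of larger value. The value of \<open>y - p\<close> is thus that of \<open>u\<close> minus \<open>k\<close>.
\<close>

definition stage :: "nat \<Rightarrow> puiseux \<Rightarrow> rat \<Rightarrow> spoly \<Rightarrow> spoly \<Rightarrow> real \<Rightarrow> rat \<Rightarrow> bool" where
  "stage n p g a u r k \<longleftrightarrow> n > 0 \<and> p \<in> ramified n \<and> g < 1 \<and> a \<in> wl \<and> lead p (rv g) a 1 (1 / of_nat n) 0 \<and>
     below p g \<and> u \<in> wl \<and> r \<noteq> 0 \<and> lead p (rv g) (dy u) r k 0 \<and>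
     (\<forall>q. cf (shift p u) 0 q \<noteq> 0 \<longrightarrow> k + 1 \<le> q) \<and> (\<exists>g1>g. vge (to_quot u) (k + g1))"

text \<open>The valuation orders \<open>wl\<close> like the Gauss valuation at p with value G. This
  is expressed through leading terms because the two valuations have values in different
  groups.\<close>

definition compat :: "puiseux \<Rightarrow> real poly \<Rightarrow> bool" where
  "compat p G \<longleftrightarrow> (\<forall>h\<in>wl. \<forall>f\<in>wl. \<forall>r s l. lead p G h r s l \<longrightarrow> r \<noteq> 0 \<longrightarrow> gauss_gt p G (wt G s l) f \<longrightarrow>
     vlt (to_quot h) (to_quot f))"

lemma cut_exists:
  assumes z: "z \<in> K" and irr: "\<And>t. \<not> veq z t"
  obtains G where "\<And>t. vge z t \<longleftrightarrow> rv t < G" "\<And>t. rv t \<noteq> G" "z \<noteq> 0 \<Longrightarrow> cut z G"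
proof -
  have "\<exists>G. \<forall>t. (vge z t \<longleftrightarrow> rv t < G) \<and> rv t \<noteq> G"
    by (rule rational_cut_ex) (rule vge_mono)
  then obtain G where "\<forall>t. (vge z t \<longleftrightarrow> rv t < G) \<and> rv t \<noteq> G" by blast
  thus thesis using that[of G] z irr by (simp add: cut_def)
qed

context
  fixes n p g a u r k
  assumes st: "stage n p g a u r k"
begin

lemma stage_facts:
  shows "n > 0" "p \<in> ramified n" "g < 1" "a \<in> wl" "lead p (rv g) a 1 (1 / of_nat n) 0" "below p g"
    "u \<in> wl" "r \<noteq> 0" "lead p (rv g) (dy u) r k 0" "lin p g u r k 1"
    "rv g \<le> g' \<Longrightarrow> g' < rv 1 \<Longrightarrow> lead p g' u r k 1" "k * of_nat n \<in> \<int>"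
    "veq (to_quot (dy u)) k" "\<not> vge (to_quot u) (k + 1)" "u \<noteq> 0"
    "veq (to_quot (stand_in n a e)) (of_int e / of_nat n)"
proof -
  show 1: "n > 0" "p \<in> ramified n" "g < 1" "a \<in> wl" "lead p (rv g) a 1 (1 / of_nat n) 0" "below p g"
    "u \<in> wl" "r \<noteq> 0" "lead p (rv g) (dy u) r k 0" using st by (auto simp: stage_def)
  show lin: "lin p g u r k 1" by (rule lin_of_lead) (use st in \<open>auto simp: stage_def\<close>)
  show "lead p g' u r k 1" if g': "rv g \<le> g'" "g' < rv 1"
  proof (rule lead_of_dy)
    show "lead p g' (dy u) r k 0"
      by (rule lead_change[OF _ _ g'(1) 1(9)]) (use 1(3) in \<open>auto simp: zero_puiseux.rep_eq\<close>)
    fix q assume "cf (shift p u) 0 q \<noteq> 0"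
    hence "rv k + rv 1 \<le> rv q" using lin by (simp add: lin_def rv_add[symmetric])
    moreover have "rv k + g' < rv k + rv 1" using g' by simp
    ultimately show "rv k + g' < rv q" by (rule less_le_trans[rotated])
  qed
  show "k * of_nat n \<in> \<int>"
    using wl_ramified[OF wl_dy[OF 1(7)] 1(2)] lead_coeff_eq[OF 1(9)] 1(8)
    by (auto simp: skew_over_def ramified_def cf_def)
  show d: "veq (to_quot (dy u)) k" by (rule below_veq[OF 1(6,3) wl_dy[OF 1(7)] 1(9,8)])
  show "\<not> vge (to_quot u) (k + 1)" by (rule dy_value_bound[OF 1(7) d])
  show "u \<noteq> 0" using d by (auto simp: veq_def)
  have "lead p (rv g) (stand_in n a e) 1 (of_int e / of_nat n) 0"
    using 1 by (intro lead_stand_in) auto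
  thus "veq (to_quot (stand_in n a e)) (of_int e / of_nat n)"
    by (rule below_veq[OF 1(6,3) stand_in_wl[OF 1(4)]]) simp
qed

lemma stage_value_bounds:
  assumes "veq (to_quot u) q"
  shows "g < q - k" "q - k < 1"
  using st assms stage_facts(14) veq_vge_iff[OF assms] by (auto simp: stage_def)

lemma stage_expand:
  assumes L: "L > 0" and f: "f \<in> wl" and z: "z \<in> wl" "lead p (rv g) z t q' L" "t \<noteq> 0" "q' * of_nat n \<in> \<int>"
    and G: "rv g \<le> G" and p': "\<And>q. pcoeff (p' - p) q \<noteq> 0 \<Longrightarrow> g \<le> q"
  shows "\<exists>h\<in>real_span (exp_term n a L u z). gauss_ge p' G (rv (of_nat j)) (f - h) \<and> vge (to_quot (f - h)) (of_nat j)"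
proof -
  note F = stage_facts
  have "\<exists>h\<in>real_span (exp_term n a L u z). gauss_ge p (rv g) (rv (of_nat j)) (f - h)"
    by (rule expansion[OF F(1,3,5,4) _ F(7) z(2,1,3,4) L F(2) f]) (use F(8) F(11)[of "rv g"] F(3,12) in auto)
  then obtain h where h: "h \<in> real_span (exp_term n a L u z)" "gauss_ge p (rv g) (rv (of_nat j)) (f - h)" by blast
  have "f - h \<in> wl" using f real_span_wl[OF h(1) exp_term_wl] F(4,7) z by (intro wl_closed) auto
  hence "vge (to_quot (f - h)) (of_nat j)" using belowD[OF F(6)] h(2) by blast
  moreover have "gauss_ge p' G (rv (of_nat j)) (f - h)"
    by (rule gauss_ge_change[OF _ _ G h(2)]) (use p' F(3) in auto)
  ultimately show ?thesis using h by blast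
qed

text \<open>Here u itself plays the role of z, with L = 1: it is linear in y - p, and its irrational
  value minus k is the value G of y - p.\<close>

lemma stage_irrational:
  assumes irr: "\<And>q. \<not> veq (to_quot u) q"
  obtains G where "rv g < G" "G < rv 1" "\<And>t. rv t \<noteq> G" "cut (to_quot u) (G + rv k)" "compat p G"
proof -
  note F = stage_facts
  obtain G0 where G0: "\<And>t. vge (to_quot u) t \<longleftrightarrow> rv t < G0" "\<And>t. rv t \<noteq> G0" "cut (to_quot u) G0"
    using cut_exists[OF wl_K[OF F(7)] irr] F(15) by auto
  define G where "G = G0 - rv k"
  have c: "cut (to_quot u) (G + rv k)" using G0(3) by (simp add: G_def)
  obtain g1 where "g < g1" "vge (to_quot u) (k + g1)" using st by (auto simp: stage_def)
  hence "rv (k + g1) < G0" "rv (k + g) < rv (k + g1)" using G0 by auto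
  hence "rv (k + g) < G0" by (rule less_trans[rotated])
  hence 1: "rv g < G" unfolding G_def rv_add by (simp add: algebra_simps)
  have "\<not> rv (k + 1) < G0" using G0(1) F(14) by blast
  hence "G0 < rv (k + 1)" using G0(2)[of "k + 1"] by (metis linorder_neqE)
  hence 2: "G < rv 1" by (simp add: G_def rv_add algebra_simps)
  have 3: "rv t \<noteq> G" for t using G0(2)[of "t + k"] by (auto simp: G_def rv_add)
  have a: "lead p G a 1 (1 / of_nat n) 0"
    by (rule lead_change[OF _ _ _ F(5)]) (use F(3) 1 in \<open>auto simp: zero_puiseux.rep_eq\<close>)
  have l: "lead p g' u r k 1" if "rv g \<le> g'" "g' < rv 1" for g' using F(11) that by blast
  have "compat p G" unfolding compat_def
  proof (intro ballI allI impI)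
    fix h f c s l' assume *: "h \<in> wl" "f \<in> wl" "lead p G h c s l'" "c \<noteq> 0" "gauss_gt p G (wt G s l') f"
    show "vlt (to_quot h) (to_quot f)"
    proof (rule irrational_vlt[where L = 1 and n = n and a = a and u = u and z = u and p = p and G = G and
          r = 1 and qu = 0 and t = r and c = k])
      show "lead p G u r k 1" using l 1 2 by simp
      show "\<exists>h\<in>real_span (exp_term n a 1 u u). gauss_ge p G (rv (of_nat j)) (f - h) \<and> vge (to_quot (f - h)) (of_nat j)"
        if "f \<in> wl" for f j
        by (rule stage_expand[OF _ that F(7) l F(8,12)]) (use F(3) 1 in \<open>auto simp: zero_puiseux.rep_eq\<close>)
      show "cut (to_quot u) (G + rv k)" by (rule c)
    qed (use * a F(1,4,7,8,16) 2 3 in auto)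
  qed
  thus thesis using that 1 2 3 c by blast
qed

section \<open>From a rational value of u to the next approximation\<close>

context
  fixes q c L e
  assumes q: "veq (to_quot u) q" and c: "c \<noteq> 0" and L: "L > 0"
    and e: "of_nat L * q * of_nat n = of_int e"
    and indep: "\<And>i. i < L \<Longrightarrow> of_nat i * q * of_nat n \<in> \<int> \<Longrightarrow> i = 0"
    and sim: "sim (to_quot u ^ L) (real_const (c ^ L) * to_quot (stand_in n a e))"
begin

text \<open>Comparing the leading term r x^(-k) (y - p) of u with the expected c x^(-q) predicts the
  next term of the series: y - p should start with (c/r) x^(-(q - k)).\<close>

definition next_p :: puiseux where
  "next_p = p + puiseux_monom (c / r) (- (q - k))"

text \<open>The power L is the least one for which c^L x^(-L q) has a stand-in with denominator n.
  The next element of the sequence takes a power N with N q integral, which may be larger; the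
  expansions require the least degree.\<close>

definition next_z :: spoly where
  "next_z = u ^ L - sconst (puiseux_monom (c ^ L) 0) * stand_in n a e"

lemma next_p_diff: "pcoeff (next_p - p) s \<noteq> 0 \<Longrightarrow> s = q - k"
  by (auto simp: next_p_def puiseux_monom.rep_eq split: if_splits)

lemma next_z_wl: "next_z \<in> wl"
  unfolding next_z_def by (intro wl_closed wl_real stand_in_wl stage_facts)

lemma next_leads:
  assumes g': "rv (q - k) < g'" "g' < rv 1"
  shows "lead next_p g' u c q 0" "lead next_p g' (dy u) r k 0"
    "lead p (rv g) f d s 0 \<Longrightarrow> lead next_p g' f d s 0"
proof -
  note F = stage_facts and B = stage_value_bounds[OF q]
  have gg: "rv g < rv (q - k)" using B by simp
  hence gg': "rv g \<le> g'" using g' by (meson less_trans less_imp_le)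
  have ch: "lead next_p g' f d s 0" if "lead p (rv g) f d s 0" for f d s
    by (rule lead_change[OF _ _ gg' that]) (use B next_p_diff in force)+
  show "lead p (rv g) f d s 0 \<Longrightarrow> lead next_p g' f d s 0" by (rule ch)
  show "lead next_p g' (dy u) r k 0" using ch F(9) .
  have "lead p (rv (q - k)) u r k 1" using F(11) gg B by simp
  hence "gauss_gt p (rv (q - k)) (rv q) (u - mon p r k 1)" by (simp add: lead_def wt_rv)
  hence "gauss_gt next_p g' (rv q) (u - mon p r k 1)"
    by (rule gauss_gt_change[rotated 3]) (use B g' next_p_diff in \<open>auto intro: less_imp_le\<close>)
  moreover have "rv q < wt g' k 1"
  proof -
    have "rv q = rv k + rv (q - k)" by (simp add: rv_add[symmetric])
    thus ?thesis using g' by (simp add: wt_def)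
  qed
  hence "gauss_gt next_p g' (rv q) (mon next_p r k 1)" by (rule gauss_gt_mon)
  ultimately have "gauss_gt next_p g' (rv q) (u - mon p r k 1 + mon next_p r k 1)" by (rule gauss_gt_add)
  moreover have "mon p r k 1 = mon next_p r k 1 + mon next_p c q 0"
  proof -
    have "mon p r k 1 = mon next_p r k 1 + sconst (puiseux_monom r (- k)) * sconst (puiseux_monom (c / r) (- (q - k)))"
      by (simp add: mon_def next_p_def sconst_add algebra_simps)
    moreover have "sconst (puiseux_monom r (- k)) * sconst (puiseux_monom (c / r) (- (q - k))) = mon next_p c q 0"
      using F(8) by (simp add: sconst_mult[symmetric] puiseux_monom_mult mon_const)
    ultimately show ?thesis by simp
  qed
  ultimately show "lead next_p g' u c q 0" by (simp add: lead_def)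
qed

lemma next_z_lin:
  obtains h where "q - k < h" "lin next_p (q - k) next_z (of_nat L * c ^ (L - 1) * r) (of_nat (L - 1) * q + k) h"
proof -
  note F = stage_facts and B = stage_value_bounds[OF q]
  let ?b = "sconst (puiseux_monom (c ^ L) 0) * stand_in n a e"
  have en: "of_int e / of_nat n = of_nat L * q" using e F(1) by (simp add: field_simps)
  have b0: "lead p (rv g) ?b (c ^ L) (of_nat L * q) 0"
    using lead_sconst_mult[OF _ lead_stand_in[OF F(1) _ F(5), of e], of "c ^ L" 0] F(3) by (simp add: en)
  have b: "lead next_p g' ?b (c ^ L) (of_nat L * q - 0) 0" if "rv (q - k) < g'" "g' < rv 1" for g'
    using next_leads(3)[OF that b0] by simp
  \<comment> \<open>Differentiation lowers the weight L q of the stand-in by at most g, whereas the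
    weight to be exceeded is L q - (q - k), and g < q - k.\<close>
  have db: "gauss_gt next_p g' (rv (of_nat (L - 1) * q + k - 0)) (dy ?b)" if g': "rv (q - k) < g'" "g' < rv 1" for g'
  proof -
    have "gauss_ge p (rv g) (rv (of_nat L * q) - rv g) (dy ?b)"
      using lead_imp_ge[OF b0] by (intro gauss_ge_dy) simp
    moreover have "of_nat L * q = of_nat (L - 1) * q + q" using L by (cases L) (auto simp: algebra_simps)
    hence "rv (of_nat (L - 1) * q + k - 0) < rv (of_nat L * q) - rv g"
      using B by (simp add: rv_diff[symmetric] del: rv_diff)
    ultimately have "gauss_gt p (rv g) (rv (of_nat (L - 1) * q + k - 0)) (dy ?b)" by (rule gauss_ge_imp_gt)
    thus ?thesis
    proof (rule gauss_gt_change[rotated 3])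
      show "rv g \<le> g'" using g' B by (meson less_trans less_imp_le rv_less_iff)
    qed (use B next_p_diff in force)+
  qed
  obtain H where "q - k < H" "lin next_p (q - k) (sconst (puiseux_monom 1 0) * u ^ L - ?b)
      (of_nat L * c ^ (L - 1) * r) (of_nat (L - 1) * q + k - 0) H"
  proof (rule lin_power_diff[where G = "q - k" and p = next_p and u = u and c = c and q = q and r = r and k = k and
        N = L and h = ?b and m = 0])
    show "lead next_p g' ?b (c ^ L) (of_nat L * q - 0) 0" if "rv (q - k) < g'" "g' < rv 1" for g' using b[OF that] .
    show "gauss_gt next_p g' (rv (of_nat (L - 1) * q + k - 0)) (dy ?b)" if "rv (q - k) < g'" "g' < rv 1" for g'
      using db[OF that] .
  qed (use B next_leads L in auto)
  thus thesis using that by (simp add: next_z_def puiseux_monom_1)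
qed

text \<open>For the old Gauss valuation the stand-in is negligible: its weight L q exceeds the
  weight L (k + g) of u^L.\<close>

lemma next_z_lead: "lead p (rv g) next_z (r ^ L) (of_nat L * k) L"
proof -
  note F = stage_facts and B = stage_value_bounds[OF q]
  let ?b = "sconst (puiseux_monom (c ^ L) 0) * stand_in n a e"
  have en: "of_int e / of_nat n = of_nat L * q" using e F(1) by (simp add: field_simps)
  have b0: "lead p (rv g) ?b (c ^ L) (of_nat L * q) 0"
    using lead_sconst_mult[OF _ lead_stand_in[OF F(1) _ F(5), of e], of "c ^ L" 0] F(3) by (simp add: en)
  have "lead p (rv g) (u ^ L) (r ^ L) (of_nat L * k) L"
    using lead_power[OF _ F(11)[of "rv g"], of L] F(3) by simp
  moreover have "gauss_gt p (rv g) (wt (rv g) (of_nat L * k) L) (next_z - u ^ L)"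
  proof -
    have "of_nat L * (k + g) < of_nat L * q" using B L by (intro mult_strict_left_mono) auto
    hence "gauss_gt p (rv g) (wt (rv g) (of_nat L * k) L) ?b"
      using lead_imp_ge[OF b0] by (intro gauss_ge_imp_gt) (auto simp: wt_rv algebra_simps)
    thus ?thesis by (simp add: next_z_def)
  qed
  ultimately show ?thesis by (rule lead_cong)
qed

lemma next_z_value: "vlt (to_quot u ^ L) (to_quot next_z)"
proof -
  have "to_quot next_z = to_quot u ^ L - real_const (c ^ L) * to_quot (stand_in n a e)"
    by (simp add: next_z_def to_quot_diff to_quot_mult to_quot_power to_quot_real)
  moreover have "vlt (real_const (c ^ L) * to_quot (stand_in n a e)) (to_quot u ^ L - real_const (c ^ L) * to_quot (stand_in n a e))"
    using sim by (simp add: sim_def)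
  ultimately show ?thesis
    using sim_veqv[OF sim] sim_K[OF sim] wl_K[OF next_z_wl] vle_vlt_trans by metis
qed

lemma next_z_vge: "vge (to_quot next_z) (of_nat L * q)"
proof -
  have "veq (to_quot u ^ L) (of_nat L * q)" by (rule veq_power[OF q])
  thus ?thesis using next_z_value vlt_imp_vle vge_vle[OF veq_imp_vge] veq_K wl_K[OF next_z_wl] by blast
qed

lemma next_exponent: "of_nat L * k * of_nat n \<in> \<int>" "of_nat (L - 1) * q + k + (q - k) = of_nat L * q"
proof -
  have "of_nat L * (k * of_nat n) \<in> \<int>" by (rule Ints_mult[OF Ints_of_nat stage_facts(12)])
  thus "of_nat L * k * of_nat n \<in> \<int>" by (simp add: mult.assoc)
  show "of_nat (L - 1) * q + k + (q - k) = of_nat L * q" using L by (cases L) (auto simp: algebra_simps)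
qed

text \<open>The value of z exceeds L q, but by no positive rational amount. The cut G for y minus
  \<open>next_p\<close> is then infinitely close to q - k from above, and the process stops although
  u has a rational value.\<close>

lemma stage_irrational_next:
  assumes irr: "\<And>\<epsilon>. \<epsilon> > 0 \<Longrightarrow> \<not> vge (to_quot next_z) (of_nat L * q + \<epsilon>)"
    and h: "q - k < h"
  obtains G where "rv (q - k) < G" "G < rv 1" "G < rv h" "\<And>t. rv t \<noteq> G"
    "cut (to_quot next_z) (G + rv (of_nat (L - 1) * q + k))" "compat next_p G"
proof -
  note F = stage_facts and B = stage_value_bounds[OF q]
  let ?k = "of_nat (L - 1) * q + k" and ?r = "of_nat L * c ^ (L - 1) * r"
  have ku: "?k + (q - k) = of_nat L * q" using next_exponent by simp
  have zK: "to_quot next_z \<in> K" by (rule wl_K[OF next_z_wl])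
  have z0: "to_quot next_z \<noteq> 0"
    using irr[of 1] vge_0 by auto
  have vge: "vge (to_quot next_z) t \<longleftrightarrow> t \<le> of_nat L * q" for t
    using irr[of "t - of_nat L * q"] vge_mono[OF next_z_vge, of t] by force
  have "\<not> veq (to_quot next_z) t" for t
  proof
    assume v: "veq (to_quot next_z) t"
    hence "t = of_nat L * q" using veq_vge_iff[OF v] vge by (metis order_antisym order_refl)
    hence "veqv (to_quot next_z) (to_quot u ^ L)" using veq_imp_veqv[OF v] veq_power[OF q] by blast
    thus False using next_z_value by blast
  qed
  then obtain G0 where G0: "\<And>t. vge (to_quot next_z) t \<longleftrightarrow> rv t < G0" "\<And>t. rv t \<noteq> G0" "cut (to_quot next_z) G0"
    using cut_exists[OF zK] z0 by metis
  define G where "G = G0 - rv ?k"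
  have cut: "cut (to_quot next_z) (G + rv ?k)" using G0(3) by (simp add: G_def)
  have "rv (of_nat L * q) < G0" using G0(1) vge by blast
  hence 1: "rv (q - k) < G" unfolding ku[symmetric] rv_add[of ?k] by (simp add: G_def algebra_simps)
  have up: "G < rv t" if "q - k < t" for t
  proof -
    have "\<not> vge (to_quot next_z) (?k + t)" using that ku vge by simp
    hence "G0 < rv (?k + t)" using G0(1,2) by (metis linorder_neqE)
    thus ?thesis unfolding rv_add[of ?k] by (simp add: G_def algebra_simps)
  qed
  have 2: "G < rv 1" "G < rv h" using up B h by auto
  have 3: "rv t \<noteq> G" for t using G0(2)[of "t + ?k"] by (auto simp: G_def rv_add)
  have r: "?r \<noteq> 0" using L c F(8) by simp
  obtain h' where h': "q - k < h'" "lin next_p (q - k) next_z ?r ?k h'" by (rule next_z_lin)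
  have zl: "lead next_p G next_z ?r ?k 1" using lin_lead[OF h'(2) 1 2(1)] up[OF h'(1)] by simp
  have p': "g \<le> s" if "pcoeff (next_p - p) s \<noteq> 0" for s using next_p_diff[OF that] B by simp
  have gG: "rv g \<le> G" using 1 B by (meson less_trans less_imp_le rv_less_iff)
  have "compat next_p G" unfolding compat_def
  proof (intro ballI allI impI)
    fix h f d s l' assume *: "h \<in> wl" "f \<in> wl" "lead next_p G h d s l'" "d \<noteq> 0" "gauss_gt next_p G (wt G s l') f"
    show "vlt (to_quot h) (to_quot f)"
    proof (rule irrational_vlt[where L = L and n = n and a = a and u = u and z = next_z and p = next_p and G = G and
          r = c and qu = q and t = ?r and c = ?k])
      show "lead next_p G a 1 (1 / of_nat n) 0" by (rule next_leads(3)[OF 1 2(1) F(5)])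
      show "lead next_p G u c q 0 \<and> c \<noteq> 0 \<and> veq (to_quot u) q" using next_leads(1)[OF 1 2(1)] c q by blast
      show "\<exists>h\<in>real_span (exp_term n a L u next_z). gauss_ge next_p G (rv (of_nat j)) (f - h) \<and> vge (to_quot (f - h)) (of_nat j)"
        if "f \<in> wl" for f j
        by (rule stage_expand[OF L that next_z_wl next_z_lead _ next_exponent(1) gG p']) (use F(8) in simp)
    qed (use * F(1,4,7,16) 2 3 L r zl cut next_z_wl indep in auto)
  qed
  thus thesis using that 1 2 3 cut by blast
qed

lemma next_lin:
  assumes N: "N > 0" "of_nat N * q = of_int m"
  obtains h where "q - k < h"
    "lin next_p (q - k) (sconst (puiseux_monom 1 (of_int m)) * u ^ N - sconst (puiseux_monom (c ^ N) 0))
      (of_nat N * c ^ (N - 1) * r) (of_nat (N - 1) * q + k - of_int m) h"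
proof (rule lin_power_diff[where G = "q - k" and p = next_p and u = u and c = c and q = q and r = r and k = k and
      N = N and h = "sconst (puiseux_monom (c ^ N) 0)" and m = "of_int m"])
  show "lead next_p g' (sconst (puiseux_monom (c ^ N) 0)) (c ^ N) (of_nat N * q - of_int m) 0" for g'
    using lead_mon[of next_p g' "c ^ N" 0 0] N by (simp add: mon_const)
qed (use that stage_value_bounds[OF q] next_leads N in auto)

text \<open>Two elements divide the work: z has the least degree and serves to raise
  \<open>below\<close> to the value g1 at \<open>next_p\<close>; w, the next element of the
  sequence, fixes the new centre p', an approximate zero of w that differs from
  \<open>next_p\<close> only beyond g1.\<close>

lemma stage_next:
  assumes eps: "\<epsilon> > 0" "vge (to_quot next_z) (of_nat L * q + \<epsilon>)" and N: "N > 0" "of_nat N * q = of_int m"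
    and h: "q - k < h"
  defines "w \<equiv> sconst (puiseux_monom 1 (of_int m)) * u ^ N - sconst (puiseux_monom (c ^ N) 0)"
  obtains p' g' g1 a' r' k' where "stage (n * L) p' g' a' w r' k'" "q - k < g'" "g' < g1" "g1 < 1" "g1 < h"
    "\<And>s. pcoeff (p' - next_p) s \<noteq> 0 \<Longrightarrow> g1 < s"
    "lead p' (rv g') u c q 0" "\<And>f d s. lead p (rv g) f d s 0 \<Longrightarrow> lead p' (rv g') f d s 0"
    "vge (to_quot next_z) (of_nat (L - 1) * q + k + g1)"
proof -
  note F = stage_facts and B = stage_value_bounds[OF q]
  let ?k = "of_nat (L - 1) * q + k" and ?r = "of_nat L * c ^ (L - 1) * r"
  let ?kw = "of_nat (N - 1) * q + k - of_int m" and ?rw = "of_nat N * c ^ (N - 1) * r"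
  obtain h' where h': "q - k < h'" "lin next_p (q - k) next_z ?r ?k h'" by (rule next_z_lin)
  obtain hw where hw: "q - k < hw" "lin next_p (q - k) w ?rw ?kw hw"
    unfolding w_def by (rule next_lin[OF N])
  have w: "w \<in> wl" unfolding w_def by (intro wl_closed wl_real wl_monom F(7))
  \<comment> \<open>All upper bounds that the new value has to respect: 1, the given h, the ranges
    in which z and w are linear, and the known excess of z. Two values g' < g1 are chosen below it
    because a stage requires strict room above g'.\<close>
  define G where "G = Min {1, h, h', hw, q - k + \<epsilon>}"
  have "q - k < G" unfolding G_def using B h h' hw eps by (subst Min_gr_iff) auto
  then obtain g1 where g1: "q - k < g1" "g1 < G" using dense by blast
  have G: "g1 < 1" "g1 < h" "g1 < h'" "g1 < hw" "g1 < q - k + \<epsilon>" using g1(2) unfolding G_def by (simp_all add: Min_gr_iff)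
  obtain g' where g': "q - k < g'" "g' < g1" using dense[OF g1(1)] by blast
  have zv: "vge (to_quot next_z) (?k + g1)"
    by (rule vge_mono[OF eps(2)]) (use G(5) next_exponent(2) in linarith)
  have r0: "?r \<noteq> 0" "?rw \<noteq> 0" using L N c F(8) by auto
  have rg1: "rv (q - k) < rv g1" "rv g1 < rv 1" using g1 G by auto
  have p': "g \<le> s" if "pcoeff (next_p - p) s \<noteq> 0" for s using next_p_diff[OF that] B by simp
  have b1: "below next_p g1"
  proof (rule below_raise[OF F(6,1,3,5,4) _ F(7) next_z_lead next_z_wl _ next_exponent(1) L F(2) p', where r' = c and qu = q and t' = ?r and c = ?k])
    show "lead p (rv g) u r k 1 \<and> r \<noteq> 0 \<and> k * of_nat n \<in> \<int>" using F(3,8,11,12) by simp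
    show "lead next_p (rv g1) u c q 0 \<and> c \<noteq> 0 \<and> vge (to_quot u) q"
      using next_leads(1)[OF rg1] c q veq_imp_vge by blast
    show "lead next_p (rv g1) next_z ?r ?k 1" using lin_lead[OF h'(2) rg1] G by simp
  qed (use F(8) B g1 G r0 zv indep in auto)
  have n': "n * L > 0" using F(1) L by simp
  have pr: "next_p \<in> ramified (n * L)"
  proof -
    have "(q - k) * of_nat (n * L) = of_int e - of_nat L * (k * of_nat n)" using e by (simp add: algebra_simps)
    moreover have "of_nat L * (k * of_nat n) \<in> \<int>" by (rule Ints_mult[OF Ints_of_nat F(12)])
    ultimately have "(q - k) * of_nat (n * L) \<in> \<int>" by (metis Ints_diff Ints_of_int)
    hence "puiseux_monom (c / r) (- (q - k)) \<in> ramified (n * L)"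
      by (auto simp: ramified_def puiseux_monom.rep_eq simp del: of_nat_mult)
    moreover have "p \<in> ramified (n * L)" using F(2) ramified_mono[of n "n * L"] by auto
    ultimately show ?thesis unfolding next_p_def by (intro dsubringD(6)[OF dsubring_ramified])
  qed
  have dw1: "lead next_p (rv g1) (dy w) ?rw ?kw 0" using hw(2) rg1 by (simp add: lin_def)
  have cw: "?kw + g1 < s" if "cf (shift next_p w) 0 s \<noteq> 0" for s
    using hw(2) that G(4) by (fastforce simp: lin_def)
  obtain p'' where p'': "p'' \<in> ramified (n * L)" "\<And>s. pcoeff (p'' - next_p) s \<noteq> 0 \<Longrightarrow> g1 < s"
    "\<And>s. cf (shift p'' w) 0 s \<noteq> 0 \<Longrightarrow> ?kw + 1 \<le> s"
    using newton[OF w pr n' G(1) dw1 r0(2) cw] by blast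
  have rg': "rv (q - k) < rv g'" "rv g' < rv 1" using g' G by auto
  have ch: "lead p'' (rv g') f d s 0" if "lead next_p (rv g') f d s 0" for f d s
    by (rule lead_change[OF _ _ _ that]) (use p''(2) g' G in force)+
  have b2: "below p'' g1"
    by (rule below_shift[OF b1]) (use p''(2) G in \<open>auto intro: less_imp_le\<close>)
  have u2: "lead p'' (rv g') u c q 0" by (rule ch[OF next_leads(1)[OF rg']])
  have all2: "lead p'' (rv g') f d s 0" if "lead p (rv g) f d s 0" for f d s
    by (rule ch[OF next_leads(3)[OF rg' that]])
  have Lq: "of_nat L * q * of_nat n \<in> \<int>" unfolding e by simp
  obtain s t where st': "of_int s / of_nat n + of_nat t * q = 1 / of_nat (n * L)"
    using bezout_stand_in[OF F(1) L Lq indep] by blast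
  \<comment> \<open>By the choice of s and t its leading exponent is 1 / (n L); the factor 1 / c^t
    normalises the coefficient to 1.\<close>
  define a' where "a' = sconst (puiseux_monom (1 / c ^ t) 0) * (stand_in n a s * u ^ t)"
  have a': "a' \<in> wl" unfolding a'_def by (intro wl_closed wl_real stand_in_wl F)
  have "lead p'' (rv g') (stand_in n a s * u ^ t) (1 * c ^ t) (of_int s / of_nat n + of_nat t * q) (0 + t * 0)"
    by (intro lead_mult lead_stand_in lead_power rg' F(1) all2 F(5) u2)
  hence "lead p'' (rv g') (sconst (puiseux_monom (1 / c ^ t) (- 0)) * (stand_in n a s * u ^ t)) (1 / c ^ t * c ^ t) (0 + 1 / of_nat (n * L)) 0"
    unfolding st' by (intro lead_sconst_mult[OF rg'(2)]) simp
  hence la': "lead p'' (rv g') a' 1 (1 / of_nat (n * L)) 0" using c by (simp add: a'_def)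
  have dw2: "lead p'' (rv g') (dy w) ?rw ?kw 0" using ch hw(2) rg' by (simp add: lin_def)
  have wv: "vge (to_quot w) (?kw + g1)"
  proof (rule belowD[OF b2 w])
    have "lead p'' (rv g1) (dy w) ?rw ?kw 0"
      by (rule lead_change[OF _ _ _ dw1]) (use p''(2) G in \<open>auto intro: less_imp_le\<close>)
    hence "lead p'' (rv g1) w ?rw ?kw 1"
    proof (rule lead_of_dy)
      fix s assume "cf (shift p'' w) 0 s \<noteq> 0"
      hence "?kw + g1 < s" using p''(3)[of s] G(1) by simp
      thus "rv ?kw + rv g1 < rv s" by (simp only: rv_add[symmetric] rv_less_iff)
    qed
    from lead_imp_ge[OF this] show "gauss_ge p'' (rv g1) (rv (?kw + g1)) w" by (simp add: wt_rv)
  qed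
  have "stage (n * L) p'' g' a' w ?rw ?kw"
    unfolding stage_def using n' p'' g' G a' la' below_mono[OF b2, of g'] w r0(2) dw2 wv by auto
  thus thesis using that[of p'' g' a' ?rw ?kw g1] g' G p''(2) u2 all2 zv by blast
qed

end

end

end

section \<open>Leading forms define a valuation on the quotient division ring\<close>

text \<open>The value s of f comes with a real leading coefficient r. Its multiplicativity makes the
  residue field the reals: the residue of a quotient of elements of equal value is the quotient of
  their leading coefficients.\<close>

locale leading_forms =
  fixes ld :: "spoly \<Rightarrow> real \<Rightarrow> real poly \<Rightarrow> bool"
  assumes ld_ex: "f \<noteq> 0 \<Longrightarrow> \<exists>r s. ld f r s"
    and ld_nz: "ld f r s \<Longrightarrow> r \<noteq> 0 \<and> f \<noteq> 0"
    and ld_unique: "ld f r s \<Longrightarrow> ld f r' s' \<Longrightarrow> r = r' \<and> s = s'"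
    and ld_mult: "ld f r s \<Longrightarrow> ld h r' s' \<Longrightarrow> ld (f * h) (r * r') (s + s')"
    and ld_add_less: "ld f r s \<Longrightarrow> ld h r' s' \<Longrightarrow> s < s' \<Longrightarrow> ld (f + h) r s"
    and ld_add: "ld f r s \<Longrightarrow> ld h r' s \<Longrightarrow> r + r' \<noteq> 0 \<Longrightarrow> ld (f + h) (r + r') s"
    and ld_cancel: "ld f r s \<Longrightarrow> ld h (- r) s \<Longrightarrow> ld (f + h) r' s' \<Longrightarrow> s < s'"
    and ld_monom: "c \<noteq> 0 \<Longrightarrow> ld (sconst (puiseux_monom c (- q))) c (rv q)"
begin

definition val :: "spoly \<Rightarrow> real poly" where
  "val f = (THE s. \<exists>r. ld f r s)"

lemma val_eq: "ld f r s \<Longrightarrow> val f = s"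
  unfolding val_def using ld_unique by blast

lemma ld_val: "f \<noteq> 0 \<Longrightarrow> \<exists>r. ld f r (val f)"
  using ld_ex val_eq by metis

lemma val_mult: "f \<noteq> 0 \<Longrightarrow> h \<noteq> 0 \<Longrightarrow> val (f * h) = val f + val h"
  using ld_val[of f] ld_val[of h] ld_mult val_eq by metis

lemma val_add:
  assumes "f \<noteq> 0" "h \<noteq> 0" "f + h \<noteq> 0"
  shows "min (val f) (val h) \<le> val (f + h)"
proof -
  obtain r where r: "ld f r (val f)" using ld_val assms by blast
  obtain r' where r': "ld h r' (val h)" using ld_val assms by blast
  obtain t where t: "ld (f + h) t (val (f + h))" using ld_val assms by blast
  consider "val f < val h" | "val h < val f" | "val f = val h" "r + r' \<noteq> 0" | "val f = val h" "r' = - r"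
    by (metis add_eq_0_iff linorder_neqE)
  thus ?thesis
  proof cases
    case 1
    thus ?thesis using val_eq[OF ld_add_less[OF r r' 1]] by simp
  next
    case 2
    thus ?thesis using val_eq[OF ld_add_less[OF r' r 2]] by (simp add: add.commute)
  next
    case 3
    hence "ld (f + h) (r + r') (val f)" using ld_add[OF r, of h r'] r' by simp
    thus ?thesis using val_eq by (metis min.cobounded1)
  next
    case 4
    hence "val f < val (f + h)" using ld_cancel[OF r _ t] r' by simp
    thus ?thesis by (simp add: min.coboundedI1)
  qed
qed

definition W :: "weyl_ext \<Rightarrow> real poly" where
  "W d = (THE s. \<exists>f h. f \<noteq> 0 \<and> h \<noteq> 0 \<and> d = ore_frac f h \<and> s = val f - val h)"

lemma W_ore_frac:
  assumes "f \<noteq> 0" "h \<noteq> 0"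
  shows "W (ore_frac f h) = val f - val h"
  unfolding W_def
proof (rule the_equality)
  show "\<exists>f' h'. f' \<noteq> 0 \<and> h' \<noteq> 0 \<and> ore_frac f h = ore_frac f' h' \<and> val f - val h = val f' - val h'"
    using assms by blast
  fix s assume "\<exists>f' h'. f' \<noteq> 0 \<and> h' \<noteq> 0 \<and> ore_frac f h = ore_frac f' h' \<and> s = val f' - val h'"
  then obtain f' h' where *: "f' \<noteq> 0" "h' \<noteq> 0" "ore_frac f h = ore_frac f' h'" "s = val f' - val h'" by blast
  hence "ore_rel (f, h) (f', h')" using assms by (simp add: ore_frac_eq_iff)
  then obtain a b where ab: "a \<noteq> 0" "b \<noteq> 0" "h * a = h' * b" "f * a = f' * b" by (auto simp: ore_rel_def)
  have "val h + val a = val h' + val b" "val f + val a = val f' + val b"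
    using ab assms * val_mult by metis+
  thus "s = val f - val h" unfolding *(4) by (simp add: algebra_simps)
qed

lemma frac_nz:
  assumes "d \<noteq> 0"
  obtains f h where "f \<noteq> 0" "h \<noteq> 0" "d = ore_frac f h"
proof -
  obtain f h where "h \<noteq> 0" "d = ore_frac f h" by (rule ore_frac_cases)
  thus thesis using that assms ore_frac_eq_0 by blast
qed

lemma W_mult:
  assumes "a \<noteq> 0" "b \<noteq> 0"
  shows "W (a * b) = W a + W b"
proof -
  obtain f h where a: "f \<noteq> 0" "h \<noteq> 0" "a = ore_frac f h" using assms(1) by (rule frac_nz)
  obtain f' h' where b: "f' \<noteq> 0" "h' \<noteq> 0" "b = ore_frac f' h'" using assms(2) by (rule frac_nz)
  obtain c e where ce: "c \<noteq> 0" "f' * c = h * e" using a(2) by (rule right_oreE)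
  hence e: "e \<noteq> 0" using b by auto
  have "acts b (h' * c) (f' * c)" using b by (intro acts_mult) (simp add: acts_iff)
  moreover have "acts a (f' * c) (f * e)" unfolding ce(2) using a by (intro acts_mult) (simp add: acts_iff)
  ultimately have "acts (a * b) (h' * c) (f * e)" using b ce by (intro ore_times) auto
  hence "a * b = ore_frac (f * e) (h' * c)" using b ce by (simp add: acts_iff)
  hence "W (a * b) = val f + val e - (val h' + val c)" using a b ce e by (simp add: W_ore_frac val_mult)
  moreover have "val f' + val c = val h + val e" using val_mult a b ce e by metis
  ultimately show ?thesis unfolding a(3) b(3) W_ore_frac[OF a(1,2)] W_ore_frac[OF b(1,2)] by (simp add: algebra_simps)
qed

lemma W_add:
  assumes "a \<noteq> 0" "b \<noteq> 0" "a + b \<noteq> 0"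
  shows "min (W a) (W b) \<le> W (a + b)"
proof -
  obtain s t t' where s: "s \<noteq> 0" and a: "acts a s t" and b: "acts b s t'"
    using acts_common[of 1 a b] by auto
  have ab: "acts (a + b) s (t + t')" by (rule ore_plus[OF a b s])
  have nz: "t \<noteq> 0" "t' \<noteq> 0" "t + t' \<noteq> 0"
    using a b ab assms s by (auto simp: acts_iff ore_frac_eq_0)
  have "W a = val t - val s" "W b = val t' - val s" "W (a + b) = val (t + t') - val s"
    using a b ab s nz W_ore_frac by (auto simp: acts_iff)
  thus ?thesis using val_add[OF nz] by (auto simp: min_def split: if_splits)
qed

lemma W_to_quot: "ld f r s \<Longrightarrow> W (to_quot f) = s"
proof -
  assume f: "ld f r s"
  have "val 1 = 0" using val_mult[of 1 1] by simp
  thus ?thesis using W_ore_frac[of f 1] ld_nz[OF f] val_eq[OF f] by (simp add: to_quot_def)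
qed

lemma W_residue:
  assumes "a \<noteq> 0" "W a = 0"
  shows "\<exists>r. a = real_const r \<or> W (a - real_const r) > 0"
proof -
  obtain f h where a: "f \<noteq> 0" "h \<noteq> 0" "a = ore_frac f h" using assms(1) by (rule frac_nz)
  obtain r where r: "ld f r (val f)" using ld_val a by blast
  obtain r' where r': "ld h r' (val h)" using ld_val a by blast
  have v: "val f = val h" using assms W_ore_frac[OF a(1,2)] a(3) by simp
  have rr: "r \<noteq> 0" "r' \<noteq> 0" using ld_nz r r' by auto
  define c where "c = r / r'"
  define e where "e = f - sconst (puiseux_monom c 0) * h"
  have "acts (real_const c) h (sconst (puiseux_monom c 0) * h)"
    unfolding to_quot_real[symmetric] by (rule acts_to_quot)
  hence "acts (- real_const c) h (- (sconst (puiseux_monom c 0) * h))" using a by (intro ore_uminus)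
  hence "acts (a + - real_const c) h (f + - (sconst (puiseux_monom c 0) * h))"
    using a by (intro ore_plus) (auto simp: acts_iff)
  hence ae: "a - real_const c = ore_frac e h" using a by (simp add: acts_iff e_def)
  show ?thesis
  proof (cases "e = 0")
    case True
    hence "a - real_const c = 0" using ae a ore_frac_0 by simp
    thus ?thesis by (intro exI[of _ c]) simp
  next
    case False
    have "ld (sconst (puiseux_monom (- c) (- 0)) * h) (- c * r') (rv 0 + val h)"
      using rr by (intro ld_mult[OF ld_monom r']) (simp add: c_def)
    moreover have "sconst (puiseux_monom (- c) 0) * h = - (sconst (puiseux_monom c 0) * h)"
    proof -
      have "puiseux_monom (- c) 0 = - puiseux_monom c 0" using puiseux_monom_diff[of 0 0 c] by simp
      thus ?thesis by (simp add: sconst_uminus)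
    qed
    ultimately have "ld (- (sconst (puiseux_monom c 0) * h)) (- r) (val f)" using rr v by (simp add: c_def)
    moreover obtain t where "ld e t (val e)" using ld_val False by blast
    ultimately have "val f < val e" using ld_cancel[OF r, of "- (sconst (puiseux_monom c 0) * h)"] by (simp add: e_def)
    hence "W (a - real_const c) > 0" unfolding ae W_ore_frac[OF False a(2)] v by simp
    thus ?thesis by blast
  qed
qed

lemma W_real: "c \<noteq> 0 \<Longrightarrow> W (real_const c) = 0"
  using W_to_quot[OF ld_monom[of c 0]] by (simp add: to_quot_real)

lemma W_1: "W 1 = 0"
  using W_real[of 1] by simp

text \<open>The value group is realised on the fibres of \<open>W\<close>, the cosets of the group of units.\<close>

definition fibre :: "real poly \<Rightarrow> weyl_ext set" where
  "fibre s = {a. a \<noteq> 0 \<and> W a = s}"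

definition fibre_val :: "weyl_ext set \<Rightarrow> real poly" where
  "fibre_val A = W (SOME a. a \<in> A)"

definition H :: "weyl_ext set ordered_group" where
  "H = \<lparr>carrier = {fibre (W a) |a. a \<noteq> 0}, mult = \<lambda>A B. fibre (fibre_val A + fibre_val B), one = fibre 0,
     le = {(fibre (W a), fibre (W b)) |a b. a \<noteq> 0 \<and> b \<noteq> 0 \<and> W a \<le> W b}\<rparr>"

definition w :: "weyl_ext \<Rightarrow> weyl_ext set with_infty" where
  "w a = (if a = 0 then Infty else Fin (fibre (W a)))"

lemma fibre_val: "a \<noteq> 0 \<Longrightarrow> fibre_val (fibre (W a)) = W a"
  unfolding fibre_val_def using someI[of "\<lambda>b. b \<in> fibre (W a)" a] by (simp add: fibre_def)

lemma fibre_inj: "a \<noteq> 0 \<Longrightarrow> b \<noteq> 0 \<Longrightarrow> fibre (W a) = fibre (W b) \<longleftrightarrow> W a = W b"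
  using fibre_val by metis

lemma H_simps: "a \<noteq> 0 \<Longrightarrow> b \<noteq> 0 \<Longrightarrow> fibre (W a) \<otimes>\<^bsub>H\<^esub> fibre (W b) = fibre (W (a * b))"
  "\<one>\<^bsub>H\<^esub> = fibre (W 1)" "carrier H = {fibre (W a) |a. a \<noteq> 0}"
  by (simp_all add: H_def fibre_val W_mult W_1)

lemma H_le: "a \<noteq> 0 \<Longrightarrow> b \<noteq> 0 \<Longrightarrow> (fibre (W a), fibre (W b)) \<in> le H \<longleftrightarrow> W a \<le> W b"
  unfolding H_def using fibre_inj by auto

lemma H_leD: "(x, y) \<in> le H \<Longrightarrow> \<exists>a b. a \<noteq> 0 \<and> b \<noteq> 0 \<and> x = fibre (W a) \<and> y = fibre (W b)"
  unfolding H_def by auto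

lemma H_group: "totally_ordered_group H"
proof (intro totally_ordered_group.intro totally_ordered_group_axioms.intro groupI)
  fix x y z assume x: "x \<in> carrier H"
  then obtain a where a: "a \<noteq> 0" "x = fibre (W a)" by (auto simp: H_simps)
  show "\<one>\<^bsub>H\<^esub> \<otimes>\<^bsub>H\<^esub> x = x" unfolding a(2) H_simps(2) using a(1) by (simp add: H_simps)
  show "\<exists>y\<in>carrier H. y \<otimes>\<^bsub>H\<^esub> x = \<one>\<^bsub>H\<^esub>"
    using a by (intro bexI[of _ "fibre (W (inverse a))"]) (auto simp: H_simps intro!: exI[of _ "inverse a"])
  assume "y \<in> carrier H"
  then obtain b where b: "b \<noteq> 0" "y = fibre (W b)" by (auto simp: H_simps)
  show "x \<otimes>\<^bsub>H\<^esub> y \<in> carrier H" using a b by (auto simp: H_simps intro!: exI[of _ "a * b"])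
  assume "z \<in> carrier H"
  then obtain c where c: "c \<noteq> 0" "z = fibre (W c)" by (auto simp: H_simps)
  show "x \<otimes>\<^bsub>H\<^esub> y \<otimes>\<^bsub>H\<^esub> z = x \<otimes>\<^bsub>H\<^esub> (y \<otimes>\<^bsub>H\<^esub> z)" using a b c by (simp add: H_simps mult.assoc)
next
  show "\<one>\<^bsub>H\<^esub> \<in> carrier H" by (auto simp: H_simps intro!: exI[of _ 1])
  show "linear_order_on (carrier H) (le H)"
    unfolding linear_order_on_def partial_order_on_def preorder_on_def
  proof (intro conjI)
    show sub: "le H \<subseteq> carrier H \<times> carrier H" by (auto simp: H_def)
    show "refl_on (carrier H) (le H)"
      using sub by (intro refl_onI) (auto simp: H_simps H_le)
    show "trans (le H)"
    proof (rule transI)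
      fix x y z assume xy: "(x, y) \<in> le H" "(y, z) \<in> le H"
      from H_leD[OF xy(1)] H_leD[OF xy(2)]
      obtain a b c where abc: "a \<noteq> 0" "b \<noteq> 0" "c \<noteq> 0" "x = fibre (W a)" "y = fibre (W b)" "z = fibre (W c)"
        by blast
      show "(x, z) \<in> le H" using xy abc by (simp add: H_le)
    qed
    show "antisym (le H)"
    proof (rule antisymI)
      fix x y assume xy: "(x, y) \<in> le H" "(y, x) \<in> le H"
      from H_leD[OF xy(1)] obtain a b where ab: "a \<noteq> 0" "b \<noteq> 0" "x = fibre (W a)" "y = fibre (W b)"
        by blast
      show "x = y" using xy ab by (simp add: H_le)
    qed
    show "total_on (carrier H) (le H)"
      by (auto simp: total_on_def H_simps H_le)
  qed
  fix x y z assume xy: "(x, y) \<in> le H" and z: "z \<in> carrier H"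
  from H_leD[OF xy] obtain a b where ab: "a \<noteq> 0" "b \<noteq> 0" "x = fibre (W a)" "y = fibre (W b)" by blast
  obtain c where c: "c \<noteq> 0" "z = fibre (W c)" using z by (auto simp: H_simps)
  show "(z \<otimes>\<^bsub>H\<^esub> x, z \<otimes>\<^bsub>H\<^esub> y) \<in> le H \<and> (x \<otimes>\<^bsub>H\<^esub> z, y \<otimes>\<^bsub>H\<^esub> z) \<in> le H"
    using xy ab c H_le[of "c * a" "c * b"] H_le[of "a * c" "b * c"] by (simp add: H_simps H_le W_mult)
qed

lemma w_le: "infty_le H (w a) (w b) \<longleftrightarrow> b = 0 \<or> a \<noteq> 0 \<and> W a \<le> W b"
  by (auto simp: w_def H_le)

lemma w_valuation: "valuation UNIV H w"
  unfolding valuation_def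
proof (intro conjI ballI)
  fix a b
  show "totally_ordered_group H" by (rule H_group)
  show "w a \<in> insert Infty (Fin ` carrier H)" by (auto simp: w_def H_simps)
  show "w a = Infty \<longleftrightarrow> a = 0" by (simp add: w_def)
  show "w (a * b) = infty_add H (w a) (w b)" by (simp add: w_def H_simps)
  show "infty_le H (infty_min H (w a) (w b)) (w (a + b))"
  proof (cases "a = 0 \<or> b = 0 \<or> a + b = 0")
    case True
    thus ?thesis by (auto simp: infty_min_def w_le)
  next
    case False
    thus ?thesis using W_add[of a b] by (auto simp: infty_min_def w_le min_def split: if_splits)
  qed
qed

end

section \<open>The quotient division ring of the Weyl algebra\<close>

text \<open>Exponents q \<le> 0 stand for non-negative powers of x, so this is the ring of real
  polynomials in x.\<close>

definition polys :: "puiseux set" where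
  "polys = {c. finite {q. pcoeff c q \<noteq> 0} \<and> (\<forall>q. pcoeff c q \<noteq> 0 \<longrightarrow> q \<in> \<int> \<and> q \<le> 0)}"

lemma polys_laurent: "polys \<subseteq> laurent"
  by (auto simp: polys_def laurent_def)

lemma dsubring_polys: "dsubring polys"
proof -
  note L = dsubringD[OF dsubring_laurent]
  have fin: "finite {q. pcoeff c q \<noteq> 0}" "q \<in> \<int>" if "c \<in> laurent" "pcoeff c q \<noteq> 0" for c q
    using that by (auto simp: laurent_def)
  have I: "c \<in> polys" if "c \<in> laurent" "\<And>q. pcoeff c q \<noteq> 0 \<Longrightarrow> q \<le> 0" for c
    using that by (auto simp: laurent_def polys_def)
  have D: "q \<le> 0" if "c \<in> polys" "pcoeff c q \<noteq> 0" for c q using that by (auto simp: polys_def)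
  show ?thesis unfolding dsubring_def
  proof (intro conjI ballI)
    show "1 \<in> polys" by (rule I[OF L(1)]) (auto simp: one_puiseux.rep_eq split: if_splits)
    fix a assume a: "a \<in> polys"
    hence aL: "a \<in> laurent" using polys_laurent by blast
    show "der a \<in> polys"
    proof (rule I[OF L(4)[OF aL]])
      fix q assume q: "pcoeff (der a) q \<noteq> 0"
      \<comment> \<open>The exponent q = 1 would come from the constant term, which the derivative
        kills.\<close>
      hence "pcoeff a (q - 1) \<noteq> 0" "q \<noteq> 1" by (auto simp: der_puiseux.rep_eq)
      have "q - 1 \<in> \<int>" using fin(2)[OF aL \<open>pcoeff a (q - 1) \<noteq> 0\<close>] .
      then obtain k where "q - 1 = of_int k" by (rule Ints_cases)
      hence "q = of_int (k + 1)" by simp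
      moreover have "q \<le> 1" using D[OF a \<open>pcoeff a (q - 1) \<noteq> 0\<close>] by simp
      ultimately show "q \<le> 0" using \<open>q \<noteq> 1\<close> by (simp add: of_int_le_1_iff)
    qed
    fix b assume b: "b \<in> polys"
    hence bL: "b \<in> laurent" using polys_laurent by blast
    show "a - b \<in> polys"
    proof (rule I[OF L(2)[OF aL bL]])
      fix q assume "pcoeff (a - b) q \<noteq> 0"
      hence "pcoeff a q \<noteq> 0 \<or> pcoeff b q \<noteq> 0" by (auto simp: minus_puiseux.rep_eq)
      thus "q \<le> 0" using D[OF a] D[OF b] by blast
    qed
    show "a * b \<in> polys"
    proof (rule I[OF L(3)[OF aL bL]])
      fix q assume "pcoeff (a * b) q \<noteq> 0"
      from pcoeff_mult_ne[OF this] obtain s t where "pcoeff a s \<noteq> 0" "pcoeff b t \<noteq> 0" "q = s + t" by blast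
      thus "q \<le> 0" using D[OF a, of s] D[OF b, of t] by simp
    qed
  qed
qed

definition wp :: "spoly set" where
  "wp = skew_over polys"

lemmas wp_closed = skew_over_closed[OF dsubring_polys, folded wp_def]

lemma spoly_degree_mult:
  fixes f h :: spoly
  assumes "f \<noteq> 0" "h \<noteq> 0"
  shows "degree (poly_of (f * h)) = degree (poly_of f) + degree (poly_of h)"
    "lead_coeff (poly_of (f * h)) = lead_coeff (poly_of f) * lead_coeff (poly_of h)"
proof -
  have "poly_of f \<noteq> 0" "poly_of h \<noteq> 0"
    using assms by (metis poly_of_inject zero_skew_poly.rep_eq)+
  from degree_skew_mult[OF this] show "degree (poly_of (f * h)) = degree (poly_of f) + degree (poly_of h)"
    "lead_coeff (poly_of (f * h)) = lead_coeff (poly_of f) * lead_coeff (poly_of h)"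
    by (simp_all add: times_skew_poly.rep_eq)
qed

lemma spoly_degree_sconst_svar:
  "c \<noteq> 0 \<Longrightarrow> degree (poly_of (sconst c * svar ^ n)) = n \<and> lead_coeff (poly_of (sconst c * svar ^ n)) = c"
  by (simp add: sconst_svar_pow skew_inverse degree_monom_eq)

text \<open>Leading coefficients cannot be divided in X. Since coefficients commute, P times the
  leading coefficient of Q and Q times that of P, with the right power of y, have the same leading
  term.\<close>

lemma skew_over_pseudo_division:
  assumes X: "dsubring X" and Q: "Q \<in> skew_over X" "Q \<noteq> 0" and P: "P \<in> skew_over X"
  shows "\<exists>c\<in>X. c \<noteq> 0 \<and> (\<exists>D\<in>skew_over X. \<exists>R\<in>skew_over X. P * sconst c = Q * D + R \<and>
    (R = 0 \<or> degree (poly_of R) < degree (poly_of Q)))"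
  using P
proof (induction "degree (poly_of P)" arbitrary: P rule: less_induct)
  case less
  note cl = skew_over_closed[OF X]
  show ?case
  proof (cases "P = 0 \<or> degree (poly_of P) < degree (poly_of Q)")
    case True
    thus ?thesis using dsubringD(1)[OF X] less.prems cl(4)
      by (intro bexI[of _ 1] conjI bexI[of _ 0] bexI[of _ P]) auto
  next
    case False
    define a b where "a = lead_coeff (poly_of P)" and "b = lead_coeff (poly_of Q)"
    have P0: "P \<noteq> 0" using False by simp
    have ab: "a \<noteq> 0" "b \<noteq> 0" "a \<in> X" "b \<in> X"
      using P0 Q less.prems skew_overD unfolding a_def b_def scoeff_def[symmetric]
      by (metis leading_coeff_0_iff poly_of_inject scoeff_def zero_skew_poly.rep_eq)+
    define M where "M = sconst a * svar ^ (degree (poly_of P) - degree (poly_of Q))"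
    have M': "degree (poly_of M) = degree (poly_of P) - degree (poly_of Q)" "lead_coeff (poly_of M) = a"
      using spoly_degree_sconst_svar[OF ab(1)] unfolding M_def by blast+
    hence "M \<noteq> 0" using ab(1) by (metis leading_coeff_0_iff zero_skew_poly.rep_eq)
    note M = this M'
    have MX: "M \<in> skew_over X" unfolding M_def using ab cl by auto
    define P' where "P' = P * sconst b - Q * M"
    have P'X: "P' \<in> skew_over X" unfolding P'_def using less.prems Q MX ab cl by auto
    have sb: "sconst b \<noteq> 0" "degree (poly_of (sconst b)) = 0" "lead_coeff (poly_of (sconst b)) = b"
      using spoly_degree_sconst_svar[OF ab(2), of 0] ab(2) sconst_inj[of b 0] by auto
    have d: "degree (poly_of (P * sconst b)) = degree (poly_of P)" "degree (poly_of (Q * M)) = degree (poly_of P)"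
      "lead_coeff (poly_of (P * sconst b)) = lead_coeff (poly_of (Q * M))"
      using spoly_degree_mult[OF P0 sb(1)] spoly_degree_mult[OF Q(2) M(1)] sb M False
      by (auto simp: a_def b_def)
    show ?thesis
    proof (cases "P' = 0")
      case True
      thus ?thesis using ab MX cl(4) by (intro bexI[of _ b] conjI bexI[of _ M] bexI[of _ 0]) (auto simp: P'_def)
    next
      case nz: False
      have "degree (poly_of P') \<le> degree (poly_of P)"
        using d by (auto simp: P'_def minus_skew_poly.rep_eq intro: degree_diff_le)
      moreover have "coeff (poly_of P') (degree (poly_of P)) = 0"
        using d by (simp add: P'_def minus_skew_poly.rep_eq)
      moreover have "poly_of P' \<noteq> 0" using nz by (metis poly_of_inject zero_skew_poly.rep_eq)
      ultimately have "degree (poly_of P') < degree (poly_of P)"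
        by (metis le_neq_implies_less leading_coeff_0_iff)
      from less.hyps[OF this P'X] obtain c D R where c: "c \<in> X" "c \<noteq> 0" "D \<in> skew_over X" "R \<in> skew_over X"
        "P' * sconst c = Q * D + R" "R = 0 \<or> degree (poly_of R) < degree (poly_of Q)" by blast
      have "P * sconst (b * c) = Q * (M * sconst c + D) + R"
        using c(5) by (simp add: P'_def sconst_mult algebra_simps)
      moreover have "b * c \<in> X" "b * c \<noteq> 0" using ab c dsubringD(3)[OF X] by auto
      moreover have "M * sconst c + D \<in> skew_over X" using MX c cl by auto
      ultimately show ?thesis using c by blast
    qed
  qed
qed

text \<open>Euclid's algorithm with pseudo-division. The common multiples have to stay over X, so
  that sums and products of fractions over X are again such fractions.\<close>

lemma skew_over_ore:
  assumes X: "dsubring X" and "P \<in> skew_over X" "Q \<in> skew_over X" "Q \<noteq> 0"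
  shows "\<exists>C\<in>skew_over X. \<exists>D\<in>skew_over X. C \<noteq> 0 \<and> P * C = Q * D"
  using assms(2-)
proof (induction "degree (poly_of Q)" arbitrary: P Q rule: less_induct)
  case less
  note cl = skew_over_closed[OF X]
  from skew_over_pseudo_division[OF X less.prems(2,3,1)] obtain c D R where
    c: "c \<in> X" "c \<noteq> 0" "D \<in> skew_over X" "R \<in> skew_over X" "P * sconst c = Q * D + R"
      "R = 0 \<or> degree (poly_of R) < degree (poly_of Q)" by blast
  have sc: "sconst c \<in> skew_over X" "sconst c \<noteq> 0" using c cl(1) sconst_inj[of c 0] by auto
  show ?case
  proof (cases "R = 0")
    case True
    hence "P * sconst c = Q * D" using c by simp
    thus ?thesis using sc c by blast
  next
    case False
    then obtain C' D' where CD: "C' \<in> skew_over X" "D' \<in> skew_over X" "C' \<noteq> 0" "Q * C' = R * D'"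
      using less.hyps[of R Q] c less.prems by blast
    hence "D' \<noteq> 0" using less.prems by auto
    have "P * (sconst c * D') = Q * (D * D' + C')"
      using c(5) CD(4) by (simp add: mult.assoc[symmetric] distrib_left distrib_right)
    moreover have "sconst c * D' \<in> skew_over X" "D * D' + C' \<in> skew_over X" using sc c CD cl by auto
    moreover have "sconst c * D' \<noteq> 0" using sc \<open>D' \<noteq> 0\<close> by simp
    ultimately show ?thesis by blast
  qed
qed

lemma skew_over_quot_closed:
  assumes X: "dsubring X"
  defines "K \<equiv> {to_quot a / to_quot b |a b. a \<in> skew_over X \<and> b \<in> skew_over X \<and> b \<noteq> 0}"
  shows "s \<in> K \<Longrightarrow> t \<in> K \<Longrightarrow> s - t \<in> K" "s \<in> K \<Longrightarrow> t \<in> K \<Longrightarrow> s * t \<in> K" "s \<in> K \<Longrightarrow> inverse s \<in> K"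
proof -
  note cl = skew_over_closed[OF X]
  have ex: "to_quot a / to_quot b = to_quot (a * e) / to_quot (b * e)" if "e \<noteq> 0" "b \<noteq> 0" for a b e :: spoly
  proof -
    have nz: "to_quot b \<noteq> 0" "to_quot e \<noteq> 0" using that by auto
    have "to_quot (a * e) / to_quot (b * e) = to_quot a * (to_quot e * inverse (to_quot e)) * inverse (to_quot b)"
      unfolding to_quot_mult divide_inverse nonzero_inverse_mult_distrib[OF nz] by (simp only: mult.assoc)
    thus ?thesis using nz by (simp add: divide_inverse)
  qed
  {
    assume "s \<in> K"
    then obtain a b where ab: "s = to_quot a / to_quot b" "a \<in> skew_over X" "b \<in> skew_over X" "b \<noteq> 0" by (auto simp: K_def)
    show "inverse s \<in> K"
    proof (cases "a = 0")
      case True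
      thus ?thesis using ab cl unfolding K_def by (intro CollectI exI[of _ 0] exI[of _ b]) auto
    next
      case False
      hence "inverse s = to_quot b / to_quot a"
        using ab by (simp add: divide_inverse nonzero_inverse_mult_distrib)
      thus ?thesis using ab False unfolding K_def by blast
    qed
  }
  assume "s \<in> K" "t \<in> K"
  then obtain a b c d where ab: "s = to_quot a / to_quot b" "a \<in> skew_over X" "b \<in> skew_over X" "b \<noteq> 0"
    and cd: "t = to_quot c / to_quot d" "c \<in> skew_over X" "d \<in> skew_over X" "d \<noteq> 0" by (auto simp: K_def)
  obtain e f where ef: "e \<in> skew_over X" "f \<in> skew_over X" "e \<noteq> 0" "b * e = d * f"
    using skew_over_ore[OF X ab(3) cd(3,4)] by blast
  have f0: "f \<noteq> 0" using ef ab by auto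
  have "s - t = to_quot (a * e) / to_quot (b * e) - to_quot (c * f) / to_quot (b * e)"
    using ex[OF ef(3) ab(4), of a] ex[OF f0 cd(4), of c] ab cd ef by simp
  also have "\<dots> = to_quot (a * e - c * f) / to_quot (b * e)" by (simp add: to_quot_diff diff_divide_distrib)
  finally have "s - t = to_quot (a * e - c * f) / to_quot (b * e)" .
  moreover have "a * e - c * f \<in> skew_over X" "b * e \<in> skew_over X" "b * e \<noteq> 0" using ab cd ef cl by auto
  ultimately show "s - t \<in> K" unfolding K_def by blast
  obtain g h where gh: "g \<in> skew_over X" "h \<in> skew_over X" "g \<noteq> 0" "c * g = b * h"
    using skew_over_ore[OF X cd(2) ab(3,4)] by blast
  have "inverse (to_quot b) * to_quot c = to_quot h * inverse (to_quot g)"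
  proof -
    have "to_quot b * (inverse (to_quot b) * to_quot c) * to_quot g = to_quot b * (to_quot h * inverse (to_quot g)) * to_quot g"
      using ab gh by (simp add: mult.assoc[symmetric] to_quot_mult[symmetric]) (simp add: mult.assoc)
    thus ?thesis using ab gh by simp
  qed
  hence "s * t = to_quot a * (to_quot h * inverse (to_quot g)) * inverse (to_quot d)"
    using ab cd by (simp add: divide_inverse mult.assoc) (simp add: mult.assoc[symmetric])
  hence "s * t = to_quot (a * h) / to_quot (d * g)"
    using cd gh by (simp add: to_quot_mult divide_inverse nonzero_inverse_mult_distrib mult.assoc)
  moreover have "a * h \<in> skew_over X" "d * g \<in> skew_over X" "d * g \<noteq> 0" using ab cd gh cl by auto
  ultimately show "s * t \<in> K" unfolding K_def by blast
qed

lemma weyl_algebra_eq: "weyl_algebra = to_quot ` wp"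
proof
  show "weyl_algebra \<subseteq> to_quot ` wp"
  proof
    fix a assume "a \<in> weyl_algebra"
    thus "a \<in> to_quot ` wp"
    proof induction
      case (real r)
      have "puiseux_monom r 0 \<in> polys"
      proof -
        have "{q. pcoeff (puiseux_monom r 0) q \<noteq> 0} \<subseteq> {0}" by (auto simp: puiseux_monom.rep_eq split: if_splits)
        thus ?thesis using finite_subset by (fastforce simp: polys_def)
      qed
      thus ?case using wp_closed(1) by (auto simp: to_quot_real[symmetric])
    next
      case x
      have "puiseux_monom 1 1 \<in> polys"
      proof -
        have "{q. pcoeff (puiseux_monom 1 1) q \<noteq> 0} \<subseteq> {- 1}" by (auto simp: puiseux_monom.rep_eq split: if_splits)
        thus ?thesis using finite_subset by (fastforce simp: polys_def)
      qed
      moreover have "weyl_x = to_quot (sconst (puiseux_monom 1 1))" by (simp add: to_quot_monom weyl_x_def)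
      ultimately show ?case using wp_closed(1) by auto
    next
      case y
      thus ?case using wp_closed(2) by (simp add: weyl_y_def)
    next
      case (add a b)
      thus ?case using wp_closed(5) by (auto simp: to_quot_add[symmetric])
    next
      case (mult a b)
      thus ?case using wp_closed(7) by (auto simp: to_quot_mult[symmetric])
    qed
  qed
  show "to_quot ` wp \<subseteq> weyl_algebra"
  proof
    fix a assume "a \<in> to_quot ` wp"
    then obtain f where f: "f \<in> wp" "a = to_quot f" by blast
    have sum: "sum F A \<in> weyl_algebra" if "\<And>x. x \<in> A \<Longrightarrow> F x \<in> weyl_algebra" for F and A :: "'b set"
      using that weyl_algebra.real[of 0] by (induction A rule: infinite_finite_induct) (auto intro: weyl_algebra.add)
    have pow: "b ^ n \<in> weyl_algebra" if "b \<in> weyl_algebra" for b n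
      using that weyl_algebra.real[of 1] by (induction n) (auto intro: weyl_algebra.mult)
    have c: "to_quot (sconst c) \<in> weyl_algebra" if "c \<in> polys" for c
    proof -
      have "to_quot (sconst c) = (\<Sum>q | pcoeff c q \<noteq> 0. real_const (pcoeff c q) * x_pow (- q))"
        using that polys_laurent by (intro to_quot_laurent) auto
      moreover have "x_pow (- q) \<in> weyl_algebra" if q: "pcoeff c q \<noteq> 0" for q
      proof -
        have "q \<in> \<int>" "q \<le> 0" using q \<open>c \<in> polys\<close> by (auto simp: polys_def)
        then obtain k where "q = of_int k" "k \<le> 0" by (auto elim: Ints_cases)
        hence "x_pow (- q) = weyl_x ^ nat (- k)" by (simp add: weyl_x_def x_pow_power)
        thus ?thesis using pow[OF weyl_algebra.x] by simp
      qed
      ultimately show ?thesis by (auto intro!: sum weyl_algebra.mult weyl_algebra.real)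
    qed
    have "to_quot (sconst (scoeff f i) * svar ^ i) \<in> weyl_algebra" for i
      unfolding to_quot_mult to_quot_power weyl_y_def[symmetric]
      using c[of "scoeff f i"] f pow[OF weyl_algebra.y] by (auto simp: wp_def skew_over_def intro: weyl_algebra.mult)
    hence "(\<Sum>i\<le>degree (poly_of f). to_quot (sconst (scoeff f i) * svar ^ i)) \<in> weyl_algebra" by (intro sum)
    thus "a \<in> weyl_algebra" unfolding f(2) by (subst spoly_sum) (simp add: to_quot_sum)
  qed
qed

lemma weyl_quot_eq: "weyl_quot = {to_quot a / to_quot b |a b. a \<in> skew_over polys \<and> b \<in> skew_over polys \<and> b \<noteq> 0}"
proof (intro equalityI subsetI)
  fix x assume "x \<in> weyl_quot"
  then obtain a b where "x = to_quot a / to_quot b" "a \<in> wp" "b \<in> wp" "to_quot b \<noteq> 0"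
    unfolding weyl_quot_def weyl_algebra_eq by blast
  moreover from this have "b \<noteq> 0" by auto
  ultimately show "x \<in> {to_quot a / to_quot b |a b. a \<in> skew_over polys \<and> b \<in> skew_over polys \<and> b \<noteq> 0}"
    unfolding wp_def by blast
next
  fix x assume "x \<in> {to_quot a / to_quot b |a b. a \<in> skew_over polys \<and> b \<in> skew_over polys \<and> b \<noteq> 0}"
  then obtain a b where "x = to_quot a / to_quot b" "a \<in> wp" "b \<in> wp" "b \<noteq> 0"
    unfolding wp_def by blast
  moreover from this have "to_quot b \<noteq> 0" by simp
  ultimately show "x \<in> weyl_quot" unfolding weyl_quot_def weyl_algebra_eq by blast
qed

lemmas weyl_quot_closed = skew_over_quot_closed[OF dsubring_polys, folded weyl_quot_eq]

lemma weyl_algebra_quot: "a \<in> weyl_algebra \<Longrightarrow> a \<in> weyl_quot"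
  unfolding weyl_quot_def using weyl_algebra.real[of 1]
  by (intro CollectI exI[of _ a] exI[of _ 1]) auto

lemma weyl_quot_real: "real_const r \<in> weyl_quot"
  and weyl_quot_x: "weyl_x \<in> weyl_quot"
  and weyl_quot_y: "weyl_y \<in> weyl_quot"
  by (auto intro: weyl_algebra_quot weyl_algebra.intros)

lemma weyl_quot_add: "a \<in> weyl_quot \<Longrightarrow> b \<in> weyl_quot \<Longrightarrow> a + b \<in> weyl_quot"
  using weyl_quot_closed(1)[of a "0 - b"] weyl_quot_closed(1)[of 0 b] weyl_quot_real[of 0] by simp

lemma weyl_quot_x_pow: "x_pow (of_int k) \<in> weyl_quot"
proof -
  have "weyl_x ^ n \<in> weyl_quot" for n
    using weyl_quot_real[of 1] weyl_quot_x weyl_quot_closed(2) by (induction n) auto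
  hence "weyl_x powi k \<in> weyl_quot" using weyl_quot_closed(3) by (auto simp: power_int_def power_inverse)
  thus ?thesis by (simp add: weyl_x_powi)
qed

lemma wl_weyl_quot: "f \<in> wl \<Longrightarrow> to_quot f \<in> weyl_quot"
proof -
  assume f: "f \<in> wl"
  have sum: "sum F A \<in> weyl_quot" if "\<And>x. x \<in> A \<Longrightarrow> F x \<in> weyl_quot" for F and A :: "'b set"
    using that weyl_quot_real[of 0] by (induction A rule: infinite_finite_induct) (auto intro: weyl_quot_add)
  have pow: "weyl_y ^ n \<in> weyl_quot" for n
    using weyl_quot_real[of 1] weyl_quot_y weyl_quot_closed(2) by (induction n) auto
  have c: "to_quot (sconst c) \<in> weyl_quot" if "c \<in> laurent" for c
  proof -
    note to_quot_laurent[OF that]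
    moreover have "x_pow (- q) \<in> weyl_quot" if q: "pcoeff c q \<noteq> 0" for q
    proof -
      have "q \<in> \<int>" using q \<open>c \<in> laurent\<close> by (auto simp: laurent_def)
      then obtain k where "q = of_int k" by (auto elim: Ints_cases)
      thus ?thesis using weyl_quot_x_pow[of "- k"] by simp
    qed
    ultimately show ?thesis by (auto intro!: sum weyl_quot_closed(2) weyl_quot_real)
  qed
  have "to_quot (sconst (scoeff f i) * svar ^ i) \<in> weyl_quot" for i
    unfolding to_quot_mult to_quot_power weyl_y_def[symmetric]
    using c[of "scoeff f i"] f pow by (auto simp: wl_def skew_over_def intro: weyl_quot_closed(2))
  hence "(\<Sum>i\<le>degree (poly_of f). to_quot (sconst (scoeff f i) * svar ^ i)) \<in> weyl_quot" by (intro sum)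
  thus ?thesis by (subst spoly_sum) (simp add: to_quot_sum)
qed

lemma wp_wl: "wp \<subseteq> wl"
  using polys_laurent by (auto simp: wp_def wl_def skew_over_def)

section \<open>Valuations with real residue field\<close>

lemma quotient_of_eqI: "n > 0 \<Longrightarrow> coprime m n \<Longrightarrow> quotient_of (of_int m / of_int n) = (m, n)"
  by (simp add: Fract_of_int_quotient[symmetric] quotient_of_Fract normalize_stable)

locale real_valuation =
  fixes K :: "weyl_ext set" and \<Gamma> :: "'g ordered_group" and v :: "weyl_ext \<Rightarrow> 'g with_infty"
  assumes val: "valuation K \<Gamma> v" and residue_real: "residue_field_real K \<Gamma> v"
    and x_neg: "infty_less \<Gamma> (v weyl_x) (infty_zero \<Gamma>)"
    and K_subring: "a \<in> K \<Longrightarrow> b \<in> K \<Longrightarrow> a - b \<in> K" "a \<in> K \<Longrightarrow> b \<in> K \<Longrightarrow> a * b \<in> K"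
      "a \<in> K \<Longrightarrow> inverse a \<in> K" "real_const r \<in> K" "weyl_x \<in> K"
begin

abbreviation vle :: "weyl_ext \<Rightarrow> weyl_ext \<Rightarrow> bool" where
  "vle a b \<equiv> infty_le \<Gamma> (v a) (v b)"

lemma group_facts: "totally_ordered_group \<Gamma>" "group \<Gamma>"
  using val totally_ordered_group.axioms(1) by (auto simp: valuation_def)

lemma order_facts:
  "g \<in> carrier \<Gamma> \<Longrightarrow> (g, g) \<in> le \<Gamma>" "(g, h) \<in> le \<Gamma> \<Longrightarrow> (h, k) \<in> le \<Gamma> \<Longrightarrow> (g, k) \<in> le \<Gamma>"
  "(g, h) \<in> le \<Gamma> \<Longrightarrow> (h, g) \<in> le \<Gamma> \<Longrightarrow> g = h"
  "g \<in> carrier \<Gamma> \<Longrightarrow> h \<in> carrier \<Gamma> \<Longrightarrow> (g, h) \<in> le \<Gamma> \<or> (h, g) \<in> le \<Gamma>"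
proof -
  have l: "linear_order_on (carrier \<Gamma>) (le \<Gamma>)" using group_facts(1) by (rule totally_ordered_group.linear_order)
  hence o: "refl_on (carrier \<Gamma>) (le \<Gamma>)" "trans (le \<Gamma>)" "antisym (le \<Gamma>)" "total_on (carrier \<Gamma>) (le \<Gamma>)"
    by (auto simp: linear_order_on_def partial_order_on_def preorder_on_def)
  show r: "(g, g) \<in> le \<Gamma>" if "g \<in> carrier \<Gamma>" for g using o(1) that by (rule refl_onD)
  show "(g, h) \<in> le \<Gamma> \<Longrightarrow> (h, k) \<in> le \<Gamma> \<Longrightarrow> (g, k) \<in> le \<Gamma>" using o(2) by (rule transD)
  show "(g, h) \<in> le \<Gamma> \<Longrightarrow> (h, g) \<in> le \<Gamma> \<Longrightarrow> g = h" using o(3) by (rule antisymD)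
  show "g \<in> carrier \<Gamma> \<Longrightarrow> h \<in> carrier \<Gamma> \<Longrightarrow> (g, h) \<in> le \<Gamma> \<or> (h, g) \<in> le \<Gamma>"
    using o(4) r by (cases "g = h") (auto simp: total_on_def)
qed

lemma v_0_iff: "a \<in> K \<Longrightarrow> v a = Infty \<longleftrightarrow> a = 0"
  using val by (simp add: valuation_def)

lemma K_zero: "0 \<in> K" and K_one: "1 \<in> K"
  using K_subring(4)[of 0] K_subring(4)[of 1] by auto

lemma v_0: "v 0 = Infty"
  using v_0_iff[OF K_zero] by simp

lemma v_Fin: "a \<in> K \<Longrightarrow> a \<noteq> 0 \<Longrightarrow> \<exists>g. g \<in> carrier \<Gamma> \<and> v a = Fin g"
  using val by (auto simp: valuation_def)

lemma v_mult: "a \<in> K \<Longrightarrow> b \<in> K \<Longrightarrow> v (a * b) = infty_add \<Gamma> (v a) (v b)"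
  using val by (simp add: valuation_def)

lemma v_real: "r \<noteq> 0 \<Longrightarrow> v (real_const r) = infty_zero \<Gamma>"
  using residue_real by (simp add: residue_field_real_def)

lemma v_1: "v 1 = infty_zero \<Gamma>"
  using v_real[of 1] by simp

lemma vle_antisym: "a \<in> K \<Longrightarrow> b \<in> K \<Longrightarrow> vle a b \<Longrightarrow> vle b a \<Longrightarrow> v a = v b"
  by (cases "v a"; cases "v b") (auto intro: order_facts(3))

lemma vle_refl': "a \<in> K \<Longrightarrow> vle a a"
  using v_Fin[of a] v_0 order_facts(1) by (cases "a = 0") auto

lemma vle_trans': "vle a b \<Longrightarrow> vle b c \<Longrightarrow> vle a c"
  by (cases "v a"; cases "v b"; cases "v c") (auto intro: order_facts(2))

lemma vle_total': "a \<in> K \<Longrightarrow> b \<in> K \<Longrightarrow> vle a b \<or> vle b a"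
proof (cases "a = 0 \<or> b = 0")
  case False
  assume "a \<in> K" "b \<in> K"
  then obtain g h where "g \<in> carrier \<Gamma>" "v a = Fin g" "h \<in> carrier \<Gamma>" "v b = Fin h"
    using v_Fin[of a] v_Fin[of b] False by blast
  thus ?thesis using order_facts(4)[of g h] by simp
qed (auto simp: v_0)

lemma less_zero_iff: "a \<in> K \<Longrightarrow> infty_less \<Gamma> (infty_zero \<Gamma>) (v a) \<longleftrightarrow> \<not> vle a 1"
proof -
  assume a: "a \<in> K"
  have "vle a 1 \<or> vle 1 a"
    by (rule vle_total'[OF a K_one])
  thus ?thesis using vle_antisym[OF a K_one] vle_refl'[OF K_one] unfolding infty_less_def v_1[symmetric] by metis
qed

lemma valuation_ring_iff: "a \<in> valuation_ring K \<Gamma> v \<longleftrightarrow> a \<in> K \<and> vle 1 a"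
  by (simp add: valuation_ring_def v_1)

lemma residue_class_iff: "a \<in> K \<Longrightarrow> b \<in> residue_class K \<Gamma> v a \<longleftrightarrow> b \<in> K \<and> vle 1 b \<and> \<not> vle (b - a) 1"
  using less_zero_iff[of "b - a"] K_subring(1)[of b a] by (auto simp: residue_class_def valuation_ring_iff)

sublocale dominance K vle
proof
  fix a b c r
  show "a \<in> K \<Longrightarrow> b \<in> K \<Longrightarrow> a - b \<in> K" "a \<in> K \<Longrightarrow> b \<in> K \<Longrightarrow> a * b \<in> K" "a \<in> K \<Longrightarrow> inverse a \<in> K"
    "real_const r \<in> K" "weyl_x \<in> K" by (rule K_subring; assumption)+
  show "vle a b \<Longrightarrow> vle b c \<Longrightarrow> vle a c" by (rule vle_trans')
  show "a \<in> K \<Longrightarrow> vle a 0" by (simp add: v_0)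
  show "a \<in> K \<Longrightarrow> vle 0 a \<Longrightarrow> a = 0" using v_0_iff by (cases "v a") (auto simp: v_0)
  show "a \<in> K \<Longrightarrow> b \<in> K \<Longrightarrow> vle a b \<or> vle b a"
    by (rule vle_total')
  show "a \<in> K \<Longrightarrow> b \<in> K \<Longrightarrow> c \<in> K \<Longrightarrow> vle a b \<Longrightarrow> vle (c * a) (c * b)"
    "a \<in> K \<Longrightarrow> b \<in> K \<Longrightarrow> c \<in> K \<Longrightarrow> vle a b \<Longrightarrow> vle (a * c) (b * c)"
  proof -
    assume *: "a \<in> K" "b \<in> K" "c \<in> K" "vle a b"
    show "vle (c * a) (c * b)" "vle (a * c) (b * c)"
    proof (atomize (full), cases "b = 0 \<or> c = 0")
      case False
      hence "v b \<noteq> Infty" using v_0_iff * by simp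
      then obtain h where h: "v b = Fin h" by (cases "v b") auto
      then obtain g where g: "v a = Fin g" using * by (cases "v a") auto
      obtain k where k: "k \<in> carrier \<Gamma>" "v c = Fin k" using v_Fin[OF *(3)] False by blast
      show "vle (c * a) (c * b) \<and> vle (a * c) (b * c)"
        using totally_ordered_group.le_translate[OF group_facts(1) _ k(1), of g h] * g h k
        by (simp add: v_mult)
    qed (auto simp: v_0)
  qed
  show "vle c (a + b)" if "a \<in> K" "b \<in> K" "c \<in> K" "vle c a" "vle c b"
  proof -
    have "infty_le \<Gamma> (infty_min \<Gamma> (v a) (v b)) (v (a + b))" using val that by (simp add: valuation_def)
    hence "vle a (a + b) \<or> vle b (a + b)" by (auto simp: infty_min_def split: if_splits)
    thus ?thesis using that vle_trans' by blast
  qed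
  show "r \<noteq> 0 \<Longrightarrow> vle 1 (real_const r)" using vle_refl'[OF K_one] by (simp add: v_real v_1)
  show "\<not> vle 1 weyl_x"
    using x_neg vle_antisym[OF K_one K_subring(5)] unfolding infty_less_def v_1[symmetric] by metis
  show "\<exists>r. \<not> vle (a - real_const r) 1" if a: "a \<in> K" "vle 1 a"
  proof -
    have "a \<in> residue_class K \<Gamma> v a" using a by (simp add: residue_class_iff v_0 v_1)
    moreover have "residue_class K \<Gamma> v a \<in> (\<lambda>r. residue_class K \<Gamma> v (real_const r)) ` UNIV"
      using residue_real a unfolding residue_field_real_def bij_betw_def by (simp add: valuation_ring_iff)
    ultimately obtain r where "a \<in> residue_class K \<Gamma> v (real_const r)" by auto
    thus ?thesis using residue_class_iff K_subring(4) by blast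
  qed
qed

lemma residue_eqI:
  assumes a: "a \<in> K" "vlt 1 (a - real_const r)"
  shows "residue K \<Gamma> v a = r"
  unfolding residue_def
proof (rule the_equality)
  have K: "a - real_const r \<in> K" using a K_diff K_real by blast
  show "residue_class K \<Gamma> v (real_const r) = residue_class K \<Gamma> v a"
  proof (intro Set.set_eqI)
    fix b
    have "vlt 1 (b - real_const r) \<longleftrightarrow> vlt 1 (b - a)" if b: "b \<in> K"
    proof
      show "vlt 1 (b - real_const r) \<Longrightarrow> vlt 1 (b - a)"
        using vlt_diff[OF K_diff[OF b K_real] K K_1 _ a(2), of r] by simp
      show "vlt 1 (b - a) \<Longrightarrow> vlt 1 (b - real_const r)"
        using vlt_add[OF K_diff[OF b a(1)] K K_1 _ a(2)] by simp
    qed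
    thus "b \<in> residue_class K \<Gamma> v (real_const r) \<longleftrightarrow> b \<in> residue_class K \<Gamma> v a"
      using residue_class_iff[OF a(1)] residue_class_iff[OF K_real] by blast
  qed
  fix r' assume r': "residue_class K \<Gamma> v (real_const r') = residue_class K \<Gamma> v a"
  have "vle 1 (real_const r')" using vle_real vle_0 K_1 by (cases "r' = 0") auto
  hence "real_const r' \<in> residue_class K \<Gamma> v (real_const r')"
    using K_real by (simp add: residue_class_iff v_0 v_1)
  hence "vlt 1 (real_const r' - a)" unfolding r' using residue_class_iff[OF a(1)] by blast
  hence "vlt 1 (real_const r' - a + (a - real_const r))"
    using a(2) by (intro vlt_add K_diff K_1 K_real a(1))
  hence "vlt 1 (real_const (r' - r))" by (simp add: real_const_diff)
  hence "r' - r = 0" using veqv_real by blast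
  thus "r' = r" by simp
qed

lemma residue_sim:
  assumes r: "r \<noteq> 0" and s: "sim a (real_const r)"
  shows "residue K \<Gamma> v a = r"
proof (rule residue_eqI)
  show a: "a \<in> K" using s by (rule sim_K)
  show "vlt 1 (a - real_const r)"
    using s veqv_real[OF r] vle_vlt_trans[OF K_1 K_real K_diff[OF a K_real]] unfolding sim_def by blast
qed

lemma sim_residue: "a \<in> K \<Longrightarrow> veqv 1 a \<Longrightarrow> sim a (real_const (residue K \<Gamma> v a)) \<and> residue K \<Gamma> v a \<noteq> 0"
proof -
  assume a: "a \<in> K" "veqv 1 a"
  obtain r where r: "r \<noteq> 0" "sim a (real_const r * 1)"
    using sim_real_ex[OF a(1) K_1 _ one_neq_zero] a(2) by metis
  hence "sim a (real_const r)" by simp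
  thus ?thesis using residue_sim[OF r(1)] r(1) by simp
qed

lemma v_power: "a \<in> K \<Longrightarrow> v a = Fin g \<Longrightarrow> g \<in> carrier \<Gamma> \<Longrightarrow> v (a ^ n) = Fin (g [^]\<^bsub>\<Gamma>\<^esub> n)"
proof (induction n)
  case 0
  thus ?case using group.is_monoid[OF group_facts(2)] by (simp add: v_1)
next
  case (Suc n)
  have "v (a ^ n * a) = Fin (g [^]\<^bsub>\<Gamma>\<^esub> Suc n)"
    using Suc v_mult[OF K_power[OF Suc.prems(1)] Suc.prems(1)] group.is_monoid[OF group_facts(2)] by simp
  thus ?case by (simp only: power_Suc2)
qed

lemma v_inverse: "a \<in> K \<Longrightarrow> a \<noteq> 0 \<Longrightarrow> v a = Fin g \<Longrightarrow> g \<in> carrier \<Gamma> \<Longrightarrow> v (inverse a) = Fin (inv\<^bsub>\<Gamma>\<^esub> g)"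
proof -
  assume a: "a \<in> K" "a \<noteq> 0" "v a = Fin g" "g \<in> carrier \<Gamma>"
  obtain h where h: "h \<in> carrier \<Gamma>" "v (inverse a) = Fin h" using v_Fin[of "inverse a"] a K_inverse by auto
  have "v (inverse a * a) = Fin (h \<otimes>\<^bsub>\<Gamma>\<^esub> g)" unfolding v_mult[OF K_inverse[OF a(1)] a(1)] a(3) h(2) by simp
  hence "h \<otimes>\<^bsub>\<Gamma>\<^esub> g = \<one>\<^bsub>\<Gamma>\<^esub>" using a v_1 by simp
  thus ?thesis using group.inv_equality[OF group_facts(2) _ a(4) h(1)] h(2) by simp
qed

lemma value_is_frac_iff:
  assumes a: "a \<in> K"
  shows "value_is_frac \<Gamma> v a m n \<longleftrightarrow> n > 0 \<and> coprime m n \<and> veq a (of_int m / of_int n)"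
proof (cases "a = 0 \<or> n \<le> 0")
  case True
  thus ?thesis by (auto simp: value_is_frac_def v_0 veq_def)
next
  case False
  obtain g where g: "g \<in> carrier \<Gamma>" "v a = Fin g" using v_Fin[OF a] False by blast
  obtain e where e: "e \<in> carrier \<Gamma>" "v weyl_x = Fin e" using v_Fin[OF K_x] by auto
  define k where "k = nat n"
  have k: "n = int k" "k > 0" using False by (auto simp: k_def)
  have fn: "v (a ^ k) = Fin (g [^]\<^bsub>\<Gamma>\<^esub> n)" using v_power[OF a g(2,1), of k] k by (simp add: int_pow_int)
  have ix: "v (inverse weyl_x) = Fin (inv\<^bsub>\<Gamma>\<^esub> e)" by (rule v_inverse[OF K_x weyl_x_nz e(2,1)])
  have ie: "inv\<^bsub>\<Gamma>\<^esub> e \<in> carrier \<Gamma>" using group.inv_closed[OF group_facts(2) e(1)] .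
  have xm: "v (inverse weyl_x powi m) = Fin ((inv\<^bsub>\<Gamma>\<^esub> e) [^]\<^bsub>\<Gamma>\<^esub> m)"
  proof (cases "m \<ge> 0")
    case True
    then obtain j where "m = int j" using nonneg_int_cases by blast
    thus ?thesis using v_power[OF K_inverse[OF K_x] ix ie, of j] by (simp add: int_pow_int)
  next
    case False
    define j where "j = nat (- m)"
    have j: "m = - int j" using False by (simp add: j_def)
    have "v (weyl_x ^ j) = Fin (e [^]\<^bsub>\<Gamma>\<^esub> j)" by (rule v_power[OF K_x e(2,1)])
    moreover have "inverse weyl_x powi m = weyl_x ^ j" unfolding j by (simp add: power_int_minus power_inverse)
    moreover have "(inv\<^bsub>\<Gamma>\<^esub> e) [^]\<^bsub>\<Gamma>\<^esub> m = e [^]\<^bsub>\<Gamma>\<^esub> j"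
      unfolding j using e group_facts(2) ie monoid.nat_pow_closed[OF group.is_monoid[OF group_facts(2)] e(1), of j]
      by (simp add: group.int_pow_neg int_pow_int group.nat_pow_inv group.inv_inv)
    ultimately show ?thesis by simp
  qed
  have "inverse weyl_x powi m = x_pow (- of_int m)" by (simp add: weyl_x_def x_pow_inverse x_pow_powi)
  hence xm: "v (x_pow (- of_int m)) = Fin ((inv\<^bsub>\<Gamma>\<^esub> e) [^]\<^bsub>\<Gamma>\<^esub> m)" using xm by simp
  have "veq a (of_int m / of_int n) \<longleftrightarrow> veqv (a ^ k) (x_pow (- of_int m))"
    by (rule veq_iff_power[OF a k(2)]) (simp add: k)
  also have "\<dots> \<longleftrightarrow> v (a ^ k) = v (x_pow (- of_int m))"
    using vle_antisym[OF K_power[OF a] K_x_pow_minus] vle_refl[OF K_power[OF a]] by metis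
  also have "\<dots> \<longleftrightarrow> g [^]\<^bsub>\<Gamma>\<^esub> n = (inv\<^bsub>\<Gamma>\<^esub> e) [^]\<^bsub>\<Gamma>\<^esub> m" by (simp add: fn xm)
  finally show ?thesis using False g e by (auto simp: value_is_frac_def)
qed

lemma value_frac:
  assumes a: "a \<in> K"
  shows "rational_value \<Gamma> v a \<longleftrightarrow> (\<exists>q. veq a q)"
    "veq a q \<Longrightarrow> (value_num \<Gamma> v a, value_den \<Gamma> v a) = quotient_of q"
    "veq a q \<Longrightarrow> value_den \<Gamma> v a > 0 \<and> q = of_int (value_num \<Gamma> v a) / of_int (value_den \<Gamma> v a)"
proof -
  have e: "value_is_frac \<Gamma> v a m n \<longleftrightarrow> (m, n) = quotient_of q" if "veq a q" for m n q
  proof -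
    have "q = of_int m / of_int n \<and> n > 0 \<and> coprime m n \<longleftrightarrow> (m, n) = quotient_of q"
      using quotient_of_eqI[of n m] quotient_of_div[of q m n] quotient_of_denom_pos[of q m n]
        quotient_of_coprime[of q m n] by auto
    thus ?thesis using value_is_frac_iff[OF a, of m n] veq_unique[OF that] that by metis
  qed
  have q: "(value_num \<Gamma> v a, value_den \<Gamma> v a) = quotient_of q" if "veq a q" for q
  proof -
    obtain m n where mn: "quotient_of q = (m, n)" by (cases "quotient_of q")
    have "value_num \<Gamma> v a = m" "value_den \<Gamma> v a = n" unfolding value_num_def value_den_def e[OF that] mn by auto
    thus ?thesis using mn by simp
  qed
  show "veq a q \<Longrightarrow> (value_num \<Gamma> v a, value_den \<Gamma> v a) = quotient_of q" by (rule q)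
  show "veq a q \<Longrightarrow> value_den \<Gamma> v a > 0 \<and> q = of_int (value_num \<Gamma> v a) / of_int (value_den \<Gamma> v a)"
    using q quotient_of_div quotient_of_denom_pos by metis
  show "rational_value \<Gamma> v a \<longleftrightarrow> (\<exists>q. veq a q)"
  proof
    show "rational_value \<Gamma> v a \<Longrightarrow> \<exists>q. veq a q" using value_is_frac_iff[OF a] by (auto simp: rational_value_def)
    assume "\<exists>q. veq a q"
    then obtain q where "veq a q" by blast
    moreover obtain m n where "quotient_of q = (m, n)" by (cases "quotient_of q")
    ultimately show "rational_value \<Gamma> v a" using e unfolding rational_value_def by metis
  qed
qed

end

lemma equivalent_valuations_le:
  assumes "equivalent_valuations K G v H w" "a \<in> K" "b \<in> K"
  shows "infty_le G (v a) (v b) \<longleftrightarrow> infty_le H (w a) (w b)"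
proof -
  obtain \<phi> where \<phi>: "\<forall>g\<in>value_group K v. \<forall>h\<in>value_group K v. (g, h) \<in> le G \<longleftrightarrow> (\<phi> g, \<phi> h) \<in> le H"
    "\<forall>a\<in>K. w a = map_with_infty \<phi> (v a)"
    using assms(1) by (auto simp: equivalent_valuations_def)
  have w: "w a = map_with_infty \<phi> (v a)" "w b = map_with_infty \<phi> (v b)" using \<phi>(2) assms by blast+
  show ?thesis
  proof (cases "v b")
    case (Fin h)
    hence h: "h \<in> value_group K v" using assms(3) by (force simp: value_group_def)
    show ?thesis
    proof (cases "v a")
      case fg: (Fin g)
      hence "g \<in> value_group K v" using assms(2) by (force simp: value_group_def)
      thus ?thesis using Fin fg w \<phi>(1) h by simp
    qed (use Fin w in simp)
  qed (use w in simp)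
qed

text \<open>Equal valuation rings give the same order of all values, after division by one of the
  two elements, so sending v a to w a is well defined and an isomorphism of the value
  groups.\<close>

lemma equivalent_valuationsI:
  assumes "real_valuation K G v" "real_valuation K H w"
    and le: "\<And>a. a \<in> K \<Longrightarrow> infty_le G (v 1) (v a) \<longleftrightarrow> infty_le H (w 1) (w a)"
  shows "equivalent_valuations K G v H w"
proof -
  interpret V: real_valuation K G v by fact
  interpret W: real_valuation K H w by fact
  have iff: "V.vle a b \<longleftrightarrow> W.vle a b" if "a \<in> K" "b \<in> K" for a b
  proof (cases "a = 0")
    case True
    thus ?thesis using that V.vle_0D V.vle_0 W.vle_0D W.vle_0 by blast
  next
    case False
    have ia: "inverse a \<in> K" "b * inverse a \<in> K" using that V.K_inverse V.K_mult by blast+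
    have "V.vle a b \<longleftrightarrow> V.vle 1 (b * inverse a)" "W.vle a b \<longleftrightarrow> W.vle 1 (b * inverse a)"
      using V.vle_cancel_right[OF that ia(1)] W.vle_cancel_right[OF that ia(1)] False by auto
    thus ?thesis using le[OF ia(2)] by simp
  qed
  have eq: "v a = v b \<longleftrightarrow> w a = w b" if "a \<in> K" "b \<in> K" for a b
    using iff[OF that] iff[OF that(2,1)] V.vle_antisym[OF that] W.vle_antisym[OF that] V.vle_refl W.vle_refl that by metis
  define \<phi> where "\<phi> g = (THE h. \<exists>a\<in>K. v a = Fin g \<and> w a = Fin h)" for g
  have \<phi>: "\<phi> g = h" if "a \<in> K" "v a = Fin g" "w a = Fin h" for a g h
    unfolding \<phi>_def using that eq by (intro the_equality) (auto, metis with_infty.inject)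
  have val: "\<exists>a\<in>K. a \<noteq> 0 \<and> v a = Fin g" if "g \<in> value_group K v" for g
    using that V.v_0 by (force simp: value_group_def)
  have fin: "\<exists>g h. v a = Fin g \<and> w a = Fin h \<and> g \<in> value_group K v \<and> h \<in> value_group K w \<and> \<phi> g = h"
    if "a \<in> K" "a \<noteq> 0" for a
  proof -
    obtain g h where "v a = Fin g" "w a = Fin h" using V.v_Fin[OF \<open>a \<in> K\<close> \<open>a \<noteq> 0\<close>] W.v_Fin[OF \<open>a \<in> K\<close> \<open>a \<noteq> 0\<close>] by blast
    thus ?thesis using \<phi> that by (force simp: value_group_def)
  qed
  have "\<phi> \<in> iso (G\<lparr>carrier := value_group K v\<rparr>) (H\<lparr>carrier := value_group K w\<rparr>)"
  proof (rule isoI)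
    show "\<phi> \<in> hom (G\<lparr>carrier := value_group K v\<rparr>) (H\<lparr>carrier := value_group K w\<rparr>)"
    proof (rule homI)
      fix g assume "g \<in> carrier (G\<lparr>carrier := value_group K v\<rparr>)"
      then obtain a where a: "a \<in> K" "a \<noteq> 0" "v a = Fin g" using val by auto
      thus "\<phi> g \<in> carrier (H\<lparr>carrier := value_group K w\<rparr>)" using fin[OF a(1,2)] by auto
      fix h assume "h \<in> carrier (G\<lparr>carrier := value_group K v\<rparr>)"
      then obtain b where b: "b \<in> K" "b \<noteq> 0" "v b = Fin h" using val by auto
      obtain g' h' where gh: "w a = Fin g'" "\<phi> g = g'" "w b = Fin h'" "\<phi> h = h'"
        using fin[OF a(1,2)] fin[OF b(1,2)] a b by auto
      have "v (a * b) = Fin (g \<otimes>\<^bsub>G\<^esub> h)" "w (a * b) = Fin (g' \<otimes>\<^bsub>H\<^esub> h')"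
        using a b gh by (simp_all add: V.v_mult W.v_mult)
      hence "\<phi> (g \<otimes>\<^bsub>G\<^esub> h) = g' \<otimes>\<^bsub>H\<^esub> h'" using \<phi> V.K_mult[OF a(1) b(1)] by blast
      thus "\<phi> (g \<otimes>\<^bsub>G\<lparr>carrier := value_group K v\<rparr>\<^esub> h) = \<phi> g \<otimes>\<^bsub>H\<lparr>carrier := value_group K w\<rparr>\<^esub> \<phi> h"
        using gh by simp
    qed
    show "bij_betw \<phi> (carrier (G\<lparr>carrier := value_group K v\<rparr>)) (carrier (H\<lparr>carrier := value_group K w\<rparr>))"
      unfolding bij_betw_def
    proof
      show "inj_on \<phi> (carrier (G\<lparr>carrier := value_group K v\<rparr>))"
      proof (rule inj_onI)
        fix g h assume gh: "g \<in> carrier (G\<lparr>carrier := value_group K v\<rparr>)" "h \<in> carrier (G\<lparr>carrier := value_group K v\<rparr>)" "\<phi> g = \<phi> h"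
        then obtain a b where ab: "a \<in> K" "a \<noteq> 0" "v a = Fin g" "b \<in> K" "b \<noteq> 0" "v b = Fin h" using val by auto metis
        have "w a = w b" using fin[OF ab(1,2)] fin[OF ab(4,5)] ab gh(3) by auto
        thus "g = h" using eq[OF ab(1,4)] ab by simp
      qed
      show "\<phi> ` carrier (G\<lparr>carrier := value_group K v\<rparr>) = carrier (H\<lparr>carrier := value_group K w\<rparr>)"
      proof (intro equalityI subsetI)
        fix h assume "h \<in> \<phi> ` carrier (G\<lparr>carrier := value_group K v\<rparr>)"
        then obtain g where g: "g \<in> value_group K v" "h = \<phi> g" by auto
        then obtain a where a: "a \<in> K" "a \<noteq> 0" "\<exists>g. v a = Fin g \<and> h = \<phi> g" using val by blast
        thus "h \<in> carrier (H\<lparr>carrier := value_group K w\<rparr>)" using fin[OF a(1,2)] by auto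
      next
        fix h assume "h \<in> carrier (H\<lparr>carrier := value_group K w\<rparr>)"
        then obtain a where a: "a \<in> K" "w a = Fin h" by (auto simp: value_group_def)
        hence "a \<noteq> 0" using W.v_0 by auto
        thus "h \<in> \<phi> ` carrier (G\<lparr>carrier := value_group K v\<rparr>)" using fin[OF a(1)] a by auto
      qed
    qed
  qed
  moreover have "(g, h) \<in> le G \<longleftrightarrow> (\<phi> g, \<phi> h) \<in> le H" if gh: "g \<in> value_group K v" "h \<in> value_group K v" for g h
  proof -
    obtain a b where ab: "a \<in> K" "a \<noteq> 0" "v a = Fin g" "b \<in> K" "b \<noteq> 0" "v b = Fin h" using val gh by metis
    thus ?thesis using iff[OF ab(1,4)] fin[OF ab(1,2)] fin[OF ab(4,5)] by auto
  qed
  moreover have "w a = map_with_infty \<phi> (v a)" if "a \<in> K" for a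
    using fin[OF that] V.v_0 W.v_0 by (cases "a = 0") auto
  ultimately show ?thesis unfolding equivalent_valuations_def by blast
qed

locale weyl_valuation = real_valuation weyl_quot \<Gamma> v for \<Gamma> :: "'g ordered_group" and v

sublocale weyl_valuation \<subseteq> weyl_dominance weyl_quot vle
  by unfold_locales (rule wl_weyl_quot)

lemma weyl_valuationI:
  assumes "valuation weyl_quot G v" "residue_field_real weyl_quot G v"
    "infty_less G (v weyl_x) (infty_zero G)"
  shows "weyl_valuation G v"
  by unfold_locales (use assms weyl_quot_closed weyl_quot_real weyl_quot_x in auto)

lemma real_valuation_UNIV_I:
  assumes "valuation UNIV G v" "residue_field_real UNIV G v"
    "infty_less G (v weyl_x) (infty_zero G)"
  shows "real_valuation UNIV G v"
  by unfold_locales (use assms in auto)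

section \<open>Extensions to the quotient division ring of the skew polynomial ring\<close>

text \<open>In terms of a root of 1/x this is the square root of a power series with constant term
  1.\<close>

lemma puiseux_sqrt_ex:
  assumes "\<And>s. pcoeff \<tau> s \<noteq> 0 \<Longrightarrow> 0 < s"
  shows "\<exists>b. b * b = 1 + \<tau>"
proof -
  obtain n F where n: "n > 0" and F: "\<tau> = puiseux_of_fls n F" by (rule puiseux_of_fls_surj)
  have z: "fls_nth F k = 0" if "k \<le> 0" for k
  proof (rule ccontr)
    assume "fls_nth F k \<noteq> 0"
    hence "0 < (of_int k / of_nat n :: rat)" using assms puiseux_of_fls_eq[OF n, of F k] F by simp
    hence "k > 0" using n by (simp add: zero_less_divide_iff)
    thus False using that by simp
  qed
  have "fls_subdegree F \<ge> 0"
    by (cases "F = 0") (auto intro!: fls_subdegree_geI z)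
  hence reg: "fps_to_fls (fls_regpart F) = F" by simp
  define R where "R = fps_radical (\<lambda>_ _. 1) (Suc 1) (1 + fls_regpart F)"
  have "R ^ Suc 1 = 1 + fls_regpart F"
    unfolding R_def by (rule power_radical[THEN iffD1]) (use z[of 0] in auto)
  hence "fps_to_fls (R * R) = fps_to_fls (1 + fls_regpart F)" by simp
  hence "fps_to_fls R * fps_to_fls R = 1 + F" by (simp add: fls_times_fps_to_fls reg)
  hence "puiseux_of_fls n (fps_to_fls R) * puiseux_of_fls n (fps_to_fls R) = 1 + \<tau>"
    using n by (simp add: puiseux_of_fls_mult F puiseux_of_fls_add[symmetric] puiseux_of_fls_1)
  thus ?thesis by blast
qed

lemma spoly_sum_at: "f = (\<Sum>i\<le>degree (poly_of (shift p f)). sconst (scoeff (shift p f) i) * (svar - sconst p) ^ i)"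
proof -
  have "f = shift (- p) (shift p f)" by (simp add: shift_shift)
  also have "\<dots> = (\<Sum>i\<le>degree (poly_of (shift p f)). sconst (scoeff (shift p f) i) * (svar - sconst p) ^ i)"
    by (simp add: shift_def[of "- p"] sconst_uminus)
  finally show ?thesis .
qed

lemma scoeff_mult_svar: "scoeff (f * svar) k = (if k = 0 then 0 else scoeff f (k - 1))"
proof -
  have t: "scoeff (sconst c * svar ^ i * svar) k = (if k = 0 then 0 else scoeff (sconst c * svar ^ i) (k - 1))" for c i
    unfolding mult.assoc power_Suc2[symmetric] scoeff_sconst_mult scoeff_svar_pow by auto
  show ?thesis
    by (subst (1 2) spoly_sum[of f]) (simp add: sum_distrib_right scoeff_sum t)
qed

lemma spoly_split:
  obtains e where "f = sconst (scoeff (shift p f) 0) + e * (svar - sconst p)"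
    "\<And>i. scoeff (shift p e) i = scoeff (shift p f) (Suc i)"
proof -
  define E where "E = skew (poly_shift 1 (poly_of (shift p f)))"
  have E: "scoeff E i = scoeff (shift p f) (Suc i)" for i
    by (simp add: E_def scoeff_def skew_inverse coeff_poly_shift)
  have "shift p f = sconst (scoeff (shift p f) 0) + E * svar"
    by (rule scoeff_eqI) (auto simp: scoeff_sconst scoeff_mult_svar E)
  hence "shift (- p) (shift p f) = shift (- p) (sconst (scoeff (shift p f) 0) + E * svar)" by simp
  hence "f = sconst (scoeff (shift p f) 0) + shift (- p) E * (svar - sconst p)"
    by (simp add: shift_shift shift_add shift_mult sconst_uminus)
  moreover have "scoeff (shift p (shift (- p) E)) i = scoeff (shift p f) (Suc i)" for i
    by (simp add: shift_shift E)
  ultimately show thesis by (rule that)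
qed

text \<open>When y - p has a value strictly above g, weak inequalities suffice in positive degree
  and only the constant term needs a strict one. This is what survives of \<open>lin\<close> at g
  itself.\<close>

definition tail :: "puiseux \<Rightarrow> rat \<Rightarrow> rat \<Rightarrow> spoly \<Rightarrow> bool" where
  "tail p g q f \<longleftrightarrow> (\<forall>i s. cf (shift p f) i s \<noteq> 0 \<longrightarrow> q \<le> s + of_nat i * g \<and> (i = 0 \<longrightarrow> q < s))"

lemma gauss_gt_tail: "gauss_gt p (rv g) (rv q) f \<Longrightarrow> tail p g q f"
  by (auto simp: tail_def gauss_gt_def wt_rv intro: less_imp_le) (metis add_0_right mult_zero_left of_nat_0 wt_0 rv_less_iff)

text \<open>Let g' tend to g in the strict inequalities for g'; the one in degree 0 does not involve
  g' and stays strict.\<close>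

lemma lin_tail:
  assumes l: "lin p g f r k h" and g: "g < 1"
  shows "tail p g k (dy f - mon p r k 0)"
  unfolding tail_def
proof (intro allI impI)
  fix i s assume c: "cf (shift p (dy f - mon p r k 0)) i s \<noteq> 0"
  have less: "k < s + of_nat i * g'" if "g < g'" "g' < 1" for g'
  proof -
    have "lead p (rv g') (dy f) r k 0" using l that by (simp add: lin_def)
    hence "wt (rv g') k 0 < wt (rv g') s i" using c gauss_gtD unfolding lead_def by blast
    thus ?thesis by (simp add: wt_rv)
  qed
  show "k \<le> s + of_nat i * g \<and> (i = 0 \<longrightarrow> k < s)"
  proof (cases "i = 0")
    case True
    obtain g' where "g < g'" "g' < 1" using dense[OF g] by blast
    thus ?thesis using less[of g'] True by simp
  next
    case False
    have "k \<le> s + of_nat i * g"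
    proof (rule ccontr)
      assume "\<not> k \<le> s + of_nat i * g"
      hence "g < (k - s) / of_nat i" using False by (simp add: pos_less_divide_eq algebra_simps)
      then obtain g' where g': "g < g'" "g' < min 1 ((k - s) / of_nat i)" using dense[of g "min 1 ((k - s) / of_nat i)"] g by auto
      hence "of_nat i * g' < k - s" using False by (simp add: pos_less_divide_eq mult.commute)
      thus False using less[of g'] g' by simp
    qed
    thus ?thesis using False by simp
  qed
qed

abbreviation y_minus :: "puiseux \<Rightarrow> weyl_ext" where
  "y_minus p \<equiv> to_quot (svar - sconst p)"

locale full_dominance = dominance UNIV vle for vle

sublocale full_dominance \<subseteq> weyl_dominance UNIV vle
  by unfold_locales simp

context full_dominance
begin

lemma veq_x_pow_rat: "veq (x_pow q) (- q)"
proof -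
  obtain n k where n: "n > 0" "q = of_int k / of_nat n" by (rule common_denominator[of q q])
  have "x_pow q ^ n = x_pow (- of_int (- k))" using n by (simp add: x_pow_power)
  moreover have "- q = of_int (- k) / of_nat n" using n by simp
  ultimately show ?thesis using veq_iff_power[OF UNIV_I n(1)] vle_refl[OF UNIV_I] by metis
qed

lemma veq_x_pow_minus: "veq (x_pow (- q)) q"
  using veq_x_pow_rat[of "- q"] by simp

text \<open>
  Otherwise some \<open>t\<close> of negative value is such that \<open>1 + t\<close> and \<open>1 - t\<close> are both squares, and \<open>- 1\<close>
  is a square in the residue field.
\<close>

lemma vle_puiseux:
  assumes c: "\<And>s. pcoeff c s \<noteq> 0 \<Longrightarrow> 0 \<le> s"
  shows "vle 1 (puiseux_emb c)"
proof -
  define c0 where "c0 = c - puiseux_monom (pcoeff c 0) 0"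
  have c0: "0 < s" if "pcoeff c0 s \<noteq> 0" for s
    using that c[of s] by (cases "s = 0") (auto simp: c0_def minus_puiseux.rep_eq puiseux_monom.rep_eq split: if_splits)
  have emb: "puiseux_emb c = puiseux_emb c0 + real_const (pcoeff c 0)"
    by (simp add: c0_def real_const_def puiseux_emb_add[symmetric])
  have "vle 1 (puiseux_emb c0)"
  proof (rule ccontr)
    assume M: "\<not> vle 1 (puiseux_emb c0)"
    define M where "M = puiseux_emb c0"
    have "c0 \<noteq> 0" using M vle_0[OF UNIV_I, of 1] by (auto simp: puiseux_emb_def)
    then obtain q where q: "pcoeff c0 q \<noteq> 0" "\<forall>s<q. pcoeff c0 s = 0" by (rule puiseux_lead)
    have q0: "q > 0" using c0 q by blast
    \<comment> \<open>As a series c0^2 starts at 2 q, so \<tau> starts at q > 0, and both 1 + \<tau>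
      and 1 - \<tau> are squares. In the valuation, however, the value of \<tau> is negative like
      those of x^q and M.\<close>
    define \<tau> where "\<tau> = puiseux_monom 1 q * (c0 * c0)"
    have \<tau>: "0 < s" if s: "pcoeff \<tau> s \<noteq> 0" for s
    proof -
      have "pcoeff (c0 * c0) (s + q) \<noteq> 0" using s by (simp add: \<tau>_def pcoeff_monom_mult)
      then obtain a b where "pcoeff c0 a \<noteq> 0" "pcoeff c0 b \<noteq> 0" "s + q = a + b" using pcoeff_mult_ne by blast
      moreover from this have "q \<le> a" "q \<le> b" using q(2) by (meson not_less)+
      ultimately show ?thesis using q0 by linarith
    qed
    obtain a where a: "a * a = 1 + \<tau>" using puiseux_sqrt_ex \<tau> by blast
    obtain b where b: "b * b = 1 + - \<tau>"
      using puiseux_sqrt_ex[of "- \<tau>"] \<tau> by (auto simp: uminus_puiseux.rep_eq)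
    define A B T where "A = puiseux_emb a" and "B = puiseux_emb b" and "T = puiseux_emb \<tau>"
    have one: "puiseux_emb 1 = 1" using real_const_1 by (simp add: real_const_def puiseux_monom_1)
    have diff: "puiseux_emb (1 - \<tau>) = 1 - T"
      unfolding T_def one[symmetric] by (simp only: puiseux_emb_def sconst_diff to_quot_diff)
    have A: "A ^ 2 = 1 + T" and B: "B ^ 2 = 1 - T"
      by (simp_all add: A_def B_def T_def power2_eq_square puiseux_emb_mult[symmetric] a b)
        (simp_all add: puiseux_emb_add one diff[unfolded T_def])
    have T: "vlt T 1"
    proof -
      have Teq: "T = x_pow q * (M * M)" by (simp add: T_def \<tau>_def M_def x_pow_def puiseux_emb_mult)
      have m: "vlt (M * M) (1 * 1)"
        using M vlt_nz[of M 1] by (intro vlt_mult_le) (auto simp: M_def intro: vlt_imp_vle)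
      moreover have "vlt (x_pow q) 1" using veq_vge_vlt[OF veq_x_pow_rat vge_1] q0 by simp
      ultimately have "vlt (x_pow q * (M * M)) (1 * 1)"
        using vlt_mult_le[of "x_pow q" 1 "M * M" 1] vlt_nz[of "M * M" 1] vlt_imp_vle[of "M * M" 1] by simp
      thus ?thesis using Teq by simp
    qed
    have "vlt T (- 1)" using T vle_uminus_left[of 1 T] by simp
    hence TA: "veqv T (A ^ 2)" unfolding A using vlt_imp_veqv_diff[of T "- 1"] by (simp add: add.commute)
    have TB: "veqv T (- (B ^ 2))" unfolding B using vlt_imp_veqv_diff[of T 1] T by simp
    have nz: "A \<noteq> 0" "B \<noteq> 0"
      using TA TB T vle_0D[of T] vle_0 vlt_nz[of T 1] by auto
    have "veqv T (B ^ 2)" using TB vle_uminus[of T "B ^ 2"] vle_uminus_left[of "B ^ 2" T] by simp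
    hence "veqv (A ^ 2) (B ^ 2)" using TA vle_trans by blast
    hence "veqv A B" using vle_power_iff[of A B 2] vle_power_iff[of B A 2] by simp
    \<comment> \<open>The squares of A and B are dominated by T and - T. So r^2 B^2 and - B^2 have
      the same leading term, which is impossible for real r.\<close>
    then obtain r where r: "r \<noteq> 0" "sim A (real_const r * B)" using sim_real_ex[of A B] nz by blast
    have "(real_const r * B) ^ 2 = real_const (r ^ 2) * B ^ 2"
    proof -
      have "(real_const r * B) ^ 2 = real_const r * (B * real_const r) * B" by (simp add: power2_eq_square mult.assoc)
      also have "\<dots> = real_const r * (real_const r * B) * B" by (simp only: real_const_comm)
      finally show ?thesis by (simp add: power2_eq_square real_const_mult mult.assoc)
    qed
    hence s1: "sim (A ^ 2) (real_const (r ^ 2) * B ^ 2)" using sim_power[OF r(2), of 2] by simp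
    have s2: "sim (A ^ 2) (- (B ^ 2))"
    proof -
      have "A ^ 2 - - (B ^ 2) = real_const 2" using A B real_const_add[of 1 1] by simp
      moreover have "vlt (- (B ^ 2)) (real_const 2)"
        using T TB veqv_real[of 2] vle_trans[OF UNIV_I UNIV_I UNIV_I] by (metis zero_neq_numeral)
      ultimately show ?thesis by (simp add: sim_def)
    qed
    have "sim (real_const (r ^ 2) * B ^ 2) (- (B ^ 2))" using sim_trans[OF sim_sym[OF s1] s2] .
    hence "vlt (- (B ^ 2)) (real_const (r ^ 2 + 1) * B ^ 2)"
      by (simp add: sim_def real_const_add distrib_right)
    moreover have "r ^ 2 + 1 \<noteq> 0" by (metis add_nonneg_pos less_numeral_extra(1,3) zero_le_power2)
    ultimately show False
      using veqv_real_mult[of "B ^ 2" "r ^ 2 + 1"] vle_uminus[of "real_const (r ^ 2 + 1) * B ^ 2" "B ^ 2"] by simp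
  qed
  moreover have "vle 1 (real_const (pcoeff c 0))" using vge_real vge_0_iff by blast
  ultimately show ?thesis unfolding emb by (intro vle_add) auto
qed

lemma vge_puiseux:
  assumes c: "\<And>s. pcoeff c s \<noteq> 0 \<Longrightarrow> q \<le> s"
  shows "vge (puiseux_emb c) q"
proof -
  have "vle 1 (puiseux_emb (puiseux_monom 1 q * c))"
    by (rule vle_puiseux) (use c in \<open>fastforce simp: pcoeff_monom_mult\<close>)
  hence "vge (puiseux_emb (puiseux_monom 1 q * c)) 0" by (simp add: vge_0_iff)
  from vge_mult[OF veq_imp_vge[OF veq_x_pow_minus] this]
  have "vge (x_pow (- q) * puiseux_emb (puiseux_monom 1 q * c)) q" by simp
  moreover have "x_pow (- q) * puiseux_emb (puiseux_monom 1 q * c) = x_pow (- q) * x_pow q * puiseux_emb c"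
    by (simp add: x_pow_def puiseux_emb_mult mult.assoc)
  ultimately show ?thesis by (simp add: x_pow_mult)
qed

lemma vle_puiseux_rat: "(\<And>s. pcoeff c s \<noteq> 0 \<Longrightarrow> q \<le> s) \<Longrightarrow> vle (x_pow (- q)) (puiseux_emb c)"
  using veq_vge_vle[OF veq_x_pow_minus vge_puiseux] .

lemma to_quot_sum_at:
  "to_quot f = (\<Sum>i\<le>degree (poly_of (shift p f)). puiseux_emb (scoeff (shift p f) i) * y_minus p ^ i)"
  by (subst spoly_sum_at[of f p]) (simp add: to_quot_sum to_quot_mult to_quot_power puiseux_emb_def)

lemma vlt_tail:
  assumes T: "vlt (x_pow (- g)) (y_minus p)" and f: "tail p g q f"
  shows "vlt (x_pow (- q)) (to_quot f)"
proof -
  have "vlt (x_pow (- q)) (puiseux_emb (scoeff (shift p f) i) * y_minus p ^ i)" for i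
  proof (cases "i = 0")
    case True
    show ?thesis
    proof (cases "scoeff (shift p f) 0 = 0")
      case True
      thus ?thesis using \<open>i = 0\<close> vle_0D[OF UNIV_I, of "x_pow (- q)"] by (auto simp: puiseux_emb_def)
    next
      case False
      then obtain e where e: "pcoeff (scoeff (shift p f) 0) e \<noteq> 0" "\<forall>s<e. pcoeff (scoeff (shift p f) 0) s = 0"
        by (rule puiseux_lead)
      hence "q < e" using f by (simp add: tail_def cf_def)
      moreover have "vge (puiseux_emb (scoeff (shift p f) 0)) e"
        by (rule vge_puiseux) (use e(2) in \<open>meson not_less\<close>)
      ultimately show ?thesis using veq_vge_vlt[OF veq_x_pow_minus] True by simp
    qed
  next
    case False
    have "vle (x_pow (- (q - of_nat i * g))) (puiseux_emb (scoeff (shift p f) i))"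
      by (rule vle_puiseux_rat) (use f in \<open>fastforce simp: tail_def cf_def\<close>)
    moreover have "vlt (x_pow (- g) ^ i) (y_minus p ^ i)" using False T by (intro vlt_power) auto
    ultimately have "vlt (x_pow (- (q - of_nat i * g)) * x_pow (- g) ^ i) (puiseux_emb (scoeff (shift p f) i) * y_minus p ^ i)"
      by (intro vle_mult_lt) auto
    thus ?thesis by (simp add: x_pow_power x_pow_mult)
  qed
  thus ?thesis unfolding to_quot_sum_at[of f p]
    by (intro conjunct2[OF vlt_sum[OF UNIV_I x_pow_nz]] conjI UNIV_I)
qed

lemma sim_tail:
  assumes "vlt (x_pow (- g)) (y_minus p)" "tail p g q (f - mon p r q 0)" "r \<noteq> 0"
  shows "sim (to_quot f) (real_const r * x_pow (- q))"
proof -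
  have "vlt (x_pow (- q)) (to_quot f - real_const r * x_pow (- q))"
    using vlt_tail[OF assms(1,2)] by (simp add: to_quot_diff to_quot_mon_const)
  thus ?thesis unfolding sim_def using veqv_real_mult[OF UNIV_I assms(3)] vle_trans[OF UNIV_I UNIV_I UNIV_I] by blast
qed

lemma sim_lead:
  assumes "vlt (x_pow (- g)) (y_minus p)" "lead p (rv g) f r q 0" "r \<noteq> 0"
  shows "sim (to_quot f) (real_const r * x_pow (- q))"
  using sim_tail[OF assms(1) gauss_gt_tail] assms(2,3) by (simp add: lead_def)

text \<open>Division by y - p on the right gives f = C + e (y - p) with a Puiseux series C of value
  at least k + h and e similar to r x^(-k). If the value of f is not that large, the second summand
  dominates.\<close>

lemma lin_value:
  assumes T: "vlt (x_pow (- g)) (y_minus p)" and t: "tail p g k (dy f - mon p r k 0)" and r: "r \<noteq> 0"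
    and c: "\<And>q. cf (shift p f) 0 q \<noteq> 0 \<Longrightarrow> k + h \<le> q"
  shows "\<not> vge (to_quot f) (k + h) \<Longrightarrow> sim (to_quot f) (real_const r * x_pow (- k) * y_minus p)"
    and "vge (to_quot f) (k + g') \<Longrightarrow> g' \<le> h \<Longrightarrow> vge (y_minus p) g'"
proof -
  obtain e where e: "f = sconst (scoeff (shift p f) 0) + e * (svar - sconst p)"
    "\<And>i. scoeff (shift p e) i = scoeff (shift p f) (Suc i)" using spoly_split[of f p] by blast
  define C where "C = puiseux_emb (scoeff (shift p f) 0)"
  have C: "vge C (k + h)" unfolding C_def by (rule vge_puiseux) (use c in \<open>simp add: cf_def\<close>)
  have f: "to_quot f = C + to_quot e * y_minus p"
    unfolding C_def puiseux_emb_def by (subst e(1)) (simp add: to_quot_add to_quot_mult)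
  have "tail p g k (e - mon p r k 0)"
    unfolding tail_def
  proof (intro allI impI)
    fix i s assume "cf (shift p (e - mon p r k 0)) i s \<noteq> 0"
    hence "cf (shift p (dy f - mon p r k 0)) i s \<noteq> 0"
      using e(2)[of i] by (cases "i = 0") (auto simp: shift_diff cf_shift_mon shift_dy cf_dy cf_def[of "shift p e"] cf_def[of "shift p f"] simp del: of_nat_Suc)
    thus "k \<le> s + of_nat i * g \<and> (i = 0 \<longrightarrow> k < s)" using t by (simp add: tail_def)
  qed
  hence s: "sim (to_quot e) (real_const r * x_pow (- k))" using sim_tail T r by blast
  have ve: "veq (to_quot e) k" by (rule veq_sim[OF s veq_real_mult[OF veq_x_pow_minus r]])
  {
    assume nv: "\<not> vge (to_quot f) (k + h)"
    hence "vlt (to_quot f) C" using vge_vle[OF C] by blast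
    hence v: "veqv (to_quot f) (to_quot f - C)" "vlt (to_quot f) C" using vlt_imp_veqv_diff by auto
    have eT: "to_quot f - C = to_quot e * y_minus p" using f by simp
    have T0: "y_minus p \<noteq> 0"
    proof
      assume "y_minus p = 0"
      hence "to_quot f - C = 0" unfolding eT by simp
      hence "vle 0 (to_quot f)" using v(1) by simp
      hence "to_quot f = 0" by (intro vle_0D UNIV_I)
      thus False using v(2) vlt_nz[OF UNIV_I UNIV_I] by blast
    qed
    have "sim (to_quot f) (to_quot e * y_minus p)"
      using v vle_trans[OF UNIV_I UNIV_I UNIV_I] unfolding sim_def eT[symmetric] by auto
    moreover have "sim (to_quot e * y_minus p) (real_const r * x_pow (- k) * y_minus p)"
      using s T0 by (intro sim_mult sim_refl) auto
    ultimately show "sim (to_quot f) (real_const r * x_pow (- k) * y_minus p)" by (rule sim_trans)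
  }
  assume v: "vge (to_quot f) (k + g')" "g' \<le> h"
  have "vge (to_quot f - C) (k + g')" using v vge_mono[OF C] by (intro vge_diff) auto
  hence "vge (to_quot e * y_minus p) (k + g')" using f by simp
  from vge_mult[OF veq_imp_vge[OF veq_inverse[OF ve]] this]
  have "vge (inverse (to_quot e) * to_quot e * y_minus p) g'" by (simp add: mult.assoc)
  thus "vge (y_minus p) g'" using ve by (simp add: veq_def)
qed

lemma cut_at:
  assumes z: "cut z (G + rv s)" and s: "sim z (B * T)" and B: "veq B s"
  shows "cut T G"
proof -
  have B0: "B \<noteq> 0" using B by (simp add: veq_def)
  have T: "T = inverse B * (B * T)" using B0 by (simp add: mult.assoc[symmetric])
  have BT: "vge (B * T) q \<longleftrightarrow> vge z q" for q
    using sim_veqv[OF s] vge_vle by blast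
  have "vge T t \<longleftrightarrow> vge (B * T) (t + s)" for t
  proof
    show "vge T t \<Longrightarrow> vge (B * T) (t + s)" using vge_mult[OF veq_imp_vge[OF B], of T t] by (simp add: add.commute)
    assume "vge (B * T) (t + s)"
    from vge_mult[OF veq_imp_vge[OF veq_inverse[OF B]] this] show "vge T t" using T by simp
  qed
  hence "vge T t \<longleftrightarrow> rv t < G" for t using z BT by (simp add: cut_def rv_add)
  moreover have "\<not> veq T t" for t
  proof
    assume "veq T t"
    hence "veq (B * T) (s + t)" using veq_mult[OF B] by blast
    hence "veq z (s + t)" using veq_sim[OF s] by blast
    thus False using z by (simp add: cut_def)
  qed
  moreover have "rv t \<noteq> G" for t
  proof
    assume "rv t = G"
    hence "rv (t + s) = G + rv s" by (simp add: rv_add)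
    thus False using z unfolding cut_def by blast
  qed
  moreover have "T \<noteq> 0" using sim_nz[OF s] by auto
  ultimately show ?thesis by (simp add: cut_def)
qed

lemma cut_vlt:
  assumes T: "cut (y_minus p) G" and f: "gauss_gt p G (wt G s l) f"
  shows "vlt (x_pow (- s) * y_minus p ^ l) (to_quot f)"
proof -
  have T0: "y_minus p \<noteq> 0" using T unfolding cut_def by blast
  have M0: "x_pow (- s) * y_minus p ^ l \<noteq> 0" using T0 by simp
  have "vlt (x_pow (- s) * y_minus p ^ l) (puiseux_emb (scoeff (shift p f) i) * y_minus p ^ i)" for i
  proof (cases "scoeff (shift p f) i = 0")
    case True
    thus ?thesis using M0 vle_0D[OF UNIV_I, of "x_pow (- s) * y_minus p ^ l"] by (auto simp: puiseux_emb_def)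
  next
    case False
    then obtain e where e: "pcoeff (scoeff (shift p f) i) e \<noteq> 0" "\<forall>s<e. pcoeff (scoeff (shift p f) i) s = 0"
      by (rule puiseux_lead)
    have "rv s + of_nat l * G < rv e + of_nat i * G"
      using gauss_gtD[OF f, of i e] e(1) by (simp add: cf_def wt_def)
    hence "vlt (x_pow (- s) * y_minus p ^ l) (x_pow (- e) * y_minus p ^ i)" by (rule cut_less[OF T veq_x_pow_minus veq_x_pow_minus])
    moreover have "vle (x_pow (- e) * y_minus p ^ i) (puiseux_emb (scoeff (shift p f) i) * y_minus p ^ i)"
      using vle_puiseux_rat[of "scoeff (shift p f) i" e] e(2) by (intro vle_mult_right) (auto simp: not_less[symmetric])
    ultimately show ?thesis using vlt_vle_trans[OF UNIV_I UNIV_I UNIV_I] by blast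
  qed
  thus ?thesis unfolding to_quot_sum_at[of f p]
    by (intro conjunct2[OF vlt_sum[OF UNIV_I M0]] conjI UNIV_I)
qed

lemma cut_sim:
  assumes T: "cut (y_minus p) G" and f: "lead p G f r s l" "r \<noteq> 0"
  shows "sim (to_quot f) (real_const r * (x_pow (- s) * y_minus p ^ l))"
proof -
  have "to_quot (mon p r s l) = real_const r * (x_pow (- s) * y_minus p ^ l)"
    by (simp add: mon_def to_quot_mult to_quot_monom to_quot_power mult.assoc)
  hence "vlt (x_pow (- s) * y_minus p ^ l) (to_quot f - real_const r * (x_pow (- s) * y_minus p ^ l))"
    using cut_vlt[OF T f(1)[unfolded lead_def]] by (simp add: to_quot_diff)
  thus ?thesis unfolding sim_def using veqv_real_mult[OF UNIV_I f(2)] vle_trans[OF UNIV_I UNIV_I UNIV_I] by blast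
qed

end

section \<open>The elements of the associated sequence\<close>

lemma odd_power_int_eq:
  fixes a b :: real
  assumes "a powi k = b powi k" "odd k" "b \<noteq> 0"
  shows "a = b"
proof -
  have k: "odd (nat \<bar>k\<bar>)" "0 < nat \<bar>k\<bar>" using assms(2) by (auto simp: even_nat_iff)
  have "a ^ nat \<bar>k\<bar> = b ^ nat \<bar>k\<bar>"
  proof (cases "k \<ge> 0")
    case True
    thus ?thesis using assms(1) by (simp add: power_int_def)
  next
    case False
    thus ?thesis using assms(1) by (simp add: power_int_def power_inverse)
  qed
  thus ?thesis using k odd_real_root_unique by metis
qed

locale gamma_data = weyl_valuation \<Gamma> v for \<Gamma> :: "'g ordered_group" and v +
  fixes \<gamma> :: "nat \<Rightarrow> real"
  assumes choice: "gamma_choice \<Gamma> v \<gamma>"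
begin

abbreviation adm :: "nat \<Rightarrow> bool" where
  "adm \<equiv> admissible \<Gamma> v"

definition vom :: "nat \<Rightarrow> rat" where
  "vom i = of_int (seq_m \<Gamma> v i) / of_int (seq_n \<Gamma> v i)"

text \<open>The elements of the sequence as skew polynomials, with the same index shift as
  \<open>omega\<close>. The constant is a power of \<gamma> instead of a residue; the two agree by
  the choice of \<gamma> as long as the sequence goes on.\<close>

fun om :: "nat \<Rightarrow> spoly" where
  "om 0 = sconst (puiseux_monom 1 1)"
| "om (Suc 0) = svar"
| "om (Suc (Suc i)) = sconst (puiseux_monom 1 (of_int (seq_m \<Gamma> v (Suc i)))) * om (Suc i) ^ nat (seq_n \<Gamma> v (Suc i))
     - sconst (puiseux_monom (\<gamma> (Suc i) ^ nat (seq_n \<Gamma> v (Suc i))) 0)"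

lemma om_wl: "om i \<in> wl"
proof (induction i rule: om.induct)
  case 1
  thus ?case using wl_monom[of 1 1] by simp
qed (auto intro!: wl_closed wl_monom wl_real)

lemma adm_mono: "adm i \<Longrightarrow> j \<le> i \<Longrightarrow> adm j"
  by (auto simp: admissible_def)

lemma adm_0: "adm 0"
  by (simp add: admissible_def)

lemma adm_Suc: "adm (Suc i) \<longleftrightarrow> adm i \<and> rational_value \<Gamma> v (omega \<Gamma> v (Suc i))"
proof -
  have "{1..Suc i} = insert (Suc i) {1..i}" by auto
  thus ?thesis by (auto simp: admissible_def)
qed

lemma omega_om: "adm (i - 1) \<Longrightarrow> omega \<Gamma> v i = to_quot (om i)"
proof (induction i rule: om.induct)
  case 1
  show ?case by (simp add: weyl_x_def to_quot_monom)
next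
  case 2
  show ?case by (simp add: weyl_y_def)
next
  case (3 i)
  let ?w = "omega \<Gamma> v (Suc i)" and ?m = "seq_m \<Gamma> v (Suc i)" and ?n = "seq_n \<Gamma> v (Suc i)"
  have a: "adm (Suc i)" using 3 by simp
  have w: "?w = to_quot (om (Suc i))" using 3 adm_mono[OF a, of i] by simp
  have K: "?w \<in> weyl_quot" unfolding w by (rule wl_K[OF om_wl])
  have "rational_value \<Gamma> v ?w" using a by (auto simp: adm_Suc)
  then obtain q where q: "veq ?w q" using value_frac(1)[OF K] by blast
  have n: "?n > 0" using value_frac(3)[OF K q] by (simp add: seq_n_def)
  have "\<gamma> (Suc i) powi ?n = seq_beta \<Gamma> v (Suc i)"
    using choice a by (auto simp: gamma_choice_def)
  hence \<beta>: "seq_beta \<Gamma> v (Suc i) = \<gamma> (Suc i) ^ nat ?n" using n by (simp add: power_int_def)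
  have "omega \<Gamma> v (Suc (Suc i)) = weyl_x powi ?m * ?w powi ?n - real_const (seq_beta \<Gamma> v (Suc i))"
    by (simp add: Let_def seq_beta_def seq_m_def seq_n_def)
  also have "weyl_x powi ?m * ?w powi ?n = x_pow (of_int ?m) * to_quot (om (Suc i)) ^ nat ?n"
    unfolding weyl_x_powi w using n by (simp add: power_int_def)
  finally show ?case by (simp add: \<beta> to_quot_diff to_quot_mult to_quot_power to_quot_monom to_quot_real)
qed

lemma om_K: "to_quot (om i) \<in> weyl_quot"
  by (rule wl_K[OF om_wl])

lemma adm_value:
  assumes "adm i"
  shows "veq (to_quot (om i)) (vom i)" "seq_n \<Gamma> v i \<noteq> 0" "\<gamma> i \<noteq> 0" "i > 0 \<Longrightarrow> seq_n \<Gamma> v i > 0"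
proof -
  have "veq (to_quot (om i)) (vom i) \<and> seq_n \<Gamma> v i \<noteq> 0 \<and> \<gamma> i \<noteq> 0 \<and> (i > 0 \<longrightarrow> seq_n \<Gamma> v i > 0)"
  proof (cases i)
    case 0
    have "\<gamma> 0 = 1" using choice by (simp add: gamma_choice_def)
    thus ?thesis using veq_x_pow[of 1] 0 by (simp add: vom_def seq_m_def seq_n_def to_quot_monom)
  next
    case (Suc j)
    let ?w = "omega \<Gamma> v i"
    have w: "?w = to_quot (om i)" using assms adm_mono[of i "i - 1"] by (intro omega_om) simp
    have K: "?w \<in> weyl_quot" unfolding w by (rule om_K)
    have "rational_value \<Gamma> v ?w" using assms Suc by (simp add: adm_Suc)
    then obtain q where q: "veq ?w q" using value_frac(1)[OF K] by blast
    note f = value_frac(3)[OF K q]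
    have n: "seq_n \<Gamma> v i > 0" "q = vom i" using f Suc by (auto simp: seq_n_def seq_m_def vom_def)
    have \<beta>: "\<gamma> i powi seq_n \<Gamma> v i = seq_beta \<Gamma> v i"
      using choice assms Suc by (auto simp: gamma_choice_def)
    let ?z = "weyl_x powi seq_m \<Gamma> v i * ?w powi seq_n \<Gamma> v i"
    have "veq ?z (of_int (seq_m \<Gamma> v i) * - 1 + of_int (seq_n \<Gamma> v i) * vom i)"
      using veq_x_pow[of 1] q n by (intro veq_mult veq_powi) (simp_all add: weyl_x_def)
    hence "veq ?z 0" using n by (simp add: vom_def)
    hence "seq_beta \<Gamma> v i \<noteq> 0" unfolding seq_beta_def
      using sim_residue[OF veq_K, of ?z 0] veq_imp_veqv[OF veq_1] by blast
    hence "\<gamma> i \<noteq> 0" using \<beta> n by (auto simp: power_int_0_left_if)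
    thus ?thesis using q n w by simp
  qed
  thus "veq (to_quot (om i)) (vom i)" "seq_n \<Gamma> v i \<noteq> 0" "\<gamma> i \<noteq> 0" "i > 0 \<Longrightarrow> seq_n \<Gamma> v i > 0" by blast+
qed

lemma adm_SucI: "adm i \<Longrightarrow> veq (to_quot (om (Suc i))) q \<Longrightarrow> adm (Suc i)"
  using omega_om[of "Suc i"] value_frac(1)[OF om_K] by (auto simp: adm_Suc)

lemma seq_K_eq: "of_int (seq_K \<Gamma> v i j) * vom i = of_int (seq_K \<Gamma> v j i) * vom j"
  if "adm i" "adm j"
proof -
  let ?m = "seq_m \<Gamma> v" and ?n = "seq_n \<Gamma> v"
  define d where "d = gcd (?m j * ?n i) (?m i * ?n j)"
  have d: "d dvd ?m j * ?n i" "d dvd ?m i * ?n j" by (auto simp: d_def)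
  have n: "?n i \<noteq> 0" "?n j \<noteq> 0" using that adm_value(2) by auto
  have "of_int (?m j * ?n i div d) * vom i = of_int (?m j * ?n i) / of_int d * vom i"
    "of_int (?m i * ?n j div d) * vom j = of_int (?m i * ?n j) / of_int d * vom j"
    using d by (simp_all only: of_int_div)
  moreover have "of_int (?m j * ?n i) * vom i = of_int (?m i * ?n j) * vom j"
    using n by (simp add: vom_def)
  ultimately show ?thesis unfolding seq_K_def d_def[symmetric] gcd.commute[of "?m i * ?n j"]
    by (simp del: of_int_mult)
qed

lemma seq_K_coprime: "coprime (seq_K \<Gamma> v i j) (seq_K \<Gamma> v j i)" if "adm i" "vom j \<noteq> 0"
proof -
  let ?m = "seq_m \<Gamma> v" and ?n = "seq_n \<Gamma> v"
  have "?m j * ?n i \<noteq> 0" using that adm_value(2) by (auto simp: vom_def)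
  thus ?thesis unfolding seq_K_def gcd.commute[of "?m i * ?n j"] by (intro div_gcd_coprime) simp
qed

text \<open>The two powers have the same value (\<open>seq_K_eq\<close>), and the condition on
  \<alpha> prescribes the residue of their quotient.\<close>

lemma alpha_sim:
  assumes "adm i" "adm j" "i \<noteq> j"
  shows "sim (to_quot (om i) powi seq_K \<Gamma> v i j)
    (real_const (\<gamma> i powi seq_K \<Gamma> v i j * \<gamma> j powi (- seq_K \<Gamma> v j i)) * to_quot (om j) powi seq_K \<Gamma> v j i)"
proof -
  let ?K = "seq_K \<Gamma> v i j" and ?K' = "seq_K \<Gamma> v j i"
  let ?a = "to_quot (om i)" and ?b = "to_quot (om j)"
  have o: "omega \<Gamma> v i = ?a" "omega \<Gamma> v j = ?b"
    using assms adm_mono[of i "i - 1"] adm_mono[of j "j - 1"] by (auto intro!: omega_om)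
  have "veq (?a powi ?K * ?b powi (- ?K')) (of_int ?K * vom i + of_int (- ?K') * vom j)"
    using adm_value assms by (intro veq_mult veq_powi)
  hence z: "veq (?a powi ?K * ?b powi (- ?K')) 0" using seq_K_eq assms by simp
  have "seq_alpha \<Gamma> v i j = \<gamma> i powi ?K * \<gamma> j powi (- ?K')"
    using choice assms unfolding gamma_choice_def by blast
  hence "residue weyl_quot \<Gamma> v (?a powi ?K * ?b powi (- ?K')) = \<gamma> i powi ?K * \<gamma> j powi (- ?K')"
    using assms(3) by (simp add: seq_alpha_def o)
  hence "sim (?a powi ?K * ?b powi (- ?K')) (real_const (\<gamma> i powi ?K * \<gamma> j powi (- ?K')))"
    using sim_residue[OF veq_K[OF z] veq_imp_veqv[OF veq_1 z]] by simp
  moreover have b0: "?b \<noteq> 0" using adm_value(1)[OF assms(2)] by (simp add: veq_def)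
  ultimately have "sim (?a powi ?K * ?b powi (- ?K') * ?b powi ?K')
      (real_const (\<gamma> i powi ?K * \<gamma> j powi (- ?K')) * ?b powi ?K')"
    using K_powi[OF om_K] by (intro sim_mult sim_refl) auto
  moreover have "?b powi (- ?K') * ?b powi ?K' = 1" using b0 by (simp add: power_int_minus)
  ultimately show ?thesis by (simp add: mult.assoc)
qed

section \<open>Stages of the approximation\<close>

text \<open>Up to similarity the stand-ins multiply like powers of one element, because a product of
  two has the leading term of the stand-in for the sum of the exponents. Inverses may lie outside
  \<open>wl\<close>, where \<open>below\<close> says nothing, and are obtained by cancelling such
  products.\<close>

lemma stand_in_powi:
  assumes n: "n > 0" and g: "g < 1" and a: "a \<in> wl" "lead p (rv g) a 1 (1 / of_nat n) 0" and b: "below p g"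
  shows "sim (to_quot (stand_in n a e) powi j) (to_quot (stand_in n a (e * j)))"
proof -
  let ?s = "\<lambda>e. stand_in n a e"
  have l: "lead p (rv g) (?s e) 1 (of_int e / of_nat n) 0" for e using n g a by (intro lead_stand_in) auto
  have w: "?s e \<in> wl" for e using a by (intro stand_in_wl)
  have nz: "sim (to_quot (?s e)) (to_quot (?s e))" for e
    using below_sim[OF b g w l w l] by simp
  have add: "sim (to_quot (?s e) * to_quot (?s e')) (to_quot (?s (e + e')))" for e e'
  proof -
    have "lead p (rv g) (?s e * ?s e') (1 * 1) (of_int e / of_nat n + of_int e' / of_nat n) (0 + 0)"
      using l g by (intro lead_mult) auto
    hence "lead p (rv g) (?s e * ?s e') 1 (of_int (e + e') / of_nat n) 0" by (simp add: add_divide_distrib)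
    from below_sim[OF b g wl_closed(7)[OF w w] this w l] show ?thesis by (simp add: to_quot_mult)
  qed
  have zero: "sim 1 (to_quot (?s 0))" using below_sim[OF b g wl_closed(3) lead_1 w l[of 0, simplified]] by (simp add: to_quot_real[of 1, symmetric] puiseux_monom_1)
  have pw: "sim (to_quot (?s e) ^ j) (to_quot (?s (e * int j)))" for e j
  proof (induction j)
    case 0
    thus ?case using zero by simp
  next
    case (Suc j)
    have "sim (to_quot (?s e) * to_quot (?s e) ^ j) (to_quot (?s e) * to_quot (?s (e * int j)))"
      using Suc nz by (intro sim_mult)
    from sim_trans[OF this add] show ?case by (simp add: algebra_simps)
  qed
  have inv: "sim (inverse (to_quot (?s e))) (to_quot (?s (- e)))" for e
  proof -
    have "sim (inverse (to_quot (?s e)) * 1) (inverse (to_quot (?s e)) * (to_quot (?s e) * to_quot (?s (- e))))"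
      using sim_mult[OF sim_inverse[OF nz] sim_trans[OF zero sim_sym[OF add[of e "- e", simplified]]]] .
    moreover have "inverse (to_quot (?s e)) * (to_quot (?s e) * to_quot (?s (- e))) = to_quot (?s (- e))"
      using sim_nz[OF nz[of e]] by (simp add: mult.assoc[symmetric])
    ultimately show ?thesis by simp
  qed
  show ?thesis
  proof (cases "j \<ge> 0")
    case True
    thus ?thesis using pw[of e "nat j"] by (simp add: power_int_def)
  next
    case False
    hence "sim (inverse (to_quot (?s e)) ^ nat (- j)) (to_quot (?s (- e)) ^ nat (- j))"
      using inv by (intro sim_power)
    from sim_trans[OF this pw] False show ?thesis by (simp add: power_int_def)
  qed
qed

text \<open>
  The relation for \<open>\<alpha>\<close> with an index \<open>i\<close> such that \<open>n\<close> times the value of \<open>om i\<close> is odd determines an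
  odd power of the residue, and odd roots are unique in the reals.
\<close>

lemma residue_power:
  assumes st: "stage n p g a (om k) r c" and k: "adm k" and L: "L > 0"
    and e: "of_nat L * vom k * of_nat n = of_int e"
    and indep: "\<And>i. i < L \<Longrightarrow> of_nat i * vom k * of_nat n \<in> \<int> \<Longrightarrow> i = 0"
    and i: "i < k" "lead p (rv g) (om i) (\<gamma> i) (vom i) 0" "odd o'" "of_nat n * vom i = of_int o'"
  shows "sim (to_quot (om k) ^ L) (real_const (\<gamma> k ^ L) * to_quot (stand_in n a e))"
proof -
  note F = stage_facts[OF st]
  let ?u = "to_quot (om k)" and ?s = "\<lambda>e. to_quot (stand_in n a e)"
  let ?K = "seq_K \<Gamma> v k i" and ?K' = "seq_K \<Gamma> v i k"
  have ai: "adm i" using adm_mono[OF k] i by simp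
  have i0: "vom i \<noteq> 0" using i by (metis even_zero mult_zero_right of_int_0_eq_iff)
  have "veq (?u ^ L) (of_nat L * vom k)" by (rule veq_power[OF adm_value(1)[OF k]])
  moreover have "of_int e / of_nat n = of_nat L * vom k" using e F(1) by (simp add: field_simps)
  ultimately have uv: "veqv (?u ^ L) (?s e)" using veq_imp_veqv F(16)[of e] by metis
  obtain \<rho> where \<rho>: "\<rho> \<noteq> 0" "sim (?u ^ L) (real_const \<rho> * ?s e)"
    using sim_real_ex[OF K_power[OF om_K] veq_K[OF F(16)] uv] F(16)[of e] by (auto simp: veq_def)
  have Kq: "of_int ?K * vom k = of_int ?K' * vom i" by (rule seq_K_eq[OF k ai])
  hence Kqn: "of_int ?K * vom k * of_nat n = of_int (?K' * o')" using i(4) by (simp add: mult_ac)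
  \<comment> \<open>K times the value of \<open>om k\<close> is an integral multiple of the value of
    \<open>om i\<close>, hence of 1/n; and L is the order of the value of
    \<open>om k\<close>.\<close>
  have "int L dvd ?K"
  proof -
    have "of_int (?K mod int L) * vom k * of_nat n = of_int (?K' * o') - of_int (?K div int L) * (of_int e :: rat)"
    proof -
      have "(of_int ?K :: rat) = of_int (?K div int L) * of_nat L + of_int (?K mod int L)"
        by (metis div_mult_mod_eq of_int_add of_int_mult of_int_of_nat_eq)
      hence "of_int ?K * vom k * of_nat n = of_int (?K div int L) * (of_nat L * vom k * of_nat n)
          + of_int (?K mod int L) * vom k * of_nat n" by (simp only: distrib_left distrib_right mult_ac)
      thus ?thesis unfolding e Kqn by (simp only: eq_diff_eq add.commute)
    qed
    also have "\<dots> \<in> \<int>" by (intro Ints_diff Ints_mult Ints_of_int)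
    also have "of_int (?K mod int L) = (of_nat (nat (?K mod int L)) :: rat)" using L by simp
    finally have "nat (?K mod int L) = 0" using L by (intro indep) (auto simp: nat_less_iff)
    hence "?K mod int L = 0" using L by (metis nat_eq_iff2 pos_mod_sign of_nat_0_less_iff of_nat_0 nle_le)
    thus ?thesis by presburger
  qed
  then obtain K1 where K1: "?K = int L * K1" by blast
  have rel: "e * K1 = o' * ?K'"
  proof -
    have "(of_int (e * K1) :: rat) = of_int (?K' * o')"
      unfolding of_int_mult[of e] e[symmetric] Kqn[symmetric] K1 by (simp add: mult_ac)
    thus ?thesis by (simp only: of_int_eq_iff mult.commute)
  qed
  \<comment> \<open>From K e = K' o' L and the coprimality of K and K' it follows that K divides o'
    L, so K1 divides the odd number o'.\<close>
  have "odd K1"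
  proof -
    have "?K * e = ?K' * (o' * int L)" using rel by (simp add: K1 mult_ac)
    hence "?K dvd ?K' * (o' * int L)" by (metis dvd_triv_left)
    hence "?K dvd o' * int L" using seq_K_coprime[OF k i0] by (simp add: coprime_dvd_mult_right_iff)
    hence "K1 dvd o'" using L by (simp add: K1 mult.commute[of o'])
    thus ?thesis using i(3) by (metis dvd_trans)
  qed
  \<comment> \<open>The power u^K is evaluated twice, through \<rho> and through the relation with
    \<open>om i\<close>. Comparison gives \<rho>^K1 = (\<gamma> k)^K, where K = L K1 and K1 is
    odd.\<close>
  have "sim (?u powi ?K) (real_const (\<rho> powi K1) * ?s (e * K1))"
  proof -
    have "sim ((?u ^ L) powi K1) ((real_const \<rho> * ?s e) powi K1)" using \<rho>(2) by (rule sim_powi)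
    moreover have "(?u ^ L) powi K1 = ?u powi ?K" by (simp add: K1 power_int_mult)
    moreover have "sim (real_const (\<rho> powi K1) * ?s e powi K1) (real_const (\<rho> powi K1) * ?s (e * K1))"
      using \<rho>(1) K_real stand_in_powi[OF F(1,3,4,5,6)] by (intro sim_mult sim_refl) auto
    ultimately show ?thesis unfolding power_real_const_mult using sim_trans by metis
  qed
  moreover have "sim (?u powi ?K) (real_const (\<gamma> k powi ?K) * ?s (e * K1))"
  proof -
    have oi: "of_int o' / of_nat n = vom i" using i(4) F(1) by (simp add: field_simps)
    have "lead p (rv g) (stand_in n a o') 1 (vom i) 0" unfolding oi[symmetric] using F by (intro lead_stand_in) auto
    from below_sim[OF F(6,3) om_wl i(2) stand_in_wl[OF F(4)] this] adm_value(3)[OF ai]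
    have "sim (to_quot (om i)) (real_const (\<gamma> i) * ?s o')" by simp
    hence "sim (to_quot (om i) powi ?K') ((real_const (\<gamma> i) * ?s o') powi ?K')" by (rule sim_powi)
    moreover have "sim (real_const (\<gamma> i powi ?K') * ?s o' powi ?K') (real_const (\<gamma> i powi ?K') * ?s (o' * ?K'))"
      using adm_value(3)[OF ai] K_real stand_in_powi[OF F(1,3,4,5,6)] by (intro sim_mult sim_refl) auto
    ultimately have "sim (to_quot (om i) powi ?K') (real_const (\<gamma> i powi ?K') * ?s (e * K1))"
      unfolding power_real_const_mult rel using sim_trans by blast
    hence "sim (real_const (\<gamma> k powi ?K * \<gamma> i powi (- ?K')) * to_quot (om i) powi ?K')
        (real_const (\<gamma> k powi ?K * \<gamma> i powi (- ?K')) * (real_const (\<gamma> i powi ?K') * ?s (e * K1)))"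
      using adm_value(3)[OF ai] adm_value(3)[OF k] K_real by (intro sim_mult sim_refl) auto
    from sim_trans[OF alpha_sim[OF k ai] this]
    have "sim (?u powi ?K) (real_const (\<gamma> k powi ?K * \<gamma> i powi (- ?K') * \<gamma> i powi ?K') * ?s (e * K1))"
      using i by (simp add: real_const_mult mult.assoc)
    moreover have "\<gamma> k powi ?K * \<gamma> i powi (- ?K') * \<gamma> i powi ?K' = \<gamma> k powi ?K"
      using adm_value(3)[OF ai] by (simp add: power_int_minus mult.assoc)
    ultimately show ?thesis by simp
  qed
  ultimately have eq: "sim (real_const (\<rho> powi K1) * ?s (e * K1)) (real_const (\<gamma> k powi ?K) * ?s (e * K1))"
    using sim_trans sim_sym by blast
  have s0: "?s (e * K1) \<noteq> 0" "inverse (?s (e * K1)) \<in> weyl_quot"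
    using F(16)[of "e * K1"] veq_K K_inverse by (auto simp: veq_def)
  have "sim (inverse (?s (e * K1))) (inverse (?s (e * K1)))" using s0 by (intro sim_refl) auto
  from sim_mult[OF eq this]
  have "sim (real_const (\<rho> powi K1)) (real_const (\<gamma> k powi ?K))" using s0 by (simp add: mult.assoc)
  hence "\<rho> powi K1 = (\<gamma> k ^ L) powi K1" by (simp add: sim_real_iff K1 power_int_mult)
  hence "\<rho> = \<gamma> k ^ L" by (rule odd_power_int_eq) (rule \<open>odd K1\<close>, simp add: adm_value(3)[OF k])
  thus ?thesis using \<rho>(2) by simp
qed

end

text \<open>Both descriptions of u have the same leading term. Cancelling r x^(-k) on the left shows
  that y - p has the leading term (c/r) x^(-(q - k)), and subtracting it raises the value.\<close>

lemma (in full_dominance) next_vlt: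
  assumes T: "sim u (real_const r * x_pow (- k) * y_minus p)" and u: "sim u (real_const c * x_pow (- q))"
    and rc: "r \<noteq> 0" "c \<noteq> 0"
  shows "vlt (x_pow (- (q - k))) (y_minus (p + puiseux_monom (c / r) (- (q - k))))"
proof -
  let ?B = "real_const r * x_pow (- k)" and ?C = "real_const (c / r) * x_pow (- (q - k))"
  have B: "?B \<noteq> 0" using rc by simp
  have BC: "?B * ?C = real_const c * x_pow (- q)"
  proof -
    have "?B * ?C = real_const r * (x_pow (- k) * real_const (c / r)) * x_pow (- (q - k))" by (simp add: mult.assoc)
    also have "\<dots> = real_const r * (real_const (c / r) * x_pow (- k)) * x_pow (- (q - k))" by (simp only: real_const_comm)
    also have "\<dots> = real_const (r * (c / r)) * (x_pow (- k) * x_pow (- (q - k)))"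
      unfolding real_const_mult by (simp only: mult.assoc)
    finally show ?thesis using rc by (simp add: x_pow_mult)
  qed
  have "sim (?B * y_minus p) (?B * ?C)" unfolding BC using sim_trans[OF sim_sym[OF T] u] .
  from sim_mult[OF sim_refl[OF UNIV_I, of "inverse ?B"] this]
  have "sim (inverse ?B * (?B * y_minus p)) (inverse ?B * (?B * ?C))" using B by simp
  moreover have "inverse ?B * (?B * a) = a" for a
    unfolding mult.assoc[of "inverse ?B" ?B, symmetric] left_inverse[OF B] by simp
  ultimately have C: "vlt ?C (y_minus p - ?C)" by (simp add: sim_def)
  have "c / r \<noteq> 0" using rc by simp
  from vle_vlt_trans[OF UNIV_I UNIV_I UNIV_I conjunct2[OF veqv_real_mult[OF UNIV_I this]] C]
  have "vlt (x_pow (- (q - k))) (y_minus p - ?C)" .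
  moreover have "y_minus (p + puiseux_monom (c / r) (- (q - k))) = y_minus p - ?C"
    by (simp add: to_quot_monom[symmetric] to_quot_diff[symmetric] sconst_add algebra_simps)
  ultimately show ?thesis by simp
qed

section \<open>Stopping or continuing the approximation\<close>

context gamma_data
begin

text \<open>
  The extensions as dominance relations, which makes their value groups, of arbitrary type,
  disappear.
\<close>

definition ext :: "(weyl_ext \<Rightarrow> weyl_ext \<Rightarrow> bool) \<Rightarrow> bool" where
  "ext vle' \<longleftrightarrow> full_dominance vle' \<and> (\<forall>a\<in>weyl_quot. \<forall>b\<in>weyl_quot. vle' a b \<longleftrightarrow> vle a b) \<and>
     (\<forall>i\<ge>1. adm i \<longrightarrow> dominance.sim UNIV vle' (to_quot (om i)) (real_const (\<gamma> i) * x_pow (- vom i)))"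

lemma agree_transfer:
  assumes "full_dominance vle'" "\<And>a b. a \<in> weyl_quot \<Longrightarrow> b \<in> weyl_quot \<Longrightarrow> vle' a b \<longleftrightarrow> vle a b"
    and a: "a \<in> weyl_quot"
  shows "dominance.vge UNIV vle' a q \<longleftrightarrow> vge a q" "dominance.veq UNIV vle' a q \<longleftrightarrow> veq a q"
    "weyl_dominance.cut UNIV vle' a G \<longleftrightarrow> local.cut a G"
proof -
  interpret E: full_dominance vle' by fact
  have vge: "E.vge a q \<longleftrightarrow> vge a q" if "a \<in> weyl_quot" for a q
    using that assms(2) K_power K_x_pow_minus by (simp add: E.vge_def vge_def)
  have veq: "E.veq a q \<longleftrightarrow> veq a q" if "a \<in> weyl_quot" for a q
    using that vge K_inverse by (simp add: E.veq_def veq_def)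
  show "E.vge a q \<longleftrightarrow> vge a q" "E.veq a q \<longleftrightarrow> veq a q" "E.cut a G \<longleftrightarrow> local.cut a G"
    using a vge veq by (simp_all add: E.cut_def cut_def)
qed

lemma ext_transfer:
  assumes "ext vle'" "a \<in> weyl_quot"
  shows "dominance.vge UNIV vle' a q \<longleftrightarrow> vge a q"
    "weyl_dominance.cut UNIV vle' a G \<longleftrightarrow> local.cut a G"
  using assms by (auto simp: ext_def agree_transfer)

text \<open>An index whose value has an odd numerator over n is what \<open>residue_power\<close>
  needs; at the start it is i = 0, as x has value - 1. The last clause quantifies over all
  extensions, so uniqueness is prepared before any extension is known to exist.\<close>

definition inv_stage :: "nat \<Rightarrow> nat \<Rightarrow> puiseux \<Rightarrow> rat \<Rightarrow> spoly \<Rightarrow> real \<Rightarrow> rat \<Rightarrow> bool" where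
  "inv_stage k n p g a r c \<longleftrightarrow> k > 0 \<and> adm (k - 1) \<and> stage n p g a (om k) r c \<and>
     (\<forall>i<k. lead p (rv g) (om i) (\<gamma> i) (vom i) 0) \<and> (\<exists>i<k. \<exists>j. odd j \<and> of_nat n * vom i = of_int j) \<and>
     (\<forall>vle'. ext vle' \<longrightarrow> \<not> vle' (y_minus p) (x_pow (- g)))"

text \<open>
  The process stops when \<open>y - p\<close> has no rational value; its value is then the cut \<open>G\<close>, and the extension is
  the Gauss valuation. If it never stops, the extension is the limit of the Gauss valuations.
\<close>

definition terminal :: "puiseux \<Rightarrow> real poly \<Rightarrow> bool" where
  "terminal p G \<longleftrightarrow> G < rv 1 \<and> (\<forall>t. rv t \<noteq> G) \<and> compat p G \<and>
     (\<forall>vle'. ext vle' \<longrightarrow> weyl_dominance.cut UNIV vle' (y_minus p) G) \<and>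
     (\<forall>i\<ge>1. adm i \<longrightarrow> lead p G (om i) (\<gamma> i) (vom i) 0)"

lemma initial_stage:
  assumes "vge weyl_y q"
  obtains g where "inv_stage 1 1 0 g (sconst (puiseux_monom 1 (- 1))) 1 0"
proof
  \<comment> \<open>Strictly below the known bound q for y and below 1.\<close>
  define g where "g = min (q - 1) 0"
  let ?a = "sconst (puiseux_monom 1 (- 1))"
  have a: "?a \<in> wl" using wl_monom[of 1 "- 1"] by simp
  have la: "lead 0 (rv g) ?a 1 (1 / of_nat 1) 0" using lead_mon[of 0 "rv g" 1 1 0] by (simp add: mon_const)
  have "below 0 g" by (rule below_initial[OF vge_mono[OF assms]]) (simp add: g_def)
  moreover have "\<exists>g1>g. vge (to_quot svar) (0 + g1)"
    using assms by (intro exI[of _ q]) (auto simp: g_def weyl_y_def)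
  moreover have "cf (shift 0 svar) 0 s = 0" for s
    using scoeff_svar_pow[of 1 0] by (simp add: cf_def zero_puiseux.rep_eq)
  moreover have "0 \<in> ramified 1" using dsubringD(5)[OF dsubring_ramified] .
  ultimately have st: "stage 1 0 g ?a svar 1 0"
    unfolding stage_def using a la wl_closed(2) lead_1 by (simp add: g_def)
  have l0: "lead 0 (rv g) (om 0) (\<gamma> 0) (vom 0) 0"
    using lead_mon[of 0 "rv g" 1 "- 1" 0] choice by (simp add: mon_const gamma_choice_def vom_def seq_m_def seq_n_def)
  have odd: "of_nat 1 * vom 0 = of_int (- 1)" by (simp add: vom_def seq_m_def seq_n_def)
  have "\<not> vle' (y_minus 0) (x_pow (- g))" if "ext vle'" for vle'
  proof -
    interpret E: full_dominance vle' using that by (simp add: ext_def)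
    have "E.vge weyl_y q" using assms ext_transfer(1)[OF that weyl_quot_y] by simp
    hence "E.vlt (x_pow (- g)) weyl_y" using E.veq_vge_vlt[OF E.veq_x_pow_minus] by (simp add: g_def)
    thus ?thesis by (simp add: weyl_y_def)
  qed
  thus "inv_stage 1 1 0 g ?a 1 0"
    unfolding inv_stage_def using st l0 odd adm_0 by (auto intro!: exI[of _ "- 1"])
qed

text \<open>No rational number bounds the value of y from below, so G lies below all of them and the
  process stops at p = 0. Elements of \<open>wl\<close> are finite sums of monomials in x and y,
  which makes their expansions exact.\<close>

lemma initial_terminal:
  assumes "\<And>q. \<not> vge weyl_y q"
  obtains G where "terminal 0 G"
proof -
  have y: "to_quot svar = weyl_y" by (simp add: weyl_y_def)
  have irr: "\<not> veq weyl_y t" for t using assms veq_imp_vge by blast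
  have "weyl_y \<noteq> 0" using assms vge_0 by metis
  then obtain G where G: "\<And>t. vge weyl_y t \<longleftrightarrow> rv t < G" "\<And>t. rv t \<noteq> G" "local.cut weyl_y G"
    using cut_exists[OF weyl_y_K irr] by metis
  have "G < rv t" for t using G(1,2)[of t] assms by (metis linorder_neqE)
  hence G1: "G < rv 1" .
  define a where "a = sconst (puiseux_monom 1 (- 1))"
  have a: "a \<in> wl" using wl_monom[of 1 "- 1"] by (simp add: a_def)
  have la: "lead 0 G a 1 (1 / of_nat 1) 0" using lead_mon[of 0 G 1 1 0] by (simp add: mon_const a_def)
  have s: "stand_in 1 a e = sconst (puiseux_monom 1 (- of_int e))" for e by (simp add: stand_in_def)
  have se: "exp_term 1 a 1 svar svar (e, j) = sconst (puiseux_monom 1 (- of_int e)) * svar ^ j" for e j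
    unfolding exp_term_def prod.case s by simp
  have span: "f \<in> real_span (exp_term 1 a 1 svar svar)" if f: "f \<in> wl" for f
  proof -
    have "sconst (scoeff f i) * svar ^ i \<in> real_span (exp_term 1 a 1 svar svar)" for i
    proof -
      let ?S = "{q. pcoeff (scoeff f i) q \<noteq> 0}"
      have c: "scoeff f i \<in> laurent" using f by (auto simp: wl_def skew_over_def)
      have "sconst (scoeff f i) * svar ^ i = (\<Sum>q\<in>?S. sconst (puiseux_monom (pcoeff (scoeff f i) q) (- q)) * svar ^ i)"
        by (subst sconst_laurent[OF c]) (simp add: sum_distrib_right)
      also have "\<dots> \<in> real_span (exp_term 1 a 1 svar svar)"
      proof (rule real_span_sum)
        fix q assume "q \<in> ?S"
        then obtain e where "q = of_int e" using c by (auto simp: laurent_def elim: Ints_cases)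
        hence "sconst (puiseux_monom (pcoeff (scoeff f i) q) (- q)) * svar ^ i =
            sconst (puiseux_monom (pcoeff (scoeff f i) q) 0) * exp_term 1 a 1 svar svar (e, i)"
          unfolding se by (simp add: mult.assoc[symmetric] sconst_mult[symmetric] puiseux_monom_mult)
        thus "sconst (puiseux_monom (pcoeff (scoeff f i) q) (- q)) * svar ^ i \<in> real_span (exp_term 1 a 1 svar svar)"
          using real_span_base by simp
      qed
      finally show ?thesis .
    qed
    hence "(\<Sum>i\<le>degree (poly_of f). sconst (scoeff f i) * svar ^ i) \<in> real_span (exp_term 1 a 1 svar svar)"
      by (intro real_span_sum)
    thus ?thesis by (simp only: spoly_sum[of f, symmetric])
  qed
  have "compat 0 G" unfolding compat_def
  proof (intro ballI allI impI)
    fix h f c s' l' assume *: "h \<in> wl" "f \<in> wl" "lead 0 G h c s' l'" "c \<noteq> 0" "gauss_gt 0 G (wt G s' l') f"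
    show "vlt (to_quot h) (to_quot f)"
    proof (rule irrational_vlt[where L = 1 and n = 1 and a = a and u = svar and z = svar and p = 0 and G = G and
          r = 1 and qu = 0 and t = 1 and c = 0])
      show "lead 0 G svar 1 0 1" using lead_mon[of 0 G 1 0 1] by (simp add: mon_def puiseux_monom_1)
      show "\<exists>h\<in>real_span (exp_term 1 a 1 svar svar). gauss_ge 0 G (rv (of_nat j)) (f - h) \<and> vge (to_quot (f - h)) (of_nat j)"
        if "f \<in> wl" for f j using span[OF that] vge_0 by (intro bexI[of _ f]) auto
      show "local.cut (to_quot svar) (G + rv 0)" using G(3) y by simp
      show "veq (to_quot (stand_in 1 a e)) (of_int e / of_nat 1)" for e
        unfolding s to_quot_monom using veq_x_pow[of "- e"] by simp
    qed (use * a la wl_closed(2) G(2) G1 in auto)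
  qed
  moreover have "weyl_dominance.cut UNIV vle' (y_minus 0) G" if "ext vle'" for vle'
    using ext_transfer(2)[OF that weyl_quot_y] G(3) by (simp add: weyl_y_def)
  moreover have "\<not> adm i" if "i \<ge> 1" for i
    using adm_mono[of i 1] that adm_value(1)[of 1] irr y by auto
  ultimately show thesis using that[of G] G1 G(2) unfolding terminal_def by blast
qed

text \<open>A rational value would give some power f^n the value of a power of x. Their weights
  differ, as that of f^n involves n times the irrational G, and \<open>compat\<close> then separates
  the values.\<close>

lemma compat_irrational:
  assumes c: "compat p G" and G: "G < rv 1" "\<And>t. rv t \<noteq> G" and f: "f \<in> wl" "lead p G f r s 1" "r \<noteq> 0"
  shows "\<not> veq (to_quot f) t"
proof
  assume t: "veq (to_quot f) t"
  obtain n k where n: "n > 0" "t = of_int k / of_nat n" by (rule common_denominator[of t t])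
  have e: "veqv (to_quot f ^ n) (x_pow (- of_int k))" using veq_iff_power[OF veq_K[OF t] n] t by blast
  have lf: "lead p G (f ^ n) (r ^ n) (of_nat n * s) n" using lead_power[OF G(1) f(2), of n] by simp
  define m where "m = mon p 1 (of_int k) 0"
  have m: "m \<in> wl" unfolding m_def by (rule wl_mon)
  have lm: "lead p G m 1 (of_int k) 0" by (simp add: m_def)
  have tm: "to_quot m = x_pow (- of_int k)" "to_quot (f ^ n) = to_quot f ^ n"
    by (simp_all add: m_def to_quot_mon_const to_quot_power)
  have fw: "f ^ n \<in> wl" using f wl_closed(8) by blast
  have "wt G (of_nat n * s) n \<noteq> wt G (of_int k) 0" using irrational_wt_eq[OF G(2)] n by (metis less_numeral_extra(3))
  then consider "wt G (of_nat n * s) n < wt G (of_int k) 0" | "wt G (of_int k) 0 < wt G (of_nat n * s) n"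
    by (metis linorder_neqE)
  thus False
  proof cases
    case 1
    hence "gauss_gt p G (wt G (of_nat n * s) n) m" using lead_imp_ge[OF lm] gauss_ge_imp_gt by blast
    hence "vlt (to_quot (f ^ n)) (to_quot m)" using c fw m lf f(3) unfolding compat_def by (metis power_not_zero)
    thus False using e unfolding tm by blast
  next
    case 2
    hence "gauss_gt p G (wt G (of_int k) 0) (f ^ n)" using lead_imp_ge[OF lf] gauss_ge_imp_gt by blast
    hence "vlt (to_quot m) (to_quot (f ^ n))" using c fw m lm unfolding compat_def by (metis zero_neq_one)
    thus False using e unfolding tm by blast
  qed
qed

text \<open>Recorded for the case of infinitely many stages: the centres first differ at G, by a
  term that is really there, and clearing the denominator of G on top of n also clears n'. This lets
  the bounded ramification of one element control all later denominators.\<close>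

definition linked :: "nat \<Rightarrow> nat \<Rightarrow> puiseux \<Rightarrow> rat \<Rightarrow> nat \<Rightarrow> puiseux \<Rightarrow> rat \<Rightarrow> rat \<Rightarrow> bool" where
  "linked k n p g n' p' g' G \<longleftrightarrow> g < G \<and> G < g' \<and> (\<forall>s. pcoeff (p' - p) s \<noteq> 0 \<longrightarrow> G \<le> s) \<and> pcoeff (p' - p) G \<noteq> 0 \<and>
     (\<forall>M. n dvd M \<longrightarrow> of_nat M * G \<in> \<int> \<longrightarrow> n' dvd M) \<and>
     (\<forall>f d s. lead p (rv g) f d s 0 \<longrightarrow> lead p' (rv g') f d s 0)"

text \<open>The process stops in two ways: the value of u is irrational, or u has a rational value
  and z exceeds L times it only by an infinitesimal. Otherwise \<gamma> k supplies the coefficient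
  of the next term.\<close>

lemma stage_step:
  assumes inv: "inv_stage k n p g a r c"
  shows "(\<exists>p G. terminal p G) \<or>
    (\<exists>n' p' g' a' r' c' G. inv_stage (Suc k) n' p' g' a' r' c' \<and> linked k n p g n' p' g' G)"
proof -
  let ?u = "om k"
  have st: "stage n p g a ?u r c" and k: "k > 0" "adm (k - 1)"
    and li: "\<And>i. i < k \<Longrightarrow> lead p (rv g) (om i) (\<gamma> i) (vom i) 0"
    and odd: "\<exists>i<k. \<exists>j. odd j \<and> of_nat n * vom i = of_int j"
    and T: "\<And>vle'. ext vle' \<Longrightarrow> \<not> vle' (y_minus p) (x_pow (- g))"
    using inv by (auto simp: inv_stage_def)
  note F = stage_facts[OF st]
  have usim: "dominance.sim UNIV vle' (to_quot ?u) (real_const r * x_pow (- c) * y_minus p)" if e: "ext vle'" for vle'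
  proof -
    interpret E: full_dominance vle' using e by (simp add: ext_def)
    show ?thesis
    proof (rule E.lin_value(1)[OF T[OF e] _ F(8)])
      show "tail p g c (dy ?u - mon p r c 0)" using F(9) gauss_gt_tail by (simp add: lead_def)
      show "c + 1 \<le> q" if "cf (shift p ?u) 0 q \<noteq> 0" for q using st that by (simp add: stage_def)
      show "\<not> E.vge (to_quot ?u) (c + 1)" using F(14) ext_transfer(1)[OF e om_K] by simp
    qed
  qed
  show ?thesis
  proof (cases "\<exists>q. veq (to_quot ?u) q")
    case False
    hence irr: "\<not> veq (to_quot ?u) q" for q by blast
    obtain G where G: "rv g < G" "G < rv 1" "\<And>t. rv t \<noteq> G" "local.cut (to_quot ?u) (G + rv c)" "compat p G"
      using stage_irrational[OF st irr] by blast
    have "weyl_dominance.cut UNIV vle' (y_minus p) G" if e: "ext vle'" for vle'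
    proof -
      interpret E: full_dominance vle' using e by (simp add: ext_def)
      have "E.cut (to_quot ?u) (G + rv c)" using G(4) ext_transfer(2)[OF e om_K] by simp
      thus ?thesis by (rule E.cut_at[OF _ usim[OF e] E.veq_real_mult[OF E.veq_x_pow_minus F(8)]])
    qed
    moreover have "lead p G (om i) (\<gamma> i) (vom i) 0" if "adm i" for i
    proof -
      have "i < k" using adm_mono[OF that, of k] adm_value(1)[of k] irr by (meson not_less)
      thus ?thesis
        by (intro lead_change[OF _ _ _ li]) (use F(3) G(1) in \<open>auto simp: zero_puiseux.rep_eq intro: less_imp_le\<close>)
    qed
    ultimately have "terminal p G" using G by (simp add: terminal_def)
    thus ?thesis by blast
  next
    case True
    then obtain q0 where q0: "veq (to_quot ?u) q0" by blast
    have ak: "adm k" using adm_SucI[of "k - 1" q0] k q0 by simp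
    define q where "q = vom k"
    have q: "veq (to_quot ?u) q" and c0: "\<gamma> k \<noteq> 0" unfolding q_def using adm_value[OF ak] by auto
    note B = stage_value_bounds[OF st q]
    obtain L e where L: "L > 0" "of_nat L * q * of_nat n = of_int e"
      "\<And>i. i < L \<Longrightarrow> of_nat i * q * of_nat n \<in> \<int> \<Longrightarrow> i = 0" using least_multiple[OF F(1), of q] by blast
    obtain i0 j0 where "i0 < k" "odd j0" "of_nat n * vom i0 = of_int j0" using odd by blast
    hence sim: "sim (to_quot ?u ^ L) (real_const (\<gamma> k ^ L) * to_quot (stand_in n a e))"
      using residue_power[OF st ak L(1) L(2,3)[unfolded q_def]] li by blast
    note N = st q c0 L sim
    let ?p = "next_p p r c q (\<gamma> k)" and ?z = "next_z n a ?u (\<gamma> k) L e"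
    let ?kz = "of_nat (L - 1) * q + c" and ?rz = "of_nat L * \<gamma> k ^ (L - 1) * r"
    define N' m where "N' = nat (seq_n \<Gamma> v k)" and "m = seq_m \<Gamma> v k"
    have N': "N' > 0" "of_nat N' * q = of_int m"
      using adm_value(4)[OF ak k(1)] by (simp_all add: N'_def m_def q_def vom_def)
    have om_Suc: "om (Suc k) = sconst (puiseux_monom 1 (of_int m)) * ?u ^ N' - sconst (puiseux_monom (\<gamma> k ^ N') 0)"
      using k by (cases k) (auto simp: N'_def m_def)
    obtain h where h: "q - c < h" "lin ?p (q - c) ?z ?rz ?kz h" using next_z_lin[OF N] by blast
    let ?kw = "of_nat (N' - 1) * q + c - of_int m" and ?rw = "of_nat N' * \<gamma> k ^ (N' - 1) * r"
    obtain hw where hw: "q - c < hw" "lin ?p (q - c) (om (Suc k)) ?rw ?kw hw"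
      unfolding om_Suc using next_lin[OF N N'] by blast
    have nz: "?rz \<noteq> 0" "?rw \<noteq> 0" using L(1) N'(1) c0 F(8) by auto
    have T': "\<not> vle' (y_minus ?p) (x_pow (- (q - c)))" if e: "ext vle'" for vle'
    proof -
      interpret E: full_dominance vle' using e by (simp add: ext_def)
      have "E.sim (to_quot ?u) (real_const (\<gamma> k) * x_pow (- q))" using e ak k(1) by (simp add: ext_def q_def)
      from E.next_vlt[OF usim[OF e] this F(8) c0] show ?thesis by (simp add: next_p_def[OF N])
    qed
    have zK: "to_quot ?z \<in> weyl_quot" using wl_K[OF next_z_wl[OF N]] .
    have lz: "tail ?p (q - c) ?kz (dy ?z - mon ?p ?rz ?kz 0)" by (rule lin_tail[OF h(2) B(2)])
    have cz: "?kz + h \<le> s" if "cf (shift ?p ?z) 0 s \<noteq> 0" for s using h(2) that by (simp add: lin_def)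
    show ?thesis
    proof (cases "\<exists>\<epsilon>>0. vge (to_quot ?z) (of_nat L * q + \<epsilon>)")
      case False
      hence nv: "\<not> vge (to_quot ?z) (of_nat L * q + \<epsilon>)" if "\<epsilon> > 0" for \<epsilon> using that by blast
      \<comment> \<open>Below both bounds z and the next element of the sequence are led by their
        linear terms. The latter then has an irrational value, so the sequence ends there and no
        further residues are prescribed.\<close>
      have mh: "q - c < min h hw" using h(1) hw(1) by simp
      obtain G where G: "rv (q - c) < G" "G < rv 1" "G < rv (min h hw)" "\<And>t. rv t \<noteq> G"
          "local.cut (to_quot ?z) (G + rv ?kz)" "compat ?p G"
        using stage_irrational_next[OF N nv mh] by blast
      have Gh: "G < rv h" "G < rv hw" using G(3) by (meson less_le_trans rv_le_iff min.cobounded1 min.cobounded2)+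
      have "weyl_dominance.cut UNIV vle' (y_minus ?p) G" if e: "ext vle'" for vle'
      proof -
        interpret E: full_dominance vle' using e by (simp add: ext_def)
        have cut: "E.cut (to_quot ?z) (G + rv ?kz)" using G(5) ext_transfer(2)[OF e zK] by simp
        have "\<not> rv (?kz + h) < G + rv ?kz" using Gh(1) unfolding rv_add[of ?kz h] by simp
        hence "\<not> E.vge (to_quot ?z) (?kz + h)" using cut unfolding E.cut_def by blast
        hence "E.sim (to_quot ?z) (real_const ?rz * x_pow (- ?kz) * y_minus ?p)"
          using E.lin_value(1)[OF T'[OF e] lz nz(1) cz] by blast
        thus ?thesis by (rule E.cut_at[OF cut _ E.veq_real_mult[OF E.veq_x_pow_minus nz(1)]])
      qed
      moreover have "lead ?p G (om i) (\<gamma> i) (vom i) 0" if i: "adm i" for i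
      proof -
        have "lead ?p G (om (Suc k)) ?rw ?kw 1" by (rule lin_lead[OF hw(2) G(1,2) Gh(2)])
        hence "\<not> veq (to_quot (om (Suc k))) t" for t
          using compat_irrational[OF G(6,2,4) om_wl _ nz(2)] by blast
        hence "i < Suc k" using adm_mono[OF i, of "Suc k"] adm_value(1)[of "Suc k"] by (meson not_less)
        thus ?thesis
          using next_leads(3)[OF N G(1,2) li] next_leads(1)[OF N G(1,2)] by (cases "i = k") (auto simp: q_def)
      qed
      ultimately have "terminal ?p G" using G by (simp add: terminal_def)
      thus ?thesis by blast
    next
      case True
      then obtain \<epsilon> where \<epsilon>: "\<epsilon> > 0" "vge (to_quot ?z) (of_nat L * q + \<epsilon>)" by blast
      have "\<exists>p' g' g1 a' r' c'. stage (n * L) p' g' a' (om (Suc k)) r' c' \<and> q - c < g' \<and> g' < g1 \<and> g1 < 1 \<and> g1 < h \<and>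
          (\<forall>s. pcoeff (p' - ?p) s \<noteq> 0 \<longrightarrow> g1 < s) \<and> lead p' (rv g') ?u (\<gamma> k) q 0 \<and>
          (\<forall>f d s. lead p (rv g) f d s 0 \<longrightarrow> lead p' (rv g') f d s 0) \<and> vge (to_quot ?z) (?kz + g1)"
        unfolding om_Suc by (rule stage_next[OF N \<epsilon> N' h(1)], assumption, assumption, (rule exI)+, intro conjI allI impI) (assumption | blast)+
      then obtain p' g' g1 a' r' c' where s0: "stage (n * L) p' g' a' (om (Suc k)) r' c'" "q - c < g'" "g' < g1" "g1 < 1" "g1 < h"
        "\<forall>s. pcoeff (p' - ?p) s \<noteq> 0 \<longrightarrow> g1 < s" "lead p' (rv g') ?u (\<gamma> k) q 0"
        "\<forall>f d s. lead p (rv g) f d s 0 \<longrightarrow> lead p' (rv g') f d s 0" "vge (to_quot ?z) (?kz + g1)"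
        by (elim exE conjE)
      note s' = s0(1-5) s0(6)[rule_format] s0(7) s0(8)[rule_format] s0(9)
      have "\<not> vle' (y_minus p') (x_pow (- g'))" if e: "ext vle'" for vle'
      proof -
        interpret E: full_dominance vle' using e by (simp add: ext_def)
        have "E.vge (to_quot ?z) (?kz + g1)" using s'(9) ext_transfer(1)[OF e zK] by simp
        hence 1: "E.vge (y_minus ?p) g1" using E.lin_value(2)[OF T'[OF e] lz nz(1) cz] s'(5) by simp
        have 2: "E.vge (puiseux_emb (p' - ?p)) g1" using s'(6) by (intro E.vge_puiseux) (auto intro: less_imp_le)
        have "y_minus p' = y_minus ?p - puiseux_emb (p' - ?p)"
          by (simp add: puiseux_emb_def to_quot_diff[symmetric] sconst_diff)
        hence "E.vge (y_minus p') g1" using E.vge_diff[OF 1 2] by simp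
        thus ?thesis using E.veq_vge_vlt[OF E.veq_x_pow_minus] s'(3) by blast
      qed
      \<comment> \<open>For even L the index k itself now has an odd numerator; for odd L an old odd
        numerator is multiplied by L.\<close>
      moreover have "\<exists>i<Suc k. \<exists>j. odd j \<and> of_nat (n * L) * vom i = of_int j"
      proof (cases "even L")
        case True
        have "of_nat L * q * of_nat n \<in> \<int>" unfolding L(2) by simp
        then obtain j where "odd j" "of_nat (n * L) * q = of_int j"
          using bezout_stand_in[OF F(1) L(1) _ L(3)] True by metis
        thus ?thesis unfolding q_def by blast
      next
        case False
        obtain i j where "i < k" "odd j" "of_nat n * vom i = of_int j" using odd by blast
        moreover from this have "of_nat (n * L) * vom i = of_int (int L * j)" by (simp add: mult_ac)
        ultimately show ?thesis using False by (intro exI[of _ i] conjI exI[of _ "int L * j"]) auto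
      qed
      moreover have "lead p' (rv g') (om i) (\<gamma> i) (vom i) 0" if "i < Suc k" for i
        using s'(7,8) li[of i] that by (cases "i = k") (auto simp: q_def)
      ultimately have "inv_stage (Suc k) (n * L) p' g' a' r' c'"
        unfolding inv_stage_def using s'(1) ak by auto
      moreover have "linked k n p g (n * L) p' g' (q - c)"
        unfolding linked_def
      proof (intro conjI allI impI)
        have pp: "pcoeff (p' - p) s = pcoeff (p' - ?p) s + pcoeff (?p - p) s" for s
          by (simp add: minus_puiseux.rep_eq)
        have z: "pcoeff (p' - ?p) s = 0" if "s \<le> q - c" for s using s'(2,3) s'(6)[of s] that by force
        have pn: "pcoeff (?p - p) s = (if s = q - c then \<gamma> k / r else 0)" for s
          by (simp add: next_p_def[OF N] minus_puiseux.rep_eq plus_puiseux.rep_eq puiseux_monom.rep_eq)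
        show "g < q - c" "q - c < g'" using B s' by auto
        show "q - c \<le> s" if "pcoeff (p' - p) s \<noteq> 0" for s
          using that z[of s] pn[of s] unfolding pp[of s] by (cases "s \<le> q - c") (auto split: if_splits)
        show "pcoeff (p' - p) (q - c) \<noteq> 0" unfolding pp[of "q - c"] pn using z c0 F(8) by simp
        show "lead p (rv g) f d s 0 \<Longrightarrow> lead p' (rv g') f d s 0" for f d s by (rule s'(8))
        show "n * L dvd M" if M: "n dvd M" "of_nat M * (q - c) \<in> \<int>" for M
        proof -
          obtain M1 where M1: "M = n * M1" using M(1) by blast
          have 1: "of_nat M1 * (c * of_nat n) \<in> \<int>" by (rule Ints_mult[OF Ints_of_nat F(12)])
          \<comment> \<open>Adding M1 n c, which is integral, turns the condition on q - c into one
            on q, and L is the order of q.\<close>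
          have "of_nat M * (q - c) + of_nat M1 * (c * of_nat n) = of_nat M1 * q * of_nat n"
            by (simp add: M1 algebra_simps)
          hence 2: "of_nat M1 * q * of_nat n \<in> \<int>" using Ints_add[OF M(2) 1] by simp
          have "(of_nat M1 :: rat) = of_nat (M1 div L) * of_nat L + of_nat (M1 mod L)"
            unfolding of_nat_mult[symmetric] of_nat_add[symmetric] by simp
          hence "of_nat M1 * q * of_nat n = of_nat (M1 div L) * (of_nat L * q * of_nat n) + of_nat (M1 mod L) * q * of_nat n"
            by (simp only: distrib_left distrib_right mult_ac)
          hence "of_nat (M1 mod L) * q * of_nat n = of_nat M1 * q * of_nat n - of_int (int (M1 div L) * e)"
            unfolding L(2) by simp
          hence "of_nat (M1 mod L) * q * of_nat n \<in> \<int>" using Ints_diff[OF 2 Ints_of_int] by metis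
          hence "M1 mod L = 0" using L(1,3) by simp
          thus ?thesis unfolding M1 by (intro mult_dvd_mono) auto
        qed
      qed
      ultimately show ?thesis by blast
    qed
  qed
qed

end

section \<open>Leading forms with respect to Gauss valuations and their limits\<close>

lemma lead_wt_le:
  "lead p G f r q i \<Longrightarrow> lead p G f r' q' i' \<Longrightarrow> r' \<noteq> 0 \<Longrightarrow> wt G q i \<le> wt G q' i'"
  using gauss_geD[OF lead_imp_ge, of p G f r q i i' q'] lead_coeff_eq[of p G f r' q' i'] by simp

lemma lead_add_gt: "lead p G f r q i \<Longrightarrow> gauss_gt p G (wt G q i) h \<Longrightarrow> lead p G (f + h) r q i"
  using lead_cong[of p G f r q i "f + h"] by simp

lemma lead_cancel_less:
  "lead p G f r q i \<Longrightarrow> lead p G h (- r) q i \<Longrightarrow> lead p G (f + h) r' q' i' \<Longrightarrow> r' \<noteq> 0 \<Longrightarrow> wt G q i < wt G q' i'"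
  using lead_add[of p G f r q i h "- r"] gauss_gtD[of p G "wt G q i" "f + h" i' q'] lead_coeff_eq[of p G "f + h" r' q' i']
  by (simp add: lead_0_iff)

lemma lead_nz: "lead p G f r q i \<Longrightarrow> r \<noteq> 0 \<Longrightarrow> f \<noteq> 0"
  using lead_coeff_eq[of p G f r q i] by auto

text \<open>An irrational G gives different weights to different positions, so exactly one term of a
  non-zero element has the least weight.\<close>

lemma gauss_leading_forms:
  assumes G: "G < rv 1" "\<And>t. rv t \<noteq> G"
  shows "leading_forms (\<lambda>f r s. r \<noteq> 0 \<and> (\<exists>q i. s = wt G q i \<and> lead p G f r q i))"
proof
  fix f h :: spoly and r r' s s'
  show "\<exists>r s. r \<noteq> 0 \<and> (\<exists>q i. s = wt G q i \<and> lead p G f r q i)" if "f \<noteq> 0"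
  proof -
    define F where "F = shift p f"
    have "F \<noteq> 0" using that by (simp add: F_def)
    define D where "D = {i. scoeff F i \<noteq> 0}"
    have "D \<subseteq> {..degree (poly_of F)}" by (auto simp: D_def scoeff_def intro: le_degree)
    hence D: "finite D" by (rule finite_subset) simp
    have "D \<noteq> {}" using \<open>F \<noteq> 0\<close> scoeff_eqI[of F 0] by (auto simp: D_def)
    have "\<exists>e. pcoeff (scoeff F i) e \<noteq> 0 \<and> (\<forall>s<e. pcoeff (scoeff F i) s = 0)" if "i \<in> D" for i
    proof -
      have "scoeff F i \<noteq> 0" using that by (simp add: D_def)
      then obtain e where "pcoeff (scoeff F i) e \<noteq> 0" "\<forall>s<e. pcoeff (scoeff F i) s = 0" by (rule puiseux_lead)
      thus ?thesis by blast
    qed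
    then obtain e where e: "\<And>i. i \<in> D \<Longrightarrow> pcoeff (scoeff F i) (e i) \<noteq> 0 \<and> (\<forall>s<e i. pcoeff (scoeff F i) s = 0)" by metis
    obtain i0 where i0: "i0 \<in> D" "\<And>i. i \<in> D \<Longrightarrow> wt G (e i0) i0 \<le> wt G (e i) i"
      using ex_min_if_finite[of "(\<lambda>i. wt G (e i) i) ` D"] D \<open>D \<noteq> {}\<close> by (auto simp: not_less)
    have "lead p G f (cf F i0 (e i0)) (e i0) i0"
      unfolding lead_def gauss_gt_def
    proof (intro allI impI)
      fix j t assume a: "cf (shift p (f - mon p (cf F i0 (e i0)) (e i0) i0)) j t \<noteq> 0"
      hence nq: "\<not> (j = i0 \<and> t = e i0)" by (auto simp: shift_diff cf_shift_mon F_def)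
      hence nz: "cf F j t \<noteq> 0" using a by (auto simp: shift_diff cf_shift_mon F_def split: if_splits)
      hence j: "j \<in> D" by (auto simp: D_def cf_def zero_puiseux.rep_eq)
      have "e j \<le> t" using e[OF j] nz unfolding cf_def by (meson not_less)
      hence "wt G (e j) j \<le> wt G t j" by (simp add: wt_def)
      hence "wt G (e i0) i0 \<le> wt G t j" using i0(2)[OF j] by simp
      moreover have "wt G (e i0) i0 \<noteq> wt G t j" using irrational_wt_eq[OF G(2)] nq by metis
      ultimately show "wt G (e i0) i0 < wt G t j" by simp
    qed
    moreover have "cf F i0 (e i0) \<noteq> 0" using e[OF i0(1)] by (simp add: cf_def)
    ultimately show ?thesis by blast
  qed
  show "r \<noteq> 0 \<and> f \<noteq> 0" if "r \<noteq> 0 \<and> (\<exists>q i. s = wt G q i \<and> lead p G f r q i)"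
    using that lead_nz by blast
  show "r = r' \<and> s = s'" if a: "r \<noteq> 0 \<and> (\<exists>q i. s = wt G q i \<and> lead p G f r q i)"
    "r' \<noteq> 0 \<and> (\<exists>q i. s' = wt G q i \<and> lead p G f r' q i)"
  proof -
    obtain q i q' i' where *: "s = wt G q i" "lead p G f r q i" "s' = wt G q' i'" "lead p G f r' q' i'"
      using a by blast
    hence "s = s'" using lead_wt_le[OF *(2,4)] lead_wt_le[OF *(4,2)] a by force
    hence "q = q' \<and> i = i'" using * irrational_wt_eq[OF G(2)] by metis
    thus ?thesis using \<open>s = s'\<close> lead_coeff_eq[OF *(2)] lead_coeff_eq[OF *(4)] by simp
  qed
  show "r * r' \<noteq> 0 \<and> (\<exists>q i. s + s' = wt G q i \<and> lead p G (f * h) (r * r') q i)"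
    if "r \<noteq> 0 \<and> (\<exists>q i. s = wt G q i \<and> lead p G f r q i)" "r' \<noteq> 0 \<and> (\<exists>q i. s' = wt G q i \<and> lead p G h r' q i)"
    using that lead_mult[OF G(1)] by (metis wt_add no_zero_divisors)
  show "r \<noteq> 0 \<and> (\<exists>q i. s = wt G q i \<and> lead p G (f + h) r q i)"
    if "r \<noteq> 0 \<and> (\<exists>q i. s = wt G q i \<and> lead p G f r q i)" "r' \<noteq> 0 \<and> (\<exists>q i. s' = wt G q i \<and> lead p G h r' q i)" "s < s'"
    using that lead_add_gt gauss_ge_imp_gt[OF lead_imp_ge] by metis
  show "r + r' \<noteq> 0 \<and> (\<exists>q i. s = wt G q i \<and> lead p G (f + h) (r + r') q i)"
    if "r \<noteq> 0 \<and> (\<exists>q i. s = wt G q i \<and> lead p G f r q i)" "r' \<noteq> 0 \<and> (\<exists>q i. s = wt G q i \<and> lead p G h r' q i)" "r + r' \<noteq> 0"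
    using that lead_add irrational_wt_eq[OF G(2)] by metis
  show "s < s'" if "r \<noteq> 0 \<and> (\<exists>q i. s = wt G q i \<and> lead p G f r q i)" "- r \<noteq> 0 \<and> (\<exists>q i. s = wt G q i \<and> lead p G h (- r) q i)"
    "r' \<noteq> 0 \<and> (\<exists>q i. s' = wt G q i \<and> lead p G (f + h) r' q i)"
    using that lead_cancel_less irrational_wt_eq[OF G(2)] by metis
  show "c \<noteq> 0 \<and> (\<exists>q' i. rv q = wt G q' i \<and> lead p G (sconst (puiseux_monom c (- q))) c q' i)" if "c \<noteq> 0" for c q
    using that lead_mon[of p G c q 0] by (intro conjI exI[of _ q] exI[of _ 0]) (auto simp: mon_const)
qed

text \<open>A leading constant persists at all later stages, so any two elements can be compared at
  a common stage; there the leading terms have degree 0 and rational weights.\<close>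

lemma chain_leading_forms:
  fixes P :: "nat \<Rightarrow> puiseux" and g :: "nat \<Rightarrow> rat"
  assumes g: "\<And>k. g k < 1"
    and keep: "\<And>k f d s. lead (P k) (rv (g k)) f d s 0 \<Longrightarrow> lead (P (Suc k)) (rv (g (Suc k))) f d s 0"
    and ex: "\<And>f. f \<noteq> 0 \<Longrightarrow> \<exists>k r q. r \<noteq> 0 \<and> lead (P k) (rv (g k)) f r q 0"
  shows "leading_forms (\<lambda>f r s. r \<noteq> 0 \<and> (\<exists>k q. s = rv q \<and> lead (P k) (rv (g k)) f r q 0))"
proof
  have up: "lead (P l) (rv (g l)) f d s 0" if "lead (P k) (rv (g k)) f d s 0" "k \<le> l" for k l f d s
    using that(2,1) by (induction l rule: dec_induct) (auto intro: keep)
  have common: "\<exists>m q q'. s = rv q \<and> lead (P m) (rv (g m)) f r q 0 \<and> s' = rv q' \<and> lead (P m) (rv (g m)) h r' q' 0"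
    if a: "\<exists>k q. s = rv q \<and> lead (P k) (rv (g k)) f r q 0" "\<exists>k q. s' = rv q \<and> lead (P k) (rv (g k)) h r' q 0"
    for s s' f h r r'
  proof -
    obtain k q l q' where "s = rv q" "lead (P k) (rv (g k)) f r q 0" "s' = rv q'" "lead (P l) (rv (g l)) h r' q' 0"
      using a by blast
    thus ?thesis using up[of k f r q "max k l"] up[of l h r' q' "max k l"] by (metis max.cobounded1 max.cobounded2)
  qed
  have g1: "rv (g k) < rv 1" for k using g by simp
  fix f h :: spoly and r r' s s'
  let ?ld = "\<lambda>f r s. r \<noteq> 0 \<and> (\<exists>k q. s = rv q \<and> lead (P k) (rv (g k)) f r q 0)"
  show "\<exists>r s. ?ld f r s" if "f \<noteq> 0" using ex[OF that] by blast
  show "r \<noteq> 0 \<and> f \<noteq> 0" if "?ld f r s" using that lead_nz by blast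
  show "r = r' \<and> s = s'" if a: "?ld f r s" "?ld f r' s'"
  proof -
    obtain m q q' where m: "s = rv q" "lead (P m) (rv (g m)) f r q 0" "s' = rv q'" "lead (P m) (rv (g m)) f r' q' 0"
      using common a by blast
    hence "q = q'" using lead_wt_le[OF m(2,4)] lead_wt_le[OF m(4,2)] a by simp
    thus ?thesis using m lead_coeff_eq[OF m(2)] lead_coeff_eq[OF m(4)] by simp
  qed
  show "?ld (f * h) (r * r') (s + s')" if a: "?ld f r s" "?ld h r' s'"
  proof -
    obtain m q q' where m: "s = rv q" "lead (P m) (rv (g m)) f r q 0" "s' = rv q'" "lead (P m) (rv (g m)) h r' q' 0"
      using common a by blast
    have "lead (P m) (rv (g m)) (f * h) (r * r') (q + q') 0" using lead_mult[OF g1 m(2,4)] by simp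
    moreover have "s + s' = rv (q + q')" by (simp only: m(1,3) rv_add)
    ultimately show ?thesis using a by (metis no_zero_divisors)
  qed
  show "?ld (f + h) r s" if a: "?ld f r s" "?ld h r' s'" "s < s'"
  proof -
    obtain m q q' where m: "s = rv q" "lead (P m) (rv (g m)) f r q 0" "s' = rv q'" "lead (P m) (rv (g m)) h r' q' 0"
      using common a by blast
    hence "lead (P m) (rv (g m)) (f + h) r q 0"
      using lead_add_gt[OF m(2)] gauss_ge_imp_gt[OF lead_imp_ge[OF m(4)]] a(3) by simp
    thus ?thesis using a m by blast
  qed
  show "?ld (f + h) (r + r') s" if a: "?ld f r s" "?ld h r' s" "r + r' \<noteq> 0"
  proof -
    obtain m q q' where m: "s = rv q" "lead (P m) (rv (g m)) f r q 0" "s = rv q'" "lead (P m) (rv (g m)) h r' q' 0"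
      using common a by blast
    hence "q = q'" by simp
    thus ?thesis using lead_add[OF m(2)] m a(3) by blast
  qed
  show "s < s'" if a: "?ld f r s" "?ld h (- r) s" "?ld (f + h) r' s'"
  proof -
    obtain k q q' where m: "s = rv q" "lead (P k) (rv (g k)) f r q 0" "s = rv q'" "lead (P k) (rv (g k)) h (- r) q' 0"
      using common a by blast
    obtain l t where l: "s' = rv t" "lead (P l) (rv (g l)) (f + h) r' t 0" using a by blast
    let ?m = "max k l"
    have "q = q'" using m by simp
    hence "wt (rv (g ?m)) q 0 < wt (rv (g ?m)) t 0"
      using up[OF m(2), of ?m] up[OF m(4), of ?m] up[OF l(2), of ?m] a(3) by (intro lead_cancel_less) auto
    thus ?thesis using m l by simp
  qed
  show "?ld (sconst (puiseux_monom c (- q))) c (rv q)" if "c \<noteq> 0" for c q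
    using that lead_mon[of "P 0" "rv (g 0)" c q 0] by (auto simp: mon_const)
qed

lemma lead_sconst_ex:
  assumes "c \<noteq> 0"
  shows "\<exists>r q. r \<noteq> 0 \<and> lead p g (sconst c) r q 0"
proof -
  obtain e where e: "pcoeff c e \<noteq> 0" "\<forall>s<e. pcoeff c s = 0" using assms by (rule puiseux_lead)
  have "gauss_gt p g (rv e) (sconst (c - puiseux_monom (pcoeff c e) (- e)))"
  proof (rule gauss_gt_sconst)
    fix s assume "pcoeff (c - puiseux_monom (pcoeff c e) (- e)) s \<noteq> 0"
    hence "s \<noteq> e" "pcoeff c s \<noteq> 0" by (auto simp: minus_puiseux.rep_eq puiseux_monom.rep_eq split: if_splits)
    thus "rv e < rv s" using e(2) by (metis linorder_neqE rv_less_iff)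
  qed
  hence "lead p g (sconst c) (pcoeff c e) e 0" by (simp add: lead_def mon_const sconst_diff)
  thus ?thesis using e(1) by blast
qed

lemma dy_degree:
  assumes "degree (poly_of f) > 0"
  shows "dy f \<noteq> 0" "degree (poly_of (dy f)) < degree (poly_of f)"
proof -
  let ?d = "degree (poly_of f)"
  have "scoeff f ?d \<noteq> 0" using assms by (auto simp: scoeff_def)
  then obtain e where "pcoeff (scoeff f ?d) e \<noteq> 0" by (rule puiseux_lead)
  hence "cf f ?d e \<noteq> 0" by (simp add: cf_def)
  hence "cf (dy f) (?d - 1) e \<noteq> 0" using assms by (simp add: cf_dy del: of_nat_Suc)
  thus "dy f \<noteq> 0" by auto
  have "degree (poly_of (dy f)) \<le> ?d - 1"
  proof (rule degree_le, intro allI impI)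
    fix i assume "?d - 1 < i"
    hence "scoeff f (Suc i) = 0" by (simp add: scoeff_def coeff_eq_0)
    hence "scoeff (dy f) i = 0" by (simp add: scoeff_dy)
    thus "coeff (poly_of (dy f)) i = 0" by (simp add: scoeff_def)
  qed
  thus "degree (poly_of (dy f)) < ?d" using assms by simp
qed

text \<open>
  If \<open>dy f\<close> has a leading constant from some stage on but \<open>f\<close> never does, then \<open>f\<close> is linear at
  all later stages with a zero agreeing with all \<open>P k\<close>; its bounded ramification excludes this.
\<close>

lemma chain_lead_ex:
  fixes P :: "nat \<Rightarrow> puiseux" and g G :: "nat \<Rightarrow> rat" and n :: "nat \<Rightarrow> nat"
  assumes g: "\<And>k. g k < 1" "\<And>k. g k < G k" "\<And>k. G k < g (Suc k)" and n: "\<And>k. n k > 0" "\<And>k. P k \<in> ramified (n k)"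
    and keep: "\<And>k f d s. lead (P k) (rv (g k)) f d s 0 \<Longrightarrow> lead (P (Suc k)) (rv (g (Suc k))) f d s 0"
    and diff: "\<And>k s. pcoeff (P (Suc k) - P k) s \<noteq> 0 \<Longrightarrow> G k \<le> s" "\<And>k. pcoeff (P (Suc k) - P k) (G k) \<noteq> 0"
    and div: "\<And>k M. n k dvd M \<Longrightarrow> of_nat M * G k \<in> \<int> \<Longrightarrow> n (Suc k) dvd M"
    and f: "f \<noteq> 0"
  shows "\<exists>k r q. r \<noteq> 0 \<and> lead (P k) (rv (g k)) f r q 0"
  using f
proof (induction "degree (poly_of f)" arbitrary: f rule: less_induct)
  case less
  show ?case
  proof (cases "degree (poly_of f) > 0")
    case False
    hence "f = sconst (scoeff f 0)"
      by (intro scoeff_eqI) (simp add: scoeff_sconst, simp add: scoeff_def coeff_eq_0)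
    moreover from this have "scoeff f 0 \<noteq> 0" using less.prems by (metis sconst_0)
    ultimately show ?thesis using lead_sconst_ex by metis
  next
    case True
    show ?thesis
    proof (rule ccontr)
      assume no: "\<not> ?thesis"
      obtain k0 r \<kappa> where r: "r \<noteq> 0" and d0: "lead (P k0) (rv (g k0)) (dy f) r \<kappa> 0"
        using less.hyps[OF dy_degree(2)[OF True] dy_degree(1)[OF True]] by blast
      have d: "lead (P k) (rv (g k)) (dy f) r \<kappa> 0" if "k0 \<le> k" for k
        using that d0 by (induction k rule: dec_induct) (auto intro: keep)
      have G1: "G k < 1" for k using g(3)[of k] g(1)[of "Suc k"] by simp
      \<comment> \<open>Otherwise the first term of the constant coefficient would lead f at stage
        k, since the terms of positive degree weigh at least \<kappa> + g k.\<close>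
      have ge: "\<kappa> + g k \<le> q" if k: "k0 \<le> k" and q: "cf (shift (P k) f) 0 q \<noteq> 0" for k q
      proof (rule ccontr)
        assume less: "\<not> \<kappa> + g k \<le> q"
        let ?c = "scoeff (shift (P k) f) 0"
        have "?c \<noteq> 0" using q by (auto simp: cf_def zero_puiseux.rep_eq)
        then obtain e where e: "pcoeff ?c e \<noteq> 0" "\<forall>s<e. pcoeff ?c s = 0" by (rule puiseux_lead)
        have "e \<le> q" using e(2) q by (metis cf_def not_less)
        hence ek: "e < \<kappa> + g k" using less by simp
        have "lead (P k) (rv (g k)) f (pcoeff ?c e) e 0"
          unfolding lead_def gauss_gt_def
        proof (intro allI impI)
          fix i s assume a: "cf (shift (P k) (f - mon (P k) (pcoeff ?c e) e 0)) i s \<noteq> 0"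
          show "wt (rv (g k)) e 0 < wt (rv (g k)) s i"
          proof (cases i)
            case 0
            hence "s \<noteq> e" "pcoeff ?c s \<noteq> 0"
              using a by (auto simp: shift_diff cf_shift_mon cf_def[of "shift (P k) f"] split: if_splits)
            hence "e < s" using e(2) by (metis linorder_neqE)
            thus ?thesis using 0 by simp
          next
            case (Suc j)
            hence "cf (shift (P k) (dy f)) j s \<noteq> 0"
              using a by (auto simp: shift_diff cf_shift_mon shift_dy cf_dy simp del: of_nat_Suc)
            hence "\<kappa> \<le> s + of_nat j * g k" using gauss_geD[OF lead_imp_ge[OF d[OF k]]] by (fastforce simp: wt_rv)
            thus ?thesis using ek Suc by (simp add: wt_rv algebra_simps)
          qed
        qed
        thus False using no e(1) by blast
      qed
      \<comment> \<open>Moving the centre from \<open>P k\<close> to \<open>P (Suc k)\<close>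
        changes the constant coefficient at \<kappa> + G k by r times the coefficient of the
        difference at G k, which is not 0. At the next stage the new coefficient vanishes by
        \<open>ge\<close>, because G k < \<open>g (Suc k)\<close>; so the old one does not.\<close>
      have nz: "cf (shift (P k) f) 0 (\<kappa> + G k) \<noteq> 0" if k: "k0 \<le> k" for k
      proof -
        let ?P = "P k" and ?P' = "P (Suc k)" and ?c = "sconst (scoeff (shift (P k) f) 0)"
        let ?t = "\<kappa> + G k"
        have dG: "lead ?P (rv (G k)) (dy (f - ?c)) r \<kappa> 0"
          using lead_change[OF _ _ _ d[OF k], of ?P "rv (G k)"] g(1,2)[of k] by (auto simp: dy_diff zero_puiseux.rep_eq)
        have "lead ?P (rv (G k)) (f - ?c) r \<kappa> 1"
          by (rule lead_of_dy[OF dG]) (auto simp: shift_diff cf_def scoeff_sconst zero_puiseux.rep_eq)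
        hence "gauss_gt ?P (rv (G k)) (rv ?t) (f - ?c - mon ?P r \<kappa> 1)" by (simp add: lead_def wt_rv)
        hence gt: "gauss_gt ?P' (rv (G k)) (rv ?t) (f - ?c - mon ?P r \<kappa> 1)"
          by (rule gauss_gt_change[rotated 3]) (use diff(1) G1[of k] in auto)
        have m: "mon ?P r \<kappa> 1 = mon ?P' r \<kappa> 1 + sconst (puiseux_monom r (- \<kappa>) * (?P' - ?P))"
          by (simp add: mon_def sconst_mult sconst_diff right_diff_distrib)
        have "f = ?c + (f - ?c - mon ?P r \<kappa> 1) + mon ?P' r \<kappa> 1 + sconst (puiseux_monom r (- \<kappa>) * (?P' - ?P))"
          using m by simp
        hence "cf (shift ?P' f) 0 ?t = cf (shift ?P' (?c + (f - ?c - mon ?P r \<kappa> 1) + mon ?P' r \<kappa> 1 + sconst (puiseux_monom r (- \<kappa>) * (?P' - ?P)))) 0 ?t"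
          by (rule arg_cong)
        also have "\<dots> = cf (shift ?P f) 0 ?t + cf (shift ?P' (f - ?c - mon ?P r \<kappa> 1)) 0 ?t + r * pcoeff (?P' - ?P) (G k)"
          by (simp only: shift_add cf_add shift_sconst cf_sconst cf_shift_mon pcoeff_monom_mult) (simp add: cf_def)
        also have "cf (shift ?P' (f - ?c - mon ?P r \<kappa> 1)) 0 ?t = 0"
          using gauss_gtD[OF gt, of 0 ?t] by (auto simp del: shift_diff)
        finally have "cf (shift ?P' f) 0 ?t = cf (shift ?P f) 0 ?t + r * pcoeff (?P' - ?P) (G k)" by simp
        moreover have "cf (shift ?P' f) 0 ?t = 0" using ge[of "Suc k" ?t] k g(3)[of k] by force
        ultimately show ?thesis using r diff(2)[of k] by auto
      qed
      obtain m where m: "m > 0" "f \<in> skew_over (ramified m)" by (rule spoly_ramified)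
      \<comment> \<open>A common denominator for f and \<open>P k0\<close>. Through
        \<open>nz\<close> it clears G k as well, and then \<open>n (Suc k)\<close> divides it, so by
        induction all denominators from stage k0 on divide M.\<close>
      define M where "M = m * n k0"
      have M0: "M > 0" using m n by (simp add: M_def)
      have fM: "f \<in> skew_over (ramified M)" using m(2) ramified_mono[of m M] by (auto simp: M_def skew_over_def)
      have GM: "of_nat M * G k \<in> \<int>" if k: "k0 \<le> k" and nM: "n k dvd M" for k
      proof -
        have P: "P k \<in> ramified M" using n(2) ramified_mono[OF nM] by blast
        have int: "q * of_nat M \<in> \<int>" if "cf (shift (P k) h) i q \<noteq> 0" "h \<in> skew_over (ramified M)" for h i q
          using shift_skew_over[OF dsubring_ramified P that(2)] that(1) by (auto simp: skew_over_def ramified_def cf_def)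
        have "\<kappa> * of_nat M \<in> \<int>"
          using int[OF _ dy_skew_over[OF dsubring_ramified fM], of 0 \<kappa>] lead_coeff_eq[OF d[OF k]] r by simp
        from Ints_diff[OF int[OF nz[OF k] fM] this] show ?thesis by (simp add: algebra_simps)
      qed
      have nM: "n k dvd M" if "k0 \<le> k" for k
        using that
      proof (induction k rule: dec_induct)
        case base
        show ?case by (simp add: M_def)
      next
        case (step k)
        show ?case by (rule div[OF step.IH GM[OF step.hyps(1) step.IH]])
      qed
      \<comment> \<open>The numbers M G k are strictly increasing integers for k \<ge> k0 and yet
        stay below M, which is the contradiction.\<close>
      have step: "of_nat M * G k + 1 \<le> of_nat M * G (Suc k)" if k: "k0 \<le> k" for k
      proof -
        have "G k < G (Suc k)" using g(3)[of k] g(2)[of "Suc k"] by simp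
        hence "of_nat M * G k < of_nat M * G (Suc k)" using M0 by simp
        moreover obtain a b where "of_nat M * G k = of_int a" "of_nat M * G (Suc k) = of_int b"
          using GM[OF k nM[OF k]] GM[of "Suc k"] nM[of "Suc k"] k by (metis Ints_cases le_SucI)
        ultimately show ?thesis by simp
      qed
      have grow: "of_nat M * G k0 + of_nat j \<le> of_nat M * G (k0 + j)" for j
      proof (induction j)
        case (Suc j)
        thus ?case using step[of "k0 + j"] by simp
      qed simp
      obtain j :: nat where "of_nat M - of_nat M * G k0 \<le> of_nat j" using real_arch_simple by blast
      hence "of_nat M \<le> of_nat M * G (k0 + j)" using grow[of j] by linarith
      moreover have "of_nat M * G (k0 + j) < of_nat M * 1" using M0 G1 by (intro mult_strict_left_mono) auto
      ultimately show False by simp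
    qed
  qed
qed

section \<open>Existence and uniqueness of the extension\<close>

context leading_forms
begin

lemma w_0: "w 0 = Infty"
  by (simp add: w_def)

lemma H_one: "infty_zero H = w 1"
  by (simp add: w_def H_simps W_1)

lemma less_zero_iff: "infty_less H (infty_zero H) (w a) \<longleftrightarrow> a = 0 \<or> W a > 0"
  unfolding H_one infty_less_def w_le by (auto simp: w_def W_1 fibre_inj[of 1 a, unfolded W_1] order_le_less)

lemma W_uminus: "a \<noteq> 0 \<Longrightarrow> W (- a) = W a"
  using W_mult[of "real_const (- 1)" a] W_real[of "- 1"] by (simp add: real_const_uminus)

definition pos :: "weyl_ext \<Rightarrow> bool" where
  "pos a \<longleftrightarrow> a = 0 \<or> W a > 0"

lemma pos_add: "pos a \<Longrightarrow> pos b \<Longrightarrow> pos (a + b)"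
  using W_add[of a b] by (cases "a = 0 \<or> b = 0 \<or> a + b = 0") (auto simp: pos_def min_def split: if_splits)

lemma pos_uminus: "pos a \<Longrightarrow> pos (- a)"
  using W_uminus[of a] by (cases "a = 0") (auto simp: pos_def)

lemma pos_real: "pos (real_const r) \<Longrightarrow> r = 0"
  using W_real[of r] by (cases "r = 0") (auto simp: pos_def)

lemma pos_residue: "a = 0 \<or> W a \<ge> 0 \<Longrightarrow> \<exists>r. pos (a - real_const r)"
proof -
  assume a: "a = 0 \<or> W a \<ge> 0"
  consider "pos a" | "a \<noteq> 0" "W a = 0" using a by (auto simp: pos_def order_le_less)
  thus ?thesis
  proof cases
    case 1
    thus ?thesis by (intro exI[of _ 0]) simp
  next
    case 2
    then obtain r where "a = real_const r \<or> W (a - real_const r) > 0" using W_residue by blast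
    thus ?thesis by (intro exI[of _ r]) (auto simp: pos_def)
  qed
qed

lemma w_residue_field:
  assumes real: "\<And>r. real_const r \<in> K"
  shows "residue_field_real K H w"
proof -
  have ring: "a \<in> valuation_ring K H w \<longleftrightarrow> a \<in> K \<and> (a = 0 \<or> W a \<ge> 0)" for a
    unfolding valuation_ring_def H_one using w_le[of 1 a] by (simp add: W_1)
  have cl: "b \<in> residue_class K H w a \<longleftrightarrow> b \<in> K \<and> (b = 0 \<or> W b \<ge> 0) \<and> pos (b - a)" for a b
    by (simp add: residue_class_def ring less_zero_iff pos_def)
  have rr: "real_const r \<in> valuation_ring K H w" for r
    unfolding ring using real[of r] W_real[of r] by (cases "r = 0") auto
  have eq: "residue_class K H w a = residue_class K H w b" if "pos (a - b)" for a b
  proof (rule Set.set_eqI)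
    fix c
    have "pos (c - a) \<longleftrightarrow> pos (c - b)"
      using pos_add[OF _ that, of "c - a"] pos_add[OF _ pos_uminus[OF that], of "c - b"] by auto
    thus "c \<in> residue_class K H w a \<longleftrightarrow> c \<in> residue_class K H w b" by (simp add: cl)
  qed
  show ?thesis
    unfolding residue_field_real_def bij_betw_def
  proof (intro conjI allI impI)
    show "w (real_const r) = infty_zero H" if "r \<noteq> 0" for r
      unfolding H_one using that W_real[of r] by (simp add: w_def W_1)
    show "inj (\<lambda>r. residue_class K H w (real_const r))"
    proof (rule injI)
      fix r r' assume e: "residue_class K H w (real_const r) = residue_class K H w (real_const r')"
      have "real_const r \<in> residue_class K H w (real_const r)" using rr[of r] by (simp add: cl ring pos_def)
      hence "pos (real_const (r - r'))" unfolding e cl by (simp add: real_const_diff)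
      thus "r = r'" using pos_real by fastforce
    qed
    show "range (\<lambda>r. residue_class K H w (real_const r)) = residue_class K H w ` valuation_ring K H w"
    proof (intro equalityI subsetI)
      fix X assume "X \<in> residue_class K H w ` valuation_ring K H w"
      then obtain a where a: "X = residue_class K H w a" "a \<in> valuation_ring K H w" by blast
      then obtain r where "pos (a - real_const r)" using pos_residue ring by blast
      thus "X \<in> range (\<lambda>r. residue_class K H w (real_const r))" unfolding a(1) using eq by blast
    qed (use rr in auto)
  qed
qed

lemma w_x_neg: "infty_less H (w weyl_x) (infty_zero H)"
proof -
  have "ld (sconst (puiseux_monom 1 (- (- 1)))) 1 (rv (- 1))" by (rule ld_monom) simp
  hence "W (to_quot (sconst (puiseux_monom 1 1))) = rv (- 1)" using W_to_quot by simp
  hence x: "W weyl_x = rv (- 1)" by (simp add: to_quot_monom weyl_x_def)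
  have "rv (- 1) < rv 0" by (simp only: rv_less_iff)
  hence less: "W weyl_x < W 1" unfolding x W_1 by simp
  hence "infty_le H (w weyl_x) (w 1)" by (simp add: w_le)
  moreover have "w weyl_x \<noteq> w 1" using less fibre_inj[of weyl_x 1] by (auto simp: w_def)
  ultimately show ?thesis by (simp add: H_one infty_less_def)
qed

lemma w_valuation_K: "valuation K H w"
  using w_valuation unfolding valuation_def by blast

text \<open>Whether a quotient has value at least 0 is decided by its numerator and denominator. The
  set A is \<open>wl\<close> for the agreement with v, and all skew polynomials for the agreement
  with any other extension.\<close>

lemma w_agree:
  assumes d: "dominance K le'" and A: "\<And>f. f \<in> A \<Longrightarrow> to_quot f \<in> K"
    and less: "\<And>f h r r' s s'. f \<in> A \<Longrightarrow> h \<in> A \<Longrightarrow> ld h r s \<Longrightarrow> ld f r' s' \<Longrightarrow> s < s' \<Longrightarrow> \<not> le' (to_quot f) (to_quot h)"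
    and eq: "\<And>f h r r' s. f \<in> A \<Longrightarrow> h \<in> A \<Longrightarrow> ld h r s \<Longrightarrow> ld f r' s \<Longrightarrow> le' (to_quot h) (to_quot f)"
    and a: "a = to_quot f / to_quot h" "f \<in> A" "h \<in> A" "h \<noteq> 0"
  shows "le' 1 a \<longleftrightarrow> infty_le H (w 1) (w a)"
proof -
  interpret D: dominance K le' by fact
  show ?thesis
  proof (cases "f = 0")
    case True
    thus ?thesis using a D.vle_0[OF D.K_1] by (simp add: w_0)
  next
    case False
    have nz: "to_quot f \<noteq> 0" "to_quot h \<noteq> 0" "a \<noteq> 0" using a False by (auto simp: divide_inverse)
    have aK: "a \<in> K" unfolding a divide_inverse using A a D.K_mult D.K_inverse by blast
    have ah: "a * to_quot h = to_quot f" using nz unfolding a(1) divide_inverse mult.assoc by simp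
    have 1: "le' 1 a \<longleftrightarrow> le' (to_quot h) (to_quot f)"
      using D.vle_cancel_right[OF D.K_1 aK A[OF a(3)] nz(2)] ah by simp
    obtain r s r' s' where ld: "ld h r s" "ld f r' s'" using ld_ex a(4) False by blast
    have W: "W a + s = s'" using W_mult[OF nz(3,2)] ah W_to_quot[OF ld(1)] W_to_quot[OF ld(2)] by simp
    have "infty_le H (w 1) (w a) \<longleftrightarrow> 0 \<le> W a" using nz by (simp add: w_le W_1)
    also have "\<dots> \<longleftrightarrow> s \<le> s'" using W by auto
    also have "\<dots> \<longleftrightarrow> le' (to_quot h) (to_quot f)"
    proof (cases s s' rule: linorder_cases)
      case less
      hence "\<not> le' (to_quot f) (to_quot h)" using assms(3)[OF a(2,3) ld] by blast
      hence "le' (to_quot h) (to_quot f)" using D.vle_total[OF A[OF a(2)] A[OF a(3)]] by blast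
      thus ?thesis using less by simp
    next
      case equal
      thus ?thesis using eq[OF a(2,3) ld(1)] ld(2) by simp
    next
      case greater
      thus ?thesis using assms(3)[OF a(3,2) ld(2,1)] by simp
    qed
    finally show ?thesis using 1 by simp
  qed
qed

end

context gamma_data
begin

text \<open>One family of leading forms answers both questions: its order agrees with v on
  \<open>wl\<close>, which gives the extension, and with every \<open>ext\<close> relation on all
  skew polynomials, which gives uniqueness up to equivalence.\<close>

lemma extension_exists:
  fixes ld :: "spoly \<Rightarrow> real \<Rightarrow> real poly \<Rightarrow> bool"
  assumes lf: "leading_forms ld"
    and wl_less: "\<And>f h r r' s s'. f \<in> wl \<Longrightarrow> h \<in> wl \<Longrightarrow> ld h r s \<Longrightarrow> ld f r' s' \<Longrightarrow> s < s' \<Longrightarrow> vlt (to_quot h) (to_quot f)"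
    and wl_eq: "\<And>f h r r' s. f \<in> wl \<Longrightarrow> h \<in> wl \<Longrightarrow> ld h r s \<Longrightarrow> ld f r' s \<Longrightarrow> vle (to_quot h) (to_quot f)"
    and om: "\<And>i. i \<ge> 1 \<Longrightarrow> adm i \<Longrightarrow> ld (om i) (\<gamma> i) (rv (vom i))"
    and ext_less: "\<And>vle' f h r r' s s'. ext vle' \<Longrightarrow> ld h r s \<Longrightarrow> ld f r' s' \<Longrightarrow> s < s' \<Longrightarrow> \<not> vle' (to_quot f) (to_quot h)"
    and ext_eq: "\<And>vle' f h r r' s. ext vle' \<Longrightarrow> ld h r s \<Longrightarrow> ld f r' s \<Longrightarrow> vle' (to_quot h) (to_quot f)"
  shows "\<exists>(H :: weyl_ext set ordered_group) w. gamma_extension \<Gamma> v \<gamma> H w \<and>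
    (\<forall>(H' :: 'h ordered_group) w'. gamma_extension \<Gamma> v \<gamma> H' w' \<longrightarrow> equivalent_valuations UNIV H w H' w')"
proof -
  interpret L: leading_forms ld by fact
  have LU: "real_valuation UNIV L.H L.w"
    by (intro real_valuation_UNIV_I L.w_valuation L.w_x_neg L.w_residue_field) simp
  interpret LK: weyl_valuation L.H L.w
    by (intro weyl_valuationI L.w_valuation_K L.w_x_neg L.w_residue_field weyl_quot_real)
  interpret LU: real_valuation UNIV L.H L.w by (rule LU)
  have om': "omega \<Gamma> v i = to_quot (om i)" if "adm i" for i
    using that adm_mono[of i "i - 1"] by (intro omega_om) simp
  have xom: "x_pow (of_int (seq_m \<Gamma> v i) / of_int (seq_n \<Gamma> v i)) * omega \<Gamma> v i = x_pow (vom i) * to_quot (om i)"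
    if "adm i" for i using om'[OF that] by (simp add: vom_def)
  have "equivalent_valuations weyl_quot \<Gamma> v L.H L.w"
  proof (rule equivalent_valuationsI)
    show "real_valuation weyl_quot \<Gamma> v" by (rule real_valuation_axioms)
    show "real_valuation weyl_quot L.H L.w" by (rule LK.real_valuation_axioms)
    fix a assume "a \<in> weyl_quot"
    then obtain f h where a: "a = to_quot f / to_quot h" "f \<in> wp" "h \<in> wp" "h \<noteq> 0"
      unfolding weyl_quot_eq wp_def by blast
    hence fh: "f \<in> wl" "h \<in> wl" using wp_wl by auto
    show "vle 1 a \<longleftrightarrow> infty_le L.H (L.w 1) (L.w a)"
      by (rule L.w_agree[OF dominance_axioms, of wl, OF wl_K wl_less wl_eq a(1) fh a(4)])
  qed
  moreover have "residue UNIV L.H L.w (x_pow (vom i) * to_quot (om i)) = \<gamma> i" if i: "i \<ge> 1" "adm i" for i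
  proof (rule LU.residue_eqI)
    let ?A = "sconst (puiseux_monom 1 (- (- vom i))) * om i" and ?B = "sconst (puiseux_monom (- \<gamma> i) (- 0))"
    have A: "ld ?A (1 * \<gamma> i) (rv (- vom i) + rv (vom i))" by (intro L.ld_mult L.ld_monom om i) simp
    hence A: "ld ?A (\<gamma> i) 0" by (simp add: rv_minus)
    have "\<gamma> i \<noteq> 0" using adm_value(3) i by blast
    hence B: "ld ?B (- \<gamma> i) 0" using L.ld_monom[of "- \<gamma> i" 0] by simp
    have e: "x_pow (vom i) * to_quot (om i) - real_const (\<gamma> i) = to_quot (?A + ?B)"
      by (simp add: to_quot_add to_quot_mult to_quot_monom real_const_uminus)
    have "?A + ?B = 0 \<or> L.W (to_quot (?A + ?B)) > 0"
    proof (cases "?A + ?B = 0")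
      case False
      then obtain r s where "ld (?A + ?B) r s" using L.ld_ex by blast
      thus ?thesis using L.ld_cancel[OF A B] L.W_to_quot by simp
    qed simp
    thus "\<not> infty_le L.H (L.w (x_pow (vom i) * to_quot (om i) - real_const (\<gamma> i))) (L.w 1)"
      unfolding e L.w_le by (auto simp: L.W_1)
  qed simp
  ultimately have "gamma_extension \<Gamma> v \<gamma> L.H L.w"
    unfolding gamma_extension_def using LU.val LU.residue_real xom by simp
  moreover have "equivalent_valuations UNIV L.H L.w H' w'" if g: "gamma_extension \<Gamma> v \<gamma> H' w'"
    for H' :: "'h ordered_group" and w'
  proof -
    have g': "valuation UNIV H' w'" "residue_field_real UNIV H' w'" "equivalent_valuations weyl_quot \<Gamma> v H' w'"
      "\<And>i. i \<ge> 1 \<Longrightarrow> adm i \<Longrightarrow> residue UNIV H' w' (x_pow (vom i) * to_quot (om i)) = \<gamma> i"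
      using g xom unfolding gamma_extension_def by auto
    have agree: "infty_le H' (w' a) (w' b) \<longleftrightarrow> vle a b" if "a \<in> weyl_quot" "b \<in> weyl_quot" for a b
      using equivalent_valuations_le[OF g'(3) that] by simp
    have one: "w' 1 = infty_zero H'" using g'(2) real_const_1 unfolding residue_field_real_def by (metis zero_neq_one)
    have x: "infty_le H' (w' weyl_x) (w' 1)" "\<not> infty_le H' (w' 1) (w' weyl_x)"
      using agree[OF weyl_quot_x K_1] agree[OF K_1 weyl_quot_x] vle_x vle_total[OF K_x K_1] by blast+
    hence "infty_less H' (w' weyl_x) (infty_zero H')" unfolding infty_less_def one[symmetric] by metis
    then interpret R: real_valuation UNIV H' w' by (intro real_valuation_UNIV_I g')
    interpret E: full_dominance R.vle by (intro full_dominance.intro R.dominance_axioms)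
    have "R.sim (to_quot (om i)) (real_const (\<gamma> i) * x_pow (- vom i))" if i: "i \<ge> 1" "adm i" for i
    proof -
      have "R.veq (to_quot (om i)) (vom i)"
        using agree_transfer(2)[OF E.full_dominance_axioms agree om_K] adm_value(1)[OF i(2)] by blast
      from R.veq_mult[OF E.veq_x_pow_rat this, of "vom i"] have "R.veq (x_pow (vom i) * to_quot (om i)) 0" by simp
      from R.sim_residue[OF UNIV_I R.veq_imp_veqv[OF R.veq_1 this]] g'(4)[OF i]
      have "R.sim (x_pow (vom i) * to_quot (om i)) (real_const (\<gamma> i))" by simp
      from R.sim_mult[OF R.sim_refl[OF UNIV_I x_pow_nz] this]
      have "R.sim (x_pow (- vom i) * (x_pow (vom i) * to_quot (om i))) (x_pow (- vom i) * real_const (\<gamma> i))" .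
      moreover have "x_pow (- vom i) * (x_pow (vom i) * to_quot (om i)) = to_quot (om i)"
        by (simp add: mult.assoc[symmetric] x_pow_mult)
      ultimately show ?thesis by (simp add: real_const_comm)
    qed
    hence ext: "ext R.vle" unfolding ext_def using agree E.full_dominance_axioms by blast
    show ?thesis
    proof (rule equivalent_valuationsI[OF LU R.real_valuation_axioms])
      fix a :: weyl_ext
      obtain f h where a: "a = to_quot f / to_quot h" "h \<noteq> 0" using ore_quot_eq_quotient[of a] by blast
      have "R.vle 1 a \<longleftrightarrow> infty_le L.H (L.w 1) (L.w a)"
        by (rule L.w_agree[OF R.dominance_axioms, of UNIV, OF UNIV_I ext_less[OF ext] ext_eq[OF ext] a(1) UNIV_I UNIV_I a(2)])
      thus "infty_le L.H (L.w 1) (L.w a) \<longleftrightarrow> R.vle 1 a" by simp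
    qed
  qed
  ultimately show ?thesis by blast
qed

lemma terminal_extension:
  assumes "terminal p G"
  shows "\<exists>(H :: weyl_ext set ordered_group) w. gamma_extension \<Gamma> v \<gamma> H w \<and>
    (\<forall>(H' :: 'h ordered_group) w'. gamma_extension \<Gamma> v \<gamma> H' w' \<longrightarrow> equivalent_valuations UNIV H w H' w')"
proof -
  have G: "G < rv 1" "\<And>t. rv t \<noteq> G" and compat: "compat p G"
    and cut: "\<And>vle'. ext vle' \<Longrightarrow> weyl_dominance.cut UNIV vle' (y_minus p) G"
    and om: "\<And>i. i \<ge> 1 \<Longrightarrow> adm i \<Longrightarrow> lead p G (om i) (\<gamma> i) (vom i) 0"
    using assms by (auto simp: terminal_def)
  let ?ld = "\<lambda>f r s. r \<noteq> 0 \<and> (\<exists>q i. s = wt G q i \<and> lead p G f r q i)"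
  show ?thesis
  proof (rule extension_exists[of ?ld, OF gauss_leading_forms[OF G]])
    have gt: "gauss_gt p G s f" if "?ld f r s'" "s < s'" for f r s s'
      using that lead_imp_ge gauss_ge_imp_gt by metis
    show "vlt (to_quot h) (to_quot f)" if "f \<in> wl" "h \<in> wl" "?ld h r s" "?ld f r' s'" "s < s'" for f h r r' s s'
      using compat gt[OF that(4,5)] that unfolding compat_def by blast
    show "vle (to_quot h) (to_quot f)" if fh: "f \<in> wl" "h \<in> wl" "?ld h r s" "?ld f r' s" for f h r r' s
    proof -
      obtain q i where h: "s = wt G q i" "lead p G h r q i" "r \<noteq> 0" using fh by blast
      obtain q' i' where f: "s = wt G q' i'" "lead p G f r' q' i'" using fh by blast
      \<comment> \<open>Equal weights mean equal positions as G is irrational, so a real multiple of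
        h has the same leading term as f; the difference is larger by \<open>compat\<close>.\<close>
      have e: "q' = q" "i' = i" using irrational_wt_eq[OF G(2)] h f by metis+
      let ?c = "sconst (puiseux_monom (r' / r) 0)"
      have "lead p G (?c * h) r' q i" using lead_sconst_mult[OF G(1) h(2), of "r' / r" 0] h(3) by simp
      hence "gauss_gt p G (wt G q i) (f - ?c * h)"
        using lead_diff[OF f(2)[unfolded e]] lead_0_iff[of p G _ q i] by fastforce
      moreover have "f - ?c * h \<in> wl" using fh wl_real by (intro wl_closed)
      ultimately have "vlt (to_quot h) (to_quot (f - ?c * h))" using compat fh(2) h unfolding compat_def by blast
      hence "vle (to_quot h) (to_quot (f - ?c * h))" using vlt_imp_vle wl_K fh \<open>f - ?c * h \<in> wl\<close> by blast
      moreover have "vle (to_quot h) (real_const (r' / r) * to_quot h)"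
        using vle_real_mult[OF wl_K wl_K vle_refl[OF wl_K]] fh(2) by blast
      ultimately have "vle (to_quot h) (to_quot (f - ?c * h) + real_const (r' / r) * to_quot h)"
        using fh wl_K \<open>f - ?c * h \<in> wl\<close> K_real K_mult by (intro vle_add) auto
      thus ?thesis by (simp add: to_quot_diff to_quot_mult to_quot_real)
    qed
    show "?ld (om i) (\<gamma> i) (rv (vom i))" if "i \<ge> 1" "adm i" for i
      using om[OF that] adm_value(3)[OF that(2)] by (metis wt_0)
    fix vle' f h r r' s s' assume e: "ext vle'" and h: "?ld h r s"
    interpret E: full_dominance vle' using e by (simp add: ext_def)
    obtain q i where h: "s = wt G q i" "lead p G h r q i" "r \<noteq> 0" using h by blast
    let ?M = "x_pow (- q) * y_minus p ^ i"
    have hM: "E.veqv (to_quot h) ?M"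
      using E.sim_veqv[OF E.cut_sim[OF cut[OF e] h(2,3)]] E.veqv_real_mult[OF UNIV_I h(3)] E.vle_trans[OF UNIV_I UNIV_I UNIV_I] by blast
    show "\<not> vle' (to_quot f) (to_quot h)" if "?ld f r' s'" "s < s'"
    proof -
      have "E.vlt ?M (to_quot f)" using E.cut_vlt[OF cut[OF e]] gt[OF that] h(1) by blast
      thus ?thesis using hM E.vle_trans[OF UNIV_I UNIV_I UNIV_I] by blast
    qed
    show "vle' (to_quot h) (to_quot f)" if f: "?ld f r' s"
    proof -
      obtain q' i' where f: "s = wt G q' i'" "lead p G f r' q' i'" "r' \<noteq> 0" using f by blast
      have e': "q' = q" "i' = i" using irrational_wt_eq[OF G(2)] h f by metis+
      have "E.veqv (to_quot f) ?M"
        using E.sim_veqv[OF E.cut_sim[OF cut[OF e] f(2,3)[unfolded e']]] E.veqv_real_mult[OF UNIV_I f(3)] E.vle_trans[OF UNIV_I UNIV_I UNIV_I] by blast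
      thus ?thesis using hM E.vle_trans[OF UNIV_I UNIV_I UNIV_I] by blast
    qed
  qed
qed

lemma infinite_extension:
  assumes no: "\<And>p G. \<not> terminal p G"
  shows "\<exists>(H :: weyl_ext set ordered_group) w. gamma_extension \<Gamma> v \<gamma> H w \<and>
    (\<forall>(H' :: 'h ordered_group) w'. gamma_extension \<Gamma> v \<gamma> H' w' \<longrightarrow> equivalent_valuations UNIV H w H' w')"
proof -
  have start: "\<exists>q. vge weyl_y q" using initial_terminal no by metis
  define Inv where "Inv j x = (case x of (n, p, g, a, r, c) \<Rightarrow> inv_stage (Suc j) n p g a r c)"
    for j and x :: "nat \<times> puiseux \<times> rat \<times> spoly \<times> real \<times> rat"
  define Q where "Q j x y = (case x of (n, p, g, a, r, c) \<Rightarrow> case y of (n', p', g', a', r', c') \<Rightarrow>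
      \<exists>G. linked (Suc j) n p g n' p' g' G)"
    for j and x y :: "nat \<times> puiseux \<times> rat \<times> spoly \<times> real \<times> rat"
  \<comment> \<open>Without a terminal centre \<open>stage_step\<close> always continues, and
    dependent choice yields an infinite chain of stages. The index j belongs to the stage of
    \<open>om (Suc j)\<close>.\<close>
  have "\<exists>X. \<forall>j. Inv j (X j) \<and> Q j (X j) (X (Suc j))"
  proof (rule dependent_nat_choice)
    show "\<exists>x. Inv 0 x" using initial_stage start unfolding Inv_def by (metis One_nat_def case_prod_conv)
    fix x j assume x: "Inv j x"
    obtain n p g a r c where xe: "x = (n, p, g, a, r, c)" by (cases x) auto
    have "inv_stage (Suc j) n p g a r c" using x by (simp add: Inv_def xe)
    from stage_step[OF this] no obtain n' p' g' a' r' c' G where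
      *: "inv_stage (Suc (Suc j)) n' p' g' a' r' c'" "linked (Suc j) n p g n' p' g' G" by blast
    show "\<exists>y. Inv (Suc j) y \<and> Q j x y"
      using * by (intro exI[of _ "(n', p', g', a', r', c')"]) (auto simp: Inv_def Q_def xe)
  qed
  then obtain X where X: "\<And>j. Inv j (X j)" "\<And>j. Q j (X j) (X (Suc j))" by blast
  define n P g a r c where "n j = fst (X j)" and "P j = fst (snd (X j))" and "g j = fst (snd (snd (X j)))"
    and "a j = fst (snd (snd (snd (X j))))" and "r j = fst (snd (snd (snd (snd (X j)))))"
    and "c j = snd (snd (snd (snd (snd (X j)))))" for j
  have inv: "inv_stage (Suc j) (n j) (P j) (g j) (a j) (r j) (c j)" for j
    using X(1)[of j] by (simp add: Inv_def n_def P_def g_def a_def r_def c_def case_prod_beta)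
  have "\<exists>G. linked (Suc j) (n j) (P j) (g j) (n (Suc j)) (P (Suc j)) (g (Suc j)) G" for j
    using X(2)[of j] by (simp add: Q_def n_def P_def g_def case_prod_beta)
  then obtain G where link: "\<And>j. linked (Suc j) (n j) (P j) (g j) (n (Suc j)) (P (Suc j)) (g (Suc j)) (G j)" by metis
  have st: "stage (n j) (P j) (g j) (a j) (om (Suc j)) (r j) (c j)" for j using inv by (simp add: inv_stage_def)
  note F = stage_facts[OF st]
  have keep: "lead (P (Suc k)) (rv (g (Suc k))) f d s 0" if "lead (P k) (rv (g k)) f d s 0" for k f d s
    using link[of k] that by (simp add: linked_def)
  have ex: "\<exists>k r q. r \<noteq> 0 \<and> lead (P k) (rv (g k)) f r q 0" if "f \<noteq> 0" for f
    by (rule chain_lead_ex[of g G n P]) (use link F(1,2,3) keep that in \<open>auto simp: linked_def\<close>)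
  let ?ld = "\<lambda>f r s. r \<noteq> 0 \<and> (\<exists>k q. s = rv q \<and> lead (P k) (rv (g k)) f r q 0)"
  show ?thesis
  proof (rule extension_exists[of ?ld, OF chain_leading_forms[OF F(3) keep ex]])
    have val: "\<exists>q. s = rv q \<and> veq (to_quot f) q" if "f \<in> wl" "?ld f r s" for f r s
      using that below_veq[OF F(6,3)] by blast
    show "vlt (to_quot h) (to_quot f)" if "f \<in> wl" "h \<in> wl" "?ld h r s" "?ld f r' s'" "s < s'" for f h r r' s s'
      using val[OF that(1,4)] val[OF that(2,3)] that(5) veq_vge_vlt veq_imp_vge by (metis rv_less_iff)
    show "vle (to_quot h) (to_quot f)" if "f \<in> wl" "h \<in> wl" "?ld h r s" "?ld f r' s" for f h r r' s
      using val[OF that(1,4)] val[OF that(2,3)] veq_imp_veqv by (metis rv_eq_iff)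
    show "?ld (om i) (\<gamma> i) (rv (vom i))" if "i \<ge> 1" "adm i" for i
      using inv[of i] adm_value(3)[OF that(2)] unfolding inv_stage_def by blast
    fix vle' f h r r' s s' assume e: "ext vle'" and h: "?ld h r s"
    interpret E: full_dominance vle' using e by (simp add: ext_def)
    have val': "\<exists>q. s = rv q \<and> E.veq (to_quot f) q" if ld: "?ld f r s" for f r s
    proof -
      obtain k q where k: "s = rv q" "lead (P k) (rv (g k)) f r q 0" "r \<noteq> 0" using ld by blast
      have "E.vlt (x_pow (- g k)) (y_minus (P k))" using inv[of k] e unfolding inv_stage_def by blast
      from E.veq_sim[OF E.sim_lead[OF this k(2,3)] E.veq_real_mult[OF E.veq_x_pow_minus k(3)]] k(1)
      show ?thesis by blast
    qed
    show "\<not> vle' (to_quot f) (to_quot h)" if "?ld f r' s'" "s < s'"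
      using val'[OF that(1)] val'[OF h] that(2) E.veq_vge_vlt E.veq_imp_vge by (metis rv_less_iff)
    show "vle' (to_quot h) (to_quot f)" if "?ld f r' s"
      using val'[OF that] val'[OF h] E.veq_imp_veqv by (metis rv_eq_iff)
  qed
qed

end

theorem theorem4p6:
  fixes G :: "'g ordered_group"
    and v :: "weyl_ext \<Rightarrow> 'g with_infty"
    and \<gamma> :: "nat \<Rightarrow> real"
  assumes "valuation weyl_quot G v"
    and "residue_field_real weyl_quot G v"
    and "infty_less G (v weyl_x) (infty_zero G)"
    and "\<And>i. admissible G v i \<Longrightarrow> even (seq_n G v i) \<Longrightarrow> seq_beta G v i > 0"
    and "\<And>i j l. admissible G v i \<Longrightarrow> admissible G v j \<Longrightarrow> admissible G v l \<Longrightarrow>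
           seq_h G v i < seq_h G v j \<Longrightarrow> seq_h G v j \<le> seq_h G v l \<Longrightarrow>
           seq_alpha G v i j * seq_alpha G v i l > 0"
    and "gamma_choice G v \<gamma>"
  shows "\<exists>(H :: weyl_ext set ordered_group) w.
           gamma_extension G v \<gamma> H w \<and>
           (\<forall>(H' :: 'h ordered_group) w'.
              gamma_extension G v \<gamma> H' w' \<longrightarrow> equivalent_valuations UNIV H w H' w')"
proof -
  interpret weyl_valuation G v by (rule weyl_valuationI[OF assms(1-3)])
  interpret gamma_data G v \<gamma> by unfold_locales (rule assms(6))
  show ?thesis using terminal_extension infinite_extension by blast
qed

end
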